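(* Let $0<\beta<1$ and let $q$ be a large natural number with $q\not\equiv 2\pmod 4$. Then $$\frac{1}{\varphi(q)}\sum_{\chi \text{ even, primitive mod } q}\left|L\left(\chi,\tfrac12\right)\right|^{2\beta}\ \ll\ (\log q)^{\beta^2},$$ where, for any $B<1$, the implicit constant is uniform for $\beta\in(0,B)$.
   Context: $\varphi$ is Euler's totient function. A Dirichlet character $\chi$ mod $q$ is even if $\chi(-1)=1$. $L(\chi,s)$ is the Dirichlet $L$-function, the analytic continuation of $\sum_{n\ge1}\chi(n)n^{-s}$. $A\ll B$ means $|A|\le CB$ for a constant $C$ not depending on $q$. *)

theory Defs
  imports "HOL-Complex_Analysis.Complex_Analysis" "HOL-Number_Theory.Number_Theory"
begin

definition dirichlet_char :: "nat \<Rightarrow> (int \<Rightarrow> complex) \<Rightarrow> bool" where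
  "dirichlet_char q X \<longleftrightarrow>
     (\<forall>a b. X (a * b) = X a * X b) \<and>
     (\<forall>a. X (a + int q) = X a) \<and>
     (\<forall>a. X a \<noteq> 0 \<longleftrightarrow> coprime a (int q))"

definition even_char :: "(int \<Rightarrow> complex) \<Rightarrow> bool" where
  "even_char X \<longleftrightarrow> X (- 1) = 1"

text \<open>A character mod \<open>q\<close> is primitive if no character to a proper divisor \<open>d\<close> of \<open>q\<close>
  induces it.\<close>

definition primitive_char :: "nat \<Rightarrow> (int \<Rightarrow> complex) \<Rightarrow> bool" where
  "primitive_char q X \<longleftrightarrow> dirichlet_char q X \<and>
     \<not> (\<exists>d Y. d dvd q \<and> d < q \<and> dirichlet_char d Y \<and>
          (\<forall>a. coprime a (int q) \<longrightarrow> X a = Y a))"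

text \<open>For a Dirichlet character, \<open>range X \<subseteq> {0, 1}\<close> says that \<open>X\<close> is principal;
  the continuation then has a pole at \<open>1\<close>, and otherwise it is entire.\<close>

definition L_domain :: "(int \<Rightarrow> complex) \<Rightarrow> complex set" where
  "L_domain X = (if range X \<subseteq> {0, 1} then - {1} else UNIV)"

definition is_L_continuation :: "(int \<Rightarrow> complex) \<Rightarrow> (complex \<Rightarrow> complex) \<Rightarrow> bool" where
  "is_L_continuation X f \<longleftrightarrow> f holomorphic_on L_domain X \<and>
     (\<forall>s. Re s > 1 \<longrightarrow> (\<lambda>n. X (int (Suc n)) * of_nat (Suc n) powr (- s)) sums f s)"

text \<open>The continuation is unique on \<open>L_domain X\<close> by the lemma below; at the pole \<open>1\<close> of a
  principal character the value is arbitrary.\<close>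

definition dirichlet_L :: "(int \<Rightarrow> complex) \<Rightarrow> complex \<Rightarrow> complex" where
  "dirichlet_L X = (SOME f. is_L_continuation X f)"

lemma is_L_continuation_unique:
  assumes "is_L_continuation X f" "is_L_continuation X g" "s \<in> L_domain X"
  shows "f s = g s"
proof (rule analytic_continuation_open[where f = f and g = g and s = "{s. Re s > 1}"
         and s' = "L_domain X"])
  show "open {s. Re s > 1}" by (rule open_halfspace_Re_gt)
  show "open (L_domain X)" by (auto simp: L_domain_def)
  show "{s. Re s > 1} \<noteq> {}" by (auto intro: exI[of _ 2])
  have "connected (- {1 :: complex})"
    by (rule connected_punctured_universe) simp
  then show "connected (L_domain X)" by (auto simp: L_domain_def)
  show "{s. Re s > 1} \<subseteq> L_domain X" by (auto simp: L_domain_def)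
  show "f holomorphic_on L_domain X" "g holomorphic_on L_domain X"
    using assms by (auto simp: is_L_continuation_def)
  show "f z = g z" if "z \<in> {s. Re s > 1}" for z
    using assms(1,2) that sums_unique2 unfolding is_L_continuation_def by blast
qed fact

lemma dirichlet_char_1:
  assumes "dirichlet_char q X"
  shows "X 1 = 1"
proof -
  have "X (1 * 1) = X 1 * X 1" "X 1 \<noteq> 0"
    using assms coprime_1_left[of "int q"] unfolding dirichlet_char_def by blast+
  then show ?thesis by simp
qed

lemma dirichlet_char_mod:
  assumes "dirichlet_char q X"
  shows "X (a mod int q) = X a"
proof -
  have *: "X (b + int n * int q) = X b" for b n
  proof (induction n)
    case (Suc n)
    have "X (b + int (Suc n) * int q) = X ((b + int n * int q) + int q)"
      by (simp add: algebra_simps)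
    also have "\<dots> = X (b + int n * int q)"
      using assms unfolding dirichlet_char_def by blast
    finally show ?case using Suc by simp
  qed simp
  show ?thesis
  proof (cases "a div int q \<ge> 0")
    case True
    then show ?thesis using *[of "a mod int q" "nat (a div int q)"] by simp
  next
    case False
    then have "a + int (nat (- (a div int q))) * int q = a mod int q"
      by (simp add: minus_div_mult_eq_mod[symmetric])
    then show ?thesis using *[of a "nat (- (a div int q))"] by simp
  qed
qed

lemma finite_dirichlet_chars:
  assumes "q > 0"
  shows "finite {X. dirichlet_char q X}"
proof -
  define R where "R = insert 0 {z :: complex. z ^ totient q = 1}"
  have "finite R"
    using finite_roots_unity[of "totient q"] assms by (simp add: R_def Suc_leI)
  have val: "X a \<in> R" if X: "dirichlet_char q X" for X and a
  proof (cases "coprime a (int q)")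
    case False
    then show ?thesis using X by (auto simp: R_def dirichlet_char_def)
  next
    case True
    define b where "b = nat (a mod int q)"
    have b: "int b = a mod int q" using assms by (simp add: b_def)
    have "coprime (int b) (int q)" using True assms by (simp add: b)
    then have "[b ^ totient q = 1] (mod q)" by (intro euler_theorem) simp
    then have "[int b ^ totient q = 1] (mod int q)"
      by (metis cong_int_iff of_nat_1 of_nat_power)
    then have "X (int b ^ totient q) = X 1"
      using dirichlet_char_mod[OF X] unfolding cong_def by metis
    moreover have "X (int b ^ k) = X (int b) ^ k" for k
      using X dirichlet_char_1[OF X] by (induction k) (auto simp: dirichlet_char_def)
    ultimately show ?thesis
      using dirichlet_char_1[OF X] dirichlet_char_mod[OF X, of a] by (simp add: R_def b)
  qed
  have "inj_on (\<lambda>X. restrict X {0..<int q}) {X. dirichlet_char q X}"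
  proof (rule inj_onI, rule ext)
    fix X Y a
    assume "X \<in> {X. dirichlet_char q X}" "Y \<in> {X. dirichlet_char q X}"
      and eq: "restrict X {0..<int q} = restrict Y {0..<int q}"
    then have "X a = X (a mod int q)" "Y a = Y (a mod int q)"
      by (simp_all add: dirichlet_char_mod)
    moreover have "a mod int q \<in> {0..<int q}" using assms by simp
    ultimately show "X a = Y a" by (metis eq restrict_apply')
  qed
  moreover have "(\<lambda>X. restrict X {0..<int q}) ` {X. dirichlet_char q X} \<subseteq> {0..<int q} \<rightarrow>\<^sub>E R"
    using val by auto
  then have "finite ((\<lambda>X. restrict X {0..<int q}) ` {X. dirichlet_char q X})"
    by (rule finite_subset) (simp add: finite_PiE \<open>finite R\<close>)
  ultimately show ?thesis by (rule finite_imageD[rotated])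
qed

end

theory Submission
  imports Defs "HOL-Probability.Probability" "HOL-Real_Asymp.Real_Asymp"
begin

text \<open>Put \<open>L = ln q\<close>. For a primitive even character, \<open>L(1/2)\<close> is, up to a factor of size \<open>q powr (-1/4)\<close>,
  the integral over the real line of \<open>h u = exp (u / 2) * (\<Sum>n\<ge>1. X n * exp (- pi * n\<^sup>2 * exp (2 * u) / q))\<close>, and
  Poisson summation shows that \<open>h (- u)\<close> is \<open>cnj (h u)\<close> times a number of modulus one. Splitting the
  integral by a smooth step function of \<open>u / L\<close> therefore bounds \<open>\<bar>L(1/2)\<bar>\<close>, up to a bounded error, by the
  modulus of a Dirichlet polynomial \<open>S = \<Sum>m. X m * W m / sqrt m\<close> which, since the transition of the step is
  placed near \<open>0\<close> on the scale \<open>L\<close>, has length only \<open>q powr (7/10)\<close>. The weight \<open>W m\<close> is a rapidly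
  converging combination of the twists \<open>exp (- \<i> * k * ln m / L)\<close>.

  For the moments of \<open>S\<close>, let \<open>P r\<close> be the sum of \<open>X p / sqrt p\<close> over the primes between
  \<open>exp (L / 2048 / 2 ^ (r + 1))\<close> and \<open>exp (L / 2048 / 2 ^ r)\<close>. Young's inequality bounds \<open>\<bar>S\<bar> powr (2 * \<beta>)\<close> by
  \<open>\<bar>S * exp ((\<beta> - 1) * \<Sum>r. P r)\<bar>\<^sup>2 + \<bar>exp (\<beta> * \<Sum>r. P r)\<bar>\<^sup>2\<close>. Where every \<open>P r\<close> is at most \<open>8 * (r + 1)\<close> the
  exponentials may be truncated to Taylor polynomials so short that the products still have length below
  \<open>q\<close>; otherwise the largest exceptional \<open>r\<close> contributes a high power of \<open>P r / (8 * (r + 1))\<close> in place of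
  its Taylor polynomial, which is small in mean square. As all lengths are below \<open>q\<close>, Bessel's inequality
  for characters leaves only diagonal terms. These form Euler products of size
  \<open>exp (\<Sum>p\<le>q. \<beta>\<^sup>2 / p)\<close>, which is of order \<open>L powr \<beta>\<^sup>2\<close> by Mertens' estimate.\<close>

section \<open>Fourier series and Poisson summation\<close>

text \<open>Two demands compete: every product must stay shorter than \<open>q\<close>, and every
  diagonal sum must be an Euler product. The weight \<open>W\<close> itself is not multiplicative,
  but its twists are, so each twist gives an Euler product and Minkowski's inequality recombines
  them. A twist with large \<open>k\<close> costs up to \<open>(1 + \<bar>k\<bar>) ^ 24\<close> in
  root mean square; the step function is therefore made smooth enough for Fourier coefficients of
  order \<open>1 / (1 + \<bar>k\<bar>) ^ 26\<close>. The prime ranges halve on the logarithmic scale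
  so that the polynomial of range \<open>r\<close> may be raised to powers linear in
  \<open>r\<close> while the total length stays a convergent series, below
  \<open>q powr (1/5)\<close>. An exceptional range \<open>v\<close> forfeits the mollifier at all
  larger primes, a loss of \<open>exp (8 * v)\<close>, and the high power placed there must win more
  than that. Finally the coefficient of \<open>ln (ln q)\<close> in the sum of \<open>1 / p\<close>
  has to be exactly 1, since it turns into the exponent of \<open>ln q\<close>; everywhere else
  crude prime sums are enough.\<close>

lemma integral_eq_zero_trig_kernel:
  fixes f :: "real \<Rightarrow> complex"
  assumes cont: "continuous_on UNIV f"
    and zero: "\<And>k :: int. integral {0..2*pi} (\<lambda>x. f x * cis (- (of_int k * x))) = 0"
  shows "integral {0..2*pi} (\<lambda>x. f x * of_real (((1 + cos (x - y)) / 2) ^ n) * cis (- (of_int k * x))) = 0"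
proof (induction n arbitrary: k)
  case 0
  then show ?case using zero by simp
next
  case (Suc n)
  define K where "K = (\<lambda>x. ((1 + cos (x - y)) / 2) ^ n :: real)"
  define J where "J = (\<lambda>k::int. (\<lambda>x. f x * of_real (K x) * cis (- (of_int k * x))))"
  have cJ: "J k integrable_on {0..2*pi}" for k
    unfolding J_def K_def
    by (intro integrable_continuous_interval continuous_intros continuous_on_subset[OF cont]) auto
  have J0: "integral {0..2*pi} (J k) = 0" for k
    using Suc unfolding J_def K_def by simp
  \<comment> \<open>The kernel only contains the frequencies -1, 0 and 1. One more power thus shifts
    \<open>k\<close> by at most one, which is why the induction runs over all \<open>k\<close> at
    once.\<close>
  have cosy: "of_real ((1 + cos (x - y)) / 2) = (2 + cis x * cis (- y) + cis (- x) * cis y) / (4::complex)" for x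
    by (auto simp: complex_eq_iff cos_diff field_simps)
  have c2: "cis (- (of_int (k-1) * x)) = cis (- (of_int k * x)) * cis x"
           "cis (- (of_int (k+1) * x)) = cis (- (of_int k * x)) * cis (-x)" for x
    by (simp_all add: cis_mult algebra_simps)
  have eq: "f x * of_real (((1 + cos (x - y)) / 2) ^ Suc n) * cis (- (of_int k * x)) =
     (1/2) * J k x + (cis (-y) / 4) * J (k - 1) x + (cis y / 4) * J (k + 1) x" for x
  proof -
    have "f x * of_real (((1 + cos (x - y)) / 2) ^ Suc n) * cis (- (of_int k * x)) =
      f x * of_real (K x) * cis (- (of_int k * x)) * of_real ((1 + cos (x - y)) / 2)"
      by (simp only: K_def power_Suc of_real_mult mult_ac)
    also have "\<dots> = f x * of_real (K x) * cis (- (of_int k * x)) * ((2 + cis x * cis (- y) + cis (- x) * cis y) / 4)"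
      by (simp only: cosy)
    also have "\<dots> = (1/2) * J k x + (cis (-y) / 4) * J (k - 1) x + (cis y / 4) * J (k + 1) x"
      unfolding J_def c2 by (simp add: field_simps)
    finally show ?thesis .
  qed
  show ?case
    unfolding eq
    by (subst integral_add integral_mult_right; (intro integrable_add integrable_on_mult_right cJ)?)+ (simp add: J0)
qed

text \<open>If \<open>f y\<close> were nonzero, the powers of \<open>(1 + cos (x - y)) / 2\<close>,
  which peak at \<open>y\<close>, would isolate it: the part near \<open>y\<close> is at least of
  order \<open>s ^ n\<close>, the rest at most of order \<open>r ^ n\<close> with
  \<open>r < s\<close>, yet the total is zero. For an interior \<open>y\<close> the peak fits into
  one period.\<close>

lemma fourier_uniqueness_interior:
  fixes f :: "real \<Rightarrow> complex"
  assumes cont: "continuous_on UNIV f"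
    and zero: "\<And>k :: int. integral {0..2*pi} (\<lambda>x. f x * cis (- (of_int k * x))) = 0"
    and y: "0 < y" "y < 2*pi"
  shows "f y = 0"
proof (rule ccontr)
  assume fy: "f y \<noteq> 0"
  \<comment> \<open>Multiplying by \<open>cnj (f y)\<close> makes the value at \<open>y\<close> real
    and positive, so a real function is localised.\<close>
  define F where "F = (\<lambda>x. Re (cnj (f y) * f x))"
  define c where "c = F y"
  have "c = (cmod (f y))\<^sup>2" unfolding c_def F_def cmod_power2 by (simp add: power2_eq_square)
  then have c: "c > 0" using fy by simp
  have contF: "continuous_on UNIV F"
    unfolding F_def by (intro continuous_intros cont)
  define K where "K = (\<lambda>n x. ((1 + cos (x - y)) / 2) ^ n :: real)"
  have intK: "integral {0..2*pi} (\<lambda>x. F x * K n x) = 0" for n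
  proof -
    have i: "(\<lambda>x. f x * of_real (K n x)) integrable_on {0..2*pi}"
      unfolding K_def by (intro integrable_continuous_interval continuous_intros continuous_on_subset[OF cont]) auto
    have "integral {0..2*pi} (\<lambda>x. f x * of_real (K n x)) = 0"
      using integral_eq_zero_trig_kernel[OF cont zero, of y n 0] unfolding K_def by simp
    then have "((\<lambda>x. f x * of_real (K n x)) has_integral 0) {0..2*pi}"
      using i by (simp add: has_integral_iff)
    then have "((\<lambda>x. cnj (f y) * (f x * of_real (K n x))) has_integral cnj (f y) * 0) {0..2*pi}"
      by (rule has_integral_mult_right)
    from has_integral_linear[OF this bounded_linear_Re]
    have "((\<lambda>x. F x * K n x) has_integral 0) {0..2*pi}"
      by (simp add: F_def o_def algebra_simps)
    then show ?thesis by (rule integral_unique)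
  qed
  have "isCont F y" using contF by (simp add: continuous_on_eq_continuous_at)
  then obtain d0 where d0: "d0 > 0" "\<And>x. \<bar>x - y\<bar> < d0 \<Longrightarrow> \<bar>F x - F y\<bar> < c/2"
    unfolding continuous_at_eps_delta using c by (metis half_gt_zero dist_real_def)
  \<comment> \<open>The window of radius \<open>d\<close> lies inside the period, and
    \<open>d \<le> pi / 2\<close> makes \<open>r\<close> positive.\<close>
  define d where "d = min (min (d0/2) (pi/2)) (min (y/2) ((2*pi - y)/2))"
  have d: "d > 0" "d < d0" "d \<le> pi/2" "d < y" "d < 2*pi - y" using d0 y pi_gt_zero by (auto simp: d_def min_def)
  have Fpos: "F x \<ge> c/2" if "\<bar>x - y\<bar> \<le> d" for x
    using d0(2)[of x] that d by (auto simp: c_def abs_if split: if_splits)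
  have "compact (F ` {0..2*pi})"
    by (intro compact_continuous_image continuous_on_subset[OF contF]) auto
  then obtain M where M: "\<And>x. x \<in> {0..2*pi} \<Longrightarrow> \<bar>F x\<bar> \<le> M"
    by (meson compact_imp_bounded bounded_real imageI)
  have M0: "M \<ge> 0" using M[of 0] by (simp) 
  define r where "r = (1 + cos d) / 2"
  define s where "s = (1 + cos (d/2)) / 2"
  have rs: "r < s" "0 < r" 
    using cos_monotone_0_pi[of "d/2" d] d pi_gt_zero cos_ge_zero[of d] by (auto simp: r_def s_def)
  have Kout: "K n x \<le> r ^ n" if "x \<in> {0..2*pi}" "\<bar>x - y\<bar> \<ge> d" for n x
  proof -
    have "cos (x - y) \<le> cos d"
    proof (cases "\<bar>x - y\<bar> \<le> pi")
      case True
      have "cos \<bar>x-y\<bar> \<le> cos d" using that True d by (intro cos_monotone_0_pi_le) auto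
      then show ?thesis by (simp)
    next
      case False
      have "cos (2*pi - \<bar>x-y\<bar>) \<le> cos d" using that False d by (intro cos_monotone_0_pi_le) (auto simp: abs_if split: if_splits)
      then show ?thesis by (simp add: cos_diff)
    qed
    moreover have "1 + cos (x-y) \<ge> 0" by (metis add.commute cos_ge_minus_one diff_ge_0_iff_ge diff_minus_eq_add)
    ultimately show ?thesis unfolding K_def r_def by (intro power_mono) auto
  qed
  have Kin: "K n x \<ge> s ^ n" if "\<bar>x - y\<bar> \<le> d/2" for n x
  proof -
    have "cos (d/2) \<le> cos \<bar>x-y\<bar>" using that d by (intro cos_monotone_0_pi_le) auto
    then show ?thesis unfolding K_def s_def using rs by (intro power_mono) (auto simp: s_def r_def)
  qed
  have K0: "K n x \<ge> 0" for n x
    unfolding K_def by (intro zero_le_power) (metis add.commute cos_ge_minus_one diff_ge_0_iff_ge diff_minus_eq_add divide_nonneg_pos zero_less_numeral)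
  have contFK: "continuous_on S (\<lambda>x. F x * K n x)" for S n
    unfolding K_def by (intro continuous_intros continuous_on_subset[OF contF]) auto
  have ii: "(\<lambda>x. F x * K n x) integrable_on {a..b}" for a b n
    by (intro integrable_continuous_interval contFK)
  have ineq: "c/2 * s^n * d \<le> 2*pi*M * r^n" for n
  proof -
    have sub: "{y - d/2..y+d/2} \<subseteq> {0..2*pi}" using d by auto
    \<comment> \<open>The added constant makes the integrand nonnegative on the whole period, so
      that the small window gives a lower bound for the full integral.\<close>
    let ?G = "\<lambda>x. F x * K n x + M * r^n"
    have Gge: "?G x \<ge> 0" if "x \<in> {0..2*pi}" for x
    proof (cases "\<bar>x - y\<bar> \<ge> d")
      case True
      have "- (F x * K n x) \<le> M * r^n"
        using M[OF that] Kout[OF that True, of n] K0[of n x] M0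
        by (metis abs_le_D2 minus_mult_left mult_mono)
      then show ?thesis by simp
    next
      case False
      then have "F x \<ge> 0" using Fpos[of x] c by auto
      then show ?thesis using K0 M0 rs by simp
    qed
    have Gin: "c/2 * s^n \<le> ?G x" if "x \<in> {y - d/2..y+d/2}" for x
    proof -
      have "\<bar>x - y\<bar> \<le> d/2" using that by (auto simp: abs_if)
      then have "c/2 * s^n \<le> F x * K n x" using Fpos[of x] Kin[of x n] d rs c by (intro mult_mono) auto
      then show ?thesis using M0 rs by (simp add: add_increasing2)
    qed
    have iG: "?G integrable_on {a..b}" for a b by (intro integrable_add ii integrable_const_ivl)
    have "c/2 * s^n * d = integral {y - d/2..y+d/2} (\<lambda>_. c/2 * s^n)"
      using d by simp
    also have "\<dots> \<le> integral {y - d/2..y+d/2} ?G"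
      by (intro integral_le integrable_const_ivl iG Gin)
    also have "\<dots> \<le> integral {0..2*pi} ?G"
      by (intro integral_subset_le sub iG ballI Gge)
    also have "\<dots> = 2*pi*M * r^n"
      by (subst integral_add[OF ii integrable_const_ivl]) (simp add: intK)
    finally show ?thesis .
  qed
  have "0 \<le> r/s" "r/s < 1" using rs by auto
  then have "(\<lambda>n. (r/s)^n) \<longlonglongrightarrow> 0" by (rule LIMSEQ_realpow_zero)
  then have "(\<lambda>n. 2*pi*M * (r/s)^n) \<longlonglongrightarrow> 2*pi*M*0" by (rule tendsto_mult_left)
  moreover have "c/2*d \<le> 2*pi*M * (r/s)^n" for n
    using ineq[of n] rs by (simp add: field_simps)
  ultimately have "c/2*d \<le> 2*pi*M*0"
    by (intro LIMSEQ_le_const) auto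
  then show False using mult_pos_pos[OF c d(1)] by simp
qed

lemma fourier_uniqueness:
  fixes f :: "real \<Rightarrow> complex"
  assumes cont: "continuous_on UNIV f" and per: "\<And>x. f (x + 2*pi) = f x"
    and zero: "\<And>k :: int. integral {0..2*pi} (\<lambda>x. f x * cis (- (of_int k * x))) = 0"
  shows "f y = 0"
proof -
  have int: "f x = 0" if "x \<in> {0<..<2*pi}" for x
    using fourier_uniqueness_interior[OF cont zero] that by auto
  have "f x = 0" if "x \<in> closure {0<..<2*pi}" for x
    using continuous_constant_on_closure[of "{0<..<2*pi}" f 0 x] int that continuous_on_subset[OF cont]
    by (metis subset_UNIV)
  then have cl: "f x = 0" if "x \<in> {0..2*pi}" for x
    using that by simp
  have nper: "f (x + of_nat n * (2*pi)) = f x" for x n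
  proof (induction n)
    case (Suc n)
    have "f (x + of_nat (Suc n) * (2*pi)) = f (x + of_nat n * (2*pi) + 2*pi)" by (simp add: algebra_simps)
    then show ?case using per Suc by simp
  qed simp
  define m where "m = \<lfloor>y / (2*pi)\<rfloor>"
  have "of_int m \<le> y / (2*pi)" "y / (2*pi) < of_int m + 1" unfolding m_def by linarith+
  then have m: "y - of_int m * (2*pi) \<in> {0..2*pi}" using pi_gt_zero by (auto simp: field_simps)
  show ?thesis
  proof (cases "m \<ge> 0")
    case True
    then show ?thesis using nper[of "y - of_int m * (2*pi)" "nat m"] cl[OF m] by simp
  next
    case False
    then show ?thesis using nper[of y "nat (-m)"] cl[OF m] by simp
  qed
qed

lemma integral_cis_int:
  "integral {0..2*pi} (\<lambda>x. cis (of_int k * x)) = (if k = 0 then of_real (2*pi) else 0)" for k :: int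
proof (cases "k = 0")
  case False
  have "((\<lambda>x. cis (of_int k * x)) has_integral (cis (of_int k * (2*pi)) / (\<i> * of_int k) - cis (of_int k * 0) / (\<i> * of_int k))) {0..2*pi}"
  proof (rule fundamental_theorem_of_calculus)
    fix x assume "x \<in> {0..2*pi}"
    show "((\<lambda>x. cis (of_int k * x) / (\<i> * of_int k)) has_vector_derivative cis (of_int k * x)) (at x within {0..2*pi})"
      unfolding cis_conv_exp using False
      by (auto intro!: derivative_eq_intros has_vector_derivative_real_field simp: field_simps)
  qed simp
  moreover have "cis (of_int k * (2*pi)) = 1"
    by (metis cis_multiple_2pi Ints_of_int mult.commute)
  ultimately show ?thesis using False by (simp add: integral_unique)
qed (simp add: scaleR_conv_of_real)

text \<open>Absolute summability makes the series converge uniformly to a continuous function with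
  the same coefficients as \<open>f\<close>; uniqueness identifies the two.\<close>

theorem fourier_series:
  fixes f :: "real \<Rightarrow> complex" and c :: "int \<Rightarrow> complex"
  assumes cont: "continuous_on UNIV f" and per: "\<And>x. f (x + 2*pi) = f x"
    and summ: "(\<lambda>k. norm (c k)) summable_on UNIV"
    and coef: "\<And>k :: int. integral {0..2*pi} (\<lambda>x. f x * cis (- (of_int k * x))) = 2*pi * c k"
  shows "((\<lambda>k. c k * cis (of_int k * x)) has_sum f x) UNIV"
proof -
  define g where "g = (\<lambda>x. \<Sum>\<^sub>\<infinity>k. c k * cis (of_int k * x))"
  have ul: "uniform_limit UNIV (\<lambda>Y x. \<Sum>k\<in>Y. c k * cis (of_int k * x)) g (finite_subsets_at_top UNIV)"
    unfolding g_def
    by (rule Weierstrass_m_test_general[where M = "\<lambda>k. norm (c k)"]) (auto simp: norm_mult summ)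
  have contg: "continuous_on UNIV g"
    by (rule uniform_limit_theorem[OF _ ul]) (auto intro!: always_eventually continuous_intros)
  have hs: "((\<lambda>k. c k * cis (of_int k * x)) has_sum g x) UNIV" for x
    unfolding g_def
    by (rule has_sum_infsum, rule abs_summable_summable) (simp add: norm_mult summ)
  have perg: "g (x + 2*pi) = g x" for x
  proof -
    have "cis (of_int k * (x + 2*pi)) = cis (of_int k * x)" for k :: int
      using cis_multiple_2pi[of "of_int k"] by (simp add: distrib_left mult_ac flip: cis_mult)
    then show ?thesis by (simp add: g_def)
  qed
  have coefg: "integral {0..2*pi} (\<lambda>x. g x * cis (- (of_int j * x))) = 2*pi * c j" for j :: int
  proof -
    have "uniform_limit {0..2*pi} (\<lambda>Y x. (\<Sum>k\<in>Y. c k * cis (of_int k * x)) * cis (- (of_int j * x))) (\<lambda>x. g x * cis (- (of_int j * x))) (finite_subsets_at_top UNIV)"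
    proof (rule uniform_lim_mult)
      show "uniform_limit {0..2*pi} (\<lambda>Y x. \<Sum>k\<in>Y. c k * cis (of_int k * x)) g (finite_subsets_at_top UNIV)"
        by (rule uniform_limit_on_subset[OF ul]) auto
      show "bounded (g ` {0..2*pi})"
        by (intro compact_imp_bounded compact_continuous_image continuous_on_subset[OF contg]) auto
      show "bounded ((\<lambda>x. cis (- (of_int j * x))) ` {0..2*pi})"
        by (intro boundedI[where B = 1]) auto
    qed (auto intro: uniform_limit_const)
    then obtain I J where IJ: "\<And>Y. ((\<lambda>x. (\<Sum>k\<in>Y. c k * cis (of_int k * x)) * cis (- (of_int j * x))) has_integral I Y) {0..2*pi}"
       "((\<lambda>x. g x * cis (- (of_int j * x))) has_integral J) {0..2*pi}" "(I \<longlongrightarrow> J) (finite_subsets_at_top UNIV)"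
      by (rule uniform_limit_integral) (auto intro!: continuous_intros)
    \<comment> \<open>The coefficient is exact as soon as \<open>j\<close> lies in the finite set,
      so the limit can be read off without an estimate.\<close>
    have "I Y = 2*pi * c j" if "finite Y" "j \<in> Y" for Y
    proof -
      have eq: "(\<Sum>k\<in>Y. c k * cis (of_int k * x)) * cis (- (of_int j * x)) = (\<Sum>k\<in>Y. c k * cis (of_int (k - j) * x))" for x
        unfolding sum_distrib_right by (intro sum.cong refl) (simp add: mult.assoc cis_mult ring_distribs)
      have "I Y = integral {0..2*pi} (\<lambda>x. \<Sum>k\<in>Y. c k * cis (of_int (k - j) * x))"
        using IJ(1)[of Y] unfolding eq by (simp add: integral_unique)
      also have "\<dots> = (\<Sum>k\<in>Y. c k * integral {0..2*pi} (\<lambda>x. cis (of_int (k - j) * x)))"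
        using that by (subst integral_sum) (auto intro!: integrable_continuous_interval continuous_intros)
      also have "\<dots> = (\<Sum>k\<in>Y. if k = j then 2*pi*c j else 0)"
        by (intro sum.cong refl) (auto simp: integral_cis_int simp del: of_int_diff)
      finally show ?thesis using that by simp
    qed
    then have "eventually (\<lambda>Y. I Y = 2*pi*c j) (finite_subsets_at_top UNIV)"
      unfolding eventually_finite_subsets_at_top by (intro exI[of _ "{j}"]) auto
    then have "(I \<longlongrightarrow> 2*pi*c j) (finite_subsets_at_top UNIV)"
      by (rule tendsto_eventually)
    then have "J = 2*pi*c j" using IJ(3) tendsto_unique finite_subsets_at_top_neq_bot by blast
    then show ?thesis using IJ(2) by (simp add: integral_unique)
  qed
  have "f x - g x = 0"
  proof (rule fourier_uniqueness)
    show "continuous_on UNIV (\<lambda>x. f x - g x)" by (intro continuous_intros cont contg)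
    show "f (x + 2*pi) - g (x + 2*pi) = f x - g x" for x by (simp add: per perg)
    show "integral {0..2*pi} (\<lambda>x. (f x - g x) * cis (- (of_int k * x))) = 0" for k :: int
      unfolding left_diff_distrib
      by (subst integral_diff)
         (auto intro!: integrable_continuous_interval continuous_intros continuous_on_subset[OF cont] continuous_on_subset[OF contg]
           simp: coef coefg)
  qed
  then show ?thesis using hs[of x] by simp
qed

section \<open>Sliding averages and the decay of Fourier coefficients\<close>

lemma has_integral_translate:
  fixes f :: "real \<Rightarrow> 'a::banach"
  assumes "(f has_integral i) {a+c..b+c}"
  shows "((\<lambda>x. f (x + c)) has_integral i) {a..b}"
proof -
  have "((\<lambda>x. f (1 *\<^sub>R x + c)) has_integral (1 / \<bar>1\<bar> ^ DIM(real)) *\<^sub>R i) ((\<lambda>x. (1/1) *\<^sub>R x + - ((1/1) *\<^sub>R c)) ` cbox (a+c) (b+c))"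
    using assms by (intro has_integral_affinity) auto
  moreover have "(\<lambda>x. x - c) ` {a+c..b+c} = {a..b}"
    using image_diff_atLeastAtMost[of "a+c" "b+c" c] by simp
  ultimately show ?thesis by simp
qed

lemma integral_translate:
  fixes f :: "real \<Rightarrow> 'a::banach"
  assumes "continuous_on UNIV f"
  shows "integral {a..b} (\<lambda>x. f (x + c)) = integral {a+c..b+c} f"
  by (intro integral_unique has_integral_translate integrable_integral integrable_continuous_interval
      continuous_on_subset[OF assms]) auto

lemma integral_periodic_translate:
  fixes f :: "real \<Rightarrow> complex"
  assumes cont: "continuous_on UNIV f" and per: "\<And>x. f (x + 2*pi) = f x" and a: "0 \<le> a" "a \<le> 2*pi"
  shows "integral {0..2*pi} (\<lambda>x. f (x + a)) = integral {0..2*pi} f"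
proof -
  have ii: "f integrable_on {u..v}" for u v
    by (intro integrable_continuous_interval continuous_on_subset[OF cont]) auto
  have "integral {0..2*pi} (\<lambda>x. f (x + a)) = integral {a..2*pi+a} f"
    using integral_translate[OF cont, of 0 "2*pi" a] by simp
  also have "\<dots> = integral {a..2*pi} f + integral {2*pi..2*pi+a} f"
    using a by (intro Henstock_Kurzweil_Integration.integral_combine[symmetric] ii) auto
  also have "integral {2*pi..2*pi+a} f = integral {0..a} (\<lambda>x. f (x + 2*pi))"
    by (subst integral_translate[OF cont]) (simp add: add.commute)
  also have "\<dots> = integral {0..a} f" by (simp add: per)
  also have "integral {a..2*pi} f + integral {0..a} f = integral {0..2*pi} f"
    using Henstock_Kurzweil_Integration.integral_combine[of 0 a "2*pi" f] a ii by (simp add: add.commute)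
  finally show ?thesis .
qed

definition fourier_int :: "(real \<Rightarrow> real) \<Rightarrow> int \<Rightarrow> complex" where
  "fourier_int f k = integral {0..2*pi} (\<lambda>x. of_real (f x) * cis (- (of_int k * x)))"

definition sliding_mean :: "real \<Rightarrow> (real \<Rightarrow> real) \<Rightarrow> real \<Rightarrow> real" where
  "sliding_mean a f x = integral {x - a..x + a} f / (2 * a)"

lemma sliding_mean_has_derivative:
  assumes cont: "continuous_on UNIV f" and a: "a > 0"
  shows "(sliding_mean a f has_real_derivative (f (x + a) - f (x - a)) / (2 * a)) (at x)"
proof -
  define F where "F = (\<lambda>t. integral {x - 2*a..t} f)"
  have ii: "f integrable_on {u..v}" for u v
    by (intro integrable_continuous_interval continuous_on_subset[OF cont]) auto
  have dF: "(F has_real_derivative f t) (at t)" if "t > x - 2*a" "t < x + 2*a" for t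
  proof -
    have "(F has_real_derivative f t) (at t within {x-2*a..x+2*a})"
      unfolding F_def using that
      by (intro integral_has_real_derivative continuous_on_subset[OF cont]) auto
    then show ?thesis using that by (simp add: at_within_Icc_at)
  qed
  have "((\<lambda>t. (F (t + a) - F (t - a)) / (2*a)) has_real_derivative (f (x + a) - f (x - a)) / (2 * a)) (at x)"
    using a by (auto intro!: derivative_eq_intros DERIV_chain2[OF dF] simp: field_simps)
  moreover have "eventually (\<lambda>t. sliding_mean a f t = (F (t + a) - F (t - a)) / (2*a)) (nhds x)"
  proof -
    have "eventually (\<lambda>t. t \<in> {x - a<..<x+a}) (nhds x)" using a by (intro eventually_nhds_in_open) auto
    then show ?thesis
    proof eventually_elim
      case (elim t)
      have "F (t + a) = F (t - a) + integral {t-a..t+a} f"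
        unfolding F_def using elim a by (intro Henstock_Kurzweil_Integration.integral_combine[symmetric] ii) auto
      then show ?case by (simp add: sliding_mean_def)
    qed
  qed
  ultimately show ?thesis by (subst DERIV_cong_ev[OF refl _ refl])
qed

text \<open>The derivative of the average is a difference quotient of \<open>f\<close>, so
  integration by parts multiplies the Fourier integral by
  \<open>sin (k * a) / (k * a)\<close>.\<close>

lemma fourier_int_sliding_mean:
  assumes cont: "continuous_on UNIV f" and per: "\<And>x. f (x + 2*pi) = f x"
    and a: "0 < a" "a \<le> 2*pi" and k: "k \<noteq> 0"
  shows "norm (fourier_int (sliding_mean a f) k) \<le> norm (fourier_int f k) / (a * \<bar>of_int k\<bar>)"
proof -
  define m where "m = sliding_mean a f"
  have dm: "(m has_real_derivative (f (x + a) - f (x - a)) / (2 * a)) (at x)" for x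
    unfolding m_def by (rule sliding_mean_has_derivative[OF cont a(1)])
  have contm: "continuous_on UNIV m"
    using DERIV_isCont[OF dm] by (simp add: continuous_on_eq_continuous_at)
  have perm: "m (x + 2*pi) = m x" for x
    using integral_translate[OF cont, of "x-a" "x+a" "2*pi", unfolded per] by (simp add: m_def sliding_mean_def algebra_simps)
  define e where "e = (\<lambda>x::real. cis (- (of_int k * x)))"
  have e2pi: "e (2*pi) = 1" "e 0 = 1" unfolding e_def using cis_multiple_2pi[of "of_int (-k)"] by (auto simp: mult_ac)
  have eper: "e (x + 2*pi) = e x" for x
  proof -
    have "e (x + 2*pi) = e x * e (2*pi)" unfolding e_def cis_mult by (simp add: algebra_simps)
    then show ?thesis using e2pi by simp
  qed
  have contf: "continuous_on S (\<lambda>x. f (x + b))" for S b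
    by (rule continuous_on_compose2[OF cont]) (auto intro!: continuous_intros)
  have contf': "continuous_on S (\<lambda>x. f (x - b))" for S b
    by (rule continuous_on_compose2[OF cont]) (auto intro!: continuous_intros)
  have conte: "continuous_on S e" for S unfolding e_def by (intro continuous_intros)
  have de: "(e has_vector_derivative (- \<i> * of_int k) * e x) (at x within S)" for x S
    unfolding e_def cis_conv_exp
    by (auto intro!: derivative_eq_intros has_vector_derivative_real_field simp: field_simps)
  have "((\<lambda>x. of_real (m x) * ((- \<i> * of_int k) * e x) + of_real ((f (x + a) - f (x - a)) / (2 * a)) * e x)
     has_integral (of_real (m (2*pi)) * e (2*pi) - of_real (m 0) * e 0)) {0..2*pi}"
  proof (rule fundamental_theorem_of_calculus)
    fix x :: real assume "x \<in> {0..2*pi}"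
    have "((\<lambda>x. complex_of_real (m x)) has_vector_derivative of_real ((f (x + a) - f (x - a)) / (2 * a))) (at x within {0..2*pi})"
      using has_vector_derivative_of_real dm[of x] has_field_derivative_at_within by blast
    from has_vector_derivative_mult[OF this de]
    show "((\<lambda>x. of_real (m x) * e x) has_vector_derivative (of_real (m x) * ((- \<i> * of_int k) * e x) + of_real ((f (x + a) - f (x - a)) / (2 * a)) * e x)) (at x within {0..2*pi})" .
  qed simp
  then have I0: "integral {0..2*pi} (\<lambda>x. of_real (m x) * ((- \<i> * of_int k) * e x) + of_real ((f (x + a) - f (x - a)) / (2 * a)) * e x) = 0"
    using perm[of 0] e2pi by (simp add: integral_unique)
  define G where "G = (\<lambda>x. complex_of_real (f x) * e x)"
  have contG: "continuous_on S G" for S unfolding G_def by (intro continuous_intros conte continuous_on_subset[OF cont]) auto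
  have perG: "G (x + 2*pi) = G x" for x by (simp add: G_def per eper)
  have G: "integral {0..2*pi} G = fourier_int f k" by (simp add: G_def fourier_int_def e_def)
  have Ga: "integral {0..2*pi} (\<lambda>x. G (x + a)) = fourier_int f k"
    using integral_periodic_translate[OF contG perG, of a] a G by simp
  have Gma: "integral {0..2*pi} (\<lambda>x. G (x - a)) = fourier_int f k"
  proof -
    have contG': "continuous_on UNIV (\<lambda>x. G (x - a))"
      by (rule continuous_on_compose2[OF contG[of UNIV]]) (auto intro!: continuous_intros)
    have "integral {0..2*pi} (\<lambda>x. G (x + a - a)) = integral {0..2*pi} (\<lambda>x. G (x - a))"
      using integral_periodic_translate[OF contG', of a] a perG by (metis add_diff_eq diff_add_eq less_imp_le)
    then show ?thesis using G by simp
  qed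
  have ea: "e x = e (x + a) * cis (of_int k * a)" "e x = e (x - a) * cis (- (of_int k * a))" for x
    by (simp_all add: e_def cis_mult algebra_simps)
  have c: "(f (x + a) - f (x - a)) / (2 * a) * e x = (cis (of_int k * a) / (2*a)) * G (x + a) - (cis (- (of_int k * a)) / (2*a)) * G (x - a)" for x
    unfolding G_def of_real_diff of_real_divide left_diff_distrib diff_divide_distrib
    by (subst (1) ea(1), subst (2) ea(2)) (simp add: mult_ac)
  have i1: "integral {0..2*pi} (\<lambda>x. of_real ((f (x + a) - f (x - a)) / (2 * a)) * e x) = (cis (of_int k * a) - cis (- (of_int k * a))) / (2*a) * fourier_int f k"
  proof -
    have "integral {0..2*pi} (\<lambda>x. of_real ((f (x + a) - f (x - a)) / (2 * a)) * e x) =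
       integral {0..2*pi} (\<lambda>x. (cis (of_int k * a) / (2*a)) * G (x + a) - (cis (- (of_int k * a)) / (2*a)) * G (x - a))"
      using c by simp
    also have "\<dots> = (cis (of_int k * a) / (2*a)) * fourier_int f k - (cis (- (of_int k * a)) / (2*a)) * fourier_int f k"
    proof (subst integral_diff)
      show "(\<lambda>x. (cis (of_int k * a) / (2*a)) * G (x + a)) integrable_on {0..2*pi}"
           "(\<lambda>x. (cis (- (of_int k * a)) / (2*a)) * G (x - a)) integrable_on {0..2*pi}"
        using a by (auto intro!: integrable_continuous_interval continuous_intros continuous_on_compose2[OF contG[of UNIV]])
    qed (simp add: Ga Gma)
    finally show ?thesis by (simp add: diff_divide_distrib left_diff_distrib)
  qed
  have "\<i> * of_int k * fourier_int m k = (cis (of_int k * a) - cis (- (of_int k * a))) / (2*a) * fourier_int f k"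
  proof -
    have "integral {0..2*pi} (\<lambda>x. of_real (m x) * ((- \<i> * of_int k) * e x) + of_real ((f (x + a) - f (x - a)) / (2 * a)) * e x) =
       (- \<i> * of_int k) * fourier_int m k + integral {0..2*pi} (\<lambda>x. of_real ((f (x + a) - f (x - a)) / (2 * a)) * e x)"
    proof (subst integral_add)
      show "(\<lambda>x. of_real (m x) * ((- \<i> * of_int k) * e x)) integrable_on {0..2*pi}"
        by (intro integrable_continuous_interval continuous_intros conte continuous_on_subset[OF contm]) auto
      show "(\<lambda>x. of_real ((f (x + a) - f (x - a)) / (2 * a)) * e x) integrable_on {0..2*pi}"
        using a by (intro integrable_continuous_interval continuous_intros conte contf contf') auto
      have "integral {0..2*pi} (\<lambda>x. of_real (m x) * ((- \<i> * of_int k) * e x)) = integral {0..2*pi} (\<lambda>x. (- \<i> * of_int k) * (of_real (m x) * e x))"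
        by (simp only: mult_ac)
      also have "\<dots> = (- \<i> * of_int k) * fourier_int m k"
        by (subst integral_mult_right) (simp_all add: fourier_int_def e_def)
      finally show "integral {0..2*pi} (\<lambda>x. of_real (m x) * ((- \<i> * of_int k) * e x)) +
         integral {0..2*pi} (\<lambda>x. of_real ((f (x + a) - f (x - a)) / (2 * a)) * e x) =
         (- \<i> * of_int k) * fourier_int m k + integral {0..2*pi} (\<lambda>x. of_real ((f (x + a) - f (x - a)) / (2 * a)) * e x)"
        by simp
    qed
    with I0 i1 show ?thesis by (simp add: algebra_simps)
  qed
  then have "norm (\<i> * of_int k * fourier_int m k) = norm ((cis (of_int k * a) - cis (- (of_int k * a))) / (2*a) * fourier_int f k)"
    by simp
  then have "\<bar>of_int k\<bar> * norm (fourier_int m k) = norm (cis (of_int k * a) - cis (- (of_int k * a))) / (2*a) * norm (fourier_int f k)"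
    using a by (simp add: norm_mult norm_divide)
  also have "\<dots> \<le> 2 / (2*a) * norm (fourier_int f k)"
    using norm_triangle_ineq4[of "cis (of_int k * a)" "cis (- (of_int k * a))"] a
    by (intro mult_right_mono divide_right_mono) auto
  finally show ?thesis using a k by (simp add: m_def field_simps)
qed

section \<open>A smooth periodic step function\<close>

lemma sin_ge_cubic:
  fixes x :: real
  assumes "x \<ge> 0"
  shows "sin x \<ge> x - x^3/6"
proof -
  have cosb: "cos y \<ge> 1 - y\<^sup>2/2" for y :: real
  proof -
    have "(sin (y/2))\<^sup>2 \<le> (y/2)\<^sup>2"
      using abs_sin_x_le_abs_x[of "y/2"] by (simp only: abs_le_square_iff)
    moreover have "cos y = 1 - 2 * (sin (y/2))\<^sup>2" using cos_double_sin[of "y/2"] by simp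
    ultimately show ?thesis by (simp add: power2_eq_square)
  qed
  have "sin 0 - (0 - 0^3/6) \<le> sin x - (x - x^3/6)"
  proof (rule DERIV_nonneg_imp_nondecreasing[OF assms])
    fix y assume "0 \<le> y" "y \<le> x"
    have "((\<lambda>x. sin x - (x - x^3/6)) has_real_derivative cos y - (1 - y\<^sup>2/2)) (at y)"
      by (auto intro!: derivative_eq_intros simp: power2_eq_square)
    then show "\<exists>z. ((\<lambda>x. sin x - (x - x^3/6)) has_real_derivative z) (at y) \<and> z \<ge> 0"
      using cosb[of y] by (intro exI[of _ "cos y - (1 - y\<^sup>2/2)"]) auto
  qed
  then show ?thesis by simp
qed

lemma summable_on_int_inverse_power:
  assumes "n \<ge> 2"
  shows "(\<lambda>k::int. 1 / (1 + \<bar>real_of_int k\<bar>) ^ n) summable_on UNIV"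
proof -
  have "summable (\<lambda>k. inverse (real (Suc k) ^ n))"
    using inverse_power_summable[OF assms, where 'a = real] by (subst summable_Suc_iff) auto
  then have "(\<lambda>k::nat. 1 / (1 + real k) ^ n) summable_on UNIV"
    by (subst summable_on_UNIV_nonneg_real_iff) (auto simp: inverse_eq_divide add.commute)
  then have nat: "((\<lambda>k::int. 1 / (1 + \<bar>real_of_int k\<bar>) ^ n) \<circ> int) summable_on UNIV"
     "((\<lambda>k::int. 1 / (1 + \<bar>real_of_int k\<bar>) ^ n) \<circ> (\<lambda>m. - int m)) summable_on UNIV"
    by (simp_all add: o_def)
  have "(\<lambda>k::int. 1 / (1 + \<bar>real_of_int k\<bar>) ^ n) summable_on range int \<union> range (\<lambda>m. - int m)"
    using nat by (intro summable_on_union) (auto simp: summable_on_reindex inj_def)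
  moreover have "range int \<union> range (\<lambda>m. - int m) = UNIV"
    by (auto simp: image_iff) (metis int_cases2)
  ultimately show ?thesis by simp
qed

text \<open>Being periodic, \<open>g\<close> is a step only within one period; every argument at
  which its vanishing is used lies in \<open>{-2..-1/10}\<close>. The symmetry
  \<open>g x + g (- x) = 1\<close> lets the functional equation fold an integral over the line into
  twice one weighted half, with no error.\<close>

lemma smooth_step_exists:
  fixes n :: nat
  assumes n: "n \<ge> 2"
  obtains g :: "real \<Rightarrow> real" and b :: "int \<Rightarrow> complex" and C :: real where
    "\<And>x. 0 \<le> g x" "\<And>x. g x \<le> 1" "continuous_on UNIV g" "\<And>x. g x + g (- x) = 1"
    "\<And>x. -2 \<le> x \<Longrightarrow> x \<le> -1/10 \<Longrightarrow> g x = 0"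
    "\<And>x. ((\<lambda>k. b k * cis (of_int k * x)) has_sum of_real (g x)) UNIV"
    "\<And>k. norm (b k) \<le> C / (1 + \<bar>of_int k\<bar>) ^ n"
proof -
  \<comment> \<open>A steep clamped sine, averaged \<open>n\<close> times over windows of radius \<open>a\<close>: each average gains a factor
    \<open>1 / \<bar>k\<bar>\<close> in the Fourier coefficients and costs \<open>a\<close> at either end of the zero set.\<close>
  define f0 :: "real \<Rightarrow> real" where "f0 = (\<lambda>x. max 0 (min 1 (1/2 + 60 * sin x)))"
  define a where "a = 1 / (20 * real n)"
  have "1 * 1 \<le> pi * (real n * 40)" using n pi_ge_two by (intro mult_mono) auto
  then have a: "0 < a" "a \<le> 2*pi" using n by (auto simp: a_def field_simps)
  define P where "P = (\<lambda>(m::nat) f. continuous_on UNIV f \<and> (\<forall>x. f (x + 2*pi) = f x) \<and> (\<forall>x. 0 \<le> f x \<and> f x \<le> (1::real))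
     \<and> (\<forall>x. f x + f (- x) = 1) \<and> (\<forall>x. -2.2 + m * a \<le> x \<and> x \<le> -1/20 - m * a \<longrightarrow> f x = 0)
     \<and> (\<forall>k\<noteq>0. norm (fourier_int f k) \<le> 2*pi * (1 / (a * \<bar>of_int k\<bar>)) ^ m))"
  have triv: "norm (fourier_int f k) \<le> 2*pi" if "continuous_on UNIV f" "\<And>x. 0 \<le> f x \<and> f x \<le> 1" for f k
  proof -
    have "norm (fourier_int f k) \<le> 1 * (2*pi - 0)"
      unfolding fourier_int_def
    proof (rule integral_bound)
      show "continuous_on {0..2*pi} (\<lambda>x. complex_of_real (f x) * cis (- (of_int k * x)))"
        by (intro continuous_intros continuous_on_subset[OF that(1)]) auto
      show "norm (complex_of_real (f x) * cis (- (of_int k * x))) \<le> 1" for x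
        using that(2)[of x] by (simp add: norm_mult)
    qed simp
    then show ?thesis by simp
  qed
  have P0: "P 0 f0"
  proof -
    have c: "continuous_on UNIV f0" unfolding f0_def by (intro continuous_intros)
    have "f0 x = 0" if "-2.2 \<le> x" "x \<le> -1/20" for x
    proof -
      define y where "y = - x"
      have y: "1/20 \<le> y" "y \<le> 2.2" using that by (auto simp: y_def)
      have "y\<^sup>2 \<le> 2.2\<^sup>2" using y by (intro power_mono) auto
      \<comment> \<open>The left side exceeds \<open>1/120\<close>, at which
        \<open>60 * sin y\<close> reaches \<open>1/2\<close> and the clamp takes over; the slope 60
        is chosen for this.\<close>
      then have "1/20 * (1 - 2.2\<^sup>2/6) \<le> y * (1 - y\<^sup>2/6)" using y by (intro mult_mono) (auto simp: power2_eq_square)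
      then have "sin y \<ge> 1/120" using sin_ge_cubic[of y] y by (simp add: power2_eq_square power3_eq_cube algebra_simps)
      then show ?thesis by (simp add: f0_def y_def)
    qed
    then show ?thesis unfolding P_def using c triv[OF c] by (auto simp: f0_def)
  qed
  have PS: "P (Suc m) (sliding_mean a f)" if "P m f" for m f
  proof -
    have cont: "continuous_on UNIV f" and per: "\<And>x. f (x + 2*pi) = f x" and b: "\<And>x. 0 \<le> f x \<and> f x \<le> 1"
      and sym: "\<And>x. f x + f (- x) = 1" and z: "\<And>x. -2.2 + m * a \<le> x \<and> x \<le> -1/20 - m * a \<Longrightarrow> f x = 0"
      and fc: "\<And>k. k \<noteq> 0 \<Longrightarrow> norm (fourier_int f k) \<le> 2*pi * (1 / (a * \<bar>of_int k\<bar>)) ^ m"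
      using that unfolding P_def by auto
    have ii: "f integrable_on {u..v}" for u v
      by (intro integrable_continuous_interval continuous_on_subset[OF cont]) auto
    have 1: "continuous_on UNIV (sliding_mean a f)"
      using DERIV_isCont[OF sliding_mean_has_derivative[OF cont a(1)]] by (simp add: continuous_on_eq_continuous_at)
    have 2: "sliding_mean a f (x + 2*pi) = sliding_mean a f x" for x
      using integral_translate[OF cont, of "x-a" "x+a" "2*pi", unfolded per] by (simp add: sliding_mean_def algebra_simps)
    have 3: "0 \<le> sliding_mean a f x \<and> sliding_mean a f x \<le> 1" for x
    proof -
      have "integral {x-a..x+a} f \<ge> 0" using b by (intro Henstock_Kurzweil_Integration.integral_nonneg ii) auto
      moreover have "integral {x-a..x+a} f \<le> integral {x-a..x+a} (\<lambda>_. 1)" using b by (intro integral_le ii) auto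
      ultimately show ?thesis using a by (simp add: sliding_mean_def)
    qed
    have 4: "sliding_mean a f x + sliding_mean a f (- x) = 1" for x
    proof -
      have "integral {-x-a..-x+a} f = integral {x-a..x+a} (\<lambda>y. f (- y))"
        using Henstock_Kurzweil_Integration.integral_reflect_real[of "x+a" "x-a" "\<lambda>y. f (- y)"] by (simp add: algebra_simps minus_diff_commute)
      moreover have "integral {x-a..x+a} f + integral {x-a..x+a} (\<lambda>y. f (- y)) = integral {x-a..x+a} (\<lambda>y. 1)"
      proof (subst integral_add[symmetric])
        show "(\<lambda>y. f (- y)) integrable_on {x - a..x + a}"
          by (intro integrable_continuous_interval continuous_on_compose2[OF cont]) (auto intro!: continuous_intros)
      qed (use ii sym in auto)
      ultimately show ?thesis using a by (simp add: sliding_mean_def add_divide_distrib[symmetric])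
    qed
    have 5: "sliding_mean a f x = 0" if "-2.2 + Suc m * a \<le> x \<and> x \<le> -1/20 - Suc m * a" for x
    proof -
      have "integral {x-a..x+a} f = integral {x-a..x+a} (\<lambda>_. 0)"
        using that by (intro Henstock_Kurzweil_Integration.integral_cong z) (auto simp: algebra_simps)
      then show ?thesis by (simp add: sliding_mean_def)
    qed
    have 6: "norm (fourier_int (sliding_mean a f) k) \<le> 2*pi * (1 / (a * \<bar>of_int k\<bar>)) ^ Suc m" if "k \<noteq> 0" for k
    proof -
      have "norm (fourier_int (sliding_mean a f) k) \<le> norm (fourier_int f k) / (a * \<bar>of_int k\<bar>)"
        by (rule fourier_int_sliding_mean[OF cont per a that])
      also have "\<dots> \<le> (2*pi * (1 / (a * \<bar>of_int k\<bar>)) ^ m) / (a * \<bar>of_int k\<bar>)"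
        using a by (intro divide_right_mono fc that) auto
      finally show ?thesis by simp
    qed
    show ?thesis unfolding P_def using 1 2 3 4 5 6 by blast
  qed
  have Pm: "\<exists>f. P m f" for m
    by (induction m) (use P0 PS in blast)+
  obtain g where "P n g" using Pm by blast
  then have cont: "continuous_on UNIV g" and per: "\<And>x. g (x + 2*pi) = g x" and b: "\<And>x. 0 \<le> g x \<and> g x \<le> 1"
      and sym: "\<And>x. g x + g (- x) = 1" and z: "\<And>x. -2.2 + n * a \<le> x \<and> x \<le> -1/20 - n * a \<Longrightarrow> g x = 0"
      and fc: "\<And>k. k \<noteq> 0 \<Longrightarrow> norm (fourier_int g k) \<le> 2*pi * (1 / (a * \<bar>of_int k\<bar>)) ^ n"
    unfolding P_def by auto
  \<comment> \<open>The averages together cost 1/20 at each end of \<open>{-2.2..-1/20}\<close>, so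
    \<open>{-2..-1/10}\<close> survives.\<close>
  have na: "n * a = 1/20" using n by (simp add: a_def)
  define c where "c = (\<lambda>k. fourier_int g k / (2*pi))"
  define C where "C = max 1 ((2/a)^n)"
  have cb: "norm (c k) \<le> C / (1 + \<bar>of_int k\<bar>) ^ n" for k
  proof (cases "k = 0")
    case True
    then show ?thesis using triv[OF cont b, of 0] by (simp add: c_def C_def norm_divide max.coboundedI1)
  next
    case False
    have "norm (c k) \<le> (1 / (a * \<bar>of_int k\<bar>)) ^ n"
      using fc[OF False] by (simp add: c_def norm_divide field_simps)
    also have "\<dots> \<le> (2 / a / (1 + \<bar>of_int k\<bar>)) ^ n"
    proof (intro power_mono)
      have "\<bar>real_of_int k\<bar> \<ge> 1" using False by linarith
      then have "1 / \<bar>real_of_int k\<bar> \<le> 2 / (1 + \<bar>real_of_int k\<bar>)" by (simp add: field_simps)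
      then have "(1 / a) * (1 / \<bar>real_of_int k\<bar>) \<le> (1 / a) * (2 / (1 + \<bar>real_of_int k\<bar>))"
        using a by (intro mult_left_mono) auto
      then show "1 / (a * \<bar>real_of_int k\<bar>) \<le> 2 / a / (1 + \<bar>real_of_int k\<bar>)" by simp
    qed (use a in auto)
    also have "\<dots> = (2 / a) ^ n / (1 + \<bar>of_int k\<bar>) ^ n" by (simp add: power_divide power_mult_distrib)
    also have "\<dots> \<le> C / (1 + \<bar>of_int k\<bar>) ^ n" by (intro divide_right_mono) (auto simp: C_def)
    finally show ?thesis .
  qed
  have "((\<lambda>k. c k * cis (of_int k * x)) has_sum of_real (g x)) UNIV" for x
  proof (rule fourier_series)
    show "continuous_on UNIV (\<lambda>x. complex_of_real (g x))" by (intro continuous_intros cont)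
    show "complex_of_real (g (x + 2*pi)) = complex_of_real (g x)" for x by (simp add: per)
    have "(\<lambda>k. C * (1 / (1 + \<bar>real_of_int k\<bar>) ^ n)) summable_on UNIV"
      by (intro summable_on_cmult_right summable_on_int_inverse_power n)
    then show "(\<lambda>k. norm (c k)) summable_on UNIV"
      by (rule summable_on_comparison_test) (use cb in auto)
    show "integral {0..2*pi} (\<lambda>x. complex_of_real (g x) * cis (- (of_int k * x))) = 2*pi * c k" for k :: int
      by (simp add: c_def fourier_int_def)
  qed
  then show ?thesis using that[of g c C] b cont sym z cb na by auto
qed

section \<open>Poisson summation for the Gaussian\<close>

lemma integral_std_gaussian_cis:
  "integral\<^sup>L lborel (\<lambda>y. of_real (exp (- y\<^sup>2 / 2)) * cis (\<xi> * y)) = of_real (sqrt (2*pi) * exp (- \<xi>\<^sup>2 / 2))"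
    (is "?I = _")
  and integrable_std_gaussian_cis:
  "integrable lborel (\<lambda>y. complex_of_real (exp (- y\<^sup>2 / 2)) * cis (\<xi> * y))"
proof -
  have eq: "std_normal_density y *\<^sub>R iexp (\<xi> * y) = of_real (1 / sqrt (2*pi)) * (of_real (exp (- y\<^sup>2 / 2)) * cis (\<xi> * y))" for y
    by (simp add: std_normal_density_def cis_conv_exp scaleR_conv_of_real)
  have "integrable lborel (\<lambda>y. of_real (std_normal_density y) * iexp (\<xi> * y))"
  proof (rule Bochner_Integration.integrable_bound)
    show "integrable lborel std_normal_density" by (simp add: integrable_normal_density)
  qed (auto simp: norm_mult)
  then have "integrable lborel (\<lambda>y. of_real (sqrt (2*pi)) * (of_real (std_normal_density y) * iexp (\<xi> * y)))"
    by (rule integrable_mult_right)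
  then show int: "integrable lborel (\<lambda>y. complex_of_real (exp (- y\<^sup>2 / 2)) * cis (\<xi> * y))"
    using eq by (simp add: scaleR_conv_of_real)
  have "exp (- \<xi>\<^sup>2 / 2) = char std_normal_distribution \<xi>"
    by (simp add: char_std_normal_distribution)
  also have "\<dots> = integral\<^sup>L lborel (\<lambda>y. std_normal_density y *\<^sub>R iexp (\<xi> * y))"
    unfolding char_def by (subst integral_density) auto
  also have "\<dots> = of_real (1 / sqrt (2*pi)) * ?I"
    unfolding eq by (rule Bochner_Integration.integral_mult_right) (rule int)
  finally have "of_real (sqrt (2*pi)) * complex_of_real (exp (- \<xi>\<^sup>2 / 2)) = of_real (sqrt (2*pi)) * (of_real (1 / sqrt (2*pi)) * ?I)"
    by simp
  also have "\<dots> = ?I" by simp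
  finally show "?I = of_real (sqrt (2*pi) * exp (- \<xi>\<^sup>2 / 2))" by simp
qed

lemma summable_on_int_gaussian:
  fixes c :: real
  assumes "c > 0"
  shows "(\<lambda>n::int. exp (- (c * (of_int n)\<^sup>2))) summable_on UNIV"
proof -
  have "(\<lambda>n::int. (2 + 2/c) * (1 / (1 + \<bar>real_of_int n\<bar>) ^ 2)) summable_on UNIV"
    by (intro summable_on_cmult_right summable_on_int_inverse_power) auto
  then show ?thesis
  proof (rule summable_on_comparison_test)
    fix n :: int
    define m where "m = \<bar>real_of_int n\<bar>"
    have "0 \<le> (m - 1)\<^sup>2" by simp
    then have m: "(1 + m)\<^sup>2 \<le> 2 + 2 * m\<^sup>2" by (simp add: power2_eq_square algebra_simps)
    have p: "1 + c * m\<^sup>2 > 0" "0 < (1 + m)\<^sup>2" using assms by (auto intro!: add_pos_nonneg simp: m_def)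
    have "exp (- (c * m\<^sup>2)) = 1 / exp (c * m\<^sup>2)" by (simp add: exp_minus inverse_eq_divide)
    also have "\<dots> \<le> 1 / (1 + c * m\<^sup>2)" using p exp_ge_add_one_self[of "c * m\<^sup>2"] by (intro divide_left_mono) auto
    also have "\<dots> \<le> (2 + 2/c) * (1 / (1 + m) ^ 2)"
    proof -
      have "2 + 2 * m\<^sup>2 \<le> (2 + 2/c) * (1 + c * m\<^sup>2)" using assms by (simp add: field_simps)
      with m have "(1 + m)\<^sup>2 \<le> (2 + 2/c) * (1 + c * m\<^sup>2)" by linarith
      then show ?thesis using p by (simp add: divide_simps mult.commute)
    qed
    finally show "exp (- (c * (of_int n)\<^sup>2)) \<le> (2 + 2/c) * (1 / (1 + \<bar>real_of_int n\<bar>) ^ 2)" by (simp add: m_def)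
  qed auto
qed

text \<open>The intervals are half open because the translate with index \<open>n\<close> covers the
  period from \<open>2 * pi * n\<close> to \<open>2 * pi * (n + 1)\<close>; their union is then
  symmetric about the origin.\<close>

lemma filterlim_symmetric_intervals:
  "filterlim (\<lambda>N. {- int N..<int N}) (finite_subsets_at_top UNIV) sequentially"
  unfolding filterlim_finite_subsets_at_top
proof (intro allI impI conjI)
  fix Y :: "int set" assume Y: "finite Y \<and> Y \<subseteq> UNIV"
  define M where "M = (\<Sum>y\<in>Y. \<bar>y\<bar>) + 1"
  have "\<bar>y\<bar> < M" if "y \<in> Y" for y
    using member_le_sum[OF that, of abs] Y by (simp add: M_def)
  then show "\<forall>\<^sub>F N in sequentially. finite {- int N..<int N} \<and> Y \<subseteq> {- int N..<int N} \<and> {- int N..<int N} \<subseteq> UNIV"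
    unfolding eventually_sequentially by (intro exI[of _ "nat M"]) force
qed

text \<open>Summing a Gaussian over the translates of a period gives a periodic function whose
  Fourier integrals unfold to the whole line, where the Gaussian reproduces itself. The Fourier
  series is evaluated at \<open>2 * pi * \<alpha>\<close>; the shift \<alpha> is what later
  distinguishes residue classes.\<close>

theorem gaussian_poisson:
  fixes t \<alpha> :: real
  assumes t: "t > 0"
  shows "((\<lambda>k::int. of_real (exp (- pi * (of_int k)\<^sup>2 / t)) * cis (2 * pi * of_int k * \<alpha>)) has_sum
     of_real (sqrt t * (\<Sum>\<^sub>\<infinity>n::int. exp (- pi * t * (of_int n + \<alpha>)\<^sup>2)))) UNIV"
proof -
  define F where "F = (\<lambda>x::real. exp (- pi * t * (x / (2*pi))\<^sup>2))"
  have contF: "continuous_on S F" for S unfolding F_def by (intro continuous_intros) auto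
  define f where "f = (\<lambda>x. \<Sum>\<^sub>\<infinity>n::int. F (x + of_int n * (2*pi)))"
  have Feq: "F (x + of_int n * (2*pi)) = exp (- pi * t * (of_int n + x / (2*pi))\<^sup>2)" for x n
    by (simp add: F_def add_divide_distrib add.commute)
  have ul: "uniform_limit {-A..A} (\<lambda>Y x. \<Sum>n\<in>Y. F (x + of_int n * (2*pi))) f (finite_subsets_at_top UNIV)" for A
    unfolding f_def
  proof (rule Weierstrass_m_test_general)
    define B where "B = A / (2*pi)"
    have "(\<lambda>n::int. exp (pi*t*B\<^sup>2) * exp (- (pi * t/2 * (of_int n)\<^sup>2))) summable_on UNIV"
      using t by (intro summable_on_cmult_right summable_on_int_gaussian) auto
    then show "(\<lambda>n::int. exp (pi*t*B\<^sup>2) * exp (- (pi * t/2 * (of_int n)\<^sup>2))) summable_on UNIV" .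
    show "norm (F (x + of_int n * (2*pi))) \<le> exp (pi*t*B\<^sup>2) * exp (- (pi * t/2 * (of_int n)\<^sup>2))" if "x \<in> {-A..A}" for x n
    proof -
      define y where "y = x / (2*pi)"
      have "\<bar>y\<bar> \<le> B" using that by (auto simp: y_def B_def abs_if divide_simps)
      then have "y\<^sup>2 \<le> B\<^sup>2" by (metis abs_ge_zero power2_abs power_mono)
      \<comment> \<open>Half of this square is
        \<open>(n + y)\<^sup>2 - n\<^sup>2 / 2 + y\<^sup>2\<close>; dropping it gives a majorant
        uniform in \<open>x\<close>.\<close>
      moreover have "0 \<le> (real_of_int n + 2*y)\<^sup>2" by simp
      ultimately have "(real_of_int n)\<^sup>2 / 2 - B\<^sup>2 \<le> (of_int n + y)\<^sup>2" by (simp add: power2_eq_square algebra_simps)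
      then have "pi * t * ((real_of_int n)\<^sup>2 / 2 - B\<^sup>2) \<le> pi * t * (of_int n + y)\<^sup>2"
        using t by (intro mult_left_mono) auto
      then have "exp (- pi * t * (of_int n + y)\<^sup>2) \<le> exp (pi*t*B\<^sup>2 - (pi * t/2 * (of_int n)\<^sup>2))" by (simp add: algebra_simps)
      then show ?thesis unfolding Feq by (simp add: y_def flip: exp_add)
    qed
  qed
  have contf: "continuous_on UNIV f"
  proof -
    have c: "continuous_on {-A..A} f" for A
      by (rule uniform_limit_theorem[OF _ ul])
         (auto intro!: always_eventually continuous_intros continuous_on_compose2[OF contF[of UNIV]])
    have "isCont f x" for x
    proof -
      have "x \<in> interior {-(\<bar>x\<bar>+1)..\<bar>x\<bar>+1}" by auto
      with c show ?thesis using continuous_on_interior by blast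
    qed
    then show ?thesis by (simp add: continuous_on_eq_continuous_at)
  qed
  have perf: "f (x + 2*pi) = f x" for x
  proof -
    have "f (x + 2*pi) = (\<Sum>\<^sub>\<infinity>n. F (x + of_int (n + 1) * (2*pi)))" by (simp add: f_def algebra_simps)
    also have "\<dots> = f x" unfolding f_def
      by (rule infsum_reindex_bij_betw[where g = "\<lambda>n::int. n + 1"]) (rule bij_plus_right)
    finally show ?thesis .
  qed
  define c where "c = (\<lambda>k::int. 1 / sqrt t * exp (- pi * (of_int k)\<^sup>2 / t))"
  have coef: "integral {0..2*pi} (\<lambda>x. of_real (f x) * cis (- (of_int k * x))) = 2*pi * of_real (c k)" for k :: int
  proof -
    define G where "G = (\<lambda>x. complex_of_real (F x) * cis (- (of_int k * x)))"
    have contG: "continuous_on S G" for S unfolding G_def by (intro continuous_intros contF)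
    have iG: "G integrable_on {a..b}" for a b by (intro integrable_continuous_interval contG)
    have shiftG: "of_real (F (x + of_int n * (2*pi))) * cis (- (of_int k * x)) = G (x + of_int n * (2*pi))" for x n
    proof -
      have "cis (- (of_int k * (x + of_int n * (2*pi)))) = cis (- (of_int k * x)) * cis (2 * pi * of_int (- k * n))"
        unfolding cis_mult by (simp add: algebra_simps)
      also have "cis (2 * pi * of_int (- k * n)) = 1" by (rule cis_multiple_2pi) auto
      finally show ?thesis by (simp add: G_def)
    qed
    have ul2: "uniform_limit {0..2*pi} (\<lambda>Y x. (\<Sum>n\<in>Y. G (x + of_int n * (2*pi)))) (\<lambda>x. of_real (f x) * cis (- (of_int k * x))) (finite_subsets_at_top UNIV)"
    proof -
      have "uniform_limit {0..2*pi} (\<lambda>Y x. of_real (\<Sum>n\<in>Y. F (x + of_int n * (2*pi)))) (\<lambda>x. complex_of_real (f x)) (finite_subsets_at_top UNIV)"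
        using uniform_limit_on_subset[OF ul[of "2*pi"], of "{0..2*pi}"]
        unfolding uniform_limit_iff by (auto simp: dist_norm simp flip: of_real_diff simp del: of_real_sum)
      then have "uniform_limit {0..2*pi} (\<lambda>Y x. of_real (\<Sum>n\<in>Y. F (x + of_int n * (2*pi))) * cis (- (of_int k * x)))
          (\<lambda>x. complex_of_real (f x) * cis (- (of_int k * x))) (finite_subsets_at_top UNIV)"
      proof (rule uniform_lim_mult)
        show "bounded ((\<lambda>x. complex_of_real (f x)) ` {0..2*pi})"
          by (intro compact_imp_bounded compact_continuous_image continuous_intros continuous_on_subset[OF contf]) auto
        show "bounded ((\<lambda>x. cis (- (of_int k * x))) ` {0..2*pi})"
          by (intro boundedI[where B = 1]) auto
      qed (rule uniform_limit_const)
      then show ?thesis by (simp add: sum_distrib_right shiftG)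
    qed
    obtain I J where IJ: "\<And>Y. ((\<lambda>x. (\<Sum>n\<in>Y. G (x + of_int n * (2*pi)))) has_integral I Y) {0..2*pi}"
       "((\<lambda>x. of_real (f x) * cis (- (of_int k * x))) has_integral J) {0..2*pi}" "(I \<longlongrightarrow> J) (finite_subsets_at_top UNIV)"
      using ul2 by (rule uniform_limit_integral) (auto intro!: continuous_intros continuous_on_compose2[OF contG[of UNIV]])
    have Isym: "I {- int N..<int N} = integral {- (real N * (2*pi))..real N * (2*pi)} G" for N
    proof -
      have "I {- int N..<int N} = integral {0..2*pi} (\<lambda>x. (\<Sum>n\<in>{- int N..<int N}. G (x + of_int n * (2*pi))))"
        by (rule integral_unique[OF IJ(1), symmetric])
      also have "\<dots> = (\<Sum>n\<in>{- int N..<int N}. integral {0..2*pi} (\<lambda>x. G (x + of_int n * (2*pi))))"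
        by (intro integral_sum) (auto intro!: integrable_continuous_interval continuous_intros continuous_on_compose2[OF contG[of UNIV]])
      also have "\<dots> = (\<Sum>n\<in>{- int N..<int N}. integral {of_int n * (2*pi)..of_int (n+1) * (2*pi)} G)"
        by (intro sum.cong refl, subst integral_translate[OF contG]) (simp add: algebra_simps)
      also have "\<dots> = integral {- (real N * (2*pi))..real N * (2*pi)} G"
      proof (induction N)
        case (Suc N)
        have "{- int (Suc N)..<int (Suc N)} = insert (- int (Suc N)) (insert (int N) {- int N..<int N})" by auto
        then have "(\<Sum>n\<in>{- int (Suc N)..<int (Suc N)}. integral {of_int n * (2*pi)..of_int (n+1) * (2*pi)} G) =
          integral {of_int (- int (Suc N)) * (2*pi)..of_int (- int (Suc N)+1) * (2*pi)} G + (integral {of_int (int N) * (2*pi)..of_int (int N+1) * (2*pi)} G +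
           integral {- (real N * (2*pi))..real N * (2*pi)} G)"
          using Suc by simp
        also have "\<dots> = integral {- (real (Suc N) * (2*pi))..- (real N * (2*pi))} G + (integral {- (real N * (2*pi))..real N * (2*pi)} G + integral {real N * (2*pi)..real (Suc N) * (2*pi)} G)"
          by (simp add: algebra_simps)
        also have "integral {- (real N * (2*pi))..real N * (2*pi)} G + integral {real N * (2*pi)..real (Suc N) * (2*pi)} G = integral {- (real N * (2*pi))..real (Suc N) * (2*pi)} G"
          by (rule Henstock_Kurzweil_Integration.integral_combine) (simp_all add: iG mult_right_mono del: of_nat_Suc)
        also have "integral {- (real (Suc N) * (2*pi))..- (real N * (2*pi))} G + integral {- (real N * (2*pi))..real (Suc N) * (2*pi)} G =
           integral {- (real (Suc N) * (2*pi))..real (Suc N) * (2*pi)} G"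
        proof (rule Henstock_Kurzweil_Integration.integral_combine)
          show "- (real (Suc N) * (2*pi)) \<le> - (real N * (2*pi))" by (simp add: mult_right_mono del: of_nat_Suc)
          show "- (real N * (2*pi)) \<le> real (Suc N) * (2*pi)" by (rule order_trans[of _ 0]) simp_all
        qed (rule iG)
        finally show ?case .
      qed simp
      finally show ?thesis .
    qed
    \<comment> \<open>At this scale \<open>F (s * y)\<close> is
      \<open>exp (- y\<^sup>2 / 2)\<close>, and the coefficient becomes the normal characteristic
      function at \<open>- k * s\<close>.\<close>
    define s where "s = sqrt (2*pi/t)"
    have s: "s > 0" "s\<^sup>2 = 2*pi/t" using t by (auto simp: s_def)
    have Gs: "G (0 + s * y) = of_real (exp (- y\<^sup>2/2)) * cis ((- of_int k * s) * y)" for y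
    proof -
      have "pi * t * (s * y / (2*pi))\<^sup>2 = y\<^sup>2/2"
        using s t by (simp add: power_divide power_mult_distrib) (simp add: power2_eq_square)
      then show ?thesis by (simp add: G_def F_def mult_ac)
    qed
    have intG: "integrable lborel G"
      using integrable_std_gaussian_cis[of "- of_int k * s"] s unfolding Gs[symmetric]
      by (subst (asm) lborel_integrable_real_affine_iff) auto
    have valG: "integral\<^sup>L lborel G = 2*pi * of_real (c k)"
    proof -
      have "integral\<^sup>L lborel G = \<bar>s\<bar> *\<^sub>R integral\<^sup>L lborel (\<lambda>y. G (0 + s * y))"
        by (rule lborel_integral_real_affine) (use s in auto)
      also have "\<dots> = of_real (s * (sqrt (2*pi) * exp (- (- of_int k * s)\<^sup>2 / 2)))"
        unfolding Gs integral_std_gaussian_cis using s by (simp add: scaleR_conv_of_real)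
      also have "s * (sqrt (2*pi) * exp (- (- of_int k * s)\<^sup>2 / 2)) = 2*pi * c k"
      proof -
        have "s * sqrt (2*pi) = 2*pi / sqrt t" by (simp add: s_def real_sqrt_divide)
        moreover have "(- real_of_int k * s)\<^sup>2 / 2 = pi * (of_int k)\<^sup>2 / t" using s by (simp add: power_mult_distrib)
        ultimately show ?thesis unfolding c_def mult.assoc[symmetric] by simp
      qed
      finally show ?thesis by simp
    qed
    have "(\<lambda>N. integral {- (real N * (2*pi))..real N * (2*pi)} G) \<longlonglongrightarrow> integral\<^sup>L lborel G"
    proof -
      have eq: "integral {- (real N * (2*pi))..real N * (2*pi)} G = integral\<^sup>L lborel (\<lambda>x. indicator {- (real N * (2*pi))..real N * (2*pi)} x *\<^sub>R G x)" for N
        using set_borel_integral_eq_integral(2)[of "{- (real N * (2*pi))..real N * (2*pi)}" G] intG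
        by (simp add: set_lebesgue_integral_def set_integrable_def integrable_mult_indicator)
      show ?thesis unfolding eq
      proof (rule integral_dominated_convergence[where w = "\<lambda>x. norm (G x)"])
        show "AE x in lborel. (\<lambda>N. indicator {- (real N * (2*pi))..real N * (2*pi)} x *\<^sub>R G x) \<longlonglongrightarrow> G x"
        proof (intro AE_I2 tendsto_eventually)
          fix x :: real
          obtain N0 :: nat where N0: "\<bar>x\<bar> / (2*pi) < real N0" using reals_Archimedean2 by blast
          have "x \<in> {- (real N * (2*pi))..real N * (2*pi)}" if "N \<ge> N0" for N
          proof -
            have "\<bar>x\<bar> / (2*pi) \<le> real N" using N0 that by linarith
            then show ?thesis by (auto simp: field_simps abs_le_iff)
          qed
          then show "\<forall>\<^sub>F N in sequentially. indicator {- (real N * (2*pi))..real N * (2*pi)} x *\<^sub>R G x = G x"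
            unfolding eventually_sequentially by (intro exI[of _ N0]) auto
        qed
      qed (use intG in \<open>auto simp: indicator_def\<close>)
    qed
    moreover have "(\<lambda>N. I {- int N..<int N}) \<longlonglongrightarrow> J"
      using filterlim_compose[OF IJ(3) filterlim_symmetric_intervals] .
    ultimately have "J = integral\<^sup>L lborel G" unfolding Isym using LIMSEQ_unique by blast
    then show ?thesis using IJ(2) valG by (simp add: integral_unique)
  qed
  have cs: "(\<lambda>k. exp (- pi * (of_int k)\<^sup>2 / t)) summable_on (UNIV :: int set)"
    using summable_on_int_gaussian[of "pi/t"] t by simp
  have "((\<lambda>k. of_real (c k) * cis (of_int k * (2*pi*\<alpha>))) has_sum of_real (f (2*pi*\<alpha>))) UNIV"
  proof (rule fourier_series[where f = "\<lambda>x. of_real (f x)"])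
    show "continuous_on UNIV (\<lambda>x. complex_of_real (f x))" by (intro continuous_intros contf)
    show "complex_of_real (f (x + 2*pi)) = complex_of_real (f x)" for x by (simp add: perf)
    show "(\<lambda>k. norm (complex_of_real (c k))) summable_on UNIV"
      using summable_on_cmult_right[OF cs, of "1 / sqrt t"] t by (simp add: c_def norm_mult norm_divide)
  qed (use coef in simp)
  then have "((\<lambda>k. of_real (sqrt t) * (of_real (c k) * cis (of_int k * (2*pi*\<alpha>)))) has_sum of_real (sqrt t) * of_real (f (2*pi*\<alpha>))) UNIV"
    by (rule has_sum_cmult_right)
  moreover have "of_real (sqrt t) * (of_real (c k) * cis (of_int k * (2*pi*\<alpha>))) = of_real (exp (- pi * (of_int k)\<^sup>2 / t)) * cis (2 * pi * of_int k * \<alpha>)" for k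
    using t by (simp add: c_def mult_ac)
  moreover have "f (2*pi*\<alpha>) = (\<Sum>\<^sub>\<infinity>n::int. exp (- pi * t * (of_int n + \<alpha>)\<^sup>2))"
    unfolding f_def Feq by simp
  ultimately show ?thesis by simp
qed

section \<open>Dirichlet characters\<close>

lemma dirichlet_char_mult: "dirichlet_char q X \<Longrightarrow> X (a * b) = X a * X b"
  by (simp add: dirichlet_char_def)

lemma dirichlet_char_eq_0_iff: "dirichlet_char q X \<Longrightarrow> X a = 0 \<longleftrightarrow> \<not> coprime a (int q)"
  unfolding dirichlet_char_def by blast

lemma dirichlet_char_cong:
  assumes "dirichlet_char q X" "[a = b] (mod int q)"
  shows "X a = X b"
  using assms(2) dirichlet_char_mod[OF assms(1)] unfolding cong_def by metis

lemma dirichlet_char_power: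
  assumes "dirichlet_char q X"
  shows "X (a ^ k) = X a ^ k"
  by (induction k) (auto simp: dirichlet_char_1[OF assms] dirichlet_char_mult[OF assms])

lemma norm_dirichlet_char:
  assumes "dirichlet_char q X" "q > 0"
  shows "norm (X a) = (if coprime a (int q) then 1 else 0)"
proof (cases "coprime a (int q)")
  case True
  define b where "b = nat (a mod int q)"
  have b: "int b = a mod int q" using assms(2) by (simp add: b_def)
  have "coprime (int b) (int q)" using True assms(2) by (simp add: b)
  then have "[b ^ totient q = 1] (mod q)" by (intro euler_theorem) simp
  then have "[int b ^ totient q = 1] (mod int q)"
    by (metis cong_int_iff of_nat_1 of_nat_power)
  then have "X (int b) ^ totient q = 1"
    using dirichlet_char_cong[OF assms(1)] dirichlet_char_power[OF assms(1)] dirichlet_char_1[OF assms(1)] by metis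
  then have "norm (X (int b)) ^ totient q = 1 ^ totient q" by (simp flip: norm_power)
  moreover have "totient q > 0" using assms(2) by simp
  ultimately have "norm (X (int b)) = 1" using power_eq_imp_eq_base[of _ "totient q" 1] by fastforce
  then show ?thesis using True dirichlet_char_mod[OF assms(1), of a] by (simp add: b)
next
  case False
  then show ?thesis using dirichlet_char_eq_0_iff[OF assms(1)] by simp
qed

lemma dirichlet_char_mult_cnj:
  assumes "dirichlet_char q X" "q > 0" "coprime a (int q)"
  shows "X a * cnj (X a) = 1"
  using norm_dirichlet_char[OF assms(1,2), of a] assms(3) by (simp add: complex_norm_square[symmetric])

lemma sum_residues_mult:
  fixes f :: "int \<Rightarrow> complex"
  assumes per: "\<And>a. f (a mod int q) = f a" and q: "q > 0" and b: "coprime b (int q)"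
  shows "(\<Sum>a\<in>{0..<int q}. f (a * b)) = (\<Sum>a\<in>{0..<int q}. f a)"
proof -
  obtain c where c: "[b * c = 1] (mod int q)" using b cong_solve_coprime_int by blast
  have inv: "((a * b) mod int q * c) mod int q = a" "((a * c) mod int q * b) mod int q = a"
    if "a \<in> {0..<int q}" for a
  proof -
    have "[a * (b * c) = a * 1] (mod int q)" by (intro cong_mult cong_refl c)
    then have "(a * (b * c)) mod int q = a" using that by (simp add: cong_def)
    then show "((a * b) mod int q * c) mod int q = a" "((a * c) mod int q * b) mod int q = a"
      by (simp_all add: mod_mult_left_eq mult.assoc mult.left_commute mult.commute[of c])
        (simp add: mult_ac)?
  qed
  show ?thesis
    by (rule sum.reindex_bij_witness[where i = "\<lambda>a. (a * c) mod int q" and j = "\<lambda>a. (a * b) mod int q"])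
       (use q inv per in auto)
qed

lemma dirichlet_char_orthogonal:
  assumes X: "dirichlet_char q X" and Y: "dirichlet_char q Y" and q: "q > 0" and neq: "X \<noteq> Y"
  shows "(\<Sum>a\<in>{0..<int q}. X a * cnj (Y a)) = 0"
proof -
  obtain b where b: "X b \<noteq> Y b" using neq by blast
  then have cop: "coprime b (int q)" using dirichlet_char_eq_0_iff[OF X] dirichlet_char_eq_0_iff[OF Y] by metis
  define S where "S = (\<Sum>a\<in>{0..<int q}. X a * cnj (Y a))"
  have "S = (\<Sum>a\<in>{0..<int q}. X (a * b) * cnj (Y (a * b)))"
    unfolding S_def by (rule sum_residues_mult[symmetric, OF _ q cop])
      (simp add: dirichlet_char_mod[OF X] dirichlet_char_mod[OF Y])
  also have "\<dots> = X b * cnj (Y b) * S"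
    by (simp add: S_def sum_distrib_left dirichlet_char_mult[OF X] dirichlet_char_mult[OF Y] mult_ac)
  finally have "S = 0 \<or> X b * cnj (Y b) = 1" by auto
  moreover have "X b * cnj (Y b) \<noteq> 1"
  proof
    assume 1: "X b * cnj (Y b) = 1"
    have "X b = X b * (Y b * cnj (Y b))" by (simp add: dirichlet_char_mult_cnj[OF Y q cop])
    also have "\<dots> = Y b * (X b * cnj (Y b))" by (simp add: mult_ac)
    finally show False using 1 b by simp
  qed
  ultimately show ?thesis by (simp add: S_def)
qed

lemma sum_residues_conv_nat:
  fixes f :: "int \<Rightarrow> complex"
  assumes "f 0 = 0"
  shows "(\<Sum>a\<in>{0..<int q}. f a) = (\<Sum>n\<in>{0<..<q}. f (int n))"
proof -
  have "(\<Sum>a\<in>{0..<int q}. f a) = (\<Sum>n\<in>{0..<q}. f (int n))"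
    by (rule sum.reindex_bij_witness[where i = int and j = nat]) auto
  also have "\<dots> = (\<Sum>n\<in>{0<..<q}. f (int n))"
    by (rule sum.mono_neutral_right) (use assms in \<open>auto simp: Suc_le_eq\<close>)
  finally show ?thesis .
qed

lemma sum_dirichlet_char_sqnorm:
  assumes X: "dirichlet_char q X" and q: "q > 1"
  shows "(\<Sum>n\<in>{0<..<q}. X (int n) * cnj (X (int n))) = of_nat (totient q)"
proof -
  have "(\<Sum>n\<in>{0<..<q}. X (int n) * cnj (X (int n))) = (\<Sum>n\<in>{0<..<q}. if coprime n q then 1 else 0)"
    using q dirichlet_char_mult_cnj[OF X] dirichlet_char_eq_0_iff[OF X] by (intro sum.cong) auto
  also have "\<dots> = of_nat (card {n\<in>{0<..<q}. coprime n q})"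
    by (simp add: sum.If_cases Int_def)
  also have "{n\<in>{0<..<q}. coprime n q} = totatives q"
  proof -
    have "n < q" if "n \<in> totatives q" for n using totatives_less[OF that] q by simp
    then show ?thesis by (auto simp: totatives_def Suc_le_eq)
  qed
  finally show ?thesis by (simp add: totient_def)
qed

text \<open>Distinct characters are orthogonal on the residues, so the squared distance from
  \<open>a\<close> to its projection onto their span is nonnegative. The case of a single nonzero
  coefficient later bounds the number of characters.\<close>

lemma dirichlet_char_bessel:
  fixes a :: "nat \<Rightarrow> complex"
  assumes q: "q > 1"
  shows "(\<Sum>X | dirichlet_char q X. (norm (\<Sum>n\<in>{0<..<q}. a n * X (int n)))\<^sup>2)
     \<le> real (totient q) * (\<Sum>n\<in>{0<..<q}. (norm (a n))\<^sup>2)"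
proof -
  define D where "D = {X. dirichlet_char q X}"
  define T where "T = (\<lambda>X::int \<Rightarrow> complex. \<Sum>n\<in>{0<..<q}. a n * X (int n))"
  define \<phi> where "\<phi> = complex_of_nat (totient q)"
  have finD: "finite D" unfolding D_def using q by (intro finite_dirichlet_chars) auto
  have cq0: "\<not> coprime 0 (int q)" using q by simp
  have orth: "(\<Sum>n\<in>{0<..<q}. X (int n) * cnj (Y (int n))) = (if X = Y then \<phi> else 0)"
    if "X \<in> D" "Y \<in> D" for X Y
  proof (cases "X = Y")
    case True
    then show ?thesis using sum_dirichlet_char_sqnorm[of q X] that q by (simp add: D_def \<phi>_def)
  next
    case False
    have "(\<Sum>a\<in>{0..<int q}. X a * cnj (Y a)) = 0"
      using dirichlet_char_orthogonal[of q X Y] that False q by (simp add: D_def)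
    moreover have "X 0 = 0" using that cq0 dirichlet_char_eq_0_iff[of q X 0] by (simp add: D_def)
    ultimately show ?thesis using False by (simp add: sum_residues_conv_nat)
  qed
  \<comment> \<open>Divided by \<open>\<phi>\<close> this is the orthogonal projection of
    \<open>a\<close> onto the span of the conjugated characters; the scaled difference
    \<open>\<phi> * a n - R n\<close> avoids the division.\<close>
  define R where "R = (\<lambda>n. \<Sum>X\<in>D. T X * cnj (X (int n)))"
  have sqn: "(\<Sum>n\<in>A. z n * cnj (z n)) = of_real (\<Sum>n\<in>A. (norm (z n))\<^sup>2)" for z :: "'b \<Rightarrow> complex" and A
    by (simp only: of_real_sum complex_norm_square)
  define S1 where "S1 = (\<Sum>n\<in>{0<..<q}. a n * cnj (a n))"
  define S2 where "S2 = (\<Sum>X\<in>D. T X * cnj (T X))"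
  have c1: "(\<Sum>n\<in>{0<..<q}. R n * cnj (a n)) = S2"
  proof -
    have "(\<Sum>n\<in>{0<..<q}. R n * cnj (a n)) = (\<Sum>X\<in>D. \<Sum>n\<in>{0<..<q}. T X * (cnj (a n) * cnj (X (int n))))"
      unfolding R_def sum_distrib_right by (subst sum.swap) (simp add: mult_ac)
    also have "\<dots> = S2" unfolding S2_def T_def by (simp add: sum_distrib_left)
    finally show ?thesis .
  qed
  have c2: "(\<Sum>n\<in>{0<..<q}. a n * cnj (R n)) = S2"
  proof -
    have "(\<Sum>n\<in>{0<..<q}. a n * cnj (R n)) = cnj (\<Sum>n\<in>{0<..<q}. R n * cnj (a n))" by (simp add: mult.commute)
    also have "\<dots> = S2" unfolding c1 by (simp add: S2_def mult.commute)
    finally show ?thesis .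
  qed
  have c3: "(\<Sum>n\<in>{0<..<q}. R n * cnj (R n)) = \<phi> * S2"
  proof -
    have "(\<Sum>n\<in>{0<..<q}. R n * cnj (R n)) = (\<Sum>n\<in>{0<..<q}. \<Sum>X\<in>D. \<Sum>Y\<in>D. T X * cnj (T Y) * (Y (int n) * cnj (X (int n))))"
      unfolding R_def by (simp add: sum_product mult_ac)
    also have "\<dots> = (\<Sum>X\<in>D. \<Sum>n\<in>{0<..<q}. \<Sum>Y\<in>D. T X * cnj (T Y) * (Y (int n) * cnj (X (int n))))"
      by (rule sum.swap)
    also have "\<dots> = (\<Sum>X\<in>D. \<Sum>Y\<in>D. T X * cnj (T Y) * (\<Sum>n\<in>{0<..<q}. Y (int n) * cnj (X (int n))))"
      by (subst sum.swap) (simp add: sum_distrib_left)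
    also have "\<dots> = (\<Sum>X\<in>D. \<Sum>Y\<in>D. if Y = X then \<phi> * (T X * cnj (T X)) else 0)"
      by (intro sum.cong refl) (simp add: orth del: One_nat_def)
    also have "\<dots> = (\<Sum>X\<in>D. \<phi> * (T X * cnj (T X)))"
    proof (rule sum.cong[OF refl])
      fix X assume "X \<in> D"
      then show "(\<Sum>Y\<in>D. if Y = X then \<phi> * (T X * cnj (T X)) else 0) = \<phi> * (T X * cnj (T X))"
        using sum.delta[OF finD, of X "\<lambda>Y. \<phi> * (T X * cnj (T X))"] by simp
    qed
    also have "\<dots> = \<phi> * S2" by (simp add: S2_def sum_distrib_left)
    finally show ?thesis .
  qed
  have "(\<Sum>n\<in>{0<..<q}. (\<phi> * a n - R n) * cnj (\<phi> * a n - R n)) = \<phi>\<^sup>2 * S1 - \<phi> * S2"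
  proof -
    have "(\<Sum>n\<in>{0<..<q}. (\<phi> * a n - R n) * cnj (\<phi> * a n - R n)) =
      (\<Sum>n\<in>{0<..<q}. \<phi>\<^sup>2 * (a n * cnj (a n)) - \<phi> * (a n * cnj (R n)) - \<phi> * (R n * cnj (a n)) + R n * cnj (R n))"
      by (intro sum.cong refl) (simp add: \<phi>_def algebra_simps power2_eq_square)
    also have "\<dots> = \<phi>\<^sup>2 * S1 - \<phi> * (\<Sum>n\<in>{0<..<q}. a n * cnj (R n)) - \<phi> * (\<Sum>n\<in>{0<..<q}. R n * cnj (a n)) + (\<Sum>n\<in>{0<..<q}. R n * cnj (R n))"
      by (simp add: sum.distrib sum_subtractf sum_distrib_left S1_def)
    finally show ?thesis by (simp add: c1 c2 c3)
  qed
  moreover have "0 \<le> Re (\<Sum>n\<in>{0<..<q}. (\<phi> * a n - R n) * cnj (\<phi> * a n - R n))"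
    unfolding sqn by (simp add: sum_nonneg)
  ultimately have "0 \<le> Re (\<phi>\<^sup>2 * S1 - \<phi> * S2)" by simp
  moreover have "S1 = of_real (\<Sum>n\<in>{0<..<q}. (norm (a n))\<^sup>2)" "S2 = of_real (\<Sum>X\<in>D. (norm (T X))\<^sup>2)"
    unfolding S1_def S2_def sqn by simp_all
  moreover have "\<phi> = of_real (real (totient q))" by (simp add: \<phi>_def)
  ultimately have "0 \<le> Re (of_real ((real (totient q))\<^sup>2 * (\<Sum>n\<in>{0<..<q}. (norm (a n))\<^sup>2) - real (totient q) * (\<Sum>X\<in>D. (norm (T X))\<^sup>2)))"
    by (simp only: of_real_diff of_real_mult of_real_power)
  then have "0 \<le> (real (totient q))\<^sup>2 * (\<Sum>n\<in>{0<..<q}. (norm (a n))\<^sup>2) - real (totient q) * (\<Sum>X\<in>D. (norm (T X))\<^sup>2)"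
    by (simp only: Re_complex_of_real)
  then have "real (totient q) * (\<Sum>X\<in>D. (norm (T X))\<^sup>2) \<le> real (totient q) * (real (totient q) * (\<Sum>n\<in>{0<..<q}. (norm (a n))\<^sup>2))"
    by (simp add: power2_eq_square mult.assoc)
  moreover have "real (totient q) > 0" using q by simp
  ultimately have "(\<Sum>X\<in>D. (norm (T X))\<^sup>2) \<le> real (totient q) * (\<Sum>n\<in>{0<..<q}. (norm (a n))\<^sup>2)"
    by (rule mult_left_le_imp_le)
  then show ?thesis by (simp add: D_def T_def)
qed

section \<open>Primitive characters and their Gauss sums\<close>

text \<open>Every prime factor of \<open>q\<close> divides exactly one of \<open>a\<close> and
  \<open>d * m\<close>: \<open>m\<close> collects the primes missing from \<open>a\<close>, and
  those dividing \<open>a\<close> divide neither \<open>d\<close> nor \<open>m\<close>. So none of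
  them divides the sum.\<close>

lemma coprime_lift:
  fixes a :: int and q d :: nat
  assumes q: "q > 0" and d: "d dvd q" and a: "coprime a (int d)"
  shows "\<exists>b. [b = a] (mod int d) \<and> coprime b (int q)"
proof -
  define m where "m = \<Prod>{p \<in> prime_factors q. \<not> int p dvd a}"
  define b where "b = a + int d * int m"
  have "coprime b (int q)"
  proof (rule ccontr)
    assume "\<not> coprime b (int q)"
    then obtain c where c: "c dvd b" "c dvd int q" "\<not> is_unit c" by (rule not_coprimeE)
    then have "c \<noteq> 0" using q by auto
    then obtain P where P: "P dvd c" "prime P" using prime_divisor_exists[of c] c(3) by blast
    define p where "p = nat P"
    have ipP: "int p = P" using P(2) by (simp add: p_def prime_ge_0_int)
    have "prime (int p)" unfolding ipP by (rule P(2))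
    then have p: "prime p" by simp
    have pb: "int p dvd b" "p dvd q"
      using dvd_trans[OF P(1) c(1)] dvd_trans[OF P(1) c(2)] by (simp_all add: ipP flip: int_dvd_int_iff)
    have pq: "p \<in> prime_factors q" using p pb(2) q by (simp add: prime_factors_dvd)
    have ip: "prime (int p)" using p by simp
    show False
    proof (cases "int p dvd a")
      case True
      then have "int p dvd int d * int m" using pb(1) by (simp add: b_def dvd_add_right_iff)
      then have "int p dvd int d \<or> int p dvd int m" using ip prime_dvd_mult_iff by blast
      then show False
      proof
        assume "int p dvd int d"
        with True a have "is_unit (int p)" by (meson coprime_def)
        then show False using ip not_prime_unit by blast
      next
        assume "int p dvd int m"
        then have "p dvd m" by simp
        then obtain p' where p': "p' \<in> {p \<in> prime_factors q. \<not> int p dvd a}" "p dvd p'"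
          using p unfolding m_def by (auto simp: prime_dvd_prod_iff)
        then have "p = p'" using p primes_dvd_imp_eq by auto
        then show False using True p' by simp
      qed
    next
      case False
      then have "p dvd m" using pq unfolding m_def by (intro dvd_prodI) auto
      then have "int p dvd int d * int m" by simp
      then show False using pb(1) False by (simp add: b_def dvd_add_left_iff)
    qed
  qed
  moreover have "[b = a] (mod int d)" by (simp add: b_def cong_def)
  ultimately show ?thesis by blast
qed

text \<open>Otherwise \<open>X\<close> would agree on units congruent modulo \<open>d\<close>, and
  its values at lifts coprime to \<open>q\<close> would define a character modulo \<open>d\<close>
  that induces it.\<close>

lemma primitive_char_nontrivial:
  assumes prim: "primitive_char q X" and q: "q > 0" and d: "d dvd q" "d < q"
  shows "\<exists>b. coprime b (int q) \<and> [b = 1] (mod int d) \<and> X b \<noteq> 1"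
proof (rule ccontr)
  assume "\<not> ?thesis"
  then have triv: "X b = 1" if "coprime b (int q)" "[b = 1] (mod int d)" for b using that by blast
  have X: "dirichlet_char q X" using prim by (simp add: primitive_char_def)
  have d0: "d > 0" using d q by (auto intro: Nat.gr0I)
  have wd: "X b = X c" if "coprime b (int q)" and cop: "coprime c (int q)" and "[b = c] (mod int d)" for b c
  proof -
    obtain e where e: "[c * e = 1] (mod int q)" using cong_solve_coprime_int[OF cop] by blast
    then have ce: "coprime (c * e) (int q)" by (meson coprime_1_left cong_imp_coprime cong_sym)
    have ed: "[c * e = 1] (mod int d)" using e d(1) by (meson cong_dvd_modulus int_dvd_int_iff)
    have "coprime e (int q)" using ce by simp
    then have be: "coprime (b * e) (int q)" using that(1) by simp
    have "[b * e = c * e] (mod int d)" using that(3) by (intro cong_mult) auto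
    then have "[b * e = 1] (mod int d)" using ed cong_trans by blast
    then have "X b * X e = 1" "X c * X e = 1"
      using triv[OF be] triv[OF ce ed] by (simp_all add: dirichlet_char_mult[OF X])
    then show ?thesis by (metis mult_cancel_right zero_neq_one mult_zero_right)
  qed
  define l where "l = (\<lambda>a. SOME b. [b = a] (mod int d) \<and> coprime b (int q))"
  have l: "[l a = a] (mod int d) \<and> coprime (l a) (int q)" if "coprime a (int d)" for a
    unfolding l_def by (rule someI_ex) (rule coprime_lift[OF q d(1) that])
  define Y where "Y = (\<lambda>a. if coprime a (int d) then X (l a) else 0)"
  have "dirichlet_char d Y"
    unfolding dirichlet_char_def
  proof (intro conjI allI)
    fix a b
    show "Y (a * b) = Y a * Y b"
    proof (cases "coprime a (int d) \<and> coprime b (int d)")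
      case True
      then have ab: "coprime (a * b) (int d)" by simp
      have "[l (a * b) = l a * l b] (mod int d)"
        using l[OF ab] l[of a] l[of b] True by (meson cong_mult cong_sym cong_trans)
      then have "X (l (a * b)) = X (l a * l b)"
        using l[OF ab] l[of a] l[of b] True by (intro wd) auto
      then show ?thesis using True ab by (simp add: Y_def dirichlet_char_mult[OF X])
    qed (auto simp: Y_def)
    have cop: "coprime (a + int d) (int d) = coprime a (int d)"
      by (simp only: coprime_iff_gcd_eq_1 gcd_add1)
    show "Y (a + int d) = Y a"
    proof (cases "coprime a (int d)")
      case True
      then have a': "coprime (a + int d) (int d)" by (simp only: cop)
      have "[l (a + int d) = l a] (mod int d)"
        using l[OF a'] l[OF True] by (simp add: cong_def)
      then have "X (l (a + int d)) = X (l a)" using l[OF a'] l[OF True] by (intro wd) auto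
      then show ?thesis using True a' by (simp add: Y_def)
    qed (simp add: Y_def cop)
    show "(Y a \<noteq> 0) = coprime a (int d)"
      using l[of a] dirichlet_char_eq_0_iff[OF X, of "l a"] by (auto simp: Y_def)
  qed
  moreover have "X a = Y a" if "coprime a (int q)" for a
  proof -
    have "coprime a (int d)" using that d(1) by (meson coprime_divisors dvd_refl int_dvd_int_iff)
    then show ?thesis using l[of a] wd[of "l a" a] that by (simp add: Y_def)
  qed
  ultimately show False using prim d unfolding primitive_char_def by blast
qed

lemma primitive_char_L_domain:
  assumes "primitive_char q X" "q > 1"
  shows "L_domain X = UNIV"
proof -
  \<comment> \<open>Modulo 1 every \<open>b\<close> is congruent to 1, and \<open>q > 1\<close>
    makes 1 a proper divisor.\<close>
  obtain b where "coprime b (int q)" "X b \<noteq> 1"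
    using primitive_char_nontrivial[OF assms(1), of 1] assms(2) by auto
  moreover have "X b \<noteq> 0"
    using assms calculation dirichlet_char_eq_0_iff by (auto simp: primitive_char_def)
  ultimately have "\<not> range X \<subseteq> {0, 1}" by auto
  then show ?thesis by (simp add: L_domain_def)
qed

definition gauss_sum :: "nat \<Rightarrow> (int \<Rightarrow> complex) \<Rightarrow> int \<Rightarrow> complex" where
  "gauss_sum q X k = (\<Sum>a\<in>{0..<int q}. X a * cis (2 * pi * of_int (a * k) / real q))"

lemma cis_cong:
  assumes "[a = b] (mod int q)" "q > 0"
  shows "cis (2 * pi * of_int a / real q) = cis (2 * pi * of_int b / real q)"
proof -
  obtain m where "b = a + int q * m" using assms(1) by (metis cong_iff_lin)
  then have "2 * pi * of_int b / real q = 2 * pi * of_int a / real q + 2 * pi * of_int m"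
    using assms(2) by (simp add: field_simps)
  moreover have "cis (2 * pi * of_int m) = 1" by (rule cis_multiple_2pi) auto
  ultimately show ?thesis by (simp flip: cis_mult)
qed

lemma gauss_sum_mult_coprime:
  assumes X: "dirichlet_char q X" and q: "q > 0" and b: "coprime b (int q)"
  shows "gauss_sum q X (k * b) = cnj (X b) * gauss_sum q X k"
proof -
  have "X b * gauss_sum q X (k * b) = (\<Sum>a\<in>{0..<int q}. X (a * b) * cis (2 * pi * of_int ((a * b) * k) / real q))"
    by (simp add: gauss_sum_def sum_distrib_left dirichlet_char_mult[OF X] mult_ac)
  also have "\<dots> = gauss_sum q X k" unfolding gauss_sum_def
  proof (rule sum_residues_mult[OF _ q b])
    fix a
    have "[a mod int q * k = a * k] (mod int q)" by (intro cong_mult) (auto simp: cong_def)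
    from cis_cong[OF this q]
    show "X (a mod int q) * cis (2 * pi * of_int (a mod int q * k) / real q) = X a * cis (2 * pi * of_int (a * k) / real q)"
      by (simp add: dirichlet_char_mod[OF X])
  qed
  finally have "cnj (X b) * gauss_sum q X k = (X b * cnj (X b)) * gauss_sum q X (k * b)" by (simp add: mult_ac)
  then show ?thesis by (simp add: dirichlet_char_mult_cnj[OF X q b])
qed

text \<open>If \<open>k\<close> and \<open>q\<close> have a common factor \<open>g > 1\<close>,
  primitivity supplies a unit \<open>b\<close>, congruent to 1 modulo \<open>q div g\<close>, with
  \<open>X b \<noteq> 1\<close>. As \<open>k * b\<close> and \<open>k\<close> agree modulo
  \<open>q\<close>, the Gauss sum equals \<open>cnj (X b)\<close> times itself and must
  vanish.\<close>

lemma gauss_sum_primitive: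
  assumes prim: "primitive_char q X" and q: "q > 0"
  shows "gauss_sum q X k = cnj (X k) * gauss_sum q X 1"
proof (cases "coprime k (int q)")
  case True
  have X: "dirichlet_char q X" using prim by (simp add: primitive_char_def)
  show ?thesis using gauss_sum_mult_coprime[OF X q True, of 1] by simp
next
  case False
  have X: "dirichlet_char q X" using prim by (simp add: primitive_char_def)
  define g where "g = nat (gcd k (int q))"
  have g: "int g = gcd k (int q)" by (simp add: g_def)
  have gq: "g dvd q" using g by (metis gcd_dvd2 int_dvd_int_iff)
  have g1: "g > 1"
  proof -
    have "g \<noteq> 1" using False g by (auto simp: coprime_iff_gcd_eq_1)
    moreover have "g \<noteq> 0" using g q by (metis gcd_eq_0_iff of_nat_0 of_nat_0_eq_iff not_gr_zero)
    ultimately show ?thesis by simp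
  qed
  have "q div g dvd q" "q div g < q" using gq g1 q by (auto intro: div_less_dividend)
  then obtain b where b: "coprime b (int q)" "[b = 1] (mod int (q div g))" "X b \<noteq> 1"
    using primitive_char_nontrivial[OF prim q] by blast
  have "[k * b = k] (mod int q)"
  proof -
    obtain c where c: "b - 1 = int (q div g) * c" using b(2) by (auto simp: cong_iff_dvd_diff dvd_def)
    obtain e where e: "k = int g * e" using g by (metis gcd_dvd1 dvdE)
    have "k * b - k = (int g * int (q div g)) * (e * c)" using c e by (simp add: algebra_simps)
    also have "int g * int (q div g) = int q" using gq by (metis dvd_mult_div_cancel of_nat_mult)
    finally show ?thesis by (simp add: cong_iff_dvd_diff)
  qed
  then have "[a * (k * b) = a * k] (mod int q)" for a by (intro cong_mult cong_refl)
  then have "gauss_sum q X (k * b) = gauss_sum q X k"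
    unfolding gauss_sum_def using cis_cong[OF _ q] by (intro sum.cong refl) metis
  then have "gauss_sum q X k = cnj (X b) * gauss_sum q X k" using gauss_sum_mult_coprime[OF X q b(1), of k] by simp
  then have "gauss_sum q X k = 0 \<or> cnj (X b) = 1" by auto
  moreover have "cnj (X b) \<noteq> 1" using b(3) by (metis complex_cnj_cnj complex_cnj_one)
  ultimately show ?thesis using False dirichlet_char_eq_0_iff[OF X] by simp
qed

section \<open>Sums over primes\<close>

definition primes_le :: "real \<Rightarrow> nat set" where
  "primes_le x = {p. prime p \<and> real p \<le> x}"

definition primes_between :: "real \<Rightarrow> real \<Rightarrow> nat set" where
  "primes_between y x = {p. prime p \<and> y < real p \<and> real p \<le> x}"

lemma finite_primes_le [simp, intro]: "finite (primes_le x)"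
proof (rule finite_subset)
  show "primes_le x \<subseteq> {..nat \<lfloor>x\<rfloor>}"
    by (auto simp: primes_le_def) linarith
qed simp

lemma finite_primes_between [simp, intro]: "finite (primes_between y x)"
  by (rule finite_subset[OF _ finite_primes_le[of x]]) (auto simp: primes_le_def primes_between_def)

lemma sum_ln_prime_factors_le:
  assumes "m > 0"
  shows "(\<Sum>p\<in>prime_factors m. ln (real p)) \<le> ln (real m)"
proof -
  have pos: "real p > 0" if "p \<in> prime_factors m" for p
    using that prime_factors_gt_0_nat by simp
  have "(\<Sum>p\<in>prime_factors m. ln (real p)) = ln (\<Prod>p\<in>prime_factors m. real p)"
    using pos by (subst ln_prod) auto
  also have "\<dots> \<le> ln (real m)"
  proof (subst ln_le_cancel_iff)
    show "(\<Prod>p\<in>prime_factors m. real p) > 0"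
      using pos by (intro prod_pos) auto
    have "(\<Prod>p\<in>prime_factors m. p) \<le> (\<Prod>p\<in>prime_factors m. p ^ multiplicity p m)"
    proof (intro prod_mono conjI)
      fix p assume "p \<in> prime_factors m"
      then have "multiplicity p m \<ge> 1" "p \<ge> 1"
        using pos[of p] by (auto simp: prime_factors_multiplicity Suc_le_eq)
      then show "p \<le> p ^ multiplicity p m" using power_increasing[of 1 "multiplicity p m" p] by simp
    qed simp
    also have "\<dots> = m" by (rule prime_factorization_nat[OF assms, symmetric])
    finally have "real (\<Prod>p\<in>prime_factors m. p) \<le> real m" by (rule of_nat_mono)
    then show "(\<Prod>p\<in>prime_factors m. real p) \<le> real m" by simp
  qed (use assms in auto)
  finally show ?thesis .
qed

text \<open>Pairs of a prime and one of its multiples up to \<open>n\<close> are counted twice: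
  \<open>p\<close> has at least \<open>n / (2 * p)\<close> multiples, while the primes dividing
  \<open>m\<close> contribute at most \<open>ln m\<close>. This is the upper half of Mertens' first
  theorem up to a factor of 2.\<close>

lemma sum_ln_over_prime_le:
  assumes "x \<ge> 1"
  shows "(\<Sum>p\<in>primes_le x. ln (real p) / real p) \<le> 2 * ln x"
proof -
  define n where "n = nat \<lfloor>x\<rfloor>"
  have n: "n \<ge> 1" "real n \<le> x" using assms unfolding n_def by linarith+
  have P: "primes_le x = {p. prime p \<and> p \<le> n}"
    using assms by (auto simp: primes_le_def n_def le_nat_iff le_floor_iff)
  have cardge: "real (card {m\<in>{1..n}. p dvd m}) \<ge> real n / (2 * real p)" if "p \<in> primes_le x" for p
  proof -
    have p: "p > 0" "p \<le> n" using that by (auto simp: P prime_gt_0_nat)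
    have "card ((\<lambda>k. p * k) ` {1..n div p}) \<le> card {m\<in>{1..n}. p dvd m}"
    proof (rule card_mono)
      show "(\<lambda>k. p * k) ` {1..n div p} \<subseteq> {m\<in>{1..n}. p dvd m}"
      proof clarify
        fix k assume k: "k \<in> {1..n div p}"
        then have "p * k \<le> p * (n div p)" by simp
        also have "\<dots> \<le> n" by simp
        finally show "p * k \<in> {1..n} \<and> p dvd p * k" using k p by auto
      qed
    qed auto
    moreover have "card ((\<lambda>k. p * k) ` {1..n div p}) = n div p"
      using p by (subst card_image) (auto simp: inj_on_def)
    moreover have "real n \<le> 2 * real p * real (n div p)"
    proof -
      have "n mod p < p" "p * (n div p) + n mod p = n" using p by auto
      moreover have "p * 1 \<le> p * (n div p)" using p div_le_mono[of p n p] by (intro mult_le_mono2) auto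
      ultimately have "n \<le> 2 * (p * (n div p))" by linarith
      then have "real n \<le> real (2 * (p * (n div p)))" by (rule of_nat_mono)
      then show ?thesis by simp
    qed
    ultimately have "real n \<le> 2 * real p * real (card {m\<in>{1..n}. p dvd m})"
      by (smt (verit) mult_left_mono of_nat_0_le_iff of_nat_mono)
    then show ?thesis using p by (simp add: field_simps)
  qed
  have "real n / 2 * (\<Sum>p\<in>primes_le x. ln (real p) / real p) = (\<Sum>p\<in>primes_le x. ln (real p) * (real n / (2 * real p)))"
    by (simp add: sum_distrib_left field_simps)
  also have "\<dots> \<le> (\<Sum>p\<in>primes_le x. ln (real p) * real (card {m\<in>{1..n}. p dvd m}))"
    by (intro sum_mono mult_left_mono cardge) (auto simp: primes_le_def dest: prime_ge_1_nat)
  also have "\<dots> = (\<Sum>p\<in>primes_le x. \<Sum>m | m \<in> {1..n} \<and> p dvd m. ln (real p))"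
    by (simp add: mult.commute)
  also have "\<dots> = (\<Sum>m\<in>{1..n}. \<Sum>p | p \<in> primes_le x \<and> p dvd m. ln (real p))"
    by (rule sum.swap_restrict) auto
  also have "\<dots> \<le> (\<Sum>m\<in>{1..n}. ln (real n))"
  proof (rule sum_mono)
    fix m assume m: "m \<in> {1..n}"
    have "{p. p \<in> primes_le x \<and> p dvd m} \<subseteq> prime_factors m"
      using m by (auto simp: primes_le_def prime_factors_dvd)
    then have "(\<Sum>p | p \<in> primes_le x \<and> p dvd m. ln (real p)) \<le> (\<Sum>p\<in>prime_factors m. ln (real p))"
      by (intro sum_mono2) (use prime_factors_gt_0_nat in \<open>force simp: Suc_le_eq intro!: ln_ge_zero\<close>)+
    also have "\<dots> \<le> ln (real m)" using m by (intro sum_ln_prime_factors_le) auto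
    also have "\<dots> \<le> ln (real n)" using m by simp
    finally show "(\<Sum>p | p \<in> primes_le x \<and> p dvd m. ln (real p)) \<le> ln (real n)" .
  qed
  finally have "real n / 2 * (\<Sum>p\<in>primes_le x. ln (real p) / real p) \<le> real n * ln (real n)" by simp
  then have "(\<Sum>p\<in>primes_le x. ln (real p) / real p) \<le> 2 * ln (real n)" using n by (simp add: field_simps)
  also have "\<dots> \<le> 2 * ln x" using n assms by simp
  finally show ?thesis .
qed

lemma sum_inverse_primes_between_le:
  assumes "1 < y" "y \<le> x"
  shows "(\<Sum>p\<in>primes_between y x. 1 / real p) \<le> 2 * ln x / ln y"
proof -
  have "ln y * (\<Sum>p\<in>primes_between y x. 1 / real p) \<le> (\<Sum>p\<in>primes_between y x. ln (real p) / real p)"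
    unfolding sum_distrib_left using assms
    by (intro sum_mono) (auto simp: primes_between_def intro!: divide_right_mono)
  also have "\<dots> \<le> (\<Sum>p\<in>primes_le x. ln (real p) / real p)"
    by (intro sum_mono2 finite_primes_le) (auto simp: primes_between_def primes_le_def dest: prime_ge_1_nat)
  also have "\<dots> \<le> 2 * ln x" using assms by (intro sum_ln_over_prime_le) auto
  finally show ?thesis using assms by (simp add: field_simps)
qed

text \<open>Each squaring of the upper end adds at most
  \<open>2 * ln (z\<^sup>2) / ln z = 4\<close>. The constant is far from sharp, so this is applied
  where a crude loss is affordable.\<close>

lemma sum_inverse_primes_between_power_le:
  assumes "1 < y" "x \<le> y ^ (2 ^ j)"
  shows "(\<Sum>p\<in>primes_between y x. 1 / real p) \<le> 4 * real j"
  using assms(2)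
proof (induction j arbitrary: x)
  case 0
  then have "primes_between y x = {}" by (auto simp: primes_between_def)
  then show ?case by simp
next
  case (Suc j)
  define z where "z = y ^ (2 ^ j)"
  have z: "1 < z" unfolding z_def using assms by (intro one_less_power) auto
  have zz: "y ^ (2 ^ Suc j) = z\<^sup>2" unfolding z_def by (simp add: power_mult[symmetric] mult.commute)
  have "(\<Sum>p\<in>primes_between y x. 1 / real p) \<le> (\<Sum>p\<in>primes_between y z \<union> primes_between z (z\<^sup>2). 1 / real p)"
    using Suc.prems unfolding zz by (intro sum_mono2 finite_UnI finite_primes_between) (auto simp: primes_between_def)
  also have "\<dots> = (\<Sum>p\<in>primes_between y z. 1 / real p) + (\<Sum>p\<in>primes_between z (z\<^sup>2). 1 / real p)"
    by (intro sum.union_disjoint finite_primes_between) (auto simp: primes_between_def)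
  also have "\<dots> \<le> 4 * real j + 2 * ln (z\<^sup>2) / ln z"
  proof (intro add_mono Suc.IH sum_inverse_primes_between_le z)
    show "z \<le> y ^ (2 ^ j)" by (simp add: z_def)
    show "z \<le> z\<^sup>2" using z by (simp add: power2_eq_square)
  qed
  also have "2 * ln (z\<^sup>2) / ln z = 4" using z by (simp add: ln_realpow)
  finally show ?case by simp
qed

text \<open>By the mean value theorem each term after the first is at most the decrease of
  \<open>n powr (- \<sigma>) / \<sigma>\<close>, and the decreases telescope.\<close>

lemma sum_powr_le:
  assumes "\<sigma> > 0"
  shows "(\<Sum>n\<in>{1..N}. real n powr (-1 - \<sigma>)) \<le> 1 + 1 / \<sigma>"
proof (cases "N = 0")
  case False
  have "(\<Sum>n\<in>{1..Suc N}. real n powr (-1 - \<sigma>)) \<le> 1 + (1 - real (Suc N) powr (-\<sigma>)) / \<sigma>" for N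
  proof (induction N)
    case (Suc N)
    have "\<exists>z. real (Suc N) < z \<and> z < real (Suc (Suc N)) \<and>
       real (Suc (Suc N)) powr (-\<sigma>) - real (Suc N) powr (-\<sigma>) =
        (real (Suc (Suc N)) - real (Suc N)) * (- \<sigma> * z powr (-\<sigma> - 1))"
      by (rule MVT2) (auto intro!: derivative_eq_intros)
    then obtain z where z: "real (Suc N) < z" "z < real (Suc (Suc N))"
       "real (Suc (Suc N)) powr (-\<sigma>) - real (Suc N) powr (-\<sigma>) = - \<sigma> * z powr (-\<sigma> - 1)" by auto
    have "real (Suc (Suc N)) powr (-1-\<sigma>) \<le> z powr (-1-\<sigma>)" using z assms by (intro powr_mono2') auto
    also have "\<dots> = (real (Suc N) powr (-\<sigma>) - real (Suc (Suc N)) powr (-\<sigma>)) / \<sigma>"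
      using z(3) assms by (simp add: field_simps minus_diff_commute)
    finally have *: "real (Suc (Suc N)) powr (-1-\<sigma>) \<le> (real (Suc N) powr (-\<sigma>) - real (Suc (Suc N)) powr (-\<sigma>)) / \<sigma>" .
    have "(\<Sum>n\<in>{1..Suc (Suc N)}. real n powr (-1 - \<sigma>)) = real (Suc (Suc N)) powr (-1 - \<sigma>) + (\<Sum>n\<in>{1..Suc N}. real n powr (-1 - \<sigma>))"
      by (rule sum.nat_ivl_Suc') simp
    with * Suc show ?case unfolding diff_divide_distrib by linarith
  qed simp
  from this[of "N - 1"] have "(\<Sum>n\<in>{1..N}. real n powr (-1 - \<sigma>)) \<le> 1 + (1 - real N powr (-\<sigma>)) / \<sigma>" using False by simp
  also have "\<dots> \<le> 1 + 1 / \<sigma>" using assms by (simp add: divide_right_mono)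
  finally show ?thesis .
qed (use assms in auto)

lemma prime_factorization_prod_primes:
  assumes "finite A" "\<And>p. p \<in> A \<Longrightarrow> prime (p::nat)"
  shows "prime_factorization (\<Prod>A) = mset_set A"
  using assms
proof (induction A rule: finite_induct)
  case (insert p A)
  have "prime_factorization (p * \<Prod>A) = prime_factorization p + prime_factorization (\<Prod>A)"
    using insert.prems insert.hyps
    by (intro prime_factorization_mult) (auto dest: prime_gt_0_nat)
  then show ?case using insert by (simp add: prime_factorization_prime)
qed simp

text \<open>Expanding the product yields a sum over squarefree numbers composed of primes of
  \<open>P\<close>, each occurring once by unique factorization; the sum over an initial segment of
  the integers dominates it.\<close>

lemma prod_one_plus_prime_powr_le:
  assumes "\<sigma> > 0" and P: "finite P" "\<And>p. p \<in> P \<Longrightarrow> prime (p::nat)"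
  shows "(\<Prod>p\<in>P. 1 + real p powr (-1 - \<sigma>)) \<le> 1 + 1 / \<sigma>"
proof -
  have pos: "p > 0" if "p \<in> P" for p using P that prime_gt_0_nat by blast
  have "(\<Prod>p\<in>P. 1 + real p powr (-1 - \<sigma>)) = (\<Prod>p\<in>P. real p powr (-1 - \<sigma>) + 1)" by (simp add: add.commute)
  also have "\<dots> = (\<Sum>A\<in>Pow P. (\<Prod>p\<in>A. real p powr (-1 - \<sigma>)) * (\<Prod>p\<in>P-A. 1))"
    by (rule prod_add[OF P(1)])
  also have "\<dots> = (\<Sum>A\<in>Pow P. real (\<Prod>A) powr (-1 - \<sigma>))"
  proof (intro sum.cong refl)
    fix A assume "A \<in> Pow P"
    then show "(\<Prod>p\<in>A. real p powr (-1 - \<sigma>)) * (\<Prod>p\<in>P-A. 1) = real (\<Prod>A) powr (-1 - \<sigma>)"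
      by (simp add: prod_powr_distrib[symmetric])
  qed
  also have "\<dots> = (\<Sum>n\<in>Prod ` Pow P. real n powr (-1 - \<sigma>))"
  proof (subst sum.reindex)
    show "inj_on Prod (Pow P)"
    proof (rule inj_onI)
      fix A B assume AB: "A \<in> Pow P" "B \<in> Pow P" "\<Prod>A = \<Prod>B"
      then have "mset_set A = mset_set B"
        using P prime_factorization_prod_primes by (metis Pow_iff finite_subset subsetD)
      then show "A = B" using AB P by (metis Pow_iff finite_subset finite_set_mset_mset_set)
    qed
  qed simp
  also have "\<dots> \<le> (\<Sum>n\<in>{1..Max (Prod ` Pow P)}. real n powr (-1 - \<sigma>))"
  proof (intro sum_mono2)
    have "\<Prod>A > 0" if "A \<subseteq> P" for A using that pos by (intro prod_pos) auto
    then show "Prod ` Pow P \<subseteq> {1..Max (Prod ` Pow P)}" using P by (auto simp: Suc_le_eq)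
  qed auto
  also have "\<dots> \<le> 1 + 1 / \<sigma>" by (rule sum_powr_le[OF assms(1)])
  finally show ?thesis .
qed

lemma sum_inverse_square_le:
  assumes "finite P" "0 \<notin> P"
  shows "(\<Sum>p\<in>P. 1 / (real p)\<^sup>2) \<le> 2"
proof -
  have "(\<Sum>p\<in>P. 1 / (real p)\<^sup>2) \<le> (\<Sum>n\<in>{1..Max P}. 1 / (real n)\<^sup>2)"
    using assms by (intro sum_mono2) (auto simp: Suc_le_eq intro: gr0I)
  also have "\<dots> = (\<Sum>n\<in>{1..Max P}. real n powr (-1 - 1))"
    by (intro sum.cong refl) (auto simp: powr_minus powr_numeral inverse_eq_divide)
  also have "\<dots> \<le> 2" using sum_powr_le[of 1] by simp
  finally show ?thesis .
qed

text \<open>The coefficient 1 of \<open>ln (ln x)\<close> is essential, because it produces the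
  exponent \<open>\<beta>\<^sup>2\<close> in the final bound. It is obtained from the Euler product
  at \<open>1 + \<sigma>\<close>, which has size \<open>1 / \<sigma>\<close>.\<close>

lemma sum_inverse_primes_le:
  assumes "x \<ge> 3"
  shows "(\<Sum>p\<in>primes_le x. 1 / real p) \<le> ln (ln x) + 5"
proof -
  have "exp 1 \<le> x" using exp_le assms by linarith
  then have L: "ln x \<ge> 1" using assms by (simp add: ln_ge_iff)
  \<comment> \<open>This choice balances both errors: moving from 1 to \<open>1 + \<sigma>\<close>
    changes the sum up to \<open>x\<close> by at most 2, and the Euler product is at most
    \<open>1 + ln x\<close>.\<close>
  define \<sigma> where "\<sigma> = 1 / ln x"
  have \<sigma>: "\<sigma> > 0" using L by (simp add: \<sigma>_def)
  define u where "u = (\<lambda>p::nat. real p powr (-1 - \<sigma>))"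
  have pr: "prime p" "p > 0" if "p \<in> primes_le x" for p using that by (auto simp: primes_le_def prime_gt_0_nat)
  have u: "0 < u p" "u p \<le> 1 / real p" if "p \<in> primes_le x" for p
  proof -
    show "0 < u p" using pr[OF that] by (simp add: u_def)
    have "u p \<le> real p powr (-1)" unfolding u_def using pr[OF that] \<sigma> by (intro powr_mono) auto
    then show "u p \<le> 1 / real p" using pr[OF that] by (simp add: powr_minus inverse_eq_divide)
  qed
  have 1: "1 / real p - u p \<le> \<sigma> * (ln (real p) / real p)" if "p \<in> primes_le x" for p
  proof -
    have "u p = exp (- (\<sigma> * ln (real p))) / real p"
      using pr[OF that] by (simp add: u_def powr_def left_diff_distrib exp_diff exp_minus field_simps)
    moreover have "exp (- (\<sigma> * ln (real p))) \<ge> 1 - \<sigma> * ln (real p)"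
      using exp_ge_add_one_self[of "- (\<sigma> * ln (real p))"] by simp
    ultimately have "u p \<ge> (1 - \<sigma> * ln (real p)) / real p" using pr[OF that] by (simp add: divide_right_mono)
    then show ?thesis by (simp add: diff_divide_distrib)
  qed
  have 2: "u p \<le> ln (1 + u p) + 1 / (real p)\<^sup>2" if "p \<in> primes_le x" for p
  proof -
    have "1 / real p \<le> 1" using pr[OF that] by simp
    then have "u p - (u p)\<^sup>2 \<le> ln (1 + u p)" using u[OF that] by (intro ln_one_plus_pos_lower_bound) auto
    moreover have "(u p)\<^sup>2 \<le> (1 / real p)\<^sup>2" using u[OF that] by (intro power_mono) auto
    ultimately show ?thesis by (simp add: power_divide)
  qed
  have "(\<Sum>p\<in>primes_le x. 1 / real p) \<le> (\<Sum>p\<in>primes_le x. \<sigma> * (ln (real p) / real p) + (ln (1 + u p) + 1 / (real p)\<^sup>2))"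
    using 1 2 by (intro sum_mono) (smt (verit))
  also have "\<dots> = \<sigma> * (\<Sum>p\<in>primes_le x. ln (real p) / real p) + (\<Sum>p\<in>primes_le x. ln (1 + u p)) + (\<Sum>p\<in>primes_le x. 1 / (real p)\<^sup>2)"
    by (simp add: sum.distrib sum_distrib_left)
  also have "\<dots> \<le> 2 + ln (1 + ln x) + 2"
  proof (intro add_mono)
    have "\<sigma> * (\<Sum>p\<in>primes_le x. ln (real p) / real p) \<le> \<sigma> * (2 * ln x)"
      using \<sigma> assms by (intro mult_left_mono sum_ln_over_prime_le) auto
    then show "\<sigma> * (\<Sum>p\<in>primes_le x. ln (real p) / real p) \<le> 2" using L by (simp add: \<sigma>_def)
    have "(\<Sum>p\<in>primes_le x. ln (1 + u p)) = ln (\<Prod>p\<in>primes_le x. 1 + u p)"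
    proof (subst ln_prod)
      show "1 + u p \<noteq> 0" if "p \<in> primes_le x" for p using u(1)[OF that] by simp
    qed auto
    also have "\<dots> \<le> ln (1 + 1 / \<sigma>)"
    proof (subst ln_le_cancel_iff)
      show "(\<Prod>p\<in>primes_le x. 1 + u p) > 0" by (intro prod_pos) (use u in \<open>smt (verit)\<close>)
      show "(\<Prod>p\<in>primes_le x. 1 + u p) \<le> 1 + 1 / \<sigma>"
        unfolding u_def using pr \<sigma> by (intro prod_one_plus_prime_powr_le) auto
    qed (use \<sigma> in \<open>auto intro: add_pos_pos\<close>)
    finally show "(\<Sum>p\<in>primes_le x. ln (1 + u p)) \<le> ln (1 + ln x)" by (simp add: \<sigma>_def)
    show "(\<Sum>p\<in>primes_le x. 1 / (real p)\<^sup>2) \<le> 2"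
      by (rule sum_inverse_square_le[OF finite_primes_le]) (auto simp: primes_le_def)
  qed
  also have "ln (1 + ln x) \<le> ln (2 * ln x)" using L by (subst ln_le_cancel_iff) auto
  also have "\<dots> = ln 2 + ln (ln x)" using L by (simp add: ln_mult)
  also have "ln 2 \<le> (1::real)" using ln_2_less_1 by simp
  finally show ?thesis by simp
qed

lemma norm_cis_diff_one_le: "norm (cis x - 1) \<le> \<bar>x\<bar>"
proof -
  have "(norm (cis x - 1))\<^sup>2 = (2 * sin (x/2))\<^sup>2"
    using cos_double_sin[of "x/2"] by (simp add: cmod_power2 power2_diff sin_squared_eq)
  also have "\<dots> \<le> \<bar>x\<bar>\<^sup>2"
    using abs_sin_x_le_abs_x[of "x/2"] abs_le_square_iff[of "2 * sin (x/2)" "\<bar>x\<bar>"] by (simp add: abs_mult)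
  finally show ?thesis by (rule power2_le_imp_le) auto
qed

text \<open>The primes up to \<open>q powr (1 / \<bar>k\<bar>)\<close> do not notice the twist; the others cost a power of \<open>\<bar>k\<bar>\<close>.\<close>

lemma sum_primes_cis_diff_one_le:
  fixes k :: int and q :: real
  assumes q: "q > 1"
  shows "(\<Sum>p\<in>primes_le q. norm (cis (- (of_int k * ln (real p) / ln q)) - 1) / real p) \<le> 10 + 12 * ln (1 + \<bar>of_int k\<bar>)"
proof (cases "k = 0")
  case True
  then show ?thesis by simp
next
  case False
  define K where "K = \<bar>real_of_int k\<bar>"
  have K: "K \<ge> 1" using False by (simp add: K_def)
  have L: "ln q > 0" using q by simp
  define y where "y = exp (ln q / K)"
  have y: "1 < y" using K L by (simp add: y_def)
  \<comment> \<open>The number of squarings leading from \<open>y\<close> past \<open>q\<close>;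
    each adds 4 to the sum of \<open>1 / p\<close>, doubled by the trivial bound 2 for
    \<open>norm (cis t - 1)\<close>.\<close>
  define j where "j = nat \<lceil>log 2 K\<rceil>"
  have "log 2 K \<ge> 0" using K by simp
  then have j: "real j \<le> 1 + log 2 K" "log 2 K \<le> real j" unfolding j_def by linarith+
  have "K = 2 powr log 2 K" using K by simp
  also have "\<dots> \<le> 2 powr real j" using j by (intro powr_mono) auto
  finally have Kj: "K \<le> 2 ^ j" by (simp add: powr_realpow)
  have yj: "q \<le> y ^ (2 ^ j)"
  proof -
    have "ln q \<le> real (2 ^ j) * (ln q / K)" using Kj K L by (simp add: field_simps)
    then have "exp (ln q) \<le> exp (real (2 ^ j) * (ln q / K))" by simp
    then show ?thesis using q unfolding y_def exp_of_nat_mult by simp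
  qed
  define e where "e = (\<lambda>p::nat. norm (cis (- (of_int k * ln (real p) / ln q)) - 1) / real p)"
  have e1: "e p \<le> K / ln q * (ln (real p) / real p)" if "p \<in> primes_le y" for p
  proof -
    have p: "p \<ge> 1" using that by (auto simp: primes_le_def dest: prime_ge_1_nat)
    have "e p \<le> \<bar>- (of_int k * ln (real p) / ln q)\<bar> / real p"
      unfolding e_def by (intro divide_right_mono norm_cis_diff_one_le) auto
    then show ?thesis using L p by (simp add: K_def abs_mult)
  qed
  have e2: "e p \<le> 2 * (1 / real p)" for p
    unfolding e_def using norm_triangle_ineq4[of "cis (- (of_int k * ln (real p) / ln q))" 1]
    by (simp add: divide_right_mono)
  have e0: "e p \<ge> 0" for p by (simp add: e_def)
  have "(\<Sum>p\<in>primes_le q. e p) \<le> (\<Sum>p\<in>primes_le y \<union> primes_between y q. e p)"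
    by (intro sum_mono2 finite_UnI finite_primes_between finite_primes_le) (auto simp: e0 primes_le_def primes_between_def)
  also have "\<dots> = (\<Sum>p\<in>primes_le y. e p) + (\<Sum>p\<in>primes_between y q. e p)"
    by (intro sum.union_disjoint finite_primes_between finite_primes_le) (auto simp: primes_le_def primes_between_def)
  also have "\<dots> \<le> (\<Sum>p\<in>primes_le y. K / ln q * (ln (real p) / real p)) + (\<Sum>p\<in>primes_between y q. 2 * (1 / real p))"
    by (intro add_mono sum_mono e1 e2)
  also have "\<dots> = K / ln q * (\<Sum>p\<in>primes_le y. ln (real p) / real p) + 2 * (\<Sum>p\<in>primes_between y q. 1 / real p)"
    by (simp only: sum_distrib_left)
  also have "\<dots> \<le> K / ln q * (2 * ln y) + 2 * (4 * real j)"
    using y K L yj by (intro add_mono mult_left_mono sum_ln_over_prime_le sum_inverse_primes_between_power_le) auto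
  also have "\<dots> = 2 + 8 * real j" using K L by (simp add: y_def)
  also have "\<dots> \<le> 10 + 8 * log 2 K" using j by simp
  also have "8 * log 2 K \<le> 12 * ln K"
  proof -
    have "ln K * 8 \<le> ln K * (12 * ln 2)" using ln2_ge_two_thirds K by (intro mult_left_mono) auto
    then show ?thesis using ln2_ge_two_thirds by (simp add: log_def field_simps)
  qed
  also have "ln K \<le> ln (1 + K)" using K by simp
  finally show ?thesis by (simp add: e_def K_def)
qed

section \<open>Square sums of convolutions\<close>

lemma divisors_mult_coprime:
  fixes a b :: nat
  assumes "coprime a b" "a > 0" "b > 0"
  shows "(\<Sum>d | d dvd a * b. f d) = (\<Sum>x | x dvd a. \<Sum>y | y dvd b. f (x * y))"
proof -
  let ?A = "{x. x dvd a} \<times> {y. y dvd b}"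
  have inj: "inj_on (\<lambda>(x, y). x * y) ?A"
  proof (rule inj_onI, clarify)
    fix x y x' y' assume dv: "x dvd a" "y dvd b" "x' dvd a" "y' dvd b" and eq: "x * y = x' * y'"
    have cop: "coprime x y'" "coprime x' y" using dv assms(1) by (meson coprime_divisors)+
    have "x dvd x' * y'" "x' dvd x * y" using eq by (metis dvd_triv_left)+
    then have "x dvd x'" "x' dvd x" using cop by (simp_all add: coprime_dvd_mult_left_iff)
    then have "x = x'" by (simp add: dvd_antisym)
    moreover have "x > 0" using dv assms by (auto intro: Nat.gr0I)
    ultimately show "x = x' \<and> y = y'" using eq by auto
  qed
  have img: "(\<lambda>(x, y). x * y) ` ?A = {d. d dvd a * b}"
  proof (intro equalityI subsetI)
    fix d assume "d \<in> {d. d dvd a * b}"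
    then obtain x y where "d = x * y" "x dvd a" "y dvd b" by (auto elim: dvd_productE)
    then show "d \<in> (\<lambda>(x, y). x * y) ` ?A" by (auto intro!: image_eqI[of _ _ "(x, y)"])
  qed (auto intro: mult_dvd_mono)
  have "(\<Sum>d | d dvd a * b. f d) = (\<Sum>p\<in>?A. f (fst p * snd p))"
    unfolding img[symmetric] by (subst sum.reindex[OF inj]) (simp add: case_prod_beta)
  also have "\<dots> = (\<Sum>x | x dvd a. \<Sum>y | y dvd b. f (x * y))"
    by (simp add: sum.cartesian_product case_prod_beta)
  finally show ?thesis .
qed

text \<open>Summing over all divisors of \<open>M\<close>, instead of an initial segment, makes this form multiplicative in \<open>M\<close>.\<close>

definition conv_sqnorm :: "nat \<Rightarrow> (nat \<Rightarrow> complex) \<Rightarrow> (nat \<Rightarrow> complex) \<Rightarrow> real" where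
  "conv_sqnorm M c u = (\<Sum>n | n dvd M. (norm (\<Sum>h | h dvd n. c h * u (n div h)))\<^sup>2)"

lemma conv_sqnorm_nonneg: "conv_sqnorm M c u \<ge> 0"
  unfolding conv_sqnorm_def by (intro sum_nonneg) auto

lemma conv_sqnorm_cong:
  assumes "\<And>h. h dvd M \<Longrightarrow> c h = c' h" "\<And>h. h dvd M \<Longrightarrow> u h = u' h"
  shows "conv_sqnorm M c u = conv_sqnorm M c' u'"
  unfolding conv_sqnorm_def
proof (intro sum.cong refl arg_cong[where f = "\<lambda>x. (norm x)\<^sup>2"])
  fix n h assume "n \<in> {n. n dvd M}" "h \<in> {h. h dvd n}"
  then have "h dvd M" "n div h dvd M" using dvd_trans div_dvd_iff_mult by (auto elim!: dvdE)
  then show "c h * u (n div h) = c' h * u' (n div h)" using assms by simp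
qed

text \<open>On the two coprime parts \<open>c\<close> may be given by different functions; in this
  way each range of primes can carry its own coefficients.\<close>

lemma conv_sqnorm_mult:
  assumes cop: "coprime a b" "a > 0" "b > 0"
    and u: "\<And>x y. x dvd a \<Longrightarrow> y dvd b \<Longrightarrow> u (x * y) = u x * u y"
    and c: "\<And>x y. x dvd a \<Longrightarrow> y dvd b \<Longrightarrow> c (x * y) = c1 x * c2 y"
  shows "conv_sqnorm (a * b) c u = conv_sqnorm a c1 u * conv_sqnorm b c2 u"
proof -
  have "conv_sqnorm (a * b) c u = (\<Sum>n | n dvd a. \<Sum>m | m dvd b. (norm (\<Sum>h | h dvd n * m. c h * u ((n * m) div h)))\<^sup>2)"
    unfolding conv_sqnorm_def by (rule divisors_mult_coprime[OF cop])
  also have "\<dots> = (\<Sum>n | n dvd a. \<Sum>m | m dvd b.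
      (norm (\<Sum>x | x dvd n. c1 x * u (n div x)))\<^sup>2 * (norm (\<Sum>y | y dvd m. c2 y * u (m div y)))\<^sup>2)"
  proof (intro sum.cong refl)
    fix n m assume nm: "n \<in> {n. n dvd a}" "m \<in> {m. m dvd b}"
    then have cop': "coprime n m" "n > 0" "m > 0"
      using cop by (auto intro: coprime_divisors Nat.gr0I)
    have "(\<Sum>h | h dvd n * m. c h * u ((n * m) div h)) = (\<Sum>x | x dvd n. \<Sum>y | y dvd m. c (x * y) * u ((n * m) div (x * y)))"
      by (rule divisors_mult_coprime[OF cop'])
    also have "\<dots> = (\<Sum>x | x dvd n. \<Sum>y | y dvd m. (c1 x * u (n div x)) * (c2 y * u (m div y)))"
    proof (intro sum.cong refl)
      fix x y assume xy: "x \<in> {x. x dvd n}" "y \<in> {y. y dvd m}"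
      then have d: "x dvd a" "y dvd b" "n div x dvd a" "m div y dvd b"
        using nm by (auto elim!: dvdE)
      have "(n * m) div (x * y) = (n div x) * (m div y)" using xy by (simp add: div_mult_div_if_dvd)
      then show "c (x * y) * u ((n * m) div (x * y)) = (c1 x * u (n div x)) * (c2 y * u (m div y))"
        using u[OF d(3,4)] c[OF d(1,2)] by simp
    qed
    also have "\<dots> = (\<Sum>x | x dvd n. c1 x * u (n div x)) * (\<Sum>y | y dvd m. c2 y * u (m div y))"
      by (simp add: sum_product)
    finally show "(norm (\<Sum>h | h dvd n * m. c h * u ((n * m) div h)))\<^sup>2 =
       (norm (\<Sum>x | x dvd n. c1 x * u (n div x)))\<^sup>2 * (norm (\<Sum>y | y dvd m. c2 y * u (m div y)))\<^sup>2"
      by (simp add: norm_mult power_mult_distrib)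
  qed
  also have "\<dots> = conv_sqnorm a c1 u * conv_sqnorm b c2 u"
    by (simp add: conv_sqnorm_def sum_product)
  finally show ?thesis .
qed

lemma conv_sqnorm_mono:
  assumes "\<And>h. norm (c h) \<le> c' h" "\<And>h. norm (u h) \<le> u' h"
  shows "conv_sqnorm M c u \<le> conv_sqnorm M (\<lambda>h. of_real (c' h)) (\<lambda>h. of_real (u' h))"
  unfolding conv_sqnorm_def
proof (intro sum_mono power_mono)
  fix n
  have pos: "0 \<le> c' h" "0 \<le> u' h" for h using assms[of h] norm_ge_zero order_trans by blast+
  have "norm (\<Sum>h | h dvd n. c h * u (n div h)) \<le> (\<Sum>h | h dvd n. c' h * u' (n div h))"
    using pos by (intro sum_norm_le) (auto simp: norm_mult intro!: mult_mono assms)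
  also have "\<dots> = norm (\<Sum>h | h dvd n. complex_of_real (c' h) * of_real (u' (n div h)))"
    using pos by (simp add: sum_nonneg flip: of_real_mult of_real_sum)
  finally show "norm (\<Sum>h | h dvd n. c h * u (n div h)) \<le> norm (\<Sum>h | h dvd n. complex_of_real (c' h) * of_real (u' (n div h)))" .
qed auto

lemma conv_sqnorm_scale:
  "conv_sqnorm M (\<lambda>h. of_real F * c h) u = F\<^sup>2 * conv_sqnorm M c u"
proof -
  have eq: "(\<Sum>h | h dvd n. of_real F * c h * u (n div h)) = of_real F * (\<Sum>h | h dvd n. c h * u (n div h))" for n
    by (simp add: sum_distrib_left mult.assoc)
  show ?thesis
    by (simp only: conv_sqnorm_def eq norm_mult power_mult_distrib norm_of_real power2_abs sum_distrib_left[symmetric])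
qed

lemma sqrt_conv_sqnorm: "sqrt (conv_sqnorm M c u) = L2_set (\<lambda>n. norm (\<Sum>h | h dvd n. c h * u (n div h))) {n. n dvd M}"
  by (simp add: conv_sqnorm_def L2_set_def)

lemma sqrt_conv_sqnorm_diff:
  "sqrt (conv_sqnorm M (\<lambda>h. c h - d h) u) \<le> sqrt (conv_sqnorm M c u) + sqrt (conv_sqnorm M d u)"
proof -
  have "sqrt (conv_sqnorm M (\<lambda>h. c h - d h) u) \<le>
     L2_set (\<lambda>n. norm (\<Sum>h | h dvd n. c h * u (n div h)) + norm (\<Sum>h | h dvd n. d h * u (n div h))) {n. n dvd M}"
    unfolding sqrt_conv_sqnorm left_diff_distrib sum_subtractf
    by (intro L2_set_mono norm_triangle_ineq4) auto
  also have "\<dots> \<le> sqrt (conv_sqnorm M c u) + sqrt (conv_sqnorm M d u)"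
    unfolding sqrt_conv_sqnorm by (rule L2_set_triangle_ineq)
  finally show ?thesis .
qed

section \<open>Integers composed of given primes\<close>

definition prime_power_prod :: "nat \<Rightarrow> nat set \<Rightarrow> nat" where
  "prime_power_prod E P = (\<Prod>p\<in>P. p ^ E)"

lemma prime_power_prod_insert:
  "finite P \<Longrightarrow> p \<notin> P \<Longrightarrow> prime_power_prod E (insert p P) = p ^ E * prime_power_prod E P"
  by (simp add: prime_power_prod_def)

lemma prime_power_prod_union:
  "finite P \<Longrightarrow> finite Q \<Longrightarrow> P \<inter> Q = {} \<Longrightarrow> prime_power_prod E (P \<union> Q) = prime_power_prod E P * prime_power_prod E Q"
  by (simp add: prime_power_prod_def prod.union_disjoint)

lemma prime_power_prod_pos:
  "(\<And>p. p \<in> P \<Longrightarrow> prime p) \<Longrightarrow> prime_power_prod E P > 0"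
  unfolding prime_power_prod_def by (intro prod_pos) (auto intro: prime_gt_0_nat)

lemma prime_power_prod_coprime:
  assumes "\<And>p. p \<in> P \<Longrightarrow> prime p" "\<And>p. p \<in> Q \<Longrightarrow> prime p" "P \<inter> Q = {}"
  shows "coprime (prime_power_prod E P) (prime_power_prod E Q)"
  unfolding prime_power_prod_def
proof (intro prod_coprime_left prod_coprime_right)
  fix p q assume "p \<in> P" "q \<in> Q"
  then have "prime p" "prime q" "p \<noteq> q" using assms by auto
  then show "coprime (p ^ E) (q ^ E)" using primes_coprime[of p q] by simp
qed

lemma prime_factors_dvd_prime_power_prod:
  assumes fin: "finite P" and P: "\<And>p. p \<in> P \<Longrightarrow> prime p" and h: "h dvd prime_power_prod E P"
  shows "h > 0" "prime_factors h \<subseteq> P"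
proof -
  show "h > 0" using h prime_power_prod_pos[OF P, of P E] by (auto intro: Nat.gr0I)
  show "prime_factors h \<subseteq> P"
  proof
    fix p assume "p \<in> prime_factors h"
    then have p: "prime p" "p dvd prime_power_prod E P" using h dvd_trans by (auto simp: in_prime_factors_iff)
    then obtain r where "r \<in> P" "p dvd r ^ E"
      using fin unfolding prime_power_prod_def by (auto simp: prime_dvd_prod_iff)
    then have "p dvd r" using p(1) prime_dvd_power by blast
    then show "p \<in> P" using \<open>r \<in> P\<close> P p(1) primes_dvd_imp_eq by blast
  qed
qed

text \<open>A multiplicity in \<open>n\<close> is smaller than \<open>n\<close> itself, so the
  exponent \<open>E\<close> leaves room for every \<open>n \<le> E\<close>.\<close>

lemma dvd_prime_power_prod:
  assumes fin: "finite P" and n: "n > 0" "prime_factors n \<subseteq> P" "n \<le> E"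
  shows "n dvd prime_power_prod E P"
proof -
  have "(\<Prod>p\<in>prime_factors n. p ^ multiplicity p n) dvd (\<Prod>p\<in>P. p ^ E)"
  proof (rule prod_dvd_prod_subset2[OF fin n(2)])
    fix p assume p: "p \<in> prime_factors n"
    have "multiplicity p n \<le> n"
    proof -
      have "p \<ge> 2" using p by (auto simp: in_prime_factors_iff prime_ge_2_nat)
      have "multiplicity p n < 2 ^ multiplicity p n" by simp
      also have "\<dots> \<le> p ^ multiplicity p n" using \<open>p \<ge> 2\<close> by (intro power_mono) auto
      also have "\<dots> \<le> n" using n(1) by (intro dvd_imp_le multiplicity_dvd) auto
      finally show ?thesis by simp
    qed
    then show "p ^ multiplicity p n dvd p ^ E" using n(3) by (intro le_imp_power_dvd) auto
  qed
  then show ?thesis using n(1) by (simp add: prime_power_prod_def flip: prime_factorization_nat)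
qed

text \<open>These are the multinomial coefficients of an exponential: in
  \<open>(\<Sum>p. x p) ^ k / fact k\<close> the monomial belonging to an \<open>h\<close> with
  \<open>k\<close> prime factors, counted with multiplicity, has the coefficient
  \<open>prime_weight h\<close>.\<close>

definition prime_weight :: "nat \<Rightarrow> real" where
  "prime_weight h = (\<Prod>p\<in>prime_factors h. 1 / fact (multiplicity p h))"

lemma multiplicity_coprime_mult:
  fixes p a b :: nat
  assumes "coprime a b" "a > 0" "b > 0" "p \<in> prime_factors a"
  shows "multiplicity p (a * b) = multiplicity p a"
proof -
  have p: "prime p" "p dvd a" using assms by (auto simp: in_prime_factors_iff)
  have "\<not> p dvd b" using p assms(1) by (metis coprime_common_divisor_nat not_prime_1)
  then have "multiplicity p b = 0" by (rule not_dvd_imp_multiplicity_0)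
  moreover have "multiplicity p (a * b) = multiplicity p a + multiplicity p b"
    using p assms by (intro prime_elem_multiplicity_mult_distrib) auto
  ultimately show ?thesis by simp
qed

lemma prime_factors_coprime_disjoint:
  fixes a b :: nat
  assumes "coprime a b"
  shows "prime_factors a \<inter> prime_factors b = {}"
proof -
  have False if "p \<in> prime_factors a" "p \<in> prime_factors b" for p
    using that assms by (metis coprime_common_divisor_nat in_prime_factors_iff not_prime_1)
  then show ?thesis by blast
qed

lemma prime_weight_mult:
  assumes "coprime a b" "a > 0" "b > 0"
  shows "prime_weight (a * b) = prime_weight a * prime_weight b"
proof -
  have pf: "prime_factors (a * b) = prime_factors a \<union> prime_factors b"
    using assms by (simp add: prime_factors_product)
  have 1: "(\<Prod>p\<in>prime_factors a. 1 / fact (multiplicity p (a * b))) = prime_weight a"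
    unfolding prime_weight_def using assms by (intro prod.cong refl) (simp add: multiplicity_coprime_mult)
  have 2: "(\<Prod>p\<in>prime_factors b. 1 / fact (multiplicity p (a * b))) = prime_weight b"
    unfolding prime_weight_def using assms multiplicity_coprime_mult[of b a]
    by (intro prod.cong refl) (simp add: coprime_commute mult.commute)
  show ?thesis
    unfolding prime_weight_def[of "a * b"] pf
    by (subst prod.union_disjoint) (use prime_factors_coprime_disjoint[OF assms(1)] 1 2 in auto)
qed

lemma prime_weight_prime_power:
  assumes "prime p"
  shows "prime_weight (p ^ k) = 1 / fact k"
proof (cases "k = 0")
  case False
  then show ?thesis using assms by (simp add: prime_weight_def prime_factors_power prime_prime_factors multiplicity_prime_power)
qed (simp add: prime_weight_def)

lemma prime_weight_nonneg: "prime_weight h \<ge> 0"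
  unfolding prime_weight_def by (intro prod_nonneg) auto

definition omega_in :: "nat set \<Rightarrow> nat \<Rightarrow> nat" where
  "omega_in I h = (\<Sum>p\<in>I. multiplicity p h)"

lemma omega_in_mult:
  assumes "\<And>p. p \<in> I \<Longrightarrow> prime p" "a > 0" "b > 0"
  shows "omega_in I (a * b) = omega_in I a + omega_in I b"
proof -
  have "(\<Sum>p\<in>I. multiplicity p (a * b)) = (\<Sum>p\<in>I. multiplicity p a + multiplicity p b)"
    using assms by (intro sum.cong refl prime_elem_multiplicity_mult_distrib) auto
  then show ?thesis by (simp add: omega_in_def sum.distrib)
qed

lemma omega_in_eq_0:
  assumes "\<And>p. p \<in> I \<Longrightarrow> \<not> p dvd h"
  shows "omega_in I h = 0"
  unfolding omega_in_def using assms by (simp add: not_dvd_imp_multiplicity_0)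

lemma omega_in_prime_power:
  assumes "finite I" "p \<in> I" "\<And>p. p \<in> I \<Longrightarrow> prime p"
  shows "omega_in I (p ^ k) = k"
proof -
  have "omega_in I (p ^ k) = (\<Sum>r\<in>I. if r = p then k else 0)"
    unfolding omega_in_def
  proof (intro sum.cong refl)
    fix r assume r: "r \<in> I"
    show "multiplicity r (p ^ k) = (if r = p then k else 0)"
    proof (cases "r = p")
      case True
      then show ?thesis using assms by (simp add: multiplicity_prime_power)
    next
      case False
      then have "multiplicity r (p ^ k) = 0" using assms r by (intro multiplicity_distinct_prime_power) auto
      then show ?thesis using False by simp
    qed
  qed
  then show ?thesis using assms by simp
qed

section \<open>Euler products for exponentials of prime sums\<close>

lemma divisors_prime_power_sum:
  assumes "prime (p::nat)"
  shows "(\<Sum>d | d dvd p ^ E. f d) = (\<Sum>i\<le>E. f (p ^ i))"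
proof -
  have "{d. d dvd p ^ E} = (\<lambda>i. p ^ i) ` {..E}"
    using divides_primepow_nat[OF assms, of _ E] by auto
  moreover have "inj_on (\<lambda>i. p ^ i) {..E}"
    using prime_gt_1_nat[OF assms] by (auto intro!: inj_onI)
  ultimately show ?thesis by (simp add: sum.reindex)
qed

lemma sum_fact_le_exp:
  fixes \<rho> :: real
  assumes "\<rho> \<ge> 0"
  shows "(\<Sum>j\<le>i. \<rho> ^ j / fact j) \<le> exp \<rho>"
proof -
  have "(\<Sum>j\<le>i. \<rho> ^ j /\<^sub>R fact j) \<le> (\<Sum>j. \<rho> ^ j /\<^sub>R fact j)"
    by (rule sum_le_suminf) (use summable_exp_generic[of \<rho>] assms in auto)
  then show ?thesis by (simp add: exp_def divide_inverse_commute)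
qed

lemma geometric_tail_le:
  fixes x :: real
  assumes "0 \<le> x" "x \<le> 1/2"
  shows "(\<Sum>i\<in>{2..E}. x ^ i) \<le> 2 * x\<^sup>2"
proof -
  have "(\<Sum>i\<in>{2..Suc (Suc n)}. x ^ i) \<le> 2 * x\<^sup>2 - x ^ Suc (Suc n)" for n
  proof (induction n)
    case (Suc n)
    have "x * x ^ Suc (Suc n) \<le> (1/2) * x ^ Suc (Suc n)" using assms by (intro mult_right_mono) auto
    moreover have "(\<Sum>i\<in>{2..Suc (Suc (Suc n))}. x ^ i) = x ^ Suc (Suc (Suc n)) + (\<Sum>i\<in>{2..Suc (Suc n)}. x ^ i)"
      by (rule sum.nat_ivl_Suc') simp
    ultimately show ?case using Suc unfolding power_Suc[of x "Suc (Suc n)"] by linarith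
  qed (simp add: power2_eq_square numeral_2_eq_2)
  note * = this
  show ?thesis
  proof (cases "E \<ge> 2")
    case True
    then obtain n where n: "E = Suc (Suc n)" by (metis add_2_eq_Suc le_Suc_ex)
    have "x ^ Suc (Suc n) \<ge> 0" using assms by simp
    then show ?thesis using *[of n] unfolding n by linarith
  qed (use assms in auto)
qed

text \<open>The coefficients of \<open>\<Sum>k. f k * P ^ k / fact k\<close>, where \<open>P\<close>
  is the sum of \<open>X p / sqrt p\<close> over \<open>I\<close>. In particular
  \<open>f k = \<alpha> ^ k\<close> represents \<open>exp (\<alpha> * P)\<close>.\<close>

definition range_coeff :: "(nat \<Rightarrow> complex) \<Rightarrow> nat set \<Rightarrow> nat \<Rightarrow> complex" where
  "range_coeff f I h = of_real (prime_weight h / sqrt (real h)) * f (omega_in I h)"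

definition half_twist :: "(nat \<Rightarrow> complex) \<Rightarrow> nat \<Rightarrow> complex" where
  "half_twist z m = z m / of_real (sqrt (real m))"

lemma half_twist_mult:
  assumes "z (a * b) = z a * z b"
  shows "half_twist z (a * b) = half_twist z a * half_twist z b"
  using assms by (simp add: half_twist_def real_sqrt_mult)

text \<open>The convolution at \<open>p ^ i\<close> is \<open>t i / sqrt (p ^ i)\<close>, where
  \<open>t i\<close> is the coefficient of \<open>x ^ i\<close> in
  \<open>exp (\<alpha> * x) / (1 - z p * x)\<close>. The linear coefficient is
  \<open>\<alpha> + z p\<close>, and \<open>norm (t i) \<le> exp \<rho>\<close> lets the higher ones
  be summed geometrically.\<close>

lemma conv_sqnorm_local:
  assumes p: "prime p" "p \<in> I" "finite I" "\<And>p. p \<in> I \<Longrightarrow> prime p"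
    and z: "\<And>k. z (p ^ k) = z p ^ k" "norm (z p) \<le> 1" and \<alpha>: "norm \<alpha> \<le> \<rho>"
  shows "conv_sqnorm (p ^ E) (range_coeff (\<lambda>k. \<alpha> ^ k) I) (half_twist z) \<le> 1 + (norm (\<alpha> + z p))\<^sup>2 / real p + 2 * exp (2 * \<rho>) / (real p)\<^sup>2"
proof -
  have \<rho>: "\<rho> \<ge> 0" using \<alpha> norm_ge_zero order_trans by blast
  have p2: "real p \<ge> 2" using prime_ge_2_nat[OF p(1)] by simp
  define t where "t = (\<lambda>i. \<Sum>j\<le>i. \<alpha> ^ j / fact j * z p ^ (i - j))"
  have inner: "(\<Sum>h | h dvd p ^ i. range_coeff (\<lambda>k. \<alpha> ^ k) I h * half_twist z (p ^ i div h)) = t i / of_real (sqrt (real p ^ i))" for i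
  proof -
    have "(\<Sum>h | h dvd p ^ i. range_coeff (\<lambda>k. \<alpha> ^ k) I h * half_twist z (p ^ i div h)) =
       (\<Sum>j\<le>i. range_coeff (\<lambda>k. \<alpha> ^ k) I (p ^ j) * half_twist z (p ^ i div p ^ j))"
      by (rule divisors_prime_power_sum[OF p(1)])
    also have "\<dots> = (\<Sum>j\<le>i. \<alpha> ^ j / fact j * z p ^ (i - j) / of_real (sqrt (real p ^ i)))"
    proof (intro sum.cong refl)
      fix j assume j: "j \<in> {..i}"
      then have "p ^ i div p ^ j = p ^ (i - j)" using p2 by (simp add: power_diff)
      moreover have "sqrt (real p ^ i) = sqrt (real p ^ j) * sqrt (real p ^ (i - j))"
        using j by (simp flip: real_sqrt_mult power_add)
      ultimately show "range_coeff (\<lambda>k. \<alpha> ^ k) I (p ^ j) * half_twist z (p ^ i div p ^ j) =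
         \<alpha> ^ j / fact j * z p ^ (i - j) / of_real (sqrt (real p ^ i))"
        using p by (simp add: range_coeff_def half_twist_def prime_weight_prime_power omega_in_prime_power z(1))
    qed
    also have "\<dots> = t i / of_real (sqrt (real p ^ i))" by (simp add: t_def sum_divide_distrib)
    finally show ?thesis .
  qed
  have tb: "norm (t i) \<le> exp \<rho>" for i
  proof -
    have "norm (t i) \<le> (\<Sum>j\<le>i. \<rho> ^ j / fact j)"
      unfolding t_def
    proof (intro sum_norm_le)
      fix j
      have "norm (\<alpha> ^ j / fact j * z p ^ (i - j)) = norm \<alpha> ^ j / fact j * norm (z p) ^ (i - j)"
        by (simp add: norm_mult norm_divide norm_power)
      also have "\<dots> \<le> \<rho> ^ j / fact j * 1"
        using \<alpha> z \<rho> by (intro mult_mono divide_right_mono power_mono power_le_one) auto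
      finally show "norm (\<alpha> ^ j / fact j * z p ^ (i - j)) \<le> \<rho> ^ j / fact j" by simp
    qed
    then show ?thesis using sum_fact_le_exp[OF \<rho>, of i] by linarith
  qed
  define b where "b = (\<lambda>i. (norm (t i))\<^sup>2 / real p ^ i)"
  have b0: "b i \<ge> 0" for i by (simp add: b_def)
  have "conv_sqnorm (p ^ E) (range_coeff (\<lambda>k. \<alpha> ^ k) I) (half_twist z) =
     (\<Sum>i\<le>E. (norm (\<Sum>h | h dvd p ^ i. range_coeff (\<lambda>k. \<alpha> ^ k) I h * half_twist z (p ^ i div h)))\<^sup>2)"
    unfolding conv_sqnorm_def by (rule divisors_prime_power_sum[OF p(1)])
  also have "\<dots> = (\<Sum>i\<le>E. b i)"
    unfolding inner b_def by (intro sum.cong refl) (simp add: norm_divide power_divide)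
  also have "\<dots> \<le> (\<Sum>i\<in>{0,1} \<union> {2..E}. b i)" by (intro sum_mono2) (auto simp: b0)
  also have "\<dots> = b 0 + b 1 + (\<Sum>i\<in>{2..E}. b i)" by (subst sum.union_disjoint) auto
  also have "b 0 = 1" by (simp add: b_def t_def)
  also have "b 1 = (norm (\<alpha> + z p))\<^sup>2 / real p" by (simp add: b_def t_def add.commute)
  also have "(\<Sum>i\<in>{2..E}. b i) \<le> (\<Sum>i\<in>{2..E}. exp (2 * \<rho>) * (1 / real p) ^ i)"
  proof (intro sum_mono)
    fix i
    have "(norm (t i))\<^sup>2 \<le> (exp \<rho>)\<^sup>2" by (intro power_mono tb) auto
    then have "b i \<le> (exp \<rho>)\<^sup>2 / real p ^ i" unfolding b_def by (intro divide_right_mono) auto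
    then show "b i \<le> exp (2 * \<rho>) * (1 / real p) ^ i" by (simp add: exp_double power_divide)
  qed
  also have "\<dots> \<le> exp (2 * \<rho>) * (2 * (1 / real p)\<^sup>2)"
    unfolding sum_distrib_left[symmetric] using p2 by (intro mult_left_mono geometric_tail_le) auto
  finally show ?thesis by (simp add: power_divide mult.commute)
qed

lemma conv_sqnorm_prime_power_prod:
  assumes P: "finite P" "\<And>p. p \<in> P \<Longrightarrow> prime p"
    and c: "\<And>a b. coprime a b \<Longrightarrow> a > 0 \<Longrightarrow> b > 0 \<Longrightarrow> c (a * b) = c a * c b" "c 1 = 1"
    and u: "\<And>a b. a > 0 \<Longrightarrow> b > 0 \<Longrightarrow> u (a * b) = u a * u b" "u 1 = 1"
  shows "conv_sqnorm (prime_power_prod E P) c u = (\<Prod>p\<in>P. conv_sqnorm (p ^ E) c u)"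
  using P
proof (induction P rule: finite_induct)
  case empty
  then show ?case using c(2) u(2) by (simp add: prime_power_prod_def conv_sqnorm_def)
next
  case (insert p P)
  have pr: "prime p" "\<And>r. r \<in> P \<Longrightarrow> prime r" using insert by auto
  have cop: "coprime (p ^ E) (prime_power_prod E P)"
    using prime_power_prod_coprime[of "{p}" P E] insert by (simp add: prime_power_prod_def)
  have pos: "p ^ E > 0" "prime_power_prod E P > 0"
    using prime_gt_0_nat[OF pr(1)] prime_power_prod_pos[of P E] pr(2) by auto
  have dpos: "x > 0" if "x dvd y" "y > 0" for x y :: nat using that by (auto intro: Nat.gr0I)
  have "conv_sqnorm (p ^ E * prime_power_prod E P) c u = conv_sqnorm (p ^ E) c u * conv_sqnorm (prime_power_prod E P) c u"
  proof (rule conv_sqnorm_mult[OF cop pos])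
    fix x y assume xy: "x dvd p ^ E" "y dvd prime_power_prod E P"
    show "u (x * y) = u x * u y" using xy dpos pos by (intro u) auto
    show "c (x * y) = c x * c y" using xy dpos pos cop by (intro c) (auto intro: coprime_divisors)
  qed
  then show ?case using insert by (simp add: prime_power_prod_insert)
qed

lemma range_coeff_power_mult:
  assumes I: "\<And>p. p \<in> I \<Longrightarrow> prime p" and ab: "coprime a b" "a > 0" "b > 0"
  shows "range_coeff (\<lambda>k. \<alpha> ^ k) I (a * b) = range_coeff (\<lambda>k. \<alpha> ^ k) I a * range_coeff (\<lambda>k. \<alpha> ^ k) I b"
  using ab by (simp add: range_coeff_def prime_weight_mult omega_in_mult[OF I] power_add real_sqrt_mult)

lemma range_coeff_1: "range_coeff f I 1 = f 0"
  by (simp add: range_coeff_def prime_weight_def omega_in_def)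

text \<open>An inequality for the norm, instead of equality, admits the indicator of 1; with it the
  convolution reduces to the coefficients \<open>c\<close> alone.\<close>

locale unit_twist =
  fixes z :: "nat \<Rightarrow> complex"
  assumes z_mult: "\<And>a b. a > 0 \<Longrightarrow> b > 0 \<Longrightarrow> z (a * b) = z a * z b"
    and z_1: "z 1 = 1"
    and z_norm: "\<And>a. norm (z a) \<le> 1"
begin

lemma z_power: "a > 0 \<Longrightarrow> z (a ^ k) = z a ^ k"
  by (induction k) (use z_1 in \<open>auto simp: z_mult\<close>)

lemma half_twist_1: "half_twist z 1 = 1"
  by (simp add: half_twist_def z_1 del: One_nat_def)

lemma conv_sqnorm_range_full:
  assumes I: "finite I" "\<And>p. p \<in> I \<Longrightarrow> prime p" and \<alpha>: "norm \<alpha> \<le> \<rho>"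
  shows "conv_sqnorm (prime_power_prod E I) (range_coeff (\<lambda>k. \<alpha> ^ k) I) (half_twist z) \<le>
     exp (\<Sum>p\<in>I. (norm (\<alpha> + z p))\<^sup>2 / real p + 2 * exp (2 * \<rho>) / (real p)\<^sup>2)"
proof -
  have "conv_sqnorm (prime_power_prod E I) (range_coeff (\<lambda>k. \<alpha> ^ k) I) (half_twist z) =
     (\<Prod>p\<in>I. conv_sqnorm (p ^ E) (range_coeff (\<lambda>k. \<alpha> ^ k) I) (half_twist z))"
  proof (rule conv_sqnorm_prime_power_prod[OF I])
    show "range_coeff (\<lambda>k. \<alpha> ^ k) I (a * b) = range_coeff (\<lambda>k. \<alpha> ^ k) I a * range_coeff (\<lambda>k. \<alpha> ^ k) I b"
      if "coprime a b" "a > 0" "b > 0" for a b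
      using range_coeff_power_mult[of I a b \<alpha>] I(2) that by blast
  qed (auto simp: half_twist_mult z_mult half_twist_1[simplified] range_coeff_1[simplified])
  also have "\<dots> \<le> (\<Prod>p\<in>I. exp ((norm (\<alpha> + z p))\<^sup>2 / real p + 2 * exp (2 * \<rho>) / (real p)\<^sup>2))"
  proof (intro prod_mono conjI conv_sqnorm_nonneg)
    fix p assume p: "p \<in> I"
    have "conv_sqnorm (p ^ E) (range_coeff (\<lambda>k. \<alpha> ^ k) I) (half_twist z) \<le> 1 + (norm (\<alpha> + z p))\<^sup>2 / real p + 2 * exp (2 * \<rho>) / (real p)\<^sup>2"
      using p I \<alpha> z_power[of p] prime_gt_0_nat[of p] by (intro conv_sqnorm_local z_norm) auto
    also have "\<dots> \<le> exp ((norm (\<alpha> + z p))\<^sup>2 / real p + 2 * exp (2 * \<rho>) / (real p)\<^sup>2)"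
      using exp_ge_add_one_self[of "(norm (\<alpha> + z p))\<^sup>2 / real p + 2 * exp (2 * \<rho>) / (real p)\<^sup>2"] by linarith
    finally show "conv_sqnorm (p ^ E) (range_coeff (\<lambda>k. \<alpha> ^ k) I) (half_twist z) \<le> \<dots>" .
  qed
  also have "\<dots> = exp (\<Sum>p\<in>I. (norm (\<alpha> + z p))\<^sup>2 / real p + 2 * exp (2 * \<rho>) / (real p)\<^sup>2)"
    using I by (simp add: exp_sum)
  finally show ?thesis .
qed

text \<open>Since \<open>\<rho> + 1 \<le> exp \<rho>\<close> and \<open>p \<ge> 2\<close>, both
  summands of the exponent are at most \<open>exp (2 * \<rho>) / p\<close>. The interplay of
  \<alpha> and \<open>z\<close> is lost, so this serves for error terms and for primes outside the
  ranges.\<close>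

lemma conv_sqnorm_range_crude:
  assumes I: "finite I" "\<And>p. p \<in> I \<Longrightarrow> prime p" and \<alpha>: "norm \<alpha> \<le> \<rho>"
  shows "conv_sqnorm (prime_power_prod E I) (range_coeff (\<lambda>k. \<alpha> ^ k) I) (half_twist z) \<le>
     exp (2 * exp (2 * \<rho>) * (\<Sum>p\<in>I. 1 / real p))"
proof -
  have \<rho>: "\<rho> \<ge> 0" using \<alpha> norm_ge_zero order_trans by blast
  have "(\<Sum>p\<in>I. (norm (\<alpha> + z p))\<^sup>2 / real p + 2 * exp (2 * \<rho>) / (real p)\<^sup>2) \<le> (\<Sum>p\<in>I. 2 * exp (2 * \<rho>) * (1 / real p))"
  proof (intro sum_mono)
    fix p assume "p \<in> I"
    then have p: "real p \<ge> 2" using I prime_ge_2_nat by fastforce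
    have "norm (\<alpha> + z p) \<le> \<rho> + 1" using norm_triangle_ineq[of \<alpha> "z p"] \<alpha> z_norm[of p] by linarith
    also have "\<dots> \<le> exp \<rho>" using exp_ge_add_one_self[of \<rho>] by linarith
    finally have "(norm (\<alpha> + z p))\<^sup>2 \<le> (exp \<rho>)\<^sup>2" by (intro power_mono) auto
    then have "(norm (\<alpha> + z p))\<^sup>2 / real p \<le> exp (2 * \<rho>) / real p"
      by (intro divide_right_mono) (auto simp: exp_double)
    moreover have "2 * exp (2 * \<rho>) / (real p)\<^sup>2 \<le> exp (2 * \<rho>) / real p"
      using p by (simp add: power2_eq_square field_simps)
    ultimately show "(norm (\<alpha> + z p))\<^sup>2 / real p + 2 * exp (2 * \<rho>) / (real p)\<^sup>2 \<le> 2 * exp (2 * \<rho>) * (1 / real p)"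
      by simp
  qed
  then have "exp (\<Sum>p\<in>I. (norm (\<alpha> + z p))\<^sup>2 / real p + 2 * exp (2 * \<rho>) / (real p)\<^sup>2) \<le> exp (2 * exp (2 * \<rho>) * (\<Sum>p\<in>I. 1 / real p))"
    unfolding exp_le_cancel_iff sum_distrib_left .
  with conv_sqnorm_range_full[OF I \<alpha>, of E] show ?thesis by (rule order_trans)
qed

end

lemma unit_twist_one: "unit_twist (\<lambda>_. 1)"
  by unfold_locales auto

context unit_twist
begin

text \<open>Absolute values reduce coefficients of geometric growth to the multiplicative case
  \<open>\<rho> ^ k\<close> with the trivial twist.\<close>

lemma conv_sqnorm_range_abs:
  assumes I: "finite I" "\<And>p. p \<in> I \<Longrightarrow> prime p"
    and f: "\<And>k. norm (f k) \<le> F * \<rho> ^ k" and \<rho>: "\<rho> \<ge> 0"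
  shows "conv_sqnorm (prime_power_prod E I) (range_coeff f I) (half_twist z) \<le>
     F\<^sup>2 * exp (2 * exp (2 * \<rho>) * (\<Sum>p\<in>I. 1 / real p))"
proof -
  interpret one: unit_twist "\<lambda>_. 1" by (rule unit_twist_one)
  have "conv_sqnorm (prime_power_prod E I) (range_coeff f I) (half_twist z) \<le>
    conv_sqnorm (prime_power_prod E I) (\<lambda>h. of_real (F * (prime_weight h / sqrt (real h) * \<rho> ^ omega_in I h))) (\<lambda>m. of_real (1 / sqrt (real m)))"
  proof (rule conv_sqnorm_mono)
    fix h
    have "norm (range_coeff f I h) = (prime_weight h / sqrt (real h)) * norm (f (omega_in I h))"
      by (simp add: range_coeff_def norm_mult norm_divide prime_weight_nonneg)
    also have "\<dots> \<le> (prime_weight h / sqrt (real h)) * (F * \<rho> ^ omega_in I h)"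
      by (intro mult_left_mono f) (auto simp: prime_weight_nonneg)
    finally show "norm (range_coeff f I h) \<le> F * (prime_weight h / sqrt (real h) * \<rho> ^ omega_in I h)" by (simp add: mult_ac)
    show "norm (half_twist z h) \<le> 1 / sqrt (real h)"
      using z_norm[of h] by (simp add: half_twist_def norm_divide divide_right_mono)
  qed
  also have "\<dots> = conv_sqnorm (prime_power_prod E I) (\<lambda>h. of_real F * range_coeff (\<lambda>k. of_real \<rho> ^ k) I h) (half_twist (\<lambda>_. 1))"
    by (intro conv_sqnorm_cong) (auto simp: range_coeff_def half_twist_def)
  also have "\<dots> = F\<^sup>2 * conv_sqnorm (prime_power_prod E I) (range_coeff (\<lambda>k. of_real \<rho> ^ k) I) (half_twist (\<lambda>_. 1))"
    by (rule conv_sqnorm_scale)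
  also have "\<dots> \<le> F\<^sup>2 * exp (2 * exp (2 * \<rho>) * (\<Sum>p\<in>I. 1 / real p))"
    using \<rho> by (intro mult_left_mono one.conv_sqnorm_range_crude I) auto
  finally show ?thesis .
qed

text \<open>Truncation destroys multiplicativity, so the truncated coefficients are written as the
  full ones minus a tail. Rankin's trick bounds the tail: for \<open>k > K\<close> the factor
  \<open>2 ^ k / 2 ^ K\<close> is at least 1. The triangle inequality for the root of
  \<open>conv_sqnorm\<close> joins the two.\<close>

lemma conv_sqnorm_range_truncated:
  assumes I: "finite I" "\<And>p. p \<in> I \<Longrightarrow> prime p" and \<alpha>: "norm \<alpha> \<le> 1"
  shows "conv_sqnorm (prime_power_prod E I) (range_coeff (\<lambda>k. if k \<le> K then \<alpha> ^ k else 0) I) (half_twist z) \<le>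
     exp (\<Sum>p\<in>I. (norm (\<alpha> + z p))\<^sup>2 / real p + 2 * exp 2 / (real p)\<^sup>2) * (1 + exp (exp 4 * (\<Sum>p\<in>I. 1 / real p)) / 2 ^ K)\<^sup>2"
proof -
  define M where "M = prime_power_prod E I"
  define S where "S = (\<Sum>p\<in>I. (norm (\<alpha> + z p))\<^sup>2 / real p + 2 * exp 2 / (real p)\<^sup>2)"
  \<comment> \<open>The square root of the crude bound with \<rho> equal to 2.\<close>
  define D where "D = exp (exp 4 * (\<Sum>p\<in>I. 1 / real p))"
  have S: "S \<ge> 0" unfolding S_def by (intro sum_nonneg) auto
  define full where "full = range_coeff (\<lambda>k. \<alpha> ^ k) I"
  define err where "err = range_coeff (\<lambda>k. if k \<le> K then 0 else \<alpha> ^ k) I"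
  have "range_coeff (\<lambda>k. if k \<le> K then \<alpha> ^ k else 0) I h = full h - err h" for h
    by (simp add: full_def err_def range_coeff_def)
  then have "sqrt (conv_sqnorm M (range_coeff (\<lambda>k. if k \<le> K then \<alpha> ^ k else 0) I) (half_twist z)) \<le>
     sqrt (conv_sqnorm M full (half_twist z)) + sqrt (conv_sqnorm M err (half_twist z))"
    using sqrt_conv_sqnorm_diff[of M full err "half_twist z"] by presburger
  also have "sqrt (conv_sqnorm M full (half_twist z)) \<le> sqrt (exp S)"
    using conv_sqnorm_range_full[OF I \<alpha>, of E] by (simp add: full_def M_def S_def)
  also have "sqrt (conv_sqnorm M err (half_twist z)) \<le> sqrt (((1/2) ^ K)\<^sup>2 * exp (2 * exp (2 * 2) * (\<Sum>p\<in>I. 1 / real p)))"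
    unfolding err_def M_def
  proof (intro real_sqrt_le_mono conv_sqnorm_range_abs I)
    fix k
    show "norm (if k \<le> K then 0 else \<alpha> ^ k) \<le> (1/2) ^ K * 2 ^ k"
    proof (cases "k \<le> K")
      case False
      have "norm (\<alpha> ^ k) \<le> 1" using \<alpha> by (simp add: norm_power power_le_one)
      also have "(1::real) \<le> (1/2) ^ K * 2 ^ k" using False by (simp add: power_divide)
      finally show ?thesis using False by simp
    qed simp
  qed auto
  also have "\<dots> = D / 2 ^ K"
  proof -
    have "exp (2 * exp (2 * 2) * (\<Sum>p\<in>I. 1 / real p)) = D\<^sup>2" by (simp add: D_def mult.assoc exp_double flip: exp_double)
    moreover have "D \<ge> 0" by (simp add: D_def)
    ultimately show ?thesis by (simp add: real_sqrt_divide power_divide)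
  qed
  \<comment> \<open>As \<open>S \<ge> 0\<close>, the error can be made relative to the main
    term.\<close>
  also have "sqrt (exp S) + D / 2 ^ K \<le> sqrt (exp S) * (1 + D / 2 ^ K)"
  proof -
    have "1 * (D / 2 ^ K) \<le> sqrt (exp S) * (D / 2 ^ K)" using S by (intro mult_right_mono) (auto simp: D_def)
    then show ?thesis by (simp add: algebra_simps)
  qed
  finally have "(sqrt (conv_sqnorm M (range_coeff (\<lambda>k. if k \<le> K then \<alpha> ^ k else 0) I) (half_twist z)))\<^sup>2 \<le> (sqrt (exp S) * (1 + D / 2 ^ K))\<^sup>2"
    by (intro power_mono) (simp_all add: conv_sqnorm_nonneg)
  then show ?thesis by (simp add: conv_sqnorm_nonneg power_mult_distrib M_def S_def D_def)
qed

end

section \<open>Several ranges of primes at once\<close>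

definition multi_coeff :: "nat set \<Rightarrow> (nat \<Rightarrow> nat set) \<Rightarrow> (nat \<Rightarrow> nat \<Rightarrow> complex) \<Rightarrow> nat \<Rightarrow> complex" where
  "multi_coeff R I f h = (if prime_factors h \<subseteq> (\<Union>r\<in>R. I r)
     then of_real (prime_weight h / sqrt (real h)) * (\<Prod>r\<in>R. f r (omega_in (I r) h)) else 0)"

lemma multi_coeff_insert_mult:
  assumes R: "finite R" "r \<notin> R"
    and I: "\<And>s p. s \<in> insert r R \<Longrightarrow> p \<in> I s \<Longrightarrow> prime p"
    and disj: "\<And>s. s \<in> R \<Longrightarrow> I r \<inter> I s = {}"
    and xy: "x > 0" "y > 0" "prime_factors x \<subseteq> I r" "prime_factors y \<inter> I r = {}"
  shows "multi_coeff (insert r R) I f (x * y) = range_coeff (f r) (I r) x * multi_coeff R I f y"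
proof -
  have pf: "prime_factors (x * y) = prime_factors x \<union> prime_factors y"
    using xy by (simp add: prime_factors_product)
  have iff: "prime_factors (x * y) \<subseteq> (\<Union>s\<in>insert r R. I s) \<longleftrightarrow> prime_factors y \<subseteq> (\<Union>s\<in>R. I s)"
    unfolding pf using xy by auto
  have cop: "coprime x y"
  proof (rule ccontr)
    assume "\<not> coprime x y"
    then obtain c where c: "c dvd x" "c dvd y" "\<not> is_unit c" by (rule not_coprimeE)
    then obtain p where p: "prime p" "p dvd c" using prime_factor_nat[of c] by auto
    then have "p \<in> prime_factors x" "p \<in> prime_factors y"
      using c xy dvd_trans by (auto simp: in_prime_factors_iff)
    then show False using xy by blast
  qed
  have o1: "omega_in (I r) (x * y) = omega_in (I r) x"
  proof -
    have "omega_in (I r) y = 0"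
    proof (rule omega_in_eq_0)
      fix p assume "p \<in> I r"
      then show "\<not> p dvd y" using xy I[of r p] by (auto simp: in_prime_factors_iff)
    qed
    moreover have "prime p" if "p \<in> I r" for p using I[of r p] that by simp
    ultimately show ?thesis using omega_in_mult[of "I r" x y] xy by simp
  qed
  have o2: "omega_in (I s) (x * y) = omega_in (I s) y" if "s \<in> R" for s
  proof -
    have "omega_in (I s) x = 0"
    proof (rule omega_in_eq_0)
      fix p assume p: "p \<in> I s"
      then have "p \<notin> I r" using disj[OF that] by blast
      then show "\<not> p dvd x" using xy I[of s p] p that by (auto simp: in_prime_factors_iff)
    qed
    moreover have "prime p" if "p \<in> I s" for p using I[of s p] that \<open>s \<in> R\<close> by simp
    ultimately show ?thesis using omega_in_mult[of "I s" x y] xy by simp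
  qed
  have "(\<Prod>s\<in>R. f s (omega_in (I s) (x * y))) = (\<Prod>s\<in>R. f s (omega_in (I s) y))"
    by (intro prod.cong refl) (simp add: o2)
  then show ?thesis
    unfolding multi_coeff_def iff
    using R cop xy by (simp add: range_coeff_def o1 prime_weight_mult real_sqrt_mult mult_ac)
qed

text \<open>The support condition of \<open>multi_coeff\<close> does the work here: the product over
  no range is 1, and only the condition confines the coefficients to \<open>h = 1\<close>.\<close>

lemma multi_coeff_empty: "h > 0 \<Longrightarrow> multi_coeff {} I f h = (if h = 1 then 1 else 0)"
  by (auto simp: multi_coeff_def prime_weight_def prime_factorization_empty_iff)

text \<open>This is the multinomial theorem, proved prime by prime from the binomial theorem. The
  assumption \<open>k \<le> E\<close> guarantees that every exponent occurring is available among
  the divisors.\<close>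

lemma eval_range_coeff_fixed:
  assumes I: "finite I" "\<And>p. p \<in> I \<Longrightarrow> prime (p::nat)"
    and X: "\<And>a b. X (a * b) = X a * X b" "X (1::nat) = 1" and kE: "k \<le> E"
  shows "(\<Sum>h | h dvd prime_power_prod E I. if omega_in I h = k then of_real (prime_weight h / sqrt (real h)) * X h else 0)
     = (\<Sum>p\<in>I. X p / of_real (sqrt (real p))) ^ k / (fact k :: complex)"
  using I kE
proof (induction I arbitrary: k rule: finite_induct)
  case empty
  have "{h. h dvd prime_power_prod E {}} = {1}" by (auto simp: prime_power_prod_def)
  then show ?case by (simp add: omega_in_def prime_weight_def X(2)[simplified] power_0_left)
next
  case (insert p I)
  have pr: "prime p" "\<And>r. r \<in> I \<Longrightarrow> prime r" using insert.prems by auto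
  have cop: "coprime (p ^ E) (prime_power_prod E I)"
    using prime_power_prod_coprime[of "{p}" I E] insert by (simp add: prime_power_prod_def)
  have pos: "p ^ E > 0" "prime_power_prod E I > 0"
    using prime_gt_0_nat[OF pr(1)] prime_power_prod_pos[of I E] pr(2) by auto
  have Xpow: "X (p ^ i) = X p ^ i" for i by (induction i) (use X in auto)
  define s where "s = X p / of_real (sqrt (real p))"
  define S where "S = (\<Sum>p\<in>I. X p / of_real (sqrt (real p)))"
  define G where "G = (\<lambda>h. of_real (prime_weight h / sqrt (real h)) * X h :: complex)"
  have Gmul: "G (p ^ i * y) = s ^ i / fact i * G y" "omega_in (insert p I) (p ^ i * y) = i + omega_in I y"
    if "y dvd prime_power_prod E I" for i y
  proof -
    have y: "y > 0" "prime_factors y \<subseteq> I" using prime_factors_dvd_prime_power_prod[OF insert.hyps(1) pr(2) that] by auto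
    have npy: "\<not> p dvd y" using y insert.hyps pr(1) by (auto simp: in_prime_factors_iff)
    have c: "coprime (p ^ i) y" using npy pr(1) by (simp add: prime_imp_coprime)
    have p0: "p ^ i > 0" using prime_gt_0_nat[OF pr(1)] by simp
    have sq: "sqrt (real p ^ i) = sqrt (real p) ^ i" by (simp add: real_sqrt_power)
    show "G (p ^ i * y) = s ^ i / fact i * G y"
      using c p0 y by (simp add: G_def prime_weight_mult prime_weight_prime_power[OF pr(1)] X Xpow real_sqrt_mult s_def power_divide sq) (simp add: mult_ac)
    have "omega_in (insert p I) (p ^ i * y) = omega_in (insert p I) (p ^ i) + omega_in (insert p I) y"
      using pr p0 y by (intro omega_in_mult) auto
    also have "omega_in (insert p I) (p ^ i) = i" using insert.hyps pr by (intro omega_in_prime_power) auto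
    also have "omega_in (insert p I) y = omega_in I y"
      using insert.hyps npy by (simp add: omega_in_def not_dvd_imp_multiplicity_0)
    finally show "omega_in (insert p I) (p ^ i * y) = i + omega_in I y" .
  qed
  have IH: "(\<Sum>y | y dvd prime_power_prod E I. if omega_in I y = j then G y else 0) = S ^ j / fact j" if "j \<le> E" for j
    unfolding G_def S_def by (rule insert.IH[OF pr(2) that])
  have "(\<Sum>h | h dvd prime_power_prod E (insert p I). if omega_in (insert p I) h = k then G h else 0) =
     (\<Sum>x | x dvd p ^ E. \<Sum>y | y dvd prime_power_prod E I. if omega_in (insert p I) (x * y) = k then G (x * y) else 0)"
    unfolding prime_power_prod_insert[OF insert.hyps] by (rule divisors_mult_coprime[OF cop pos])
  also have "\<dots> = (\<Sum>i\<le>E. \<Sum>y | y dvd prime_power_prod E I. if omega_in (insert p I) (p ^ i * y) = k then G (p ^ i * y) else 0)"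
    by (rule divisors_prime_power_sum[OF pr(1)])
  also have "\<dots> = (\<Sum>i\<le>E. if i \<le> k then s ^ i / fact i * (S ^ (k - i) / fact (k - i)) else 0)"
  proof (intro sum.cong refl)
    fix i
    have "(\<Sum>y | y dvd prime_power_prod E I. if omega_in (insert p I) (p ^ i * y) = k then G (p ^ i * y) else 0) =
      (\<Sum>y | y dvd prime_power_prod E I. if i \<le> k then s ^ i / fact i * (if omega_in I y = k - i then G y else 0) else 0)"
      by (intro sum.cong refl) (auto simp: Gmul)
    also have "\<dots> = (if i \<le> k then s ^ i / fact i * (S ^ (k - i) / fact (k - i)) else 0)"
    proof (cases "i \<le> k")
      case True
      have "k - i \<le> E" using insert.prems(2) by simp
      from IH[OF this] True show ?thesis by (simp only: if_True sum_distrib_left[symmetric])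
    qed simp
    finally show "(\<Sum>y | y dvd prime_power_prod E I. if omega_in (insert p I) (p ^ i * y) = k then G (p ^ i * y) else 0) =
       (if i \<le> k then s ^ i / fact i * (S ^ (k - i) / fact (k - i)) else 0)" .
  qed
  also have "\<dots> = (\<Sum>i\<le>k. s ^ i / fact i * (S ^ (k - i) / fact (k - i)))"
    using insert.prems(2) by (intro sum.mono_neutral_cong_right) auto
  also have "\<dots> = (\<Sum>i\<le>k. of_nat (k choose i) * s ^ i * S ^ (k - i) / fact k)"
    by (intro sum.cong refl) (simp add: binomial_fact field_simps)
  also have "\<dots> = (s + S) ^ k / fact k"
    by (simp add: binomial_ring sum_divide_distrib)
  also have "s + S = (\<Sum>p\<in>insert p I. X p / of_real (sqrt (real p)))"
    using insert.hyps by (simp add: s_def S_def)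
  finally show ?case unfolding G_def .
qed

lemma eval_range_coeff:
  assumes I: "finite I" "\<And>p. p \<in> I \<Longrightarrow> prime (p::nat)"
    and X: "\<And>a b. X (a * b) = X a * X b" "X (1::nat) = 1" and f: "\<And>k. k > E \<Longrightarrow> f k = 0"
  shows "(\<Sum>h | h dvd prime_power_prod E I. range_coeff f I h * X h)
     = (\<Sum>k\<le>E. f k * (\<Sum>p\<in>I. X p / of_real (sqrt (real p))) ^ k / fact k)"
proof -
  define G where "G = (\<lambda>h. of_real (prime_weight h / sqrt (real h)) * X h :: complex)"
  have "(\<Sum>h | h dvd prime_power_prod E I. range_coeff f I h * X h) =
    (\<Sum>h | h dvd prime_power_prod E I. \<Sum>k\<le>E. f k * (if omega_in I h = k then G h else 0))"
  proof (intro sum.cong refl)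
    fix h
    have "(\<Sum>k\<le>E. f k * (if omega_in I h = k then G h else 0)) = (\<Sum>k\<le>E. if k = omega_in I h then f k * G h else 0)"
      by (intro sum.cong refl) auto
    also have "\<dots> = f (omega_in I h) * G h" using f[of "omega_in I h"] by (auto simp: not_le)
    finally show "range_coeff f I h * X h = (\<Sum>k\<le>E. f k * (if omega_in I h = k then G h else 0))"
      by (simp add: range_coeff_def G_def mult_ac)
  qed
  also have "\<dots> = (\<Sum>k\<le>E. f k * (\<Sum>h | h dvd prime_power_prod E I. if omega_in I h = k then G h else 0))"
    by (subst sum.swap) (simp add: sum_distrib_left)
  also have "\<dots> = (\<Sum>k\<le>E. f k * (\<Sum>p\<in>I. X p / of_real (sqrt (real p))) ^ k / fact k)"
    unfolding G_def by (intro sum.cong refl) (simp add: eval_range_coeff_fixed[OF I X])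
  finally show ?thesis .
qed

text \<open>\<open>P0\<close> holds the remaining primes of the modulus. The coefficients are
  trivial there, but the function they are convolved with is not, so these primes contribute a
  factor of their own.\<close>

context
  fixes R :: "nat set" and I :: "nat \<Rightarrow> nat set" and P0 :: "nat set"
  assumes R: "finite R"
    and I: "\<And>r. r \<in> R \<Longrightarrow> finite (I r)" "\<And>r p. r \<in> R \<Longrightarrow> p \<in> I r \<Longrightarrow> prime p"
    and disj: "\<And>r s. r \<in> R \<Longrightarrow> s \<in> R \<Longrightarrow> r \<noteq> s \<Longrightarrow> I r \<inter> I s = {}"
    and P0: "finite P0" "\<And>p. p \<in> P0 \<Longrightarrow> prime p" "\<And>r. r \<in> R \<Longrightarrow> P0 \<inter> I r = {}"
begin

lemma prime_power_prod_step:
  fixes E :: nat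
  assumes "S \<subseteq> R" "r \<in> R" "r \<notin> S"
  defines "a \<equiv> prime_power_prod E (I r)" and "b \<equiv> prime_power_prod E (P0 \<union> (\<Union>s\<in>S. I s))"
  shows "prime_power_prod E (P0 \<union> (\<Union>s\<in>insert r S. I s)) = a * b" "coprime a b" "a > 0" "b > 0"
    "\<And>x. x dvd a \<Longrightarrow> x > 0 \<and> prime_factors x \<subseteq> I r"
    "\<And>y. y dvd b \<Longrightarrow> y > 0 \<and> prime_factors y \<inter> I r = {}"
proof -
  define P where "P = P0 \<union> (\<Union>s\<in>S. I s)"
  have finS: "finite S" using assms(1) R finite_subset by blast
  have P: "finite P" "\<And>p. p \<in> P \<Longrightarrow> prime p" "I r \<inter> P = {}"
    using assms P0 I disj finS unfolding P_def by blast+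
  have Ir: "finite (I r)" "\<And>p. p \<in> I r \<Longrightarrow> prime p" using I assms by auto
  have "P0 \<union> (\<Union>s\<in>insert r S. I s) = I r \<union> P" by (auto simp: P_def)
  then show "prime_power_prod E (P0 \<union> (\<Union>s\<in>insert r S. I s)) = a * b"
    using prime_power_prod_union[OF Ir(1) P(1,3)] by (simp add: a_def b_def P_def)
  show "coprime a b" unfolding a_def b_def P_def[symmetric] by (rule prime_power_prod_coprime[OF Ir(2) P(2,3)])
  show "a > 0" "b > 0" unfolding a_def b_def P_def[symmetric] using prime_power_prod_pos Ir P by blast+
  show "x > 0 \<and> prime_factors x \<subseteq> I r" if "x dvd a" for x
    using prime_factors_dvd_prime_power_prod[OF Ir, of x E] that by (auto simp: a_def)
  show "y > 0 \<and> prime_factors y \<inter> I r = {}" if "y dvd b" for y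
    using prime_factors_dvd_prime_power_prod[OF P(1,2), of y E] that P(3) by (auto simp: b_def P_def)
qed

text \<open>Each range splits off a coprime part of the modulus, and multiplicativity of
  \<open>conv_sqnorm\<close> applies with the coefficients of that range.\<close>

lemma conv_sqnorm_multi_coeff:
  assumes u: "\<And>a b. a > 0 \<Longrightarrow> b > 0 \<Longrightarrow> u (a * b) = u a * u b"
  shows "conv_sqnorm (prime_power_prod E (P0 \<union> (\<Union>r\<in>R. I r))) (multi_coeff R I f) u =
    conv_sqnorm (prime_power_prod E P0) (multi_coeff {} I f) u * (\<Prod>r\<in>R. conv_sqnorm (prime_power_prod E (I r)) (range_coeff (f r) (I r)) u)"
proof -
  have "S \<subseteq> R \<Longrightarrow> conv_sqnorm (prime_power_prod E (P0 \<union> (\<Union>r\<in>S. I r))) (multi_coeff S I f) u =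
    conv_sqnorm (prime_power_prod E P0) (multi_coeff {} I f) u * (\<Prod>r\<in>S. conv_sqnorm (prime_power_prod E (I r)) (range_coeff (f r) (I r)) u)" for S
  proof (induction S rule: infinite_finite_induct)
    case (infinite S)
    then show ?case using R finite_subset by blast
  next
    case (insert r S)
    have r: "S \<subseteq> R" "r \<in> R" "r \<notin> S" using insert by auto
    note st = prime_power_prod_step[OF r, where E = E]
    have "conv_sqnorm (prime_power_prod E (P0 \<union> (\<Union>s\<in>insert r S. I s))) (multi_coeff (insert r S) I f) u =
      conv_sqnorm (prime_power_prod E (I r)) (range_coeff (f r) (I r)) u * conv_sqnorm (prime_power_prod E (P0 \<union> (\<Union>s\<in>S. I s))) (multi_coeff S I f) u"
      unfolding st(1)
    proof (rule conv_sqnorm_mult[OF st(2,3,4)])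
      fix x y assume xy: "x dvd prime_power_prod E (I r)" "y dvd prime_power_prod E (P0 \<union> (\<Union>s\<in>S. I s))"
      show "u (x * y) = u x * u y" using st(5)[OF xy(1)] st(6)[OF xy(2)] by (intro u) auto
      show "multi_coeff (insert r S) I f (x * y) = range_coeff (f r) (I r) x * multi_coeff S I f y"
      proof (rule multi_coeff_insert_mult)
        show "prime p" if "s \<in> insert r S" "p \<in> I s" for s p using I(2)[of s p] that r by auto
        show "I r \<inter> I s = {}" if "s \<in> S" for s using disj[of r s] that r by auto
      qed (use insert st(5)[OF xy(1)] st(6)[OF xy(2)] in auto)
    qed
    then show ?case using insert r by simp
  qed simp
  then show ?thesis by simp
qed

lemma eval_multi_coeff:
  assumes X: "\<And>a b. X (a * b) = X a * X b" "X (1::nat) = 1" and f: "\<And>r k. r \<in> R \<Longrightarrow> k > E \<Longrightarrow> f r k = 0"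
  shows "(\<Sum>h | h dvd prime_power_prod E (P0 \<union> (\<Union>r\<in>R. I r)). multi_coeff R I f h * X h)
     = (\<Prod>r\<in>R. \<Sum>k\<le>E. f r k * (\<Sum>p\<in>I r. X p / of_real (sqrt (real p))) ^ k / fact k)"
proof -
  have "S \<subseteq> R \<Longrightarrow> (\<Sum>h | h dvd prime_power_prod E (P0 \<union> (\<Union>r\<in>S. I r)). multi_coeff S I f h * X h)
     = (\<Prod>r\<in>S. \<Sum>k\<le>E. f r k * (\<Sum>p\<in>I r. X p / of_real (sqrt (real p))) ^ k / fact k)" for S
  proof (induction S rule: infinite_finite_induct)
    case (infinite S)
    then show ?case using R finite_subset by blast
  next
    case empty
    have fin: "finite {h. h dvd prime_power_prod E P0}" using prime_power_prod_pos[OF P0(2), of P0 E] by simp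
    have "(\<Sum>h | h dvd prime_power_prod E P0. multi_coeff {} I f h * X h) = (\<Sum>h | h dvd prime_power_prod E P0. if h = 1 then 1 else 0)"
    proof (intro sum.cong refl)
      fix h assume "h \<in> {h. h dvd prime_power_prod E P0}"
      then have "h > 0" using prime_factors_dvd_prime_power_prod(1)[OF P0(1,2), of h E] by auto
      then show "multi_coeff {} I f h * X h = (if h = 1 then 1 else 0)" using X(2) by (simp add: multi_coeff_empty)
    qed
    also have "\<dots> = 1" using fin by simp
    finally show ?case by simp
  next
    case (insert r S)
    have r: "S \<subseteq> R" "r \<in> R" "r \<notin> S" using insert by auto
    note st = prime_power_prod_step[OF r, where E = E]
    have Ir: "finite (I r)" "\<And>p. p \<in> I r \<Longrightarrow> prime p" using I r by auto
    have "(\<Sum>h | h dvd prime_power_prod E (P0 \<union> (\<Union>s\<in>insert r S. I s)). multi_coeff (insert r S) I f h * X h) =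
      (\<Sum>x | x dvd prime_power_prod E (I r). \<Sum>y | y dvd prime_power_prod E (P0 \<union> (\<Union>s\<in>S. I s)). multi_coeff (insert r S) I f (x * y) * X (x * y))"
      unfolding st(1) by (rule divisors_mult_coprime[OF st(2,3,4)])
    also have "\<dots> = (\<Sum>x | x dvd prime_power_prod E (I r). \<Sum>y | y dvd prime_power_prod E (P0 \<union> (\<Union>s\<in>S. I s)).
       (range_coeff (f r) (I r) x * X x) * (multi_coeff S I f y * X y))"
    proof (intro sum.cong refl)
      fix x y assume "x \<in> {x. x dvd prime_power_prod E (I r)}" "y \<in> {y. y dvd prime_power_prod E (P0 \<union> (\<Union>s\<in>S. I s))}"
      then have xy: "x dvd prime_power_prod E (I r)" "y dvd prime_power_prod E (P0 \<union> (\<Union>s\<in>S. I s))" by auto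
      have "multi_coeff (insert r S) I f (x * y) = range_coeff (f r) (I r) x * multi_coeff S I f y"
      proof (rule multi_coeff_insert_mult)
        show "prime p" if "s \<in> insert r S" "p \<in> I s" for s p using I(2)[of s p] that r by auto
        show "I r \<inter> I s = {}" if "s \<in> S" for s using disj[of r s] that r by auto
      qed (use insert st(5)[OF xy(1)] st(6)[OF xy(2)] in auto)
      then show "multi_coeff (insert r S) I f (x * y) * X (x * y) = (range_coeff (f r) (I r) x * X x) * (multi_coeff S I f y * X y)"
        by (simp add: X mult_ac)
    qed
    also have "\<dots> = (\<Sum>x | x dvd prime_power_prod E (I r). range_coeff (f r) (I r) x * X x) *
       (\<Sum>y | y dvd prime_power_prod E (P0 \<union> (\<Union>s\<in>S. I s)). multi_coeff S I f y * X y)"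
      by (simp add: sum_product)
    also have "(\<Sum>x | x dvd prime_power_prod E (I r). range_coeff (f r) (I r) x * X x) =
       (\<Sum>k\<le>E. f r k * (\<Sum>p\<in>I r. X p / of_real (sqrt (real p))) ^ k / fact k)"
      by (rule eval_range_coeff[OF Ir X f[OF r(2)]])
    finally show ?case using insert r by simp
  qed
  then show ?thesis by simp
qed

end

section \<open>Lengths of polynomials and mean squares over characters\<close>

lemma omega_in_bound:
  assumes R: "finite R" and I: "\<And>r. r \<in> R \<Longrightarrow> finite (I r)" "\<And>r p. r \<in> R \<Longrightarrow> p \<in> I r \<Longrightarrow> real p \<le> T r"
    and prim: "\<And>r p. r \<in> R \<Longrightarrow> p \<in> I r \<Longrightarrow> prime p"
    and disj: "\<And>r s. r \<in> R \<Longrightarrow> s \<in> R \<Longrightarrow> r \<noteq> s \<Longrightarrow> I r \<inter> I s = {}"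
    and T: "\<And>r. r \<in> R \<Longrightarrow> T r \<ge> 1"
    and h: "h > 0" "prime_factors h \<subseteq> (\<Union>r\<in>R. I r)" and K: "\<And>r. r \<in> R \<Longrightarrow> omega_in (I r) h \<le> K r"
  shows "real h \<le> (\<Prod>r\<in>R. T r ^ K r)"
proof -
  have U: "finite (\<Union>r\<in>R. I r)" using R I by auto
  have "h = (\<Prod>p\<in>prime_factors h. p ^ multiplicity p h)" using prime_factorization_nat[OF h(1)] .
  also have "\<dots> = (\<Prod>p\<in>(\<Union>r\<in>R. I r). p ^ multiplicity p h)"
  proof (rule prod.mono_neutral_left[OF U h(2)])
    show "\<forall>p\<in>(\<Union>r\<in>R. I r) - prime_factors h. p ^ multiplicity p h = 1"
    proof
      fix p assume p: "p \<in> (\<Union>r\<in>R. I r) - prime_factors h"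
      then have "prime p" using prim by blast
      then have "\<not> p dvd h" using p h(1) by (simp add: in_prime_factors_iff)
      then show "p ^ multiplicity p h = 1" by (simp add: not_dvd_imp_multiplicity_0)
    qed
  qed
  also have "\<dots> = (\<Prod>r\<in>R. \<Prod>p\<in>I r. p ^ multiplicity p h)"
    by (rule prod.UNION_disjoint) (use R I disj in auto)
  finally have "real h = (\<Prod>r\<in>R. \<Prod>p\<in>I r. real p ^ multiplicity p h)"
    by (metis (mono_tags, lifting) of_nat_power of_nat_prod prod.cong)
  also have "\<dots> \<le> (\<Prod>r\<in>R. T r ^ K r)"
  proof (intro prod_mono conjI)
    fix r assume r: "r \<in> R"
    show "0 \<le> (\<Prod>p\<in>I r. real p ^ multiplicity p h)" by (intro prod_nonneg) auto
    have "(\<Prod>p\<in>I r. real p ^ multiplicity p h) \<le> (\<Prod>p\<in>I r. T r ^ multiplicity p h)"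
      using I(2)[OF r] by (intro prod_mono conjI power_mono) auto
    also have "\<dots> = T r ^ omega_in (I r) h" by (simp add: omega_in_def power_sum)
    also have "\<dots> \<le> T r ^ K r" by (intro power_increasing K T r)
    finally show "(\<Prod>p\<in>I r. real p ^ multiplicity p h) \<le> T r ^ K r" .
  qed
  finally show ?thesis .
qed

text \<open>Since \<open>c * w\<close> is supported below \<open>q\<close>, distinct terms lie in distinct residue classes, and
  Bessel's inequality sees the diagonal only.\<close>

lemma character_mean_square:
  fixes c w :: "nat \<Rightarrow> complex"
  assumes q: "q > 1"
    and supp: "\<And>h m. 0 < h \<Longrightarrow> 0 < m \<Longrightarrow> m < q \<Longrightarrow> c h \<noteq> 0 \<Longrightarrow> w m \<noteq> 0 \<Longrightarrow> h * m < q"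
    and M: "M > 0" "\<And>n. 0 < n \<Longrightarrow> n < q \<Longrightarrow> n dvd M"
  shows "(\<Sum>X | dirichlet_char q X. (norm ((\<Sum>m\<in>{0<..<q}. w m * X (int m)) * (\<Sum>h | h dvd M. c h * X (int h))))\<^sup>2)
     \<le> real (totient q) * conv_sqnorm M c w"
proof -
  define a where "a = (\<lambda>n. \<Sum>h | h dvd n. c h * w (n div h))"
  have fM: "finite {h. h dvd M}" using M by simp
  have hpos: "h > 0" if "h dvd M" for h using that M by (auto intro: Nat.gr0I)
  have prod_eq: "(\<Sum>m\<in>{0<..<q}. w m * X (int m)) * (\<Sum>h | h dvd M. c h * X (int h)) = (\<Sum>n\<in>{0<..<q}. a n * X (int n))"
    if X: "dirichlet_char q X" for X
  proof -
    define A where "A = {(m, h). m \<in> {0<..<q} \<and> h dvd M \<and> h * m < q}"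
    have fA: "finite A" by (rule finite_subset[of _ "{0<..<q} \<times> {h. h dvd M}"]) (use fM in \<open>auto simp: A_def\<close>)
    have "(\<Sum>m\<in>{0<..<q}. w m * X (int m)) * (\<Sum>h | h dvd M. c h * X (int h)) =
       (\<Sum>(m, h)\<in>{0<..<q} \<times> {h. h dvd M}. w m * X (int m) * (c h * X (int h)))"
      by (simp add: sum_product sum.cartesian_product)
    also have "\<dots> = (\<Sum>(m, h)\<in>A. w m * X (int m) * (c h * X (int h)))"
    proof (rule sum.mono_neutral_right)
      show "finite ({0<..<q} \<times> {h. h dvd M})" using fM by simp
      show "A \<subseteq> {0<..<q} \<times> {h. h dvd M}" by (auto simp: A_def)
      show "\<forall>x\<in>{0<..<q} \<times> {h. h dvd M} - A. (case x of (m, h) \<Rightarrow> w m * X (int m) * (c h * X (int h))) = 0"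
      proof clarify
        fix m h assume mh: "(m, h) \<notin> A" "m \<in> {0<..<q}" "h dvd M"
        then have "\<not> h * m < q" by (simp add: A_def)
        then have "c h = 0 \<or> w m = 0" using supp[of h m] hpos mh by auto
        then show "w m * X (int m) * (c h * X (int h)) = 0" by auto
      qed
    qed
    \<comment> \<open>Pairs are indexed by the product \<open>n = h * m\<close> and the factor
      \<open>h\<close>; the coefficient of \<open>X n\<close> becomes a convolution.\<close>
    also have "\<dots> = (\<Sum>(n, h)\<in>(SIGMA n:{0<..<q}. {h. h dvd n}). c h * w (n div h) * X (int n))"
    proof (rule sum.reindex_bij_witness[where i = "\<lambda>(n, h). (n div h, h)" and j = "\<lambda>(m, h). (h * m, h)"])
      show "(case case x of (m, h) \<Rightarrow> (h * m, h) of (n, h) \<Rightarrow> (n div h, h)) = x" if "x \<in> A" for x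
        using that hpos by (auto simp: A_def)
      show "(case x of (m, h) \<Rightarrow> (h * m, h)) \<in> (SIGMA n:{0<..<q}. {h. h dvd n})" if "x \<in> A" for x
        using that hpos by (auto simp: A_def)
      show "(case case y of (n, h) \<Rightarrow> (n div h, h) of (m, h) \<Rightarrow> (h * m, h)) = y" if "y \<in> (SIGMA n:{0<..<q}. {h. h dvd n})" for y
        using that by auto
      show "(case y of (n, h) \<Rightarrow> (n div h, h)) \<in> A" if y: "y \<in> (SIGMA n:{0<..<q}. {h. h dvd n})" for y
      proof -
        obtain n h where nh: "y = (n, h)" "0 < n" "n < q" "h dvd n" using y by auto
        then have "h dvd M" using M(2)[of n] dvd_trans by blast
        moreover have "0 < n div h" using nh by (auto elim!: dvdE)
        moreover have "n div h < q" using nh by (meson div_le_dividend le_less_trans)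
        ultimately show ?thesis using nh by (auto simp: A_def)
      qed
      show "(case (case x of (m, h) \<Rightarrow> (h * m, h)) of (n, h) \<Rightarrow> c h * w (n div h) * X (int n)) =
         (case x of (m, h) \<Rightarrow> w m * X (int m) * (c h * X (int h)))" if "x \<in> A" for x
        using that hpos by (auto simp: A_def dirichlet_char_mult[OF X])
    qed
    also have "\<dots> = (\<Sum>n\<in>{0<..<q}. \<Sum>h | h dvd n. c h * w (n div h) * X (int n))"
      by (subst sum.Sigma) auto
    also have "\<dots> = (\<Sum>n\<in>{0<..<q}. a n * X (int n))" by (simp add: a_def sum_distrib_right)
    finally show ?thesis .
  qed
  have "(\<Sum>X | dirichlet_char q X. (norm ((\<Sum>m\<in>{0<..<q}. w m * X (int m)) * (\<Sum>h | h dvd M. c h * X (int h))))\<^sup>2) =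
    (\<Sum>X | dirichlet_char q X. (norm (\<Sum>n\<in>{0<..<q}. a n * X (int n)))\<^sup>2)"
    by (intro sum.cong refl) (simp add: prod_eq)
  also have "\<dots> \<le> real (totient q) * (\<Sum>n\<in>{0<..<q}. (norm (a n))\<^sup>2)"
    by (rule dirichlet_char_bessel[OF q])
  \<comment> \<open>Positivity allows the passage from \<open>n < q\<close> to all divisors of
    \<open>M\<close>, where the sum factors over primes.\<close>
  also have "(\<Sum>n\<in>{0<..<q}. (norm (a n))\<^sup>2) \<le> conv_sqnorm M c w"
    unfolding conv_sqnorm_def a_def using M fM by (intro sum_mono2) auto
  finally show ?thesis by (simp add: mult_left_mono)
qed

text \<open>Minkowski's inequality for finitely many twists, followed by a limit. Only finitely many
  \<open>n\<close> divide \<open>M\<close>, so pointwise convergence of the weights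
  suffices.\<close>

lemma sqrt_conv_sqnorm_series:
  fixes d :: "int \<Rightarrow> complex"
  assumes M: "M > 0"
    and w: "\<And>m. m > 0 \<Longrightarrow> ((\<lambda>k. d k * z k m) has_sum w m) UNIV"
    and B: "\<And>k. sqrt (conv_sqnorm M c (half_twist (z k))) \<le> b k"
    and s: "((\<lambda>k. norm (d k) * b k) has_sum S) UNIV"
  shows "sqrt (conv_sqnorm M c (half_twist w)) \<le> S"
proof -
  have fM: "finite {h. h dvd M}" using M by simp
  define v where "v = (\<lambda>Y m. \<Sum>k\<in>Y. d k * z k m)"
  have b0: "b k \<ge> 0" for k using B[of k] conv_sqnorm_nonneg[of M c] by (meson order_trans real_sqrt_ge_zero)
  have fin: "sqrt (conv_sqnorm M c (half_twist (v Y))) \<le> S" if Y: "finite Y" for Y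
  proof -
    have "sqrt (conv_sqnorm M c (half_twist (v Y))) \<le> (\<Sum>k\<in>Y. norm (d k) * b k)"
      using Y
    proof (induction Y rule: finite_induct)
      case empty
      then show ?case by (simp add: v_def half_twist_def conv_sqnorm_def)
    next
      case (insert j Y)
      have eq: "(\<Sum>h | h dvd n. c h * half_twist (v (insert j Y)) (n div h)) =
         d j * (\<Sum>h | h dvd n. c h * half_twist (z j) (n div h)) + (\<Sum>h | h dvd n. c h * half_twist (v Y) (n div h))" for n
        using insert.hyps by (simp add: v_def half_twist_def sum_distrib_left add_divide_distrib distrib_left sum.distrib mult_ac)
      have "sqrt (conv_sqnorm M c (half_twist (v (insert j Y)))) \<le>
        L2_set (\<lambda>n. norm (d j) * norm (\<Sum>h | h dvd n. c h * half_twist (z j) (n div h)) + norm (\<Sum>h | h dvd n. c h * half_twist (v Y) (n div h))) {n. n dvd M}"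
        unfolding sqrt_conv_sqnorm eq
        by (intro L2_set_mono order_trans[OF norm_triangle_ineq]) (auto simp: norm_mult)
      also have "\<dots> \<le> L2_set (\<lambda>n. norm (d j) * norm (\<Sum>h | h dvd n. c h * half_twist (z j) (n div h))) {n. n dvd M} + sqrt (conv_sqnorm M c (half_twist (v Y)))"
        unfolding sqrt_conv_sqnorm by (rule L2_set_triangle_ineq)
      also have "L2_set (\<lambda>n. norm (d j) * norm (\<Sum>h | h dvd n. c h * half_twist (z j) (n div h))) {n. n dvd M} = norm (d j) * sqrt (conv_sqnorm M c (half_twist (z j)))"
        unfolding sqrt_conv_sqnorm by (rule L2_set_right_distrib[symmetric]) auto
      also have "\<dots> \<le> norm (d j) * b j" by (intro mult_left_mono B) auto
      finally show ?case using insert by simp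
    qed
    also have "\<dots> \<le> S"
      by (rule has_sum_mono_neutral[OF has_sum_finite[OF Y] s]) (auto simp: b0)
    finally show ?thesis .
  qed
  have "((\<lambda>Y. sqrt (conv_sqnorm M c (half_twist (v Y)))) \<longlongrightarrow> sqrt (conv_sqnorm M c (half_twist w))) (finite_subsets_at_top UNIV)"
    unfolding conv_sqnorm_def half_twist_def
  proof (intro tendsto_intros)
    fix n h assume "n \<in> {n. n dvd M}" "h \<in> {h. h dvd n}"
    then have nh: "n dvd M" "h dvd n" by auto
    then have "n > 0" using M by (auto intro: Nat.gr0I)
    then have pos: "n div h > 0" using nh by (auto elim!: dvdE)
    show "((\<lambda>Y. v Y (n div h)) \<longlongrightarrow> w (n div h)) (finite_subsets_at_top UNIV)"
      using w[OF pos] unfolding has_sum_def v_def by simp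
    show "complex_of_real (sqrt (real (n div h))) \<noteq> 0" using pos by simp
  qed
  then show ?thesis
    by (rule tendsto_upperbound) (auto simp: eventually_finite_subsets_at_top_weakI fin intro!: eventually_finite_subsets_at_top_weakI)
qed

section \<open>Truncated exponentials\<close>

text \<open>Rankin's trick again: in the tail \<open>4 ^ k / 4 ^ K\<close> is at least 1, which
  replaces the tail by the whole series at \<open>4 * norm z\<close>.\<close>

lemma exp_taylor_tail:
  fixes z :: complex
  shows "norm (exp z - (\<Sum>k\<le>K. z ^ k / fact k)) \<le> exp (4 * norm z) / 4 ^ K"
proof -
  define a where "a = (\<lambda>k. z ^ k /\<^sub>R fact k)"
  define b where "b = (\<lambda>k. (4 * norm z) ^ k /\<^sub>R fact k)"
  have sa: "summable a" unfolding a_def by (rule summable_exp_generic)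
  have sb: "summable b" unfolding b_def by (rule summable_exp_generic)
  have aeq: "a k = z ^ k / fact k" for k by (simp add: a_def scaleR_conv_of_real field_simps)
  have na: "norm (a k) = norm z ^ k / fact k" for k by (simp add: aeq norm_divide norm_power)
  have bn: "b k \<ge> 0" for k by (simp add: b_def)
  have "exp z = (\<Sum>k. a (k + Suc K)) + (\<Sum>k<Suc K. a k)"
    unfolding exp_def a_def[symmetric] by (rule suminf_split_initial_segment[OF sa])
  then have "exp z - (\<Sum>k\<le>K. z ^ k / fact k) = (\<Sum>k. a (k + Suc K))"
    by (simp add: aeq lessThan_Suc_atMost)
  also have "norm \<dots> \<le> (\<Sum>k. b (k + Suc K) / 4 ^ K)"
  proof (rule norm_suminf_le)
    show "summable (\<lambda>k. b (k + Suc K) / 4 ^ K)"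
      using sb by (intro summable_divide) (rule summable_ignore_initial_segment)
    fix k
    have "norm (a (k + Suc K)) * 4 ^ K \<le> norm (a (k + Suc K)) * 4 ^ (k + Suc K)"
      by (intro mult_left_mono power_increasing) auto
    also have "\<dots> = b (k + Suc K)" unfolding na b_def by (simp add: power_mult_distrib field_simps)
    finally show "norm (a (k + Suc K)) \<le> b (k + Suc K) / 4 ^ K" by (simp add: field_simps)
  qed
  also have "\<dots> = (\<Sum>k. b (k + Suc K)) / 4 ^ K"
    using summable_ignore_initial_segment[OF sb, of "Suc K"] by (rule suminf_divide)
  also have "(\<Sum>k. b (k + Suc K)) \<le> (\<Sum>k. b k)"
  proof -
    have "(\<Sum>k. b k) = (\<Sum>k. b (k + Suc K)) + (\<Sum>k<Suc K. b k)"
      by (rule suminf_split_initial_segment[OF sb])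
    moreover have "(\<Sum>k<Suc K. b k) \<ge> 0" by (intro sum_nonneg bn)
    ultimately show ?thesis by simp
  qed
  also have "(\<Sum>k. b k) = exp (4 * norm z)" by (simp add: exp_def b_def)
  finally show ?thesis by (simp add: divide_right_mono)
qed

definition trunc_exp_coeff :: "real \<Rightarrow> nat \<Rightarrow> nat \<Rightarrow> complex" where
  "trunc_exp_coeff \<alpha> K k = (if k \<le> K then of_real \<alpha> ^ k else 0)"

text \<open>With these coefficients \<open>poly_eval\<close> gives \<open>(x / s) ^ s\<close>, of modulus at least one as soon as \<open>norm x \<ge> s\<close>.\<close>

definition monomial_coeff :: "nat \<Rightarrow> nat \<Rightarrow> complex" where
  "monomial_coeff s k = (if k = s then of_real (fact s / real s ^ s) else 0)"

definition poly_eval :: "nat \<Rightarrow> (nat \<Rightarrow> complex) \<Rightarrow> complex \<Rightarrow> complex" where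
  "poly_eval E f x = (\<Sum>k\<le>E. f k * x ^ k / fact k)"

lemma poly_eval_trunc_exp:
  assumes "K \<le> E"
  shows "poly_eval E (trunc_exp_coeff \<alpha> K) x = (\<Sum>k\<le>K. (of_real \<alpha> * x) ^ k / fact k)"
proof -
  have "poly_eval E (trunc_exp_coeff \<alpha> K) x = (\<Sum>k\<le>K. trunc_exp_coeff \<alpha> K k * x ^ k / fact k)"
    unfolding poly_eval_def using assms by (intro sum.mono_neutral_right) (auto simp: trunc_exp_coeff_def)
  also have "\<dots> = (\<Sum>k\<le>K. (of_real \<alpha> * x) ^ k / fact k)"
    by (intro sum.cong refl) (simp add: trunc_exp_coeff_def power_mult_distrib)
  finally show ?thesis .
qed

lemma poly_eval_monomial:
  assumes "s \<le> E" "s > 0"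
  shows "poly_eval E (monomial_coeff s) x = (x / of_nat s) ^ s"
proof -
  have "poly_eval E (monomial_coeff s) x = (\<Sum>k\<le>E. if k = s then of_real (fact s / real s ^ s) * x ^ s / fact s else 0)"
    unfolding poly_eval_def by (intro sum.cong refl) (simp add: monomial_coeff_def)
  also have "\<dots> = (x / of_nat s) ^ s" using assms by (simp add: power_divide)
  finally show ?thesis .
qed

text \<open>Truncation at degree \<open>10 * s\<close> leaves an error of at most
  \<open>1 / 4 ^ s\<close> relative to \<open>exp z\<close>, because
  \<open>exp 5 \<le> 4 ^ 9\<close>. A relative error is required as \<open>norm (exp z)\<close> may
  be as small as \<open>exp (- s)\<close>; the resulting factors have a bounded product over all
  stages.\<close>

lemma exp_le_trunc_exp:
  fixes P :: complex
  assumes s: "s > 0" and P: "norm P \<le> real s" and \<alpha>: "\<bar>\<alpha>\<bar> \<le> 1" and E: "10 * s \<le> E"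
  shows "exp (2 * \<alpha> * Re P) \<le> exp (4 / 4 ^ s) * (norm (poly_eval E (trunc_exp_coeff \<alpha> (10 * s)) P))\<^sup>2"
proof -
  define z where "z = of_real \<alpha> * P"
  define N where "N = (\<Sum>k\<le>10 * s. z ^ k / fact k)"
  define x :: real where "x = 1 / 4 ^ s"
  have "norm z \<le> 1 * real s" unfolding z_def norm_mult using P \<alpha> by (intro mult_mono) auto
  then have nz: "norm z \<le> real s" by simp
  have "4 ^ 1 \<le> (4::real) ^ s" using s by (intro power_increasing) auto
  then have x: "0 \<le> x" "x \<le> 1/4" by (auto simp: x_def field_simps)
  have "norm (exp z - N) \<le> exp (4 * norm z) / 4 ^ (10 * s)" unfolding N_def by (rule exp_taylor_tail)
  also have "\<dots> \<le> exp (4 * real s) / 4 ^ (10 * s)" using nz by (intro divide_right_mono) auto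
  also have "\<dots> \<le> x * exp (- real s)"
  proof -
    have "exp (5::real) = exp 1 ^ 5" by (simp flip: exp_of_nat_mult)
    also have "\<dots> \<le> 3 ^ 5" using exp_le by (intro power_mono) auto
    finally have "exp (5::real) \<le> 4 ^ 9" by simp
    then have "exp (5::real) ^ s \<le> (4 ^ 9) ^ s" by (intro power_mono) auto
    then have e5: "exp (real s * 5) \<le> 4 ^ (9 * s)" unfolding exp_of_nat_mult power_mult .
    have e4: "exp (4 * real s) * exp (real s) = exp (real s * 5)" by (simp flip: exp_add)
    have "exp (4 * real s) * exp (real s) * 4 ^ s \<le> 4 ^ (9 * s) * 4 ^ s"
      unfolding e4 using e5 by simp
    also have "\<dots> = 4 ^ (10 * s)" by (simp flip: power_add)
    finally show ?thesis by (simp add: x_def exp_minus field_simps)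
  qed
  also have "\<dots> \<le> x * norm (exp z)"
  proof (intro mult_left_mono x)
    have "- real s \<le> Re z" using nz abs_Re_le_cmod[of z] by linarith
    then show "exp (- real s) \<le> norm (exp z)" by simp
  qed
  finally have "norm (exp z) - x * norm (exp z) \<le> norm N"
    using norm_triangle_ineq2[of "exp z" N] by linarith
  then have "(1 - x) * norm (exp z) \<le> norm N" by (simp add: algebra_simps)
  \<comment> \<open>For \<open>x \<le> 1/4\<close> the loss \<open>1 - x\<close> is at least
    \<open>exp (- 2 * x)\<close>; squaring accounts for the factor
    \<open>exp (4 / 4 ^ s)\<close>.\<close>
  moreover have "exp (- 2 * x) \<le> 1 - x"
  proof -
    have "- x - 2 * x\<^sup>2 \<le> ln (1 - x)" using x by (intro ln_one_minus_pos_lower_bound) auto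
    moreover have "x * x \<le> 1/4 * x" using x by (intro mult_right_mono) auto
    ultimately have "- 2 * x \<le> ln (1 - x)" using x by (simp add: power2_eq_square)
    then have "exp (- 2 * x) \<le> exp (ln (1 - x))" by simp
    then show ?thesis using x by simp
  qed
  then have "exp (- 2 * x) * norm (exp z) \<le> (1 - x) * norm (exp z)" by (intro mult_right_mono) auto
  ultimately have "exp (- 2 * x) * norm (exp z) \<le> norm N" by linarith
  then have "norm (exp z) \<le> exp (2 * x) * norm N" by (simp add: exp_minus field_simps)
  then have "(norm (exp z))\<^sup>2 \<le> (exp (2 * x) * norm N)\<^sup>2" by (intro power_mono) auto
  moreover have "(norm (exp z))\<^sup>2 = exp (2 * \<alpha> * Re P)"
    by (simp add: z_def power2_eq_square mult_exp_exp)
  moreover have "(exp (2 * x) * norm N)\<^sup>2 = exp (4 / 4 ^ s) * (norm N)\<^sup>2"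
    by (simp add: power_mult_distrib x_def power2_eq_square mult_exp_exp)
  ultimately have "exp (2 * \<alpha> * Re P) \<le> exp (4 / 4 ^ s) * (norm N)\<^sup>2" by (simp only:)
  then show ?thesis using E by (simp add: poly_eval_trunc_exp N_def z_def)
qed

text \<open>Interpolation between the mollified second moment and the short polynomial; the exponents
  \<open>\<beta> - 1\<close> and \<open>\<beta>\<close> are the ones for which no power of \<open>exp Z\<close> is lost.\<close>

lemma powr_le_mollified:
  fixes x \<beta> Z :: real
  assumes "x \<ge> 0" "0 < \<beta>" "\<beta> < 1"
  shows "x powr (2 * \<beta>) \<le> x\<^sup>2 * exp (2 * (\<beta> - 1) * Z) + exp (2 * \<beta> * Z)"
proof (cases "x = 0")
  case False
  then have x: "x > 0" using assms by simp
  define Y where "Y = ln x"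
  have xY: "x = exp Y" using x by (simp add: Y_def)
  have "x powr (2 * \<beta>) = exp (2 * \<beta> * Y)" using x by (simp add: powr_def Y_def)
  moreover have "x\<^sup>2 * exp (2 * (\<beta> - 1) * Z) = exp (2 * Y + 2 * (\<beta> - 1) * Z)"
    by (simp add: xY exp_add exp_double)
  moreover have "exp (2 * \<beta> * Y) \<le> exp (2 * Y + 2 * (\<beta> - 1) * Z) + exp (2 * \<beta> * Z)"
  proof (cases "Y \<ge> Z")
    case True
    have "(1 - \<beta>) * Z \<le> (1 - \<beta>) * Y" using True assms by (intro mult_left_mono) auto
    then have "2 * \<beta> * Y \<le> 2 * Y + 2 * (\<beta> - 1) * Z" by (simp add: algebra_simps)
    then show ?thesis by (simp add: add_increasing2)
  next
    case False
    then have "2 * \<beta> * Y \<le> 2 * \<beta> * Z" using assms by simp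
    then show ?thesis by (simp add: add_increasing)
  qed
  ultimately show ?thesis by simp
qed auto

lemma powr_le_trunc_exp:
  fixes x \<beta> :: real and P :: "nat \<Rightarrow> complex"
  assumes x: "x \<ge> 0" "0 < \<beta>" "\<beta> < 1" and R: "finite R"
    and P: "\<And>r. r \<in> R \<Longrightarrow> norm (P r) \<le> real (s r)" "\<And>r. r \<in> R \<Longrightarrow> s r > 0" "\<And>r. r \<in> R \<Longrightarrow> 10 * s r \<le> E"
    and c: "(\<Sum>r\<in>R. 4 / 4 ^ s r) \<le> c"
  shows "x powr (2 * \<beta>) \<le> exp c *
    (x\<^sup>2 * (norm (\<Prod>r\<in>R. poly_eval E (trunc_exp_coeff (\<beta> - 1) (10 * s r)) (P r)))\<^sup>2
     + (norm (\<Prod>r\<in>R. poly_eval E (trunc_exp_coeff \<beta> (10 * s r)) (P r)))\<^sup>2)"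
proof -
  \<comment> \<open>With the real parts as interpolation parameter, both exponentials factor over
    the stages.\<close>
  define Z where "Z = (\<Sum>r\<in>R. Re (P r))"
  have e: "exp (2 * \<alpha> * Z) \<le> exp c * (norm (\<Prod>r\<in>R. poly_eval E (trunc_exp_coeff \<alpha> (10 * s r)) (P r)))\<^sup>2"
    if "\<bar>\<alpha>\<bar> \<le> 1" for \<alpha>
  proof -
    have "exp (2 * \<alpha> * Z) = (\<Prod>r\<in>R. exp (2 * \<alpha> * Re (P r)))"
      using R by (simp add: Z_def sum_distrib_left exp_sum)
    also have "\<dots> \<le> (\<Prod>r\<in>R. exp (4 / 4 ^ s r) * (norm (poly_eval E (trunc_exp_coeff \<alpha> (10 * s r)) (P r)))\<^sup>2)"
      using P that by (intro prod_mono conjI exp_le_trunc_exp) auto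
    also have "\<dots> = exp (\<Sum>r\<in>R. 4 / 4 ^ s r) * (norm (\<Prod>r\<in>R. poly_eval E (trunc_exp_coeff \<alpha> (10 * s r)) (P r)))\<^sup>2"
      using R by (simp add: prod.distrib exp_sum prod_norm[symmetric] prod_power_distrib)
    also have "\<dots> \<le> exp c * (norm (\<Prod>r\<in>R. poly_eval E (trunc_exp_coeff \<alpha> (10 * s r)) (P r)))\<^sup>2"
      using c by (intro mult_right_mono) auto
    finally show ?thesis .
  qed
  have "x powr (2 * \<beta>) \<le> x\<^sup>2 * exp (2 * (\<beta> - 1) * Z) + exp (2 * \<beta> * Z)" by (rule powr_le_mollified[OF x])
  also have "\<dots> \<le> x\<^sup>2 * (exp c * (norm (\<Prod>r\<in>R. poly_eval E (trunc_exp_coeff (\<beta> - 1) (10 * s r)) (P r)))\<^sup>2)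
      + exp c * (norm (\<Prod>r\<in>R. poly_eval E (trunc_exp_coeff \<beta> (10 * s r)) (P r)))\<^sup>2"
    using x by (intro add_mono mult_left_mono e) auto
  finally show ?thesis by (simp add: algebra_simps)
qed

text \<open>In use \<open>V\<close> is empty or consists of the one stage at which the threshold is
  exceeded.\<close>

definition stage_coeff :: "(nat \<Rightarrow> nat) \<Rightarrow> real \<Rightarrow> nat set \<Rightarrow> nat \<Rightarrow> nat \<Rightarrow> complex" where
  "stage_coeff s \<alpha> V r = (if r \<in> V then monomial_coeff (s r) else trunc_exp_coeff \<alpha> (10 * s r))"

definition stage_term :: "nat \<Rightarrow> (nat \<Rightarrow> nat) \<Rightarrow> (nat \<Rightarrow> complex) \<Rightarrow> real \<Rightarrow> real \<Rightarrow> nat set \<Rightarrow> nat set \<Rightarrow> real" where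
  "stage_term E s P x \<beta> V R =
     (norm (of_real x * (\<Prod>r\<in>R. poly_eval E (stage_coeff s (\<beta> - 1) V r) (P r))))\<^sup>2
     + (norm (\<Prod>r\<in>R. poly_eval E (stage_coeff s \<beta> V r) (P r)))\<^sup>2"

text \<open>The sum is over the largest index at which the polynomial exceeds its threshold.\<close>

lemma powr_le_stages:
  fixes x \<beta> :: real and P :: "nat \<Rightarrow> complex"
  assumes x: "x \<ge> 0" "0 < \<beta>" "\<beta> < 1"
    and s: "\<And>r. r < n \<Longrightarrow> s r > 0" "\<And>r. r < n \<Longrightarrow> 10 * s r \<le> E"
    and c: "(\<Sum>r<n. 4 / 4 ^ s r) \<le> c"
  shows "x powr (2 * \<beta>) \<le> exp c * (stage_term E s P x \<beta> {} {0..<n} + (\<Sum>v<n. stage_term E s P x \<beta> {v} {v..<n}))"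
proof -
  have st0: "stage_term E s P x \<beta> V R \<ge> 0" for V R by (simp add: stage_term_def)
  show ?thesis
  proof (cases "\<forall>r<n. norm (P r) \<le> real (s r)")
    case True
    have "x powr (2 * \<beta>) \<le> exp c * stage_term E s P x \<beta> {} {0..<n}"
      unfolding stage_term_def stage_coeff_def norm_mult power_mult_distrib
      using powr_le_trunc_exp[OF x, of "{0..<n}" P s E c] True s c x by (simp add: atLeast0LessThan)
    also have "\<dots> \<le> exp c * (stage_term E s P x \<beta> {} {0..<n} + (\<Sum>v<n. stage_term E s P x \<beta> {v} {v..<n}))"
      using st0 by (intro mult_left_mono) (auto simp: sum_nonneg)
    finally show ?thesis .
  next
    case False
    define v where "v = Max {r. r < n \<and> norm (P r) > real (s r)}"
    have fin: "finite {r. r < n \<and> norm (P r) > real (s r)}" by simp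
    have "v \<in> {r. r < n \<and> norm (P r) > real (s r)}"
      unfolding v_def by (rule Max_in[OF fin]) (use False in \<open>auto simp: not_le\<close>)
    then have v: "v < n" "norm (P v) > real (s v)" by auto
    have ok: "norm (P r) \<le> real (s r)" if "v < r" "r < n" for r
    proof (rule ccontr)
      assume "\<not> ?thesis"
      then have "r \<le> v" unfolding v_def using that by (intro Max_ge fin) auto
      then show False using that by simp
    qed
    define R where "R = {Suc v..<n}"
    have "(\<Sum>r\<in>R. 4 / 4 ^ s r) \<le> (\<Sum>r<n. 4 / 4 ^ s r :: real)" unfolding R_def by (intro sum_mono2) auto
    then have cR: "(\<Sum>r\<in>R. 4 / 4 ^ s r) \<le> c" using c by linarith
    \<comment> \<open>Being at least 1, this factor can be inserted for free; it is small in mean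
      square and pays for the omitted stages below \<open>v\<close>.\<close>
    define t where "t = (norm (P v) / real (s v)) ^ s v"
    have t1: "t \<ge> 1" unfolding t_def using v s(1)[OF v(1)] by (intro one_le_power) (simp add: field_simps)
    have pe: "norm (poly_eval E (monomial_coeff (s v)) (P v)) = t"
      using poly_eval_monomial[of "s v" E "P v"] s[OF v(1)] by (simp add: t_def norm_power norm_divide)
    have Rv: "{v..<n} = insert v R" "v \<notin> R" using v by (auto simp: R_def)
    have pr: "norm (\<Prod>r\<in>{v..<n}. poly_eval E (stage_coeff s \<alpha> {v} r) (P r)) = t * norm (\<Prod>r\<in>R. poly_eval E (trunc_exp_coeff \<alpha> (10 * s r)) (P r))" for \<alpha>
    proof -
      have "(\<Prod>r\<in>R. poly_eval E (stage_coeff s \<alpha> {v} r) (P r)) = (\<Prod>r\<in>R. poly_eval E (trunc_exp_coeff \<alpha> (10 * s r)) (P r))"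
        using Rv by (intro prod.cong refl) (auto simp: stage_coeff_def)
      then show ?thesis unfolding Rv(1) using Rv(2) by (simp add: R_def stage_coeff_def norm_mult pe)
    qed
    define A where "A = x\<^sup>2 * (norm (\<Prod>r\<in>R. poly_eval E (trunc_exp_coeff (\<beta> - 1) (10 * s r)) (P r)))\<^sup>2
     + (norm (\<Prod>r\<in>R. poly_eval E (trunc_exp_coeff \<beta> (10 * s r)) (P r)))\<^sup>2"
    have A0: "A \<ge> 0" by (simp add: A_def)
    have stA: "stage_term E s P x \<beta> {v} {v..<n} = t\<^sup>2 * A"
      unfolding stage_term_def norm_mult[of "of_real x"] pr A_def by (simp add: power_mult_distrib algebra_simps)
    have "x powr (2 * \<beta>) \<le> exp c * A"
      unfolding A_def using s ok cR by (intro powr_le_trunc_exp x) (auto simp: R_def)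
    also have "A \<le> t\<^sup>2 * A" using t1 A0 by (simp add: mult_le_cancel_right1)
    also have "\<dots> \<le> (\<Sum>v<n. stage_term E s P x \<beta> {v} {v..<n})"
      unfolding stA[symmetric] using v st0 by (intro member_le_sum) auto
    also have "\<dots> \<le> stage_term E s P x \<beta> {} {0..<n} + (\<Sum>v<n. stage_term E s P x \<beta> {v} {v..<n})"
      using st0 by simp
    finally show ?thesis by simp
  qed
qed

section \<open>Moments of a short polynomial\<close>

text \<open>Linear growth keeps the total length under control, as stage \<open>r\<close> carries
  the weight \<open>1 / 2 ^ r\<close> on the logarithmic scale. The factor 8 lets the gain
  \<open>4 ^ (8 * (v + 1))\<close> of an exceptional stage beat the loss
  \<open>exp (8 * v)\<close>.\<close>

definition threshold :: "nat \<Rightarrow> nat" where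
  "threshold r = 8 * (r + 1)"

lemma sum_half_powers: "(\<Sum>r<n. real (r + 1) / 2 ^ r) \<le> 4"
proof -
  have "(\<Sum>r<n. real (r + 1) / 2 ^ r) = 4 - (2 * real n + 4) / 2 ^ n"
  proof (induction n)
    case (Suc n)
    have "(\<Sum>r<Suc n. real (r + 1) / 2 ^ r) = 4 - (2 * real n + 4) / 2 ^ n + real (n + 1) / 2 ^ n"
      using Suc by simp
    also have "\<dots> = 4 - (2 * real (Suc n) + 4) / 2 ^ Suc n" by (simp add: field_simps)
    finally show ?case .
  qed simp
  then show ?thesis by simp
qed

lemma sum_geometric_le:
  fixes x :: real
  assumes "0 \<le> x" "x \<le> 1/2"
  shows "(\<Sum>r<n. x ^ (r + 1)) \<le> 1"
proof -
  have "(\<Sum>r<n. x ^ (r + 1)) \<le> (\<Sum>r<n. (1/2) ^ (r + 1))"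
    using assms by (intro sum_mono power_mono) auto
  also have "\<dots> = 1 - (1/2) ^ n" by (induction n) (auto simp: field_simps)
  finally show ?thesis by (simp add: order_trans[of _ "1 - (1/2) ^ n"])
qed

text \<open>The bound makes \<open>L / 2048\<close> at least 1, so the logarithm that gives the
  number of stages is nonnegative.\<close>

locale large_modulus =
  fixes q :: nat
  assumes q_large: "real q \<ge> exp 2048"
begin

definition "L = ln (real q)"

lemma q_gt_3: "real q > 3"
proof -
  have "exp (2048::real) \<ge> 1 + 2048" by (rule exp_ge_add_one_self)
  then show ?thesis using q_large by linarith
qed

lemma q_gt_1: "q > 1" using q_gt_3 by linarith

lemma L_ge: "L \<ge> 2048"
proof -
  have "ln (exp 2048) \<le> ln (real q)" using q_large q_gt_3 by (subst ln_le_cancel_iff) auto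
  then show ?thesis by (simp add: L_def)
qed

lemma exp_L: "exp L = real q" using q_gt_3 by (simp add: L_def)

text \<open>The stages stop at an endpoint between \<open>exp 1\<close> and \<open>exp 2\<close>, so
  only boundedly many small primes lie below them.\<close>

definition "n_stages = nat \<lfloor>log 2 (L / 2048)\<rfloor>"

definition "endpoint r = exp (L / 2048 / 2 ^ r)"

definition "stage r = primes_between (endpoint (r + 1)) (endpoint r)"

lemma n_stages: "2 ^ n_stages \<le> L / 2048" "L / 2048 < 2 * 2 ^ n_stages"
proof -
  have L1: "L / 2048 \<ge> 1" using L_ge by simp
  then have "log 2 (L / 2048) \<ge> 0" by simp
  then have n: "real n_stages \<le> log 2 (L / 2048)" "log 2 (L / 2048) < real n_stages + 1"
    unfolding n_stages_def by linarith+
  have "2 powr real n_stages \<le> 2 powr log 2 (L / 2048)" using n by (intro powr_mono) auto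
  then show "2 ^ n_stages \<le> L / 2048" using L1 by (simp add: powr_realpow)
  have "2 powr log 2 (L / 2048) < 2 powr (real n_stages + 1)" using n by (intro powr_less_mono) auto
  then show "L / 2048 < 2 * 2 ^ n_stages" using L1 by (simp add: powr_realpow powr_add)
qed

lemma endpoint_gt_1: "endpoint r > 1"
  using L_ge by (simp add: endpoint_def)

lemma endpoint_antimono:
  assumes "r \<le> s"
  shows "endpoint s \<le> endpoint r"
proof -
  have "(2::real) ^ r \<le> 2 ^ s" using assms by (intro power_increasing) auto
  then have "L / 2048 / 2 ^ s \<le> L / 2048 / 2 ^ r" using L_ge by (intro divide_left_mono) auto
  then show ?thesis by (simp add: endpoint_def)
qed

lemma endpoint_le_q: "endpoint r \<le> real q"
proof -
  have "L / 2048 / 2 ^ r \<le> L / 2048 / 1" using L_ge by (intro divide_left_mono) auto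
  then have "L / 2048 / 2 ^ r \<le> L" using L_ge by linarith
  then show ?thesis unfolding endpoint_def exp_L[symmetric] by simp
qed

lemma finite_stage: "finite (stage r)" by (simp add: stage_def)

lemma prime_stage: "p \<in> stage r \<Longrightarrow> prime p" by (simp add: stage_def primes_between_def)

lemma stage_le: "p \<in> stage r \<Longrightarrow> real p \<le> endpoint r" by (simp add: stage_def primes_between_def)

lemma stage_disjoint: "r \<noteq> s \<Longrightarrow> stage r \<inter> stage s = {}"
proof (induction r s rule: linorder_wlog)
  case (le r s)
  then have "endpoint s \<le> endpoint (r + 1)" by (intro endpoint_antimono) auto
  then show ?case by (auto simp: stage_def primes_between_def)
qed auto

lemma stage_union:
  assumes "v \<le> n"
  shows "(\<Union>r\<in>{v..<n}. stage r) = primes_between (endpoint n) (endpoint v)"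
  using assms
proof (induction n rule: dec_induct)
  case base
  then show ?case by (auto simp: primes_between_def)
next
  case (step n)
  have "endpoint (Suc n) \<le> endpoint n" "endpoint n \<le> endpoint v"
    using step by (auto intro: endpoint_antimono)
  moreover have "{v..<Suc n} = insert n {v..<n}" using step by auto
  ultimately show ?case using step by (auto simp: stage_def primes_between_def)
qed

lemma sum_stage_le: "(\<Sum>p\<in>stage r. 1 / real p) \<le> 4"
proof -
  have "(\<Sum>p\<in>stage r. 1 / real p) \<le> 2 * ln (endpoint r) / ln (endpoint (r + 1))"
    unfolding stage_def by (rule sum_inverse_primes_between_le) (auto intro: endpoint_gt_1 endpoint_antimono)
  also have "\<dots> = 4" using L_ge by (simp add: endpoint_def field_simps)
  finally show ?thesis .
qed

text \<open>The primes in question are at most 9 or lie above \<open>endpoint v\<close>. From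
  \<open>endpoint v\<close> it takes \<open>v + 11\<close> squarings to reach \<open>q\<close>,
  since 2048 is \<open>2 ^ 11\<close>.\<close>

lemma sum_outside_le:
  assumes v: "v \<le> n_stages"
  shows "(\<Sum>p\<in>primes_le (real q) - (\<Union>r\<in>{v..<n_stages}. stage r). 1 / real p) \<le> 53 + 4 * real v"
proof -
  have sub: "primes_le (real q) - (\<Union>r\<in>{v..<n_stages}. stage r) \<subseteq> primes_le (endpoint n_stages) \<union> primes_between (endpoint v) (real q)"
    unfolding stage_union[OF v] by (auto simp: primes_between_def primes_le_def)
  have T9: "endpoint n_stages \<le> 9"
  proof -
    have "L / 2048 / 2 ^ n_stages \<le> 2" using n_stages(2) by (simp add: field_simps)
    then have "endpoint n_stages \<le> exp 2" by (simp add: endpoint_def)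
    also have "exp (2::real) = exp 1 * exp 1" by (simp flip: exp_add)
    also have "\<dots> \<le> 3 * 3" using exp_le by (intro mult_mono) auto
    finally show ?thesis by simp
  qed
  have small: "(\<Sum>p\<in>primes_le (endpoint n_stages). 1 / real p) \<le> 9"
  proof -
    have "(\<Sum>p\<in>primes_le (endpoint n_stages). 1 / real p) \<le> (\<Sum>p\<in>primes_le (endpoint n_stages). 1)"
    proof (rule sum_mono)
      fix p assume "p \<in> primes_le (endpoint n_stages)"
      then have "real p \<ge> 1" by (auto simp: primes_le_def dest: prime_ge_1_nat)
      then show "1 / real p \<le> 1" by simp
    qed
    also have "\<dots> = real (card (primes_le (endpoint n_stages)))" by simp
    also have "card (primes_le (endpoint n_stages)) \<le> card {1..9::nat}"
    proof (rule card_mono)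
      show "primes_le (endpoint n_stages) \<subseteq> {1..9}"
      proof
        fix p assume "p \<in> primes_le (endpoint n_stages)"
        then have "prime p" "real p \<le> 9" using T9 by (auto simp: primes_le_def)
        then show "p \<in> {1..9}" using prime_ge_1_nat[of p] by auto
      qed
    qed simp
    finally show ?thesis by simp
  qed
  have big: "(\<Sum>p\<in>primes_between (endpoint v) (real q). 1 / real p) \<le> 4 * real (v + 11)"
  proof (rule sum_inverse_primes_between_power_le[OF endpoint_gt_1])
    have "endpoint v ^ (2 ^ (v + 11)) = exp (real (2 ^ (v + 11)) * (L / 2048 / 2 ^ v))"
      unfolding endpoint_def by (rule exp_of_nat_mult[symmetric])
    also have "real (2 ^ (v + 11)) * (L / 2048 / 2 ^ v) = L" by (simp add: power_add)
    finally show "real q \<le> endpoint v ^ (2 ^ (v + 11))" by (simp add: exp_L)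
  qed
  have "(\<Sum>p\<in>primes_le (real q) - (\<Union>r\<in>{v..<n_stages}. stage r). 1 / real p) \<le>
     (\<Sum>p\<in>primes_le (endpoint n_stages) \<union> primes_between (endpoint v) (real q). 1 / real p)"
    by (intro sum_mono2 sub) auto
  also have "\<dots> \<le> (\<Sum>p\<in>primes_le (endpoint n_stages). 1 / real p) + (\<Sum>p\<in>primes_between (endpoint v) (real q). 1 / real p)"
  proof -
    let ?A = "primes_le (endpoint n_stages)" and ?B = "primes_between (endpoint v) (real q)"
    have "(\<Sum>p\<in>?A \<union> ?B. 1 / real p) + (\<Sum>p\<in>?A \<inter> ?B. 1 / real p) = (\<Sum>p\<in>?A. 1 / real p) + (\<Sum>p\<in>?B. 1 / real p)"
      by (rule sum.union_inter) auto
    moreover have "(\<Sum>p\<in>?A \<inter> ?B. 1 / real p) \<ge> 0" by (rule sum_nonneg) simp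
    ultimately show ?thesis by linarith
  qed
  finally show ?thesis using small big by simp
qed

text \<open>The sum of \<open>(r + 1) / 2 ^ r\<close> is at most 4, so the logarithm of the length
  is at most \<open>80 * 4 / 2048\<close> times \<open>L\<close>, which is below
  \<open>L / 5\<close>; this accounts for the size of 2048.\<close>

lemma prod_endpoint_le:
  "(\<Prod>r\<in>{v..<n_stages}. endpoint r ^ (10 * threshold r)) \<le> real q powr (1/5)"
proof -
  have "(\<Prod>r\<in>{v..<n_stages}. endpoint r ^ (10 * threshold r)) = exp (\<Sum>r\<in>{v..<n_stages}. real (10 * threshold r) * (L / 2048 / 2 ^ r))"
    by (subst exp_sum) (simp_all only: finite_atLeastLessThan endpoint_def exp_of_nat_mult)
  also have "(\<Sum>r\<in>{v..<n_stages}. real (10 * threshold r) * (L / 2048 / 2 ^ r)) \<le> (\<Sum>r<n_stages. real (10 * threshold r) * (L / 2048 / 2 ^ r))"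
    using L_ge by (intro sum_mono2) auto
  also have "\<dots> = 80 * (L / 2048) * (\<Sum>r<n_stages. real (r + 1) / 2 ^ r)"
    unfolding sum_distrib_left by (intro sum.cong refl) (simp add: threshold_def field_simps)
  also have "\<dots> \<le> 80 * (L / 2048) * 4"
    using L_ge sum_half_powers[of n_stages] by (intro mult_left_mono) auto
  also have "\<dots> \<le> 1/5 * L" using L_ge by simp
  also have "exp (1/5 * L) = real q powr (1/5)" using q_gt_3 by (simp add: powr_def L_def)
  finally show ?thesis by simp
qed

text \<open>Large enough in two respects: every number below \<open>q\<close> divides
  \<open>full_modulus\<close>, and every degree \<open>10 * threshold r\<close> is covered when the
  polynomials are evaluated.\<close>

definition "max_exponent = q + 80 * (n_stages + 1)"

definition "full_modulus = prime_power_prod max_exponent (primes_le (real q))"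

definition stage_poly :: "real \<Rightarrow> nat set \<Rightarrow> nat \<Rightarrow> nat \<Rightarrow> complex" where
  "stage_poly \<alpha> V v = multi_coeff {v..<n_stages} stage (stage_coeff threshold \<alpha> V)"

lemma full_modulus_pos: "full_modulus > 0"
  unfolding full_modulus_def by (rule prime_power_prod_pos) (auto simp: primes_le_def)

lemma dvd_full_modulus:
  assumes "0 < n" "n < q"
  shows "n dvd full_modulus"
  unfolding full_modulus_def
proof (rule dvd_prime_power_prod)
  show "prime_factors n \<subseteq> primes_le (real q)"
  proof
    fix p assume "p \<in> prime_factors n"
    then have "prime p" "p dvd n" by auto
    then have "p \<le> n" using assms dvd_imp_le by blast
    then show "p \<in> primes_le (real q)" using assms \<open>prime p\<close> by (auto simp: primes_le_def)
  qed
qed (use assms in \<open>auto simp: max_exponent_def\<close>)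

lemma stage_poly_support:
  assumes "h > 0" "stage_poly \<alpha> V v h \<noteq> 0"
  shows "real h \<le> real q powr (1/5)"
proof -
  have pf: "prime_factors h \<subseteq> (\<Union>r\<in>{v..<n_stages}. stage r)"
    and nz: "(\<Prod>r\<in>{v..<n_stages}. stage_coeff threshold \<alpha> V r (omega_in (stage r) h)) \<noteq> 0"
    using assms(2) unfolding stage_poly_def multi_coeff_def by (auto split: if_splits)
  have "real h \<le> (\<Prod>r\<in>{v..<n_stages}. endpoint r ^ (10 * threshold r))"
  proof (rule omega_in_bound[of _ stage])
    show "omega_in (stage r) h \<le> 10 * threshold r" if "r \<in> {v..<n_stages}" for r
    proof -
      have "stage_coeff threshold \<alpha> V r (omega_in (stage r) h) \<noteq> 0" using nz that by auto
      then show ?thesis by (auto simp: stage_coeff_def monomial_coeff_def trunc_exp_coeff_def split: if_splits)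
    qed
    show "1 \<le> endpoint r" for r using endpoint_gt_1[of r] by simp
  qed (use assms pf stage_disjoint stage_le prime_stage finite_stage in auto)
  also have "\<dots> \<le> real q powr (1/5)" by (rule prod_endpoint_le)
  finally show ?thesis .
qed

lemma primes_split:
  assumes "v \<le> n_stages"
  defines "P0 \<equiv> primes_le (real q) - (\<Union>r\<in>{v..<n_stages}. stage r)"
  shows "primes_le (real q) = P0 \<union> (\<Union>r\<in>{v..<n_stages}. stage r)" "finite P0"
    "\<And>p. p \<in> P0 \<Longrightarrow> prime p" "\<And>r. r \<in> {v..<n_stages} \<Longrightarrow> P0 \<inter> stage r = {}"
proof -
  have "stage r \<subseteq> primes_le (real q)" for r
    using endpoint_le_q[of r] by (auto simp: stage_def primes_between_def primes_le_def)
  then show "primes_le (real q) = P0 \<union> (\<Union>r\<in>{v..<n_stages}. stage r)" by (auto simp: P0_def)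
qed (auto simp: P0_def primes_le_def finite_primes_le[unfolded primes_le_def])

lemma eval_stage_poly:
  assumes v: "v \<le> n_stages" and X: "\<And>a b. X (a * b) = X a * X b" "X (1::nat) = 1"
  shows "(\<Sum>h | h dvd full_modulus. stage_poly \<alpha> V v h * X h) =
    (\<Prod>r\<in>{v..<n_stages}. poly_eval max_exponent (stage_coeff threshold \<alpha> V r) (\<Sum>p\<in>stage r. X p / of_real (sqrt (real p))))"
proof -
  note sp = primes_split[OF v]
  show ?thesis
    unfolding full_modulus_def stage_poly_def poly_eval_def
    apply (subst sp(1))
  proof (rule eval_multi_coeff)
    show "stage_coeff threshold \<alpha> V r k = 0" if r: "r \<in> {v..<n_stages}" and k: "k > max_exponent" for r k
    proof -
      have "10 * threshold r < k" using r k by (simp add: threshold_def max_exponent_def)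
      then show ?thesis by (auto simp: stage_coeff_def monomial_coeff_def trunc_exp_coeff_def threshold_def)
    qed
  qed (use sp X stage_disjoint prime_stage finite_stage in auto)
qed

end

section \<open>Mean squares of the stages\<close>

lemma norm_monomial_coeff_le:
  "norm (monomial_coeff s k) \<le> (1/2) ^ s * 2 ^ k"
proof (cases "k = s")
  case True
  have "(fact s :: real) \<le> real (s ^ s)" by (rule fact_le_power)
  then have "fact s / real s ^ s \<le> 1" by (cases "s = 0") (auto simp: divide_simps)
  then show ?thesis using True by (simp add: monomial_coeff_def norm_divide norm_power power_divide del: of_real_divide)
qed (simp add: monomial_coeff_def)

text \<open>With \<alpha> equal to 0 the primes outside the stages fall under the same estimate as
  the others; the convention \<open>0 ^ 0 = 1\<close> retains \<open>h = 1\<close>.\<close>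

lemma multi_coeff_empty_eq_range_coeff:
  assumes P: "finite P" "\<And>p. p \<in> P \<Longrightarrow> prime p" and h: "h dvd prime_power_prod E P"
  shows "multi_coeff {} I f h = range_coeff (\<lambda>k. 0 ^ k) P h"
proof -
  have h': "h > 0" "prime_factors h \<subseteq> P" using prime_factors_dvd_prime_power_prod[OF P h] by auto
  show ?thesis
  proof (cases "h = 1")
    case True
    then show ?thesis unfolding True range_coeff_1 using multi_coeff_empty[of 1 I f] by simp
  next
    case False
    then obtain p where p: "prime p" "p dvd h" using prime_factor_nat by blast
    then have pP: "p \<in> P" using h' by (auto simp: in_prime_factors_iff)
    have "multiplicity p h \<ge> 1" using p h' by (intro multiplicity_geI) auto
    also have "multiplicity p h \<le> omega_in P h"
      unfolding omega_in_def using P pP by (intro member_le_sum) auto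
    finally show ?thesis using False h' by (simp add: multi_coeff_empty range_coeff_def)
  qed
qed

text \<open>At \<open>z = 1\<close> the left side is exactly \<open>\<beta>\<^sup>2\<close>. The
  deviation is linear in \<open>norm (z - 1)\<close>, whose sum over primes measures the cost of a
  twist.\<close>

lemma norm_shift_square_le:
  fixes z :: complex
  assumes "norm z \<le> 1" "0 \<le> \<beta>" "\<beta> \<le> 1"
  shows "(norm (of_real (\<beta> - 1) + z))\<^sup>2 \<le> \<beta>\<^sup>2 + 4 * norm (z - 1)"
proof -
  define t where "t = norm (z - 1)"
  have t: "0 \<le> t" "t \<le> 2" using norm_triangle_ineq4[of z 1] assms(1) by (auto simp: t_def)
  have eq: "of_real (\<beta> - 1) + z = of_real \<beta> + (z - 1)" by simp
  have "norm (of_real (\<beta> - 1) + z) \<le> norm (complex_of_real \<beta>) + t"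
    unfolding eq t_def by (rule norm_triangle_ineq)
  then have "norm (of_real (\<beta> - 1) + z) \<le> \<beta> + t" using assms by simp
  then have "(norm (of_real (\<beta> - 1) + z))\<^sup>2 \<le> (\<beta> + t)\<^sup>2" by (intro power_mono) auto
  also have "\<dots> = \<beta>\<^sup>2 + 2 * (\<beta> * t) + t * t" by (simp add: power2_eq_square algebra_simps)
  also have "\<beta> * t \<le> 1 * t" using assms t by (intro mult_right_mono) auto
  also have "t * t \<le> 2 * t" using t by (intro mult_right_mono) auto
  finally show ?thesis by (simp add: t_def)
qed

context large_modulus
begin

text \<open>The exponent collects losses: 106 from the primes outside the stages, 5 from Mertens'
  bound, \<open>4 * exp 2\<close> from the squares of primes, \<open>2 * exp (4 * exp 4)\<close>
  from the truncations and \<open>8 * exp 4\<close> from an exceptional stage. As \<open>q\<close>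
  does not occur, the constant is absolute outside the locale.\<close>

definition "mean_const = exp (111 + 4 * exp 2 + 2 * exp (4 * exp 4) + 8 * exp 4 :: real)"

text \<open>The exponential is the loss at the primes above stage \<open>v\<close>, the quotient the
  gain from the exceptional stage.\<close>

definition stage_weight :: "nat set \<Rightarrow> nat \<Rightarrow> real" where
  "stage_weight V v = exp (8 * real v) * (if V = {} then 1 else 1 / 4 ^ threshold v)"

text \<open>The function \<eta> bounds the excess of \<open>(norm (\<alpha> + z p))\<^sup>2\<close>
  over \<open>\<beta>\<^sup>2\<close>, so that the mollified and the plain polynomial are treated
  together. Each regular stage contributes its Euler product times a factor whose logarithm decays
  geometrically in \<open>r\<close>.\<close>

lemma conv_sqnorm_stage_poly:
  assumes z: "unit_twist z" and v: "v \<le> n_stages" and V: "V = {} \<or> V = {v} \<and> v < n_stages"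
    and \<alpha>: "\<bar>\<alpha>\<bar> \<le> 1" and \<beta>: "0 \<le> \<beta>" "\<beta> \<le> 1"
    and \<eta>: "\<And>p. p \<in> primes_le (real q) \<Longrightarrow> (norm (of_real \<alpha> + z p))\<^sup>2 \<le> \<beta>\<^sup>2 + \<eta> p" "\<And>p. \<eta> p \<ge> 0"
      "(\<Sum>p\<in>primes_le (real q). \<eta> p / real p) \<le> H"
  shows "conv_sqnorm full_modulus (stage_poly \<alpha> V v) (half_twist z) \<le> mean_const * exp H * L powr (\<beta>\<^sup>2) * stage_weight V v"
proof -
  interpret unit_twist z by (rule z)
  define P0 where "P0 = primes_le (real q) - (\<Union>r\<in>{v..<n_stages}. stage r)"
  note sp = primes_split[OF v, folded P0_def]
  define E where "E = max_exponent"
  define D where "D = exp (4 * exp 4 :: real)"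
  define e where "e = (\<lambda>r. \<Sum>p\<in>stage r. (norm (of_real \<alpha> + z p))\<^sup>2 / real p + 2 * exp 2 / (real p)\<^sup>2)"
  define m where "m = (\<lambda>r. if r \<in> V then exp (8 * exp 4) / 4 ^ threshold r else (1::real))"
  have e0: "e r \<ge> 0" for r unfolding e_def by (intro sum_nonneg) auto
  have mult: "conv_sqnorm full_modulus (stage_poly \<alpha> V v) (half_twist z) =
    conv_sqnorm (prime_power_prod E P0) (multi_coeff {} stage (stage_coeff threshold \<alpha> V)) (half_twist z) *
      (\<Prod>r\<in>{v..<n_stages}. conv_sqnorm (prime_power_prod E (stage r)) (range_coeff (stage_coeff threshold \<alpha> V r) (stage r)) (half_twist z))"
    unfolding full_modulus_def stage_poly_def E_def[symmetric]
    apply (subst sp(1))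
    apply (rule conv_sqnorm_multi_coeff)
    using sp stage_disjoint prime_stage finite_stage half_twist_mult z_mult by auto
  \<comment> \<open>The factor 2 of the crude bound doubles \<open>53 + 4 * v\<close>.\<close>
  have b0: "conv_sqnorm (prime_power_prod E P0) (multi_coeff {} stage (stage_coeff threshold \<alpha> V)) (half_twist z) \<le> exp (106 + 8 * real v)"
  proof -
    have "conv_sqnorm (prime_power_prod E P0) (multi_coeff {} stage (stage_coeff threshold \<alpha> V)) (half_twist z) =
      conv_sqnorm (prime_power_prod E P0) (range_coeff (\<lambda>k. 0 ^ k) P0) (half_twist z)"
      using multi_coeff_empty_eq_range_coeff[OF sp(2,3)] by (intro conv_sqnorm_cong) auto
    also have "\<dots> \<le> exp (2 * exp (2 * 0) * (\<Sum>p\<in>P0. 1 / real p))"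
      by (rule conv_sqnorm_range_crude[OF sp(2,3)]) auto
    also have "\<dots> \<le> exp (106 + 8 * real v)"
      using sum_outside_le[OF v] by (simp add: P0_def)
    finally show ?thesis .
  qed
  have br: "conv_sqnorm (prime_power_prod E (stage r)) (range_coeff (stage_coeff threshold \<alpha> V r) (stage r)) (half_twist z)
     \<le> exp (e r + 2 * D * (1/2) ^ (r + 1)) * m r" for r
  proof (cases "r \<in> V")
    case True
    then have sc: "stage_coeff threshold \<alpha> V r = monomial_coeff (threshold r)" by (simp add: stage_coeff_def fun_eq_iff)
    have "conv_sqnorm (prime_power_prod E (stage r)) (range_coeff (monomial_coeff (threshold r)) (stage r)) (half_twist z)
       \<le> ((1/2) ^ threshold r)\<^sup>2 * exp (2 * exp (2 * 2) * (\<Sum>p\<in>stage r. 1 / real p))"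
      using prime_stage by (intro conv_sqnorm_range_abs finite_stage norm_monomial_coeff_le) auto
    also have "\<dots> \<le> ((1/2) ^ threshold r)\<^sup>2 * exp (8 * exp 4)"
      using sum_stage_le[of r] by (intro mult_left_mono) auto
    also have "((1/2::real) ^ threshold r)\<^sup>2 = 1 / 4 ^ threshold r"
    proof -
      have "((1/2::real) ^ threshold r)\<^sup>2 = ((1/2)\<^sup>2) ^ threshold r"
        by (simp only: power_mult[symmetric] mult.commute)
      then show ?thesis by (simp add: power_divide)
    qed
    also have "1 / 4 ^ threshold r * exp (8 * exp 4) = 1 * m r" using True by (simp add: m_def)
    also have "\<dots> \<le> exp (e r + 2 * D * (1/2) ^ (r + 1)) * m r"
      using e0[of r] by (intro mult_right_mono) (auto simp: D_def m_def)
    finally show ?thesis unfolding sc .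
  next
    case False
    then have sc: "stage_coeff threshold \<alpha> V r = (\<lambda>k. if k \<le> 10 * threshold r then of_real \<alpha> ^ k else 0)"
      by (simp add: stage_coeff_def trunc_exp_coeff_def fun_eq_iff)
    define x where "x = exp (exp 4 * (\<Sum>p\<in>stage r. 1 / real p)) / 2 ^ (10 * threshold r)"
    have "exp (exp 4 * (\<Sum>p\<in>stage r. 1 / real p)) \<le> D"
      unfolding D_def using sum_stage_le[of r] by (simp add: mult.commute)
    \<comment> \<open>Of the available \<open>2 ^ (80 * (r + 1))\<close> only as much is kept as
      makes the errors summable over \<open>r\<close>.\<close>
    moreover have "(1::real) / 2 ^ (10 * threshold r) \<le> 1 / 2 ^ (r + 1)"
      by (intro divide_left_mono power_increasing) (auto simp: threshold_def)
    ultimately have "exp (exp 4 * (\<Sum>p\<in>stage r. 1 / real p)) * (1 / 2 ^ (10 * threshold r)) \<le> D * (1 / 2 ^ (r + 1))"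
      by (intro mult_mono) (auto simp: D_def)
    then have x: "0 \<le> x" "x \<le> D * (1/2) ^ (r + 1)" by (auto simp: x_def power_divide)
    have "conv_sqnorm (prime_power_prod E (stage r)) (range_coeff (\<lambda>k. if k \<le> 10 * threshold r then of_real \<alpha> ^ k else 0) (stage r)) (half_twist z)
       \<le> exp (e r) * (1 + x)\<^sup>2"
      unfolding e_def x_def using prime_stage \<alpha> by (intro conv_sqnorm_range_truncated finite_stage) auto
    also have "(1 + x)\<^sup>2 \<le> (exp x)\<^sup>2" using x exp_ge_add_one_self[of x] by (intro power_mono) auto
    also have "(exp x)\<^sup>2 = exp (2 * x)" by (simp add: exp_double)
    also have "\<dots> \<le> exp (2 * D * (1/2) ^ (r + 1))" using x by simp
    finally show ?thesis unfolding sc using False by (simp add: m_def exp_add)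
  qed
  have se: "(\<Sum>r\<in>{v..<n_stages}. e r) \<le> \<beta>\<^sup>2 * ln L + 5 + H + 4 * exp 2"
  proof -
    have "(\<Sum>r\<in>{v..<n_stages}. e r) = (\<Sum>p\<in>(\<Union>r\<in>{v..<n_stages}. stage r). (norm (of_real \<alpha> + z p))\<^sup>2 / real p + 2 * exp 2 / (real p)\<^sup>2)"
      unfolding e_def by (rule sum.UNION_disjoint[symmetric]) (use finite_stage stage_disjoint in auto)
    also have "\<dots> \<le> (\<Sum>p\<in>primes_le (real q). (norm (of_real \<alpha> + z p))\<^sup>2 / real p + 2 * exp 2 / (real p)\<^sup>2)"
      by (rule sum_mono2[OF finite_primes_le]) (use sp(1) in auto)
    also have "\<dots> \<le> (\<Sum>p\<in>primes_le (real q). \<beta>\<^sup>2 * (1 / real p) + \<eta> p / real p + 2 * exp 2 * (1 / (real p)\<^sup>2))"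
    proof (intro sum_mono)
      fix p assume "p \<in> primes_le (real q)"
      then have "(norm (of_real \<alpha> + z p))\<^sup>2 / real p \<le> (\<beta>\<^sup>2 + \<eta> p) / real p"
        by (intro divide_right_mono \<eta>) auto
      then show "(norm (of_real \<alpha> + z p))\<^sup>2 / real p + 2 * exp 2 / (real p)\<^sup>2 \<le> \<beta>\<^sup>2 * (1 / real p) + \<eta> p / real p + 2 * exp 2 * (1 / (real p)\<^sup>2)"
        by (simp add: add_divide_distrib)
    qed
    also have "\<dots> = \<beta>\<^sup>2 * (\<Sum>p\<in>primes_le (real q). 1 / real p) + (\<Sum>p\<in>primes_le (real q). \<eta> p / real p) + 2 * exp 2 * (\<Sum>p\<in>primes_le (real q). 1 / (real p)\<^sup>2)"
      by (simp only: sum.distrib sum_distrib_left)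
    also have "\<dots> \<le> \<beta>\<^sup>2 * (ln L + 5) + H + 2 * exp 2 * 2"
    proof (intro add_mono mult_left_mono \<eta>)
      show "(\<Sum>p\<in>primes_le (real q). 1 / real p) \<le> ln L + 5"
        unfolding L_def using q_gt_3 by (intro sum_inverse_primes_le) auto
      show "(\<Sum>p\<in>primes_le (real q). 1 / (real p)\<^sup>2) \<le> 2"
        by (rule sum_inverse_square_le[OF finite_primes_le]) (auto simp: primes_le_def)
    qed auto
    also have "\<beta>\<^sup>2 * (ln L + 5) \<le> \<beta>\<^sup>2 * ln L + 5"
      using \<beta> by (simp add: distrib_left power_le_one)
    finally show ?thesis by simp
  qed
  have sg: "(\<Sum>r\<in>{v..<n_stages}. 2 * D * (1/2) ^ (r + 1)) \<le> 2 * D"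
  proof -
    have "(\<Sum>r\<in>{v..<n_stages}. 2 * D * (1/2) ^ (r + 1)) \<le> (\<Sum>r<n_stages. 2 * D * (1/2) ^ (r + 1))"
      by (intro sum_mono2) (auto simp: D_def)
    also have "\<dots> = 2 * D * (\<Sum>r<n_stages. (1/2) ^ (r + 1))" by (simp only: sum_distrib_left)
    also have "\<dots> \<le> 2 * D * 1" by (intro mult_left_mono sum_geometric_le) (auto simp: D_def)
    finally show ?thesis by simp
  qed
  have pm: "(\<Prod>r\<in>{v..<n_stages}. m r) \<le> exp (8 * exp 4) * (if V = {} then 1 else 1 / 4 ^ threshold v)"
  proof (cases "V = {}")
    case False
    then have V': "V = {v}" "v < n_stages" using V by auto
    then have "{v..<n_stages} = insert v {Suc v..<n_stages}" by auto
    moreover have "(\<Prod>r\<in>{Suc v..<n_stages}. m r) = 1" using V' by (intro prod.neutral) (auto simp: m_def)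
    ultimately show ?thesis using V' by (simp add: m_def)
  qed (simp add: m_def)
  have "(\<Prod>r\<in>{v..<n_stages}. conv_sqnorm (prime_power_prod E (stage r)) (range_coeff (stage_coeff threshold \<alpha> V r) (stage r)) (half_twist z))
     \<le> (\<Prod>r\<in>{v..<n_stages}. exp (e r + 2 * D * (1/2) ^ (r + 1)) * m r)"
    by (intro prod_mono conjI conv_sqnorm_nonneg br)
  also have "\<dots> = exp ((\<Sum>r\<in>{v..<n_stages}. e r) + (\<Sum>r\<in>{v..<n_stages}. 2 * D * (1/2) ^ (r + 1))) * (\<Prod>r\<in>{v..<n_stages}. m r)"
    by (simp only: prod.distrib sum.distrib[symmetric] exp_sum[OF finite_atLeastLessThan])
  also have "\<dots> \<le> exp ((\<beta>\<^sup>2 * ln L + 5 + H + 4 * exp 2) + 2 * D) * (exp (8 * exp 4) * (if V = {} then 1 else 1 / 4 ^ threshold v))"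
    using se sg pm by (intro mult_mono) (auto intro!: prod_nonneg simp: m_def)
  finally have pr: "(\<Prod>r\<in>{v..<n_stages}. conv_sqnorm (prime_power_prod E (stage r)) (range_coeff (stage_coeff threshold \<alpha> V r) (stage r)) (half_twist z)) \<le> \<dots>" .
  have "conv_sqnorm full_modulus (stage_poly \<alpha> V v) (half_twist z) \<le>
    exp (106 + 8 * real v) * (exp ((\<beta>\<^sup>2 * ln L + 5 + H + 4 * exp 2) + 2 * D) * (exp (8 * exp 4) * (if V = {} then 1 else 1 / 4 ^ threshold v)))"
    unfolding mult by (intro mult_mono b0 pr prod_nonneg conv_sqnorm_nonneg) auto
  also have "\<dots> = mean_const * exp H * L powr (\<beta>\<^sup>2) * stage_weight V v"
  proof -
    have "L powr (\<beta>\<^sup>2) = exp (\<beta>\<^sup>2 * ln L)" using L_ge by (simp add: powr_def)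
    then have "mean_const * exp H * L powr (\<beta>\<^sup>2) * exp (8 * real v) =
      exp (106 + 8 * real v) * (exp ((\<beta>\<^sup>2 * ln L + 5 + H + 4 * exp 2) + 2 * D) * exp (8 * exp 4))"
      unfolding mean_const_def D_def by (simp only: exp_add[symmetric]) (simp add: algebra_simps)
    then show ?thesis unfolding stage_weight_def by (simp only: mult.assoc[symmetric])
  qed
  finally show ?thesis .
qed

text \<open>Since \<open>4 * exp 8 \<le> 4 ^ 8\<close>, the gain outweighs the loss by a geometric
  factor.\<close>

lemma sum_stage_weight_le: "(\<Sum>v<n_stages. stage_weight {v} v) \<le> 1"
proof -
  have "stage_weight {v} v \<le> (1/4) ^ (v + 1)" for v
  proof -
    have "exp (8::real) = exp 1 ^ 8" by (simp flip: exp_of_nat_mult)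
    also have "\<dots> \<le> 3 ^ 8" using exp_le by (intro power_mono) auto
    finally have e8: "exp (8::real) * 4 \<le> 4 ^ 8" by simp
    have "exp (8 * real v) * 4 ^ (v + 1) \<le> exp (8 * real (v + 1)) * 4 ^ (v + 1)" by simp
    also have "\<dots> = (exp 8 * 4) ^ (v + 1)"
    proof -
      have "exp (8 * real (v + 1)) = exp 8 ^ (v + 1)" by (metis exp_of_nat_mult mult.commute)
      then show ?thesis by (simp only: power_mult_distrib)
    qed
    also have "\<dots> \<le> (4 ^ 8) ^ (v + 1)" using e8 by (intro power_mono) auto
    also have "\<dots> = 4 ^ threshold v" by (simp only: threshold_def power_mult)
    finally show ?thesis by (simp add: stage_weight_def power_divide field_simps)
  qed
  then have "(\<Sum>v<n_stages. stage_weight {v} v) \<le> (\<Sum>v<n_stages. (1/4) ^ (v + 1))" by (intro sum_mono)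
  also have "\<dots> \<le> 1" by (rule sum_geometric_le) auto
  finally show ?thesis .
qed

lemma stage_mean_square:
  assumes v: "v \<le> n_stages" and W: "\<And>m. real q powr (7/10) < real m \<Longrightarrow> m < q \<Longrightarrow> W m = 0"
  shows "(\<Sum>X | dirichlet_char q X. (norm ((\<Sum>m\<in>{0<..<q}. half_twist W m * X (int m)) *
      (\<Prod>r\<in>{v..<n_stages}. poly_eval max_exponent (stage_coeff threshold \<alpha> V r) (\<Sum>p\<in>stage r. X (int p) / of_real (sqrt (real p))))))\<^sup>2)
    \<le> real (totient q) * conv_sqnorm full_modulus (stage_poly \<alpha> V v) (half_twist W)"
proof -
  have "(\<Sum>X | dirichlet_char q X. (norm ((\<Sum>m\<in>{0<..<q}. half_twist W m * X (int m)) *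
      (\<Prod>r\<in>{v..<n_stages}. poly_eval max_exponent (stage_coeff threshold \<alpha> V r) (\<Sum>p\<in>stage r. X (int p) / of_real (sqrt (real p))))))\<^sup>2) =
    (\<Sum>X | dirichlet_char q X. (norm ((\<Sum>m\<in>{0<..<q}. half_twist W m * X (int m)) * (\<Sum>h | h dvd full_modulus. stage_poly \<alpha> V v h * X (int h))))\<^sup>2)"
  proof (intro sum.cong refl)
    fix X assume "X \<in> {X. dirichlet_char q X}"
    then have X: "dirichlet_char q X" by simp
    have "(\<Sum>h | h dvd full_modulus. stage_poly \<alpha> V v h * X (int h)) =
      (\<Prod>r\<in>{v..<n_stages}. poly_eval max_exponent (stage_coeff threshold \<alpha> V r) (\<Sum>p\<in>stage r. X (int p) / of_real (sqrt (real p))))"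
      using dirichlet_char_1[OF X] by (intro eval_stage_poly[OF v]) (auto simp: dirichlet_char_mult[OF X])
    then show "(norm ((\<Sum>m\<in>{0<..<q}. half_twist W m * X (int m)) *
      (\<Prod>r\<in>{v..<n_stages}. poly_eval max_exponent (stage_coeff threshold \<alpha> V r) (\<Sum>p\<in>stage r. X (int p) / of_real (sqrt (real p))))))\<^sup>2 =
      (norm ((\<Sum>m\<in>{0<..<q}. half_twist W m * X (int m)) * (\<Sum>h | h dvd full_modulus. stage_poly \<alpha> V v h * X (int h))))\<^sup>2" by simp
  qed
  also have "\<dots> \<le> real (totient q) * conv_sqnorm full_modulus (stage_poly \<alpha> V v) (half_twist W)"
  proof (rule character_mean_square[OF q_gt_1 _ full_modulus_pos dvd_full_modulus])
    fix h m assume hm: "0 < h" "0 < m" "m < q" "stage_poly \<alpha> V v h \<noteq> 0" "half_twist W m \<noteq> 0"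
    have "W m \<noteq> 0" using hm by (auto simp: half_twist_def)
    then have m: "real m \<le> real q powr (7/10)" using W[of m] hm by force
    \<comment> \<open>The exponents 1/5 and 7/10 add up to 9/10, so the product stays below
      \<open>q\<close>.\<close>
    have "real h * real m \<le> real q powr (1/5) * real q powr (7/10)"
      using stage_poly_support[OF hm(1,4)] m by (intro mult_mono) auto
    also have "\<dots> = real q powr (9/10)" by (simp flip: powr_add)
    also have "\<dots> < real q powr 1" using q_gt_3 by (intro powr_less_mono) auto
    finally have "real (h * m) < real q" using q_gt_3 by simp
    then show "h * m < q" by (simp only: of_nat_less_iff)
  qed
  finally show ?thesis .
qed

text \<open>For a single twist \<open>exp H\<close> is
  \<open>exp 40 * (1 + \<bar>k\<bar>) ^ 48\<close>, hence the power 24 after taking roots.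
  Coefficients of order \<open>1 / (1 + \<bar>k\<bar>) ^ 26\<close> leave the summable
  \<open>1 / (1 + \<bar>k\<bar>) ^ 2\<close>.\<close>

lemma stage_mean_mollified:
  assumes v: "v \<le> n_stages" and V: "V = {} \<or> V = {v} \<and> v < n_stages" and \<beta>: "0 < \<beta>" "\<beta> < 1"
    and d: "\<And>m. m > 0 \<Longrightarrow> ((\<lambda>k. d k * cis (- (of_int k * ln (real m) / ln (real q)))) has_sum W m) UNIV"
      "\<And>k. norm (d k) \<le> C0 / (1 + \<bar>of_int k\<bar>) ^ 26"
    and Z: "((\<lambda>k::int. 1 / (1 + \<bar>real_of_int k\<bar>) ^ 2) has_sum Z) UNIV"
  shows "conv_sqnorm full_modulus (stage_poly (\<beta> - 1) V v) (half_twist W) \<le> (C0 * Z)\<^sup>2 * (mean_const * exp 40) * L powr (\<beta>\<^sup>2) * stage_weight V v"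
proof -
  define z where "z = (\<lambda>(k::int) (m::nat). cis (- (of_int k * ln (real m) / ln (real q))))"
  define F where "F = mean_const * exp 40 * L powr (\<beta>\<^sup>2) * stage_weight V v"
  have F0: "F \<ge> 0" by (simp add: F_def mean_const_def stage_weight_def)
  have C0: "C0 \<ge> 0" using order_trans[OF norm_ge_zero d(2)[of 0]] by simp
  have ut: "unit_twist (z k)" for k
    by unfold_locales (auto simp: z_def cis_mult ln_mult add_divide_distrib distrib_left algebra_simps)
  have b: "sqrt (conv_sqnorm full_modulus (stage_poly (\<beta> - 1) V v) (half_twist (z k))) \<le> sqrt F * (1 + \<bar>of_int k\<bar>) ^ 24" for k
  proof -
    define H where "H = 4 * (10 + 12 * ln (1 + \<bar>real_of_int k\<bar>))"
    have "conv_sqnorm full_modulus (stage_poly (\<beta> - 1) V v) (half_twist (z k)) \<le> mean_const * exp H * L powr (\<beta>\<^sup>2) * stage_weight V v"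
    proof (rule conv_sqnorm_stage_poly[OF ut v V, where \<eta> = "\<lambda>p. 4 * norm (z k p - 1)"])
      show "(norm (of_real (\<beta> - 1) + z k p))\<^sup>2 \<le> \<beta>\<^sup>2 + 4 * norm (z k p - 1)" for p
        using \<beta> by (intro norm_shift_square_le) (auto simp: z_def)
      have "(\<Sum>p\<in>primes_le (real q). 4 * norm (z k p - 1) / real p) = 4 * (\<Sum>p\<in>primes_le (real q). norm (z k p - 1) / real p)"
        by (simp add: sum_distrib_left)
      also have "\<dots> \<le> H"
        unfolding H_def z_def using q_gt_3 by (intro mult_left_mono sum_primes_cis_diff_one_le) auto
      finally show "(\<Sum>p\<in>primes_le (real q). 4 * norm (z k p - 1) / real p) \<le> H" .
    qed (use \<beta> in auto)
    also have "exp H = exp 40 * ((1 + \<bar>real_of_int k\<bar>) ^ 24)\<^sup>2"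
    proof -
      have "exp H = exp (40 + 48 * ln (1 + \<bar>real_of_int k\<bar>))" by (simp add: H_def algebra_simps)
      also have "\<dots> = exp 40 * exp (ln (1 + \<bar>real_of_int k\<bar>)) ^ 48" using exp_of_nat_mult[of 48 "ln (1 + \<bar>real_of_int k\<bar>)"] by (simp add: exp_add)
      also have "exp (ln (1 + \<bar>real_of_int k\<bar>)) = 1 + \<bar>real_of_int k\<bar>" by (simp add: add_pos_nonneg)
      finally show ?thesis by (simp flip: power_mult)
    qed
    finally have "conv_sqnorm full_modulus (stage_poly (\<beta> - 1) V v) (half_twist (z k)) \<le> F * ((1 + \<bar>real_of_int k\<bar>) ^ 24)\<^sup>2"
      by (simp add: F_def mult_ac)
    then have "sqrt (conv_sqnorm full_modulus (stage_poly (\<beta> - 1) V v) (half_twist (z k))) \<le> sqrt (F * ((1 + \<bar>real_of_int k\<bar>) ^ 24)\<^sup>2)"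
      by simp
    then show ?thesis unfolding real_sqrt_mult real_sqrt_abs by simp
  qed
  have le: "norm (d k) * (sqrt F * (1 + \<bar>of_int k\<bar>) ^ 24) \<le> (sqrt F * C0) * (1 / (1 + \<bar>real_of_int k\<bar>) ^ 2)" for k
  proof -
    define t where "t = 1 + \<bar>real_of_int k\<bar>"
    have t: "t > 0" by (simp add: t_def add_pos_nonneg)
    have "norm (d k) * (sqrt F * t ^ 24) \<le> C0 / t ^ 26 * (sqrt F * t ^ 24)"
      using d(2)[of k] t F0 by (intro mult_right_mono) (auto simp: t_def)
    also have "t ^ 26 = t ^ 24 * t ^ 2" by (simp flip: power_add)
    also have "C0 / (t ^ 24 * t ^ 2) * (sqrt F * t ^ 24) = (sqrt F * C0) * (1 / t ^ 2)"
    proof -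
      have "C0 / (a * b) * (c * a) = (c * C0) * (1 / b)" if "a \<noteq> 0" for a b c :: real using that by simp
      then show ?thesis using t by (metis less_irrefl zero_less_power)
    qed
    finally show ?thesis by (simp add: t_def)
  qed
  have Zs: "((\<lambda>k::int. (sqrt F * C0) * (1 / (1 + \<bar>real_of_int k\<bar>) ^ 2)) has_sum (sqrt F * C0) * Z) UNIV"
    using Z by (rule has_sum_cmult_right)
  have "(\<lambda>k. norm (d k) * (sqrt F * (1 + \<bar>of_int k\<bar>) ^ 24)) summable_on UNIV"
    by (rule summable_on_comparison_test[OF has_sum_imp_summable[OF Zs]]) (use le F0 in auto)
  then obtain S where S: "((\<lambda>k. norm (d k) * (sqrt F * (1 + \<bar>of_int k\<bar>) ^ 24)) has_sum S) UNIV"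
    by (auto simp: summable_on_def)
  have "S \<le> (sqrt F * C0) * Z" by (rule has_sum_mono[OF S Zs le])
  moreover have "sqrt (conv_sqnorm full_modulus (stage_poly (\<beta> - 1) V v) (half_twist W)) \<le> S"
    by (rule sqrt_conv_sqnorm_series[OF full_modulus_pos _ b S]) (use d(1) in \<open>auto simp: z_def\<close>)
  ultimately have "sqrt (conv_sqnorm full_modulus (stage_poly (\<beta> - 1) V v) (half_twist W)) \<le> sqrt F * C0 * Z" by linarith
  then have "(sqrt (conv_sqnorm full_modulus (stage_poly (\<beta> - 1) V v) (half_twist W)))\<^sup>2 \<le> (sqrt F * C0 * Z)\<^sup>2"
    by (intro power_mono) (auto simp: conv_sqnorm_nonneg)
  then show ?thesis using F0 by (simp add: conv_sqnorm_nonneg power_mult_distrib F_def mult_ac)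
qed

lemma unit_twist_delta: "unit_twist (\<lambda>m. if m = 1 then 1 else 0)"
  by unfold_locales auto

text \<open>The indicator of 1 is completely multiplicative and vanishes at primes, so the exponent
  \<beta> gives exactly \<open>\<beta>\<^sup>2\<close> with no excess. This is the mean square of
  the exponential polynomial alone.\<close>

lemma stage_mean_plain:
  assumes v: "v \<le> n_stages" and V: "V = {} \<or> V = {v} \<and> v < n_stages" and \<beta>: "0 < \<beta>" "\<beta> < 1"
  shows "conv_sqnorm full_modulus (stage_poly \<beta> V v) (half_twist (\<lambda>m. if m = 1 then 1 else 0)) \<le> mean_const * L powr (\<beta>\<^sup>2) * stage_weight V v"
proof -
  have "conv_sqnorm full_modulus (stage_poly \<beta> V v) (half_twist (\<lambda>m. if m = 1 then 1 else 0)) \<le> mean_const * exp 0 * L powr (\<beta>\<^sup>2) * stage_weight V v"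
    by (rule conv_sqnorm_stage_poly[OF unit_twist_delta v V, where \<eta> = "\<lambda>p. 0"]) (use \<beta> in \<open>auto simp: primes_le_def\<close>)
  then show ?thesis by simp
qed

text \<open>The weights of the exceptional stages sum to at most 1, so together they cost no more
  than the regular case; this is the factor 2. The factor \<open>exp 4\<close> is the accumulated
  truncation loss.\<close>

theorem short_polynomial_moment:
  assumes \<beta>: "0 < \<beta>" "\<beta> < 1"
    and W: "\<And>m. real q powr (7/10) < real m \<Longrightarrow> m < q \<Longrightarrow> W m = 0"
    and d: "\<And>m. m > 0 \<Longrightarrow> ((\<lambda>k. d k * cis (- (of_int k * ln (real m) / ln (real q)))) has_sum W m) UNIV"
      "\<And>k. norm (d k) \<le> C0 / (1 + \<bar>of_int k\<bar>) ^ 26"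
    and Z: "((\<lambda>k::int. 1 / (1 + \<bar>real_of_int k\<bar>) ^ 2) has_sum Z) UNIV"
  shows "(\<Sum>X | dirichlet_char q X. norm (\<Sum>m\<in>{0<..<q}. half_twist W m * X (int m)) powr (2 * \<beta>))
    \<le> real (totient q) * (2 * exp 4 * mean_const * ((C0 * Z)\<^sup>2 * exp 40 + 1)) * ln (real q) powr (\<beta>\<^sup>2)"
proof -
  define S where "S = (\<lambda>X. \<Sum>m\<in>{0<..<q}. half_twist W m * X (int m))"
  define P where "P = (\<lambda>X r. \<Sum>p\<in>stage r. X (int p) / of_real (sqrt (real p)) :: complex)"
  define D where "D = {X. dirichlet_char q X}"
  define G where "G = real (totient q) * (mean_const * ((C0 * Z)\<^sup>2 * exp 40 + 1)) * L powr (\<beta>\<^sup>2)"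
  have G0: "G \<ge> 0" by (simp add: G_def mean_const_def)
  define st where "st = (\<lambda>X V v. stage_term max_exponent threshold (P X) (norm (S X)) \<beta> V {v..<n_stages})"
  have mean: "(\<Sum>X\<in>D. st X V v) \<le> G * stage_weight V v"
    if v: "v \<le> n_stages" and V: "V = {} \<or> V = {v} \<and> v < n_stages" for V v
  proof -
    define ev where "ev = (\<lambda>\<alpha> X. \<Prod>r\<in>{v..<n_stages}. poly_eval max_exponent (stage_coeff threshold \<alpha> V r) (P X r))"
    have "(\<Sum>X\<in>D. st X V v) = (\<Sum>X\<in>D. (norm (S X * ev (\<beta> - 1) X))\<^sup>2) + (\<Sum>X\<in>D. (norm (ev \<beta> X))\<^sup>2)"
      by (simp add: st_def stage_term_def ev_def sum.distrib norm_mult)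
    also have "(\<Sum>X\<in>D. (norm (S X * ev (\<beta> - 1) X))\<^sup>2) \<le> real (totient q) * ((C0 * Z)\<^sup>2 * (mean_const * exp 40) * L powr (\<beta>\<^sup>2) * stage_weight V v)"
    proof -
      have "(\<Sum>X\<in>D. (norm (S X * ev (\<beta> - 1) X))\<^sup>2) \<le> real (totient q) * conv_sqnorm full_modulus (stage_poly (\<beta> - 1) V v) (half_twist W)"
        unfolding D_def S_def ev_def P_def by (rule stage_mean_square[OF v W])
      also have "\<dots> \<le> real (totient q) * ((C0 * Z)\<^sup>2 * (mean_const * exp 40) * L powr (\<beta>\<^sup>2) * stage_weight V v)"
        by (intro mult_left_mono stage_mean_mollified[OF v V \<beta> d Z]) auto
      finally show ?thesis .
    qed
    also have "(\<Sum>X\<in>D. (norm (ev \<beta> X))\<^sup>2) \<le> real (totient q) * (mean_const * L powr (\<beta>\<^sup>2) * stage_weight V v)"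
    proof -
      have one: "(\<Sum>m\<in>{0<..<q}. half_twist (\<lambda>m. if m = 1 then 1 else 0) m * X (int m)) = 1" if "X \<in> D" for X
      proof -
        have "(\<Sum>m\<in>{0<..<q}. half_twist (\<lambda>m. if m = 1 then 1 else 0) m * X (int m)) = (\<Sum>m\<in>{0<..<q}. if m = 1 then 1 else 0)"
          using that dirichlet_char_1 by (intro sum.cong refl) (auto simp: half_twist_def D_def)
        then show ?thesis using q_gt_1 by simp
      qed
      have "(\<Sum>X\<in>D. (norm (ev \<beta> X))\<^sup>2) = (\<Sum>X\<in>D. (norm ((\<Sum>m\<in>{0<..<q}. half_twist (\<lambda>m. if m = 1 then 1 else 0) m * X (int m)) * ev \<beta> X))\<^sup>2)"
        by (intro sum.cong refl) (simp add: one del: One_nat_def)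
      also have "\<dots> \<le> real (totient q) * conv_sqnorm full_modulus (stage_poly \<beta> V v) (half_twist (\<lambda>m. if m = 1 then 1 else 0))"
        unfolding D_def ev_def P_def
      proof (rule stage_mean_square[OF v])
        fix m assume m: "real q powr (7/10) < real m"
        have "1 \<le> real q powr (7/10)" using q_gt_3 by (intro ge_one_powr_ge_zero) auto
        then show "(if m = 1 then 1 else 0 :: complex) = 0" using m by auto
      qed
      also have "\<dots> \<le> real (totient q) * (mean_const * L powr (\<beta>\<^sup>2) * stage_weight V v)"
        by (intro mult_left_mono stage_mean_plain[OF v V \<beta>]) auto
      finally show ?thesis .
    qed
    finally show ?thesis by (simp add: G_def algebra_simps)
  qed
  have c4: "(\<Sum>r<n_stages. 4 / 4 ^ threshold r) \<le> (4::real)"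
  proof -
    have "(\<Sum>r<n_stages. 4 / 4 ^ threshold r) \<le> (\<Sum>r<n_stages. 4 * (1/4) ^ (r + 1) :: real)"
    proof (intro sum_mono)
      fix r
      have "(4::real) ^ (r + 1) \<le> 4 ^ threshold r" by (intro power_increasing) (auto simp: threshold_def)
      then have "(4::real) / 4 ^ threshold r \<le> 4 / 4 ^ (r + 1)" by (intro divide_left_mono) auto
      then show "(4::real) / 4 ^ threshold r \<le> 4 * (1/4) ^ (r + 1)" by (simp add: power_divide)
    qed
    also have "\<dots> = 4 * (\<Sum>r<n_stages. (1/4) ^ (r + 1))" by (simp only: sum_distrib_left)
    also have "\<dots> \<le> 4 * 1" by (intro mult_left_mono sum_geometric_le) auto
    finally show ?thesis by simp
  qed
  have "(\<Sum>X\<in>D. norm (S X) powr (2 * \<beta>)) \<le> (\<Sum>X\<in>D. exp 4 * (st X {} 0 + (\<Sum>v<n_stages. st X {v} v)))"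
    unfolding st_def
    by (intro sum_mono powr_le_stages[OF _ \<beta> _ _ c4]) (auto simp: threshold_def max_exponent_def)
  also have "\<dots> = exp 4 * ((\<Sum>X\<in>D. st X {} 0) + (\<Sum>v<n_stages. \<Sum>X\<in>D. st X {v} v))"
    by (simp add: sum_distrib_left[symmetric] sum.distrib sum.swap[of _ "{..<n_stages}" D])
  also have "\<dots> \<le> exp 4 * (G * stage_weight {} 0 + (\<Sum>v<n_stages. G * stage_weight {v} v))"
    by (intro mult_left_mono add_mono sum_mono mean) auto
  also have "\<dots> = exp 4 * (G * (1 + (\<Sum>v<n_stages. stage_weight {v} v)))"
  proof -
    have "(\<Sum>v<n_stages. G * stage_weight {v} v) = G * (\<Sum>v<n_stages. stage_weight {v} v)"
      by (simp only: sum_distrib_left)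
    moreover have "stage_weight {} 0 = 1" by (simp add: stage_weight_def)
    ultimately show ?thesis by (simp add: distrib_left)
  qed
  also have "\<dots> \<le> exp 4 * (G * (1 + 1))"
    using G0 sum_stage_weight_le by (intro mult_left_mono add_mono) auto
  finally show ?thesis by (simp add: S_def D_def G_def L_def mult_ac)
qed

end

section \<open>Theta series and the analytic continuation\<close>

lemma has_sum_int_even:
  fixes F :: "int \<Rightarrow> complex"
  assumes even: "\<And>n. F (- n) = F n" and F0: "F 0 = 0"
    and summ: "summable (\<lambda>n. norm (F (int (Suc n))))"
  shows "(F has_sum 2 * (\<Sum>n. F (int (Suc n)))) UNIV"
proof -
  define S where "S = (\<Sum>n. F (int (Suc n)))"
  have "((\<lambda>n. F (int (Suc n))) has_sum S) UNIV"
    unfolding S_def by (rule norm_summable_imp_has_sum[OF summ summable_sums[OF summable_norm_cancel[OF summ]]])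
  then have nat: "((F \<circ> (\<lambda>n. int (Suc n))) has_sum S) UNIV" by (simp add: o_def)
  then have "((F \<circ> (\<lambda>n. - int (Suc n))) has_sum S) UNIV" by (simp only: o_def even)
  then have neg: "(F has_sum S) (range (\<lambda>n. - int (Suc n)))"
    by (subst has_sum_reindex) (auto simp: inj_def)
  have pos: "(F has_sum S) (range (\<lambda>n. int (Suc n)))"
    using nat by (subst has_sum_reindex) (auto simp: inj_def)
  have "(F has_sum (S + S)) (range (\<lambda>n. int (Suc n)) \<union> range (\<lambda>n. - int (Suc n)))"
    by (rule has_sum_Un_disjoint[OF pos neg]) auto
  then have "(F has_sum (S + S)) UNIV"
  proof (rule has_sum_cong_neutral[THEN iffD1, rotated -1])
    fix n :: int assume n: "n \<in> UNIV - (range (\<lambda>n. int (Suc n)) \<union> range (\<lambda>n. - int (Suc n)))"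
    have "n = 0"
    proof (rule ccontr)
      assume "n \<noteq> 0"
      then consider "n > 0" | "n < 0" by linarith
      then show False
      proof cases
        case 1
        then have "n = int (Suc (nat n - 1))" by simp
        then show False using n by blast
      next
        case 2
        then have "n = - int (Suc (nat (- n) - 1))" by simp
        then show False using n by blast
      qed
    qed
    then show "F n = 0" using F0 by simp
  qed auto
  then show ?thesis by (simp add: S_def)
qed

lemma integrable_exp_minus_abs: "integrable lborel (\<lambda>u::real. exp (- \<bar>u\<bar>))"
proof -
  have "(\<lambda>x. exp (- 1 * x) :: real) absolutely_integrable_on {0..}"
    by (rule nonnegative_absolutely_integrable_1[OF integrable_on_exp_minus_to_infinity]) auto
  then have "integrable lebesgue (\<lambda>x::real. indicat_real {0..} x *\<^sub>R exp (- 1 * x))"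
    unfolding set_integrable_def .
  then have 1: "integrable lborel (\<lambda>x::real. indicat_real {0..} x *\<^sub>R exp (- 1 * x))"
    by (subst (asm) integrable_completion) auto
  have 2: "integrable lborel (\<lambda>x::real. indicat_real {0..} (0 + (-1) * x) *\<^sub>R exp (- 1 * (0 + (-1) * x)))"
    by (rule lborel_integrable_real_affine[OF 1]) simp
  show ?thesis
    by (rule Bochner_Integration.integrable_bound[OF Bochner_Integration.integrable_add[OF 1 2]])
       (auto simp: indicator_def)
qed

text \<open>Euler's integral for \<open>Gamma (s / 2)\<close> under the substitution \<open>t = c * exp (2 * u)\<close>.\<close>

lemma gaussian_mellin:
  fixes s :: complex and c :: real
  assumes c: "c > 0" and s: "Re s > 0"
  shows "integrable lborel (\<lambda>u. exp (s * of_real u) * of_real (exp (- c * exp (2 * u))))"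
    and "integral\<^sup>L lborel (\<lambda>u. exp (s * of_real u) * of_real (exp (- c * exp (2 * u)))) = Gamma (s/2) / 2 * of_real c powr (- s / 2)"
proof -
  define z where "z = s / 2"
  have z: "Re z > 0" using s by (simp add: z_def)
  define f where "f = (\<lambda>t::real. of_real t powr (z - 1) / of_real (exp t) :: complex)"
  define g where "g = (\<lambda>u. c * exp (2 * u))"
  define k where "k = (\<lambda>u. exp (s * of_real u) * of_real (exp (- c * exp (2 * u))))"
  have abs: "f absolutely_integrable_on {0<..}"
    using absolutely_integrable_Gamma_integral[OF z, of 1] by (simp add: f_def)
  have val: "integral {0<..} f = Gamma z"
  proof -
    have "(f has_integral Gamma z) {0..}" using Gamma_integral_complex[OF z] by (simp add: f_def)
    moreover have "(f has_integral Gamma z) {0..} \<longleftrightarrow> (f has_integral Gamma z) {0<..}"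
      by (rule has_integral_spike_set_eq) (auto intro: negligible_subset[of "{0::real}"])
    ultimately have "(f has_integral Gamma z) {0<..}" by simp
    then show ?thesis by (rule integral_unique)
  qed
  have rg: "range g = {0<..}"
  proof (intro equalityI subsetI)
    fix t :: real assume "t \<in> {0<..}"
    then have "g (ln (t / c) / 2) = t" using c by (simp add: g_def)
    then show "t \<in> range g" by (metis rangeI)
  qed (use c in \<open>auto simp: g_def\<close>)
  have dg: "(g has_field_derivative (2 * g u)) (at u within UNIV)" for u
    unfolding g_def by (auto intro!: derivative_eq_intros)
  have ig: "inj_on g UNIV" using c by (auto simp: inj_on_def g_def)
  have gpos: "g u > 0" for u using c by (simp add: g_def)
  \<comment> \<open>The Jacobian \<open>2 * g u\<close> raises the exponent \<open>z - 1\<close> to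
    \<open>z\<close>, which leaves a pure exponential in \<open>u\<close>.\<close>
  have fg: "of_real \<bar>2 * g u\<bar> * f (g u) = (2 * of_real c powr z) * k u" for u
  proof -
    have "of_real (g u) * of_real (g u) powr (z - 1) = of_real (g u) powr z"
      using gpos[of u] by (simp add: powr_diff)
    moreover have "of_real (g u) powr z = of_real c powr z * exp (s * of_real u)"
    proof -
      have "of_real (g u) powr z = exp (z * of_real (ln (g u)))"
        using gpos[of u] by (simp add: powr_def Ln_of_real)
      also have "ln (g u) = ln c + 2 * u" using c by (simp add: g_def ln_mult)
      also have "exp (z * of_real (ln c + 2 * u)) = exp (z * of_real (ln c)) * exp (s * of_real u)"
        by (simp add: z_def distrib_left exp_add)
      also have "exp (z * of_real (ln c)) = of_real c powr z" using c by (simp add: powr_def Ln_of_real)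
      finally show ?thesis .
    qed
    ultimately have "of_real (g u) * of_real (g u) powr (z - 1) = of_real c powr z * exp (s * of_real u)" by simp
    moreover have "of_real \<bar>2 * g u\<bar> * f (g u) = 2 * (of_real (g u) * of_real (g u) powr (z - 1)) * of_real (exp (- g u))"
      using gpos[of u] by (simp add: f_def exp_minus divide_inverse)
    ultimately show ?thesis by (simp add: k_def g_def)
  qed
  have re: "(\<lambda>u. \<bar>2 * g u\<bar> * Re (f (g u))) absolutely_integrable_on UNIV \<and> integral UNIV (\<lambda>u. \<bar>2 * g u\<bar> * Re (f (g u))) = integral {0<..} (\<lambda>t. Re (f t))"
    using has_absolute_integral_change_of_variables_1'[of UNIV g "\<lambda>u. 2 * g u" "\<lambda>t. Re (f t)"] dg ig
      absolutely_integrable_linear[OF abs bounded_linear_Re] unfolding o_def rg by simp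
  have im: "(\<lambda>u. \<bar>2 * g u\<bar> * Im (f (g u))) absolutely_integrable_on UNIV \<and> integral UNIV (\<lambda>u. \<bar>2 * g u\<bar> * Im (f (g u))) = integral {0<..} (\<lambda>t. Im (f t))"
    using has_absolute_integral_change_of_variables_1'[of UNIV g "\<lambda>u. 2 * g u" "\<lambda>t. Im (f t)"] dg ig
      absolutely_integrable_linear[OF abs bounded_linear_Im] unfolding o_def rg by simp
  define G where "G = (\<lambda>u. (2 * of_real c powr z) * k u)"
  have ReG: "Re (G u) = \<bar>2 * g u\<bar> * Re (f (g u))" and ImG: "Im (G u) = \<bar>2 * g u\<bar> * Im (f (g u))" for u
    unfolding G_def fg[symmetric] by simp_all
  have Gabs: "G absolutely_integrable_on UNIV"
  proof -
    have "(\<lambda>u. complex_of_real (Re (G u)) + \<i> * of_real (Im (G u))) absolutely_integrable_on UNIV"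
    proof (rule set_integral_add(1))
      have "(\<lambda>u. Re (G u)) absolutely_integrable_on UNIV" "(\<lambda>u. Im (G u)) absolutely_integrable_on UNIV"
        using re im unfolding ReG ImG by auto
      then show "(\<lambda>u. complex_of_real (Re (G u))) absolutely_integrable_on UNIV"
        "(\<lambda>u. \<i> * complex_of_real (Im (G u))) absolutely_integrable_on UNIV"
        using absolutely_integrable_linear[OF _ bounded_linear_of_real]
          absolutely_integrable_linear[OF _ bounded_linear_compose[OF bounded_linear_mult_right[of \<i>] bounded_linear_of_real]]
        unfolding o_def by blast+
    qed
    then show ?thesis by (simp add: complex_eq[symmetric])
  qed
  have Ghi: "(G has_integral integral UNIV G) UNIV"
    using Gabs by (simp add: set_lebesgue_integral_eq_integral integrable_integral set_lebesgue_integral_eq_integral(1))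
  have Gval: "integral UNIV G = Gamma z"
  proof (rule complex_eqI)
    have fh: "(f has_integral Gamma z) {0<..}"
      using abs val by (metis integrable_integral set_lebesgue_integral_eq_integral(1))
    have "Re (integral UNIV G) = integral UNIV (\<lambda>u. Re (G u))"
      using has_integral_Re[OF Ghi] by (simp add: integral_unique)
    also have "\<dots> = integral {0<..} (\<lambda>t. Re (f t))" using re by (simp add: ReG)
    also have "\<dots> = Re (Gamma z)" using has_integral_Re[OF fh] by (simp add: integral_unique)
    finally show "Re (integral UNIV G) = Re (Gamma z)" .
    have "Im (integral UNIV G) = integral UNIV (\<lambda>u. Im (G u))"
      using has_integral_Im[OF Ghi] by (simp add: integral_unique)
    also have "\<dots> = integral {0<..} (\<lambda>t. Im (f t))" using im by (simp add: ImG)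
    also have "\<dots> = Im (Gamma z)" using has_integral_Im[OF fh] by (simp add: integral_unique)
    finally show "Im (integral UNIV G) = Im (Gamma z)" .
  qed
  have meas: "G \<in> borel_measurable borel"
    unfolding G_def k_def by (intro borel_measurable_continuous_onI continuous_intros)
  have Gint: "integrable lborel G"
  proof -
    have "integrable lebesgue G" using Gabs by (simp add: set_integrable_def)
    then show ?thesis using meas by (subst (asm) integrable_completion) auto
  qed
  have GL: "integral\<^sup>L lborel G = Gamma z"
    using integral_lborel[OF Gint] Gval by simp
  have cz: "2 * of_real c powr z \<noteq> 0" using c by simp
  have keq: "k = (\<lambda>u. inverse (2 * of_real c powr z) * G u)" using cz by (simp add: G_def fun_eq_iff)
  show "integrable lborel (\<lambda>u. exp (s * of_real u) * of_real (exp (- c * exp (2 * u))))"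
    unfolding k_def[symmetric] keq by (rule integrable_mult_right[OF Gint])
  have "integral\<^sup>L lborel k = inverse (2 * of_real c powr z) * Gamma z"
    unfolding keq using GL by (subst Bochner_Integration.integral_mult_right) (auto simp: Gint)
  also have "\<dots> = Gamma (s/2) / 2 * of_real c powr (- s / 2)"
    using c by (simp add: z_def powr_minus field_simps)
  finally show "integral\<^sup>L lborel (\<lambda>u. exp (s * of_real u) * of_real (exp (- c * exp (2 * u)))) = Gamma (s/2) / 2 * of_real c powr (- s / 2)"
    by (simp add: k_def)
qed

lemma has_sum_finite_sum:
  fixes f :: "'i \<Rightarrow> 'a \<Rightarrow> 'b::topological_comm_monoid_add"
  assumes "finite I" "\<And>i. i \<in> I \<Longrightarrow> (f i has_sum s i) A"
  shows "((\<lambda>x. \<Sum>i\<in>I. f i x) has_sum (\<Sum>i\<in>I. s i)) A"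
  using assms by (induction I rule: finite_induct) (auto intro: has_sum_add)

lemma has_sum_residue_classes:
  fixes f :: "int \<Rightarrow> complex"
  assumes q: "q > 0" and s: "\<And>a. a \<in> {0..<int q} \<Longrightarrow> ((\<lambda>m. f (a + int q * m)) has_sum s a) UNIV"
  shows "(f has_sum (\<Sum>a\<in>{0..<int q}. s a)) UNIV"
proof -
  have "((\<lambda>n. if n mod int q = a then f n else 0) has_sum s a) UNIV" if a: "a \<in> {0..<int q}" for a
  proof -
    have inj: "inj (\<lambda>m. a + int q * m)" using q by (auto simp: inj_def)
    have "((\<lambda>n. if n mod int q = a then f n else 0) \<circ> (\<lambda>m. a + int q * m) has_sum s a) UNIV"
      using s[OF a] a by (simp add: o_def)
    then have "((\<lambda>n. if n mod int q = a then f n else 0) has_sum s a) (range (\<lambda>m. a + int q * m))"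
      by (subst has_sum_reindex[OF inj])
    then show ?thesis
    proof (rule has_sum_cong_neutral[THEN iffD1, rotated -1])
      fix n assume n: "n \<in> UNIV - range (\<lambda>m. a + int q * m)"
      have "n mod int q \<noteq> a"
      proof
        assume "n mod int q = a"
        then have "n = a + int q * (n div int q)" using mult_div_mod_eq[of "int q" n] by simp
        then show False using n by blast
      qed
      then show "(if n mod int q = a then f n else 0) = 0" by simp
    qed auto
  qed
  then have "((\<lambda>n. \<Sum>a\<in>{0..<int q}. if n mod int q = a then f n else 0) has_sum (\<Sum>a\<in>{0..<int q}. s a)) UNIV"
    by (intro has_sum_finite_sum) auto
  moreover have "(\<Sum>a\<in>{0..<int q}. if n mod int q = a then f n else 0) = f n" for n
    using q by simp
  ultimately show ?thesis by simp
qed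

section \<open>The theta series of an even primitive character\<close>

locale even_primitive =
  fixes q :: nat and X :: "int \<Rightarrow> complex"
  assumes q: "q > 1" and prim: "primitive_char q X" and even: "even_char X"
begin

lemma X: "dirichlet_char q X"
  using prim by (simp add: primitive_char_def)

lemma X_minus: "X (- n) = X n"
  using dirichlet_char_mult[OF X, of "-1" n] even by (simp add: even_char_def)

lemma X_0: "X 0 = 0"
  using dirichlet_char_eq_0_iff[OF X, of 0] q by simp

lemma norm_X_le: "norm (X n) \<le> 1"
  using norm_dirichlet_char[OF X, of n] q by auto

definition theta_term :: "real \<Rightarrow> nat \<Rightarrow> complex" where
  "theta_term u n = X (int (Suc n)) * of_real (exp (- pi * (real (Suc n))\<^sup>2 * exp (2 * u) / real q))"

definition theta :: "real \<Rightarrow> complex" where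
  "theta u = (\<Sum>n. theta_term u n)"

text \<open>Replacing the square of \<open>n + 1\<close> by its first power gives a geometric
  majorant, uniform for \<open>u \<ge> a\<close>.\<close>

lemma norm_theta_term_le:
  assumes "a \<le> u"
  shows "norm (theta_term u n) \<le> exp (- pi * exp (2 * a) / real q) ^ Suc n"
proof -
  have "norm (theta_term u n) \<le> 1 * exp (- pi * (real (Suc n))\<^sup>2 * exp (2 * u) / real q)"
    unfolding theta_term_def norm_mult by (intro mult_mono norm_X_le) auto
  also have "\<dots> \<le> exp (real (Suc n) * (- pi * exp (2 * a) / real q))"
  proof -
    have "real (Suc n) * 1 \<le> real (Suc n) * real (Suc n)" by (intro mult_left_mono) auto
    then have "real (Suc n) * exp (2 * a) \<le> (real (Suc n))\<^sup>2 * exp (2 * u)"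
      using assms by (intro mult_mono) (auto simp: power2_eq_square)
    then have "pi * (real (Suc n) * exp (2 * a)) / real q \<le> pi * ((real (Suc n))\<^sup>2 * exp (2 * u)) / real q"
      by (intro divide_right_mono mult_left_mono) auto
    then show ?thesis by (simp add: mult_ac)
  qed
  also have "\<dots> = exp (- pi * exp (2 * a) / real q) ^ Suc n" by (rule exp_of_nat_mult)
  finally show ?thesis .
qed

lemma theta_ratio: "0 < exp (- pi * exp (2 * a) / real q)" "exp (- pi * exp (2 * a) / real q) < 1"
  using q by auto

lemma summable_theta_bound: "summable (\<lambda>n. exp (- pi * exp (2 * a) / real q) ^ Suc n)"
  using theta_ratio[of a] by (subst summable_Suc_iff) (simp add: summable_geometric)

lemma summable_theta: "summable (\<lambda>n. norm (theta_term u n))"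
  by (rule summable_comparison_test'[OF summable_theta_bound[of u]]) (use norm_theta_term_le[of u u] in auto)

lemma continuous_theta: "continuous_on UNIV theta"
proof -
  have c: "continuous_on {a<..} theta" for a
  proof -
    have ul: "uniform_limit {a<..} (\<lambda>N u. \<Sum>n<N. theta_term u n) theta sequentially"
      unfolding theta_def
      by (rule Weierstrass_m_test[OF norm_theta_term_le[of a] summable_theta_bound[of a]]) auto
    show ?thesis
    proof (rule uniform_limit_theorem[OF _ ul])
      show "\<forall>\<^sub>F N in sequentially. continuous_on {a<..} (\<lambda>u. \<Sum>n<N. theta_term u n)"
        unfolding theta_term_def using q by (intro always_eventually allI continuous_intros) auto
    qed simp
  qed
  have "isCont theta u" for u
    using c[of "u - 1"] continuous_on_interior[of "{u-1<..}" theta u] by (simp add: interior_open)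
  then show ?thesis by (simp add: continuous_on_eq_continuous_at)
qed

text \<open>The majorizing geometric series sums to \<open>1 / (exp x - 1)\<close>, and a single
  term of the exponential series bounds \<open>exp x - 1\<close> from below;
  \<open>j \<ge> 1\<close> keeps that term apart from the subtracted 1.\<close>

lemma norm_theta_le:
  assumes j: "j \<ge> 1"
  shows "norm (theta u) \<le> fact j * real q ^ j * exp (- (2 * real j * u))"
proof -
  define x where "x = pi * exp (2 * u) / real q"
  have x: "x > 0" using q by (simp add: x_def)
  have "norm (theta u) \<le> (\<Sum>n. exp (- x) ^ Suc n)"
    unfolding theta_def x_def
    by (rule norm_suminf_le) (use norm_theta_term_le[of u u] summable_theta_bound[of u] in auto)
  also have "\<dots> = exp (- x) * (1 / (1 - exp (- x)))"
    using x by (simp add: suminf_mult suminf_geometric summable_geometric)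
  also have "\<dots> = 1 / (exp x - 1)"
    using x by (simp add: exp_minus field_simps)
  also have "\<dots> \<le> 1 / (x ^ j / fact j)"
  proof (intro divide_left_mono mult_pos_pos)
    have "(\<Sum>k\<in>{0, j}. x ^ k / fact k) \<le> (\<Sum>k\<le>j. x ^ k / fact k)" using x by (intro sum_mono2) auto
    also have "\<dots> \<le> exp x" using x by (intro sum_fact_le_exp) auto
    finally show "x ^ j / fact j \<le> exp x - 1" using j by simp
  qed (use x in auto)
  also have "\<dots> = fact j * real q ^ j * exp (- (2 * real j * u)) / pi ^ j"
  proof -
    have "exp (2 * u) ^ j = exp (2 * real j * u)" by (simp add: mult_ac flip: exp_of_nat_mult)
    then show ?thesis using q by (simp add: x_def power_divide power_mult_distrib exp_minus field_simps)
  qed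
  also have "\<dots> \<le> fact j * real q ^ j * exp (- (2 * real j * u)) / 1"
    using pi_ge_two by (intro divide_left_mono one_le_power) auto
  finally show ?thesis by simp
qed

definition root_number :: complex where
  "root_number = gauss_sum q X 1 / of_real (sqrt (real q))"

lemma has_sum_theta:
  "((\<lambda>n. X n * of_real (exp (- (pi * exp (2 * u) / real q * (of_int n)\<^sup>2)))) has_sum 2 * theta u) UNIV"
proof -
  define F where "F = (\<lambda>n::int. X n * of_real (exp (- (pi * exp (2 * u) / real q * (of_int n)\<^sup>2))))"
  have F: "F (int (Suc n)) = theta_term u n" for n
    by (simp add: F_def theta_term_def mult_ac)
  have "(F has_sum 2 * (\<Sum>n. F (int (Suc n)))) UNIV"
  proof (rule has_sum_int_even)
    show "F (- n) = F n" for n by (simp add: F_def X_minus)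
    show "F 0 = 0" by (simp add: F_def X_0)
    show "summable (\<lambda>n. norm (F (int (Suc n))))" unfolding F by (rule summable_theta)
  qed
  then show ?thesis unfolding F theta_def[symmetric] unfolding F_def .
qed

text \<open>Residue classes modulo \<open>q\<close> turn \<open>theta\<close> into shifted Gaussian
  sums. Poisson summation converts the shifts into additive characters, whose sum against
  \<open>X\<close> is a Gauss sum, and primitivity factors it as \<open>cnj (X k)\<close> times a
  constant.\<close>

lemma theta_functional_equation:
  "theta u = root_number * exp (- of_real u) * cnj (theta (- u))"
proof -
  define y where "y = exp (2 * u)"
  have y: "y > 0" by (simp add: y_def)
  define t where "t = real q * y"
  have t: "t > 0" using q y by (simp add: t_def)
  define E where "E = (\<lambda>n::int. exp (- (pi * y / real q * (of_int n)\<^sup>2)))"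
  define S where "S = (\<lambda>a::int. \<Sum>\<^sub>\<infinity>m::int. exp (- pi * t * (of_int m + of_int a / real q)\<^sup>2))"
  have sE: "E summable_on UNIV"
    unfolding E_def using y q by (intro summable_on_int_gaussian) auto
  have Eeq: "exp (- pi * t * (of_int m + of_int a / real q)\<^sup>2) = E (a + int q * m)" for m a
  proof -
    have "t * (of_int m + of_int a / real q)\<^sup>2 = y / real q * (of_int (a + int q * m))\<^sup>2"
      using q by (simp add: t_def power2_eq_square field_simps)
    then show ?thesis by (simp add: E_def mult.assoc)
  qed
  have hS: "((\<lambda>m. E (a + int q * m)) has_sum S a) UNIV" for a
  proof -
    have inj: "inj (\<lambda>m. a + int q * m)" using q by (auto simp: inj_def)
    have "E summable_on range (\<lambda>m. a + int q * m)" by (rule summable_on_subset_banach[OF sE]) auto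
    then have "(\<lambda>m. E (a + int q * m)) summable_on UNIV"
      by (simp add: summable_on_reindex[OF inj] o_def)
    then show ?thesis unfolding S_def Eeq by (rule has_sum_infsum)
  qed
  have A: "((\<lambda>n. X n * of_real (E n)) has_sum (\<Sum>a\<in>{0..<int q}. X a * of_real (S a))) UNIV"
  proof (rule has_sum_residue_classes)
    fix a assume "a \<in> {0..<int q}"
    have "X (a + int q * m) = X a" for m
      by (rule dirichlet_char_cong[OF X]) (simp add: cong_def)
    moreover have "((\<lambda>m. X a * of_real (E (a + int q * m))) has_sum X a * of_real (S a)) UNIV"
      by (intro has_sum_cmult_right has_sum_of_real hS)
    ultimately show "((\<lambda>m. X (a + int q * m) * of_real (E (a + int q * m))) has_sum X a * of_real (S a)) UNIV"
      by simp
  qed (use q in auto)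
  have th: "2 * theta u = (\<Sum>a\<in>{0..<int q}. X a * of_real (S a))"
    using has_sum_unique[OF has_sum_theta[of u] A[unfolded E_def y_def]] .
  have B: "((\<lambda>k. \<Sum>a\<in>{0..<int q}. X a * (of_real (exp (- pi * (of_int k)\<^sup>2 / t)) * cis (2 * pi * of_int k * (of_int a / real q)))) has_sum
       (\<Sum>a\<in>{0..<int q}. X a * of_real (sqrt t * S a))) UNIV"
    unfolding S_def by (intro has_sum_finite_sum has_sum_cmult_right gaussian_poisson t) auto
  have Beq: "(\<Sum>a\<in>{0..<int q}. X a * (of_real (exp (- pi * (of_int k)\<^sup>2 / t)) * cis (2 * pi * of_int k * (of_int a / real q)))) =
     gauss_sum q X 1 * cnj (X k * of_real (exp (- (pi * exp (2 * (- u)) / real q * (of_int k)\<^sup>2))))" for k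
  proof -
    have "(\<Sum>a\<in>{0..<int q}. X a * (of_real (exp (- pi * (of_int k)\<^sup>2 / t)) * cis (2 * pi * of_int k * (of_int a / real q)))) =
      of_real (exp (- pi * (of_int k)\<^sup>2 / t)) * gauss_sum q X k"
      by (simp add: gauss_sum_def sum_distrib_left mult_ac)
    also have "\<dots> = gauss_sum q X 1 * cnj (X k * of_real (exp (- (pi * exp (2 * (- u)) / real q * (of_int k)\<^sup>2))))"
    proof -
      have g: "gauss_sum q X k = cnj (X k) * gauss_sum q X 1" by (rule gauss_sum_primitive[OF prim]) (use q in simp)
      have e: "- pi * (of_int k)\<^sup>2 / t = - (pi * exp (2 * (- u)) / real q * (of_int k)\<^sup>2)"
        by (simp add: t_def y_def exp_minus field_simps)
      show ?thesis unfolding e by (subst g) simp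
    qed
    finally show ?thesis .
  qed
  have C: "((\<lambda>k. gauss_sum q X 1 * cnj (X k * of_real (exp (- (pi * exp (2 * (- u)) / real q * (of_int k)\<^sup>2))))) has_sum
      gauss_sum q X 1 * cnj (2 * theta (- u))) UNIV"
    by (intro has_sum_cmult_right has_sum_theta has_sum_cnj_iff[THEN iffD2])
  have "(\<Sum>a\<in>{0..<int q}. X a * of_real (sqrt t * S a)) = gauss_sum q X 1 * cnj (2 * theta (- u))"
    using has_sum_unique[OF B[unfolded Beq] C] .
  moreover have "(\<Sum>a\<in>{0..<int q}. X a * of_real (sqrt t * S a)) = of_real (sqrt t) * (2 * theta u)"
    unfolding th by (simp add: sum_distrib_left mult_ac)
  ultimately have "of_real (sqrt t) * theta u = gauss_sum q X 1 * cnj (theta (- u))" by simp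
  moreover have "sqrt t = sqrt (real q) * exp u"
    using q by (simp add: t_def y_def real_sqrt_mult exp_double)
  moreover have "complex_of_real (exp u) = exp (of_real u)" by (simp add: exp_of_real)
  ultimately show ?thesis using q by (simp add: root_number_def exp_minus field_simps)
qed

text \<open>Applying the functional equation twice at a point where \<open>theta\<close> is nonzero
  determines the modulus. If \<open>theta\<close> vanishes identically, the later bounds are
  trivial.\<close>

lemma norm_root_number: "norm root_number = 1 \<or> (\<forall>u. theta u = 0)"
proof (rule disjCI)
  assume "\<not> (\<forall>u. theta u = 0)"
  then obtain u where u: "theta u \<noteq> 0" by blast
  have 1: "norm (theta u) = norm root_number * exp (- u) * norm (theta (- u))"
    by (subst theta_functional_equation) (simp add: norm_mult)
  have 2: "norm (theta (- u)) = norm root_number * exp u * norm (theta u)"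
    by (subst theta_functional_equation) (simp add: norm_mult)
  have "norm (theta u) = (norm root_number)\<^sup>2 * (exp (- u) * exp u) * norm (theta u)"
    using 1 unfolding 2 by (simp only: power2_eq_square mult_ac)
  then have "norm (theta u) = (norm root_number)\<^sup>2 * norm (theta u)" by (simp add: mult_exp_exp)
  then have "(norm root_number)\<^sup>2 = 1" using u by simp
  then show "norm root_number = 1" by (simp add: power2_eq_1_iff) (use norm_ge_zero[of root_number] in linarith)
qed

lemma norm_theta_reflect: "norm (theta (- u)) = exp u * norm (theta u)"
proof (cases "\<forall>u. theta u = 0")
  case False
  then have "norm root_number = 1" using norm_root_number by blast
  then show ?thesis by (subst theta_functional_equation) (simp add: norm_mult)
qed simp

section \<open>The Mellin transform of theta and the continuation of L\<close>

definition mellin_term :: "complex \<Rightarrow> real \<Rightarrow> complex" where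
  "mellin_term s u = exp (s * of_real u) * theta u"

definition mellin :: "complex \<Rightarrow> complex" where
  "mellin s = integral\<^sup>L lborel (mellin_term s)"

lemma continuous_mellin_term: "continuous_on A (mellin_term s)"
  unfolding mellin_term_def by (intro continuous_intros continuous_on_subset[OF continuous_theta]) auto

lemma measurable_mellin_term [measurable]: "mellin_term s \<in> borel_measurable borel"
  by (intro borel_measurable_continuous_onI continuous_mellin_term)

text \<open>For \<open>u < 0\<close> the reflection of \<open>theta\<close> exchanges
  \<open>s\<close> with \<open>1 - s\<close>, so the bound for positive \<open>u\<close> is first
  proved on the wider strip of half-width \<open>R + 1\<close>.\<close>

lemma norm_mellin_term_le:
  assumes R: "R \<ge> 0"
  obtains C where "C \<ge> 0" "\<And>s u. \<bar>Re s\<bar> \<le> R \<Longrightarrow> norm (mellin_term s u) \<le> C * exp (- 2 * \<bar>u\<bar>)"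
proof
  define j where "j = nat \<lceil>R\<rceil> + 2"
  have j: "j \<ge> 1" "real j \<ge> R + 2" unfolding j_def by linarith+
  define C where "C = fact j * real q ^ j"
  show "C \<ge> 0" by (simp add: C_def)
  have pos: "norm (mellin_term s u) \<le> C * exp (- 2 * u)" if "\<bar>Re s\<bar> \<le> R + 1" "u \<ge> 0" for s u
  proof -
    have "norm (mellin_term s u) = exp (Re s * u) * norm (theta u)" by (simp add: mellin_term_def norm_mult)
    also have "\<dots> \<le> exp (Re s * u) * (C * exp (- (2 * real j * u)))"
      unfolding C_def by (intro mult_left_mono norm_theta_le j) auto
    also have "\<dots> = C * exp (Re s * u - 2 * real j * u)" by (simp add: exp_diff exp_minus field_simps)
    also have "\<dots> \<le> C * exp (- 2 * u)"
    proof -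
      have "(Re s - 2 * real j) * u \<le> (- 2) * u" using that j R by (intro mult_right_mono) auto
      then show ?thesis by (intro mult_left_mono) (auto simp: C_def algebra_simps)
    qed
    finally show ?thesis .
  qed
  show "norm (mellin_term s u) \<le> C * exp (- 2 * \<bar>u\<bar>)" if "\<bar>Re s\<bar> \<le> R" for s u
  proof (cases "u \<ge> 0")
    case True
    then show ?thesis using pos[of s u] that by simp
  next
    case False
    have "norm (mellin_term s u) = exp (Re s * u) * norm (theta (- (- u)))" by (simp add: mellin_term_def norm_mult)
    also have "\<dots> = (exp (Re s * u) * exp (- u)) * norm (theta (- u))"
      by (simp only: norm_theta_reflect[of "- u"] mult.assoc)
    also have "exp (Re s * u) * exp (- u) = exp (Re ((1 - s) * of_real (- u)))"
      by (simp add: mult_exp_exp algebra_simps)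
    also have "\<dots> * norm (theta (- u)) = norm (mellin_term (1 - s) (- u))"
      by (simp only: mellin_term_def norm_mult norm_exp_eq_Re)
    also have "\<dots> \<le> C * exp (- 2 * (- u))" using False that by (intro pos) auto
    finally show ?thesis using False by simp
  qed
qed

lemma integrable_mellin_term: "integrable lborel (mellin_term s)"
proof -
  obtain C where C: "C \<ge> 0" "\<And>s' u. \<bar>Re s'\<bar> \<le> \<bar>Re s\<bar> \<Longrightarrow> norm (mellin_term s' u) \<le> C * exp (- 2 * \<bar>u\<bar>)"
    using norm_mellin_term_le[of "\<bar>Re s\<bar>"] by auto
  have "integrable lborel (\<lambda>u::real. C * exp (- \<bar>u\<bar>))" by (intro integrable_mult_right integrable_exp_minus_abs)
  then show ?thesis
  proof (rule Bochner_Integration.integrable_bound)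
    show "AE u in lborel. norm (mellin_term s u) \<le> norm (C * exp (- \<bar>u\<bar>))"
    proof (rule AE_I2)
      fix u :: real
      have "norm (mellin_term s u) \<le> C * exp (- 2 * \<bar>u\<bar>)" by (rule C(2)) simp
      also have "\<dots> \<le> C * exp (- \<bar>u\<bar>)" using C(1) by (intro mult_left_mono) auto
      finally show "norm (mellin_term s u) \<le> norm (C * exp (- \<bar>u\<bar>))" using C(1) by simp
    qed
  qed simp
qed

text \<open>Integrals over bounded intervals are holomorphic, and the decay of the integrand makes
  them converge locally uniformly.\<close>

lemma holomorphic_mellin: "mellin holomorphic_on UNIV"
proof (rule holomorphic_uniform_sequence[where f = "\<lambda>N s. integral (cbox (- real N) (real N)) (mellin_term s)"])
  show "(\<lambda>s. integral (cbox (- real N) (real N)) (mellin_term s)) holomorphic_on UNIV" for N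
  proof (rule leibniz_rule_holomorphic[where fx = "\<lambda>s u. of_real u * mellin_term s u"])
    show "((\<lambda>s. mellin_term s u) has_field_derivative of_real u * mellin_term s u) (at s within UNIV)" for s u
      unfolding mellin_term_def by (auto intro!: derivative_eq_intros)
    show "mellin_term s integrable_on cbox (- real N) (real N)" for s
      by (intro integrable_continuous continuous_mellin_term)
    show "continuous_on (UNIV \<times> cbox (- real N) (real N)) (\<lambda>(s, u). of_real u * mellin_term s u)"
      unfolding mellin_term_def case_prod_beta
      by (intro continuous_intros continuous_on_compose2[OF continuous_theta]) auto
  qed auto
  fix s0 :: complex
  define R where "R = norm s0 + 1"
  obtain C where C: "C \<ge> 0" "\<And>s u. \<bar>Re s\<bar> \<le> R \<Longrightarrow> norm (mellin_term s u) \<le> C * exp (- 2 * \<bar>u\<bar>)"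
    using norm_mellin_term_le[of R] by (auto simp: R_def)
  define I0 where "I0 = integral\<^sup>L lborel (\<lambda>u::real. exp (- \<bar>u\<bar>))"
  have bnd: "norm (integral (cbox (- real N) (real N)) (mellin_term s) - mellin s) \<le> C * I0 * exp (- real N)"
    if "s \<in> cball s0 1" for s N
  proof -
    have "norm s \<le> R" using that norm_triangle_ineq2[of s s0] by (simp add: R_def dist_norm norm_minus_commute)
    then have Rs: "\<bar>Re s\<bar> \<le> R" using abs_Re_le_cmod[of s] by linarith
    define K where "K = {- real N..real N}"
    have si: "integrable lborel (\<lambda>u. indicator K u *\<^sub>R mellin_term s u)"
      unfolding K_def by (intro integrable_mult_indicator integrable_mellin_term) auto
    have "integral (cbox (- real N) (real N)) (mellin_term s) = integral\<^sup>L lborel (\<lambda>u. indicator K u *\<^sub>R mellin_term s u)"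
      using set_borel_integral_eq_integral(2)[of K "mellin_term s"] si
      by (simp add: K_def set_lebesgue_integral_def set_integrable_def)
    then have "norm (integral (cbox (- real N) (real N)) (mellin_term s) - mellin s) =
      norm (integral\<^sup>L lborel (\<lambda>u. indicator K u *\<^sub>R mellin_term s u - mellin_term s u))"
      unfolding mellin_def by (simp add: Bochner_Integration.integral_diff[OF si integrable_mellin_term])
    also have "\<dots> \<le> integral\<^sup>L lborel (\<lambda>u. C * exp (- real N) * exp (- \<bar>u\<bar>))"
    proof (rule order_trans[OF Bochner_Integration.integral_norm_bound integral_mono])
      show "integrable lborel (\<lambda>u. norm (indicator K u *\<^sub>R mellin_term s u - mellin_term s u))"
        by (intro integrable_norm Bochner_Integration.integrable_diff si integrable_mellin_term)
      show "integrable lborel (\<lambda>u::real. C * exp (- real N) * exp (- \<bar>u\<bar>))"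
        by (intro integrable_mult_right integrable_exp_minus_abs)
      fix u :: real
      show "norm (indicator K u *\<^sub>R mellin_term s u - mellin_term s u) \<le> C * exp (- real N) * exp (- \<bar>u\<bar>)"
      proof (cases "u \<in> K")
        case False
        then have u: "\<bar>u\<bar> \<ge> real N" by (auto simp: K_def)
        have "norm (mellin_term s u) \<le> C * exp (- 2 * \<bar>u\<bar>)" by (rule C(2)[OF Rs])
        also have "\<dots> \<le> C * exp (- real N - \<bar>u\<bar>)" using C(1) u by (intro mult_left_mono) auto
        finally show ?thesis using False by (simp add: exp_diff exp_minus field_simps)
      qed (use C(1) in simp)
    qed
    also have "\<dots> = C * I0 * exp (- real N)" by (simp add: I0_def)
    finally show ?thesis .
  qed
  have "uniform_limit (cball s0 1) (\<lambda>N s. integral (cbox (- real N) (real N)) (mellin_term s)) mellin sequentially"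
  proof (rule uniform_limitI)
    fix e :: real assume e: "e > 0"
    have "((\<lambda>N. C * I0 * exp (- real N)) \<longlongrightarrow> 0) sequentially" by real_asymp
    then have "\<forall>\<^sub>F N in sequentially. C * I0 * exp (- real N) < e" using e by (auto dest: order_tendstoD(2))
    then show "\<forall>\<^sub>F N in sequentially. \<forall>s\<in>cball s0 1. dist (integral (cbox (- real N) (real N)) (mellin_term s)) (mellin s) < e"
    proof eventually_elim
      case (elim N)
      show ?case
      proof
        fix s assume "s \<in> cball s0 1"
        from bnd[OF this, of N] elim
        show "dist (integral (cbox (- real N) (real N)) (mellin_term s)) (mellin s) < e" by (simp add: dist_norm)
      qed
    qed
  qed
  then show "\<exists>d>0. cball s0 d \<subseteq> UNIV \<and> uniform_limit (cball s0 d) (\<lambda>N s. integral (cbox (- real N) (real N)) (mellin_term s)) mellin sequentially"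
    by (intro exI[of _ 1]) auto
qed auto

text \<open>This is the completed function divided by its Gamma factor; as \<open>rGamma\<close> is
  entire, so is the quotient.\<close>

definition L_fun :: "complex \<Rightarrow> complex" where
  "L_fun s = 2 * rGamma (s / 2) * of_real (pi / real q) powr (s / 2) * mellin s"

text \<open>Integration term by term is justified by the integrals of the absolute values: they are
  bounded by Gaussian Mellin integrals at the real point \<open>Re s\<close>, and these form a
  convergent series for \<open>Re s > 1\<close>.\<close>

lemma L_fun_sums:
  assumes s: "Re s > 1"
  shows "(\<lambda>n. X (int (Suc n)) * of_nat (Suc n) powr (- s)) sums L_fun s"
proof -
  define c where "c = (\<lambda>n. pi * (real (Suc n))\<^sup>2 / real q)"
  have c: "c n > 0" for n using q by (simp add: c_def)
  define f where "f = (\<lambda>n u. X (int (Suc n)) * (exp (s * of_real u) * of_real (exp (- c n * exp (2 * u)))))"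
  have feq: "f n u = exp (s * of_real u) * theta_term u n" for n u
    by (simp add: f_def theta_term_def c_def mult_ac)
  have cp: "of_real (c n) powr (- w / 2) = of_real (pi / real q) powr (- w / 2) * of_nat (Suc n) powr (- w)" for n and w :: complex
  proof -
    have "complex_of_real (c n) powr (- w / 2) = exp ((- w / 2) * of_real (ln (c n)))"
      using c[of n] by (simp add: powr_def Ln_of_real)
    also have "ln (c n) = ln (pi / real q) + 2 * ln (real (Suc n))"
    proof -
      have "c n = (pi / real q) * (real (Suc n))\<^sup>2" by (simp add: c_def)
      then have "ln (c n) = ln (pi / real q) + ln ((real (Suc n))\<^sup>2)" using q by (simp only: ln_mult) simp
      then show ?thesis by (simp only: ln_realpow of_nat_numeral)
    qed
    also have "exp ((- w / 2) * of_real (ln (pi / real q) + 2 * ln (real (Suc n)))) =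
      exp ((- w / 2) * of_real (ln (pi / real q))) * exp ((- w) * of_real (ln (real (Suc n))))"
      by (simp add: distrib_left exp_add[symmetric] algebra_simps del: of_nat_Suc)
    also have "exp ((- w / 2) * of_real (ln (pi / real q))) = of_real (pi / real q) powr (- w / 2)"
      using q by (simp add: powr_def Ln_of_real del: of_real_divide)
    also have "exp ((- w) * of_real (ln (real (Suc n)))) = of_nat (Suc n) powr (- w)"
      by (simp add: powr_def Ln_of_nat del: of_nat_Suc)
    finally show ?thesis .
  qed
  have int_f: "integrable lborel (f n)" for n
    unfolding f_def using gaussian_mellin(1)[OF c[of n], of s] s by (intro integrable_mult_right) auto
  have val_f: "integral\<^sup>L lborel (f n) = Gamma (s/2) / 2 * of_real (pi / real q) powr (- s / 2) * (X (int (Suc n)) * of_nat (Suc n) powr (- s))" for n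
  proof -
    have "integral\<^sup>L lborel (f n) = X (int (Suc n)) * (Gamma (s/2) / 2 * of_real (c n) powr (- s / 2))"
      unfolding f_def using gaussian_mellin[OF c[of n], of s] s
      by (subst Bochner_Integration.integral_mult_right) auto
    then show ?thesis unfolding cp by (simp add: mult_ac)
  qed
  have "(\<lambda>n. integral\<^sup>L lborel (f n)) sums integral\<^sup>L lborel (\<lambda>u. \<Sum>n. f n u)"
  proof (rule sums_integral[OF int_f])
    show "AE u in lborel. summable (\<lambda>n. norm (f n u))"
      unfolding feq norm_mult by (intro AE_I2 summable_mult summable_theta)
    define \<sigma> where "\<sigma> = Re s"
    define B where "B = norm (Gamma (of_real \<sigma> / 2) / 2 * of_real (pi / real q) powr (- of_real \<sigma> / 2) :: complex)"
    have "integral\<^sup>L lborel (\<lambda>u. norm (f n u)) \<le> B * real (Suc n) powr (- \<sigma>)" for n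
    proof -
      define k where "k = (\<lambda>u. exp (\<sigma> * u) * exp (- c n * exp (2 * u)))"
      have kc: "complex_of_real (k u) = exp (of_real \<sigma> * of_real u) * of_real (exp (- c n * exp (2 * u)))" for u
        by (simp add: k_def exp_of_real[symmetric])
      have ik: "integrable lborel k"
      proof -
        have "integrable lborel (\<lambda>u. complex_of_real (k u))"
          unfolding kc using s by (intro gaussian_mellin(1) c) (simp add: \<sigma>_def)
        from integrable_Re[OF this] show ?thesis by simp
      qed
      have "integral\<^sup>L lborel (\<lambda>u. norm (f n u)) \<le> integral\<^sup>L lborel k"
      proof (rule integral_mono[OF integrable_norm[OF int_f] ik])
        fix u
        have "norm (f n u) = norm (X (int (Suc n))) * k u" by (simp add: f_def k_def norm_mult \<sigma>_def)
        also have "\<dots> \<le> 1 * k u" by (intro mult_right_mono norm_X_le) (simp add: k_def)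
        finally show "norm (f n u) \<le> k u" by simp
      qed
      also have "\<dots> = norm (complex_of_real (integral\<^sup>L lborel k))"
        by (simp add: k_def Bochner_Integration.integral_nonneg)
      also have "complex_of_real (integral\<^sup>L lborel k) = integral\<^sup>L lborel (\<lambda>u. complex_of_real (k u))"
        by simp
      also have "\<dots> = Gamma (of_real \<sigma> / 2) / 2 * of_real (c n) powr (- of_real \<sigma> / 2)"
        unfolding kc using s by (intro gaussian_mellin(2) c) (simp add: \<sigma>_def)
      also have "norm \<dots> = B * norm ((of_nat (Suc n) :: complex) powr (- of_real \<sigma>))"
        unfolding cp B_def by (simp add: norm_mult norm_divide)
      also have "norm ((of_nat (Suc n) :: complex) powr (- of_real \<sigma>)) = real (Suc n) powr (- \<sigma>)"
        by (subst norm_powr_real_powr') (auto simp del: of_nat_Suc)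
      finally show ?thesis .
    qed
    moreover have "summable (\<lambda>n. B * real (Suc n) powr (- \<sigma>))"
    proof (intro summable_mult)
      have "summable (\<lambda>n. real n powr (- \<sigma>))" using s by (simp add: summable_real_powr_iff \<sigma>_def)
      then show "summable (\<lambda>n. real (Suc n) powr (- \<sigma>))" by (subst summable_Suc_iff)
    qed
    moreover have "norm (integral\<^sup>L lborel (\<lambda>u. norm (f n u))) = integral\<^sup>L lborel (\<lambda>u. norm (f n u))" for n
      unfolding real_norm_def by (rule abs_of_nonneg) (rule Bochner_Integration.integral_nonneg, rule norm_ge_zero)
    ultimately show "summable (\<lambda>n. integral\<^sup>L lborel (\<lambda>u. norm (f n u)))"
      by - (rule summable_comparison_test'[where g = "\<lambda>n. B * real (Suc n) powr (- \<sigma>)" and N = 0], simp_all only:)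
  qed
  moreover have "(\<Sum>n. f n u) = mellin_term s u" for u
    unfolding feq mellin_term_def theta_def
    by (rule suminf_mult[OF summable_norm_cancel[OF summable_theta]])
  ultimately have "(\<lambda>n. Gamma (s/2) / 2 * of_real (pi / real q) powr (- s / 2) * (X (int (Suc n)) * of_nat (Suc n) powr (- s))) sums mellin s"
    unfolding val_f mellin_def by simp
  then have "(\<lambda>n. 2 * rGamma (s / 2) * of_real (pi / real q) powr (s / 2) *
     (Gamma (s/2) / 2 * of_real (pi / real q) powr (- s / 2) * (X (int (Suc n)) * of_nat (Suc n) powr (- s)))) sums L_fun s"
    unfolding L_fun_def by (rule sums_mult)
  moreover have "2 * rGamma (s / 2) * of_real (pi / real q) powr (s / 2) *
     (Gamma (s/2) / 2 * of_real (pi / real q) powr (- s / 2) * x) = x" for x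
  proof -
    have "s / 2 \<notin> \<int>\<^sub>\<le>\<^sub>0"
    proof
      assume "s / 2 \<in> \<int>\<^sub>\<le>\<^sub>0"
      then obtain n :: int where n: "s / 2 = of_int n" "n \<le> 0" by (elim nonpos_Ints_cases)
      then have "Re (s / 2) \<le> 0" by simp
      then show False using s by simp
    qed
    then have g: "rGamma (s/2) * Gamma (s/2) = 1" by (simp add: rGamma_inverse_Gamma Gamma_eq_zero_iff)
    have p: "complex_of_real (pi / real q) powr (s / 2) * of_real (pi / real q) powr (- s / 2) = 1"
      using q by (simp flip: powr_add)
    have "2 * rGamma (s / 2) * of_real (pi / real q) powr (s / 2) * (Gamma (s/2) / 2 * of_real (pi / real q) powr (- s / 2) * x)
      = (rGamma (s/2) * Gamma (s/2)) * (complex_of_real (pi / real q) powr (s / 2) * of_real (pi / real q) powr (- s / 2)) * x"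
      by (simp add: mult_ac)
    then show ?thesis unfolding g p by simp
  qed
  ultimately show ?thesis by (simp only:)
qed

lemma is_L_continuation_L_fun: "is_L_continuation X L_fun"
proof -
  have "L_fun holomorphic_on UNIV"
    unfolding L_fun_def using q by (intro holomorphic_intros holomorphic_mellin) auto
  then show ?thesis
    using L_fun_sums primitive_char_L_domain[OF prim q] by (simp add: is_L_continuation_def)
qed

lemma dirichlet_L_eq: "dirichlet_L X s = L_fun s"
proof -
  have "is_L_continuation X (dirichlet_L X)"
    unfolding dirichlet_L_def by (rule someI[where P = "is_L_continuation X", OF is_L_continuation_L_fun])
  then show ?thesis
    using is_L_continuation_unique[OF _ is_L_continuation_L_fun] primitive_char_L_domain[OF prim q] by blast
qed

end

section \<open>Approximation of the central value\<close>

lemma exp_minus_le_fact_div: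
  fixes x :: real
  assumes "x > 0"
  shows "exp (- x) \<le> fact j / x ^ j"
proof -
  have "x ^ j / fact j \<le> (\<Sum>k\<le>j. x ^ k / fact k)"
    using assms member_le_sum[of j "{..j}" "\<lambda>k. x ^ k / fact k"] by simp
  also have "\<dots> \<le> exp x" using assms by (intro sum_fact_le_exp) auto
  finally show ?thesis using assms by (simp add: exp_minus field_simps)
qed

definition gauss_weight :: "real \<Rightarrow> real" where
  "gauss_weight v = exp (v / 2) * exp (- pi * exp (2 * v))"

lemma continuous_gauss_weight [continuous_intros]:
  "continuous_on S f \<Longrightarrow> continuous_on S (\<lambda>x. gauss_weight (f x))"
  unfolding gauss_weight_def by (intro continuous_intros) auto

lemma gauss_weight_nonneg: "gauss_weight v \<ge> 0"
  by (simp add: gauss_weight_def)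

text \<open>At \<open>v = L / 10\<close> the exponent 30 yields \<open>q powr (- 3)\<close>, enough
  for trivial bounds of both the integral and the sum over \<open>m\<close>.\<close>

lemma gauss_weight_le:
  assumes "v \<ge> 0"
  shows "gauss_weight v \<le> fact 20 * exp (- (30 * v))"
proof -
  have "gauss_weight v \<le> exp (v / 2) * (fact 20 / (pi * exp (2 * v)) ^ 20)"
    unfolding gauss_weight_def using exp_minus_le_fact_div[of "pi * exp (2 * v)" 20]
    by (intro mult_left_mono) auto
  also have "\<dots> \<le> exp (v / 2) * (fact 20 / (exp (2 * v)) ^ 20)"
    using pi_ge_two by (intro mult_left_mono divide_left_mono power_mono mult_pos_pos zero_less_power) auto
  also have "\<dots> = fact 20 * exp (v / 2 - 40 * v)"
    by (subst exp_diff) (simp add: mult_ac flip: exp_of_nat_mult)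
  also have "\<dots> \<le> fact 20 * exp (- (30 * v))"
    using assms by (intro mult_left_mono) auto
  finally show ?thesis .
qed

lemma integrable_gauss_weight: "gauss_weight integrable_on UNIV"
proof -
  have "integrable lborel (\<lambda>u. exp ((1/2) * of_real u) * of_real (exp (- pi * exp (2 * u))) :: complex)"
    by (rule gaussian_mellin(1)) auto
  from integrable_Re[OF this] have "integrable lborel gauss_weight"
    by (simp add: gauss_weight_def[abs_def] Re_exp)
  then show ?thesis by (rule integrable_on_lborel)
qed

text \<open>Cutting the integral at \<open>L / 10\<close> makes the weight vanish exactly for
  \<open>x\<close> between \<open>7 / 10 * L\<close> and \<open>L\<close>, where the argument of
  \<open>g\<close> is then at most \<open>-1/10\<close>.\<close>

definition step_weight :: "(real \<Rightarrow> real) \<Rightarrow> real \<Rightarrow> real \<Rightarrow> real" where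
  "step_weight g L x = integral {- L..L / 10} (\<lambda>v. g ((v + L / 2 - x) / L) * gauss_weight v)"

lemma step_weight_eq_0:
  assumes g: "\<And>x. -2 \<le> x \<Longrightarrow> x \<le> -1/10 \<Longrightarrow> g x = 0"
    and L: "L > 0" "7 / 10 * L \<le> x" "x \<le> L"
  shows "step_weight g L x = 0"
proof -
  have "g ((v + L / 2 - x) / L) = 0" if "v \<in> {- L..L / 10}" for v
    using that L by (intro g) (auto simp: field_simps)
  then have "step_weight g L x = integral {- L..L / 10} (\<lambda>v. 0)"
    unfolding step_weight_def by (intro integral_cong) auto
  then show ?thesis by simp
qed

text \<open>The Fourier series of \<open>g\<close> is integrated term by term. The dependence on
  \<open>x\<close> separates as \<open>cis (- (k * x / L))\<close>, which at \<open>x = ln m\<close>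
  is a completely multiplicative function of \<open>m\<close>.\<close>

lemma step_weight_fourier:
  assumes cont: "continuous_on UNIV g" and L: "L > 0"
    and b: "\<And>x. ((\<lambda>k. b k * cis (of_int k * x)) has_sum of_real (g x)) UNIV"
    and summ: "(\<lambda>k. norm (b k)) summable_on UNIV"
  obtains d :: "int \<Rightarrow> complex" where
    "\<And>x. ((\<lambda>k. d k * cis (- (of_int k * x / L))) has_sum of_real (step_weight g L x)) UNIV"
    "\<And>k. norm (d k) \<le> norm (b k) * integral UNIV gauss_weight"
proof
  define D where "D = (\<lambda>k::int. integral {- L..L / 10} (\<lambda>v. of_real (gauss_weight v) * cis (of_int k * (v / L + 1 / 2))))"
  define d where "d = (\<lambda>k. b k * D k)"
  have cw: "continuous_on S (\<lambda>v. complex_of_real (gauss_weight v) * cis (of_int k * f v))"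
    if "continuous_on S f" for S f and k :: int
    using that by (intro continuous_intros) auto
  show "norm (d k) \<le> norm (b k) * integral UNIV gauss_weight" for k
  proof -
    have "norm (D k) \<le> integral {- L..L / 10} gauss_weight"
      unfolding D_def
    proof (rule integral_norm_bound_integral)
      show "gauss_weight integrable_on {- L..L / 10}"
        by (intro integrable_continuous_interval continuous_intros)
    qed (use L in \<open>auto intro!: integrable_continuous_interval cw continuous_intros simp: norm_mult gauss_weight_nonneg\<close>)
    also have "\<dots> \<le> integral UNIV gauss_weight"
      by (intro integral_subset_le integrable_gauss_weight integrable_continuous_interval continuous_intros)
         (auto simp: gauss_weight_nonneg)
    finally show ?thesis by (simp add: d_def norm_mult mult_left_mono)
  qed
  fix x :: real
  define y where "y = (\<lambda>v. (v + L / 2 - x) / L)"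
  have cy: "continuous_on S y" for S unfolding y_def by (intro continuous_intros) (use L in auto)
  have cg: "continuous_on S (\<lambda>v. complex_of_real (g (y v)))" for S
    by (intro continuous_intros continuous_on_compose2[OF cont cy]) auto
  have ul0: "uniform_limit UNIV (\<lambda>Y v. \<Sum>k\<in>Y. b k * cis (of_int k * y v)) (\<lambda>v. of_real (g (y v))) (finite_subsets_at_top UNIV)"
  proof -
    have "uniform_limit UNIV (\<lambda>Y v. \<Sum>k\<in>Y. b k * cis (of_int k * y v)) (\<lambda>v. \<Sum>\<^sub>\<infinity>k. b k * cis (of_int k * y v)) (finite_subsets_at_top UNIV)"
      by (rule Weierstrass_m_test_general[where M = "\<lambda>k. norm (b k)"]) (auto simp: norm_mult summ)
    moreover have "(\<Sum>\<^sub>\<infinity>k. b k * cis (of_int k * y v)) = of_real (g (y v))" for v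
      by (rule infsumI[OF b])
    ultimately show ?thesis by simp
  qed
  have "uniform_limit {- L..L / 10} (\<lambda>Y v. (\<Sum>k\<in>Y. b k * cis (of_int k * y v)) * of_real (gauss_weight v))
      (\<lambda>v. of_real (g (y v)) * of_real (gauss_weight v)) (finite_subsets_at_top UNIV)"
  proof (rule uniform_lim_mult)
    show "uniform_limit {- L..L / 10} (\<lambda>Y v. \<Sum>k\<in>Y. b k * cis (of_int k * y v)) (\<lambda>v. of_real (g (y v))) (finite_subsets_at_top UNIV)"
      by (rule uniform_limit_on_subset[OF ul0]) auto
    show "bounded ((\<lambda>v. complex_of_real (g (y v))) ` {- L..L / 10})"
      by (intro compact_imp_bounded compact_continuous_image cg) auto
    show "bounded ((\<lambda>v. complex_of_real (gauss_weight v)) ` {- L..L / 10})"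
      by (intro compact_imp_bounded compact_continuous_image continuous_intros) auto
  qed (auto intro: uniform_limit_const)
  then obtain I J where IJ: "\<And>Y. ((\<lambda>v. (\<Sum>k\<in>Y. b k * cis (of_int k * y v)) * of_real (gauss_weight v)) has_integral I Y) {- L..L / 10}"
     "((\<lambda>v. complex_of_real (g (y v)) * of_real (gauss_weight v)) has_integral J) {- L..L / 10}" "(I \<longlongrightarrow> J) (finite_subsets_at_top UNIV)"
    by (rule uniform_limit_integral) (auto intro!: continuous_intros cy)
  have "I Y = (\<Sum>k\<in>Y. d k * cis (- (of_int k * x / L)))" for Y
  proof (cases "finite Y")
    case True
    have eq: "(\<Sum>k\<in>Y. b k * cis (of_int k * y v)) * of_real (gauss_weight v) =
       (\<Sum>k\<in>Y. b k * cis (- (of_int k * x / L)) * (of_real (gauss_weight v) * cis (of_int k * (v / L + 1 / 2))))" for v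
      unfolding sum_distrib_right
    proof (intro sum.cong refl)
      fix k
      have "of_int k * y v = - (of_int k * x / L) + of_int k * (v / L + 1 / 2)"
        using L by (simp add: y_def field_simps)
      then have "cis (of_int k * y v) = cis (- (of_int k * x / L)) * cis (of_int k * (v / L + 1 / 2))"
        by (simp only: cis_mult)
      then show "b k * cis (of_int k * y v) * of_real (gauss_weight v) =
         b k * cis (- (of_int k * x / L)) * (of_real (gauss_weight v) * cis (of_int k * (v / L + 1 / 2)))"
        by (simp only: mult_ac)
    qed
    have "I Y = integral {- L..L / 10} (\<lambda>v. \<Sum>k\<in>Y. b k * cis (- (of_int k * x / L)) * (of_real (gauss_weight v) * cis (of_int k * (v / L + 1 / 2))))"
      using IJ(1)[of Y] unfolding eq by (rule integral_unique[symmetric])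
    also have "\<dots> = (\<Sum>k\<in>Y. integral {- L..L / 10} (\<lambda>v. b k * cis (- (of_int k * x / L)) * (of_real (gauss_weight v) * cis (of_int k * (v / L + 1 / 2)))))"
      using True L by (intro integral_sum integrable_continuous_interval continuous_on_mult_left cw continuous_intros) auto
    also have "\<dots> = (\<Sum>k\<in>Y. d k * cis (- (of_int k * x / L)))"
      by (intro sum.cong refl) (simp add: d_def D_def)
    finally show ?thesis .
  next
    case False
    \<comment> \<open>For infinite \<open>Y\<close> the finite sums are 0 by convention.\<close>
    then have "((\<lambda>v::real. 0::complex) has_integral I Y) {- L..L / 10}" using IJ(1)[of Y] by simp
    then have "I Y = 0" by (simp add: has_integral_0_eq)
    with False show ?thesis by simp
  qed
  moreover have "J = of_real (step_weight g L x)"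
  proof -
    have "((\<lambda>v. g (y v) * gauss_weight v) has_integral step_weight g L x) {- L..L / 10}"
      unfolding step_weight_def fun_cong[OF y_def, symmetric]
      by (intro integrable_integral integrable_continuous_interval continuous_intros continuous_on_compose2[OF cont cy]) auto
    from has_integral_linear[OF this bounded_linear_of_real]
    have "((\<lambda>v. complex_of_real (g (y v)) * of_real (gauss_weight v)) has_integral of_real (step_weight g L x)) {- L..L / 10}"
      by (simp add: o_def)
    then show ?thesis using IJ(2) has_integral_unique by blast
  qed
  ultimately show "((\<lambda>k. d k * cis (- (of_int k * x / L))) has_sum of_real (step_weight g L x)) UNIV"
    unfolding has_sum_def using IJ(3) ext[of I "sum (\<lambda>k. d k * cis (- (of_int k * x / L)))"] by simp
qed

text \<open>The substitution \<open>v = u + ln m - L / 2\<close>; the part of the range below \<open>- L\<close> or where the step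
  function vanishes costs nothing, and the part beyond \<open>L / 10\<close> is negligible by the Gaussian decay.\<close>

lemma smoothed_gaussian_integral:
  fixes q m :: nat
  assumes cont: "continuous_on UNIV g" and g: "\<And>x. 0 \<le> g x" "\<And>x. g x \<le> 1" "\<And>x. -2 \<le> x \<Longrightarrow> x \<le> -1/10 \<Longrightarrow> g x = 0"
    and q: "q > 1" and m: "0 < m" "m < q"
  defines "L \<equiv> ln (real q)"
  shows "\<bar>sqrt (real m) * integral {- L / 10..2 * L} (\<lambda>u. g (u / L) * (exp (u / 2) * exp (- pi * (real m)\<^sup>2 * exp (2 * u) / real q)))
     - exp (L / 4) * step_weight g L (ln (real m))\<bar> \<le> exp (L / 4) * (3 * fact 20 / (real q)\<^sup>2)"
proof -
  have L: "L > 0" using q by (simp add: L_def)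
  define x where "x = ln (real m)"
  have x: "0 \<le> x" "x \<le> L" using m q by (auto simp: x_def L_def)
  define c where "c = x - L / 2"
  define F where "F = (\<lambda>v. g ((v - c) / L) * gauss_weight v)"
  have cF: "continuous_on S F" for S
    unfolding F_def using L
    by (intro continuous_intros continuous_on_compose2[OF cont]) auto
  have iF: "F integrable_on {a..b}" for a b by (intro integrable_continuous_interval cF)
  have eq: "sqrt (real m) * (g (u / L) * (exp (u / 2) * exp (- pi * (real m)\<^sup>2 * exp (2 * u) / real q))) = exp (L / 4) * F (u + c)" for u
  proof -
    have mx: "real m = exp x" and qL: "real q = exp L" using m q by (auto simp: x_def L_def)
    have s: "sqrt (real m) = exp (x / 2)"
      by (rule real_sqrt_unique) (auto simp: mx simp flip: exp_of_nat_mult)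
    have e1: "(real m)\<^sup>2 * exp (2 * u) / real q = exp (2 * (u + c))"
      by (simp add: mx qL c_def algebra_simps flip: exp_of_nat_mult exp_add exp_diff)
    have e2: "exp (x / 2) * exp (u / 2) = exp (L / 4) * exp ((u + c) / 2)"
      by (simp add: c_def flip: exp_add) (simp add: field_simps)
    have "sqrt (real m) * (g (u / L) * (exp (u / 2) * exp (- pi * (real m)\<^sup>2 * exp (2 * u) / real q)))
       = (exp (x / 2) * exp (u / 2)) * g (u / L) * exp (- pi * ((real m)\<^sup>2 * exp (2 * u) / real q))"
      unfolding s by (simp add: mult_ac)
    also have "\<dots> = exp (L / 4) * F (u + c)" unfolding e1 e2 by (simp add: F_def gauss_weight_def mult_ac)
    finally show ?thesis .
  qed
  have "sqrt (real m) * integral {- L / 10..2 * L} (\<lambda>u. g (u / L) * (exp (u / 2) * exp (- pi * (real m)\<^sup>2 * exp (2 * u) / real q)))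
     = integral {- L / 10..2 * L} (\<lambda>u. sqrt (real m) * (g (u / L) * (exp (u / 2) * exp (- pi * (real m)\<^sup>2 * exp (2 * u) / real q))))"
    by simp
  also have "\<dots> = exp (L / 4) * integral {- L / 10..2 * L} (\<lambda>u. F (u + c))" unfolding eq by simp
  also have "integral {- L / 10..2 * L} (\<lambda>u. F (u + c)) = integral {x - 6 / 10 * L..x + 3 / 2 * L} F"
    unfolding integral_translate[OF cF] by (simp add: c_def algebra_simps)
  also have "\<dots> = integral {- L..x + 3 / 2 * L} F"
  proof -
    have "integral {- L..x - 6 / 10 * L} F = integral {- L..x - 6 / 10 * L} (\<lambda>v. 0)"
    proof (intro integral_cong)
      fix v assume "v \<in> {- L..x - 6 / 10 * L}"
      then have "g ((v - c) / L) = 0" using L x by (intro g) (auto simp: field_simps c_def)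
      then show "F v = 0" by (simp add: F_def)
    qed
    moreover have "integral {- L..x - 6 / 10 * L} F + integral {x - 6 / 10 * L..x + 3 / 2 * L} F = integral {- L..x + 3 / 2 * L} F"
      using L x by (intro Henstock_Kurzweil_Integration.integral_combine iF) auto
    ultimately show ?thesis by simp
  qed
  also have "\<dots> = step_weight g L x + integral {L / 10..x + 3 / 2 * L} F"
  proof -
    have "integral {- L..L / 10} F + integral {L / 10..x + 3 / 2 * L} F = integral {- L..x + 3 / 2 * L} F"
      using L x by (intro Henstock_Kurzweil_Integration.integral_combine iF) auto
    moreover have "integral {- L..L / 10} F = step_weight g L x"
      unfolding step_weight_def F_def c_def by (simp add: algebra_simps)
    ultimately show ?thesis by simp
  qed
  finally have E: "sqrt (real m) * integral {- L / 10..2 * L} (\<lambda>u. g (u / L) * (exp (u / 2) * exp (- pi * (real m)\<^sup>2 * exp (2 * u) / real q)))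
     - exp (L / 4) * step_weight g L x = exp (L / 4) * integral {L / 10..x + 3 / 2 * L} F" by (simp add: algebra_simps)
  have "\<bar>integral {L / 10..x + 3 / 2 * L} F\<bar> \<le> fact 20 * exp (- (3 * L)) * (x + 3 / 2 * L - L / 10)"
  proof -
    have "norm (integral {L / 10..x + 3 / 2 * L} F) \<le> (fact 20 * exp (- (3 * L))) * (x + 3 / 2 * L - L / 10)"
    proof (rule integral_bound)
      show "L / 10 \<le> x + 3 / 2 * L" using L x by simp
      fix v assume v: "v \<in> {L / 10..x + 3 / 2 * L}"
      have "norm (F v) = g ((v - c) / L) * gauss_weight v" using g gauss_weight_nonneg by (simp add: F_def)
      also have "\<dots> \<le> 1 * gauss_weight v" by (intro mult_right_mono g gauss_weight_nonneg)
      also have "1 * gauss_weight v \<le> fact 20 * exp (- (30 * v))" using gauss_weight_le[of v] v L by simp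
      also have "\<dots> \<le> fact 20 * exp (- (3 * L))" using v by (intro mult_left_mono) auto
      finally show "norm (F v) \<le> fact 20 * exp (- (3 * L))" .
    qed (rule cF)
    then show ?thesis by simp
  qed
  \<comment> \<open>The length of the range costs one of the three powers of
    \<open>q\<close>.\<close>
  also have "\<dots> \<le> fact 20 * exp (- (3 * L)) * (3 * real q)"
  proof -
    have "L \<le> real q" using q by (auto simp: L_def intro: ln_bound)
    then show ?thesis using x L by (intro mult_left_mono) auto
  qed
  also have "\<dots> = 3 * fact 20 / (real q)\<^sup>2"
  proof -
    have "exp (- (3 * L)) = inverse (exp (real 3 * L))" by (simp add: exp_minus)
    also have "exp (real 3 * L) = real q ^ 3" unfolding exp_of_nat_mult using q by (simp add: L_def)
    finally show ?thesis using q by (simp add: field_simps power2_eq_square power3_eq_cube)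
  qed
  finally have "exp (L / 4) * \<bar>integral {L / 10..x + 3 / 2 * L} F\<bar> \<le> exp (L / 4) * (3 * fact 20 / (real q)\<^sup>2)"
    by (intro mult_left_mono) auto
  then show ?thesis unfolding x_def[symmetric] E abs_mult by (simp only: abs_exp_cancel)
qed

section \<open>Replacing the Mellin integral by a Dirichlet polynomial\<close>

context even_primitive
begin

lemma mellin_term_half_reflect:
  "mellin_term (1 / 2) (- u) = root_number * cnj (mellin_term (1 / 2) u)"
proof -
  have "exp (1 / 2 * of_real (- u)) * exp (- of_real (- u)) = exp (1 / 2 * complex_of_real u)"
    by (simp add: field_simps flip: exp_add)
  moreover have "cnj (exp (1 / 2 * of_real u)) = exp (1 / 2 * complex_of_real u)"
    by (simp add: exp_cnj)
  ultimately show ?thesis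
    unfolding mellin_term_def using theta_functional_equation[of "- u"] by (simp add: mult_ac)
qed

text \<open>Under the reflection of the integrand, the part weighted with
  \<open>g (- (u / L))\<close> is \<open>root_number\<close> times the conjugate of the part
  weighted with \<open>g (u / L)\<close>, so both have the same modulus.\<close>

lemma norm_mellin_half_le:
  assumes cont: "continuous_on UNIV g" and g: "\<And>x. 0 \<le> g x" "\<And>x. g x \<le> 1" "\<And>x. g x + g (- x) = 1"
  shows "norm (mellin (1 / 2)) \<le> 2 * norm (integral\<^sup>L lborel (\<lambda>u. of_real (g (u / L)) * mellin_term (1 / 2) u))"
proof (cases "\<forall>u. theta u = 0")
  case True
  then show ?thesis by (simp add: mellin_def mellin_term_def[abs_def])
next
  case False
  then have rn: "norm root_number = 1" using norm_root_number by blast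
  define h where "h = mellin_term (1 / 2)"
  define G where "G = (\<lambda>u. complex_of_real (g (u / L)) * h u)"
  have mg: "(\<lambda>u. complex_of_real (g (u / L))) \<in> borel_measurable borel"
    by (cases "L = 0") (auto intro!: borel_measurable_continuous_onI continuous_intros continuous_on_compose2[OF cont])
  have iG: "integrable lborel G"
    by (rule Bochner_Integration.integrable_bound[OF integrable_mellin_term[of "1 / 2"]])
       (use mg g in \<open>auto simp: G_def h_def norm_mult intro!: mult_left_le_one_le\<close>)
  define I where "I = integral\<^sup>L lborel G"
  have iG': "integrable lborel (\<lambda>u. G (0 + (-1) * u))"
    by (rule lborel_integrable_real_affine[OF iG]) simp
  have I': "integral\<^sup>L lborel (\<lambda>u. G (0 + (-1) * u)) = I"
    using lborel_integral_real_affine[of "-1" G 0] by (simp add: I_def)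
  have hG: "h u = G u + root_number * cnj (G (0 + (-1) * u))" for u
  proof -
    have "root_number * cnj (h (- u)) = h u"
      using mellin_term_half_reflect[of "- u"] by (simp add: h_def)
    then have "G u + root_number * cnj (G (0 + (-1) * u)) = of_real (g (u / L) + g (- (u / L))) * h u"
      by (simp add: G_def algebra_simps)
    then show ?thesis using g(3)[of "u / L"] by simp
  qed
  have "mellin (1 / 2) = integral\<^sup>L lborel (\<lambda>u. G u + root_number * cnj (G (0 + (-1) * u)))"
    unfolding mellin_def h_def[symmetric] by (rule Bochner_Integration.integral_cong[OF refl hG])
  also have "\<dots> = I + root_number * cnj I"
    using iG iG' I' by (subst Bochner_Integration.integral_add) (auto simp: I_def)
  finally have "norm (mellin (1 / 2)) \<le> norm I + norm (root_number * cnj I)"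
    using norm_triangle_ineq by metis
  then show ?thesis by (simp add: norm_mult rn I_def G_def h_def)
qed

text \<open>With \<open>t = q powr (1/5)\<close> the assumption gives
  \<open>exp (2 * u) \<ge> 1 / t\<close>. For \<open>m \<ge> q = t ^ 5\<close> the exponent is then
  at least \<open>m / t\<close>, and its tenth power at least \<open>m\<^sup>2 * q ^ 6\<close>: the
  square makes the tail summable, the powers of \<open>q\<close> absorb trivial bounds
  elsewhere.\<close>

lemma norm_theta_minus_partial_le:
  assumes u: "u \<ge> - ln (real q) / 10"
  shows "norm (theta u - (\<Sum>m\<in>{0<..<q}. X (int m) * of_real (exp (- pi * (real m)\<^sup>2 * exp (2 * u) / real q))))
     \<le> (\<Sum>n. 1 / (real (Suc n))\<^sup>2) * fact 10 / real q ^ 6"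
proof -
  define t where "t = exp (ln (real q) / 5)"
  have t: "t \<ge> 1" using q by (simp add: t_def)
  have t5: "t ^ 5 = real q" using q by (simp add: t_def flip: exp_of_nat_mult)
  have sq: "summable (\<lambda>n. 1 / (real (Suc n))\<^sup>2)"
    using inverse_power_summable[of 2, where 'a = real]
    by (subst summable_Suc_iff[of "\<lambda>n. 1 / (real n)\<^sup>2"]) (simp add: inverse_eq_divide)
  have term_le: "norm (theta_term u n) \<le> fact 10 / real q ^ 6 * (1 / (real (Suc n))\<^sup>2)" if n: "n \<ge> q - 1" for n
  proof -
    define m where "m = real (Suc n)"
    have mq: "m \<ge> t ^ 5" "m \<ge> 1" using n q by (auto simp: m_def t5)
    define y where "y = pi * m\<^sup>2 * exp (2 * u) / real q"
    have "exp (2 * u) \<ge> 1 / t"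
    proof -
      have "exp (2 * u) \<ge> exp (- (ln (real q) / 5))" using u by simp
      then show ?thesis by (simp add: t_def exp_minus inverse_eq_divide)
    qed
    then have "1 * m\<^sup>2 * (1 / t) / real q \<le> pi * m\<^sup>2 * exp (2 * u) / real q"
      using pi_ge_two t by (intro divide_right_mono mult_mono) auto
    then have "m\<^sup>2 / (t * t ^ 5) \<le> y" by (simp add: y_def t5)
    moreover have "m * t ^ 5 / (t * t ^ 5) \<le> m\<^sup>2 / (t * t ^ 5)"
      unfolding power2_eq_square using mq t by (intro divide_right_mono mult_left_mono) auto
    ultimately have y: "m / t \<le> y" using t by simp
    have mt: "m / t > 0" using mq t by simp
    have "m\<^sup>2 * real q ^ 6 \<le> (m / t) ^ 10"
    proof -
      have "m\<^sup>2 * real q ^ 6 * t ^ 10 = m\<^sup>2 * (t ^ 5) ^ 8" unfolding t5[symmetric] by (simp flip: power_mult power_add)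
      also have "\<dots> \<le> m\<^sup>2 * m ^ 8" using mq t by (intro mult_left_mono power_mono) auto
      finally have "m\<^sup>2 * real q ^ 6 * t ^ 10 \<le> m ^ 10" by (simp flip: power_add)
      then show ?thesis using t by (simp add: power_divide field_simps)
    qed
    also have "\<dots> \<le> y ^ 10" using y mt by (intro power_mono) auto
    finally have my: "m\<^sup>2 * real q ^ 6 \<le> y ^ 10" .
    have "norm (theta_term u n) \<le> 1 * exp (- y)"
      unfolding theta_term_def norm_mult m_def[symmetric]
      by (intro mult_mono norm_X_le) (auto simp: y_def)
    also have "1 * exp (- y) \<le> fact 10 / y ^ 10"
      using exp_minus_le_fact_div[of y 10] y mt by simp
    also have "\<dots> \<le> fact 10 / (m\<^sup>2 * real q ^ 6)"
      using my mq q y mt by (intro divide_left_mono mult_pos_pos) auto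
    finally show ?thesis by (simp add: m_def mult_ac)
  qed
  have s: "summable (theta_term u)" by (rule summable_norm_cancel[OF summable_theta])
  have "(\<Sum>m\<in>{0<..<q}. X (int m) * of_real (exp (- pi * (real m)\<^sup>2 * exp (2 * u) / real q))) = (\<Sum>n<q - 1. theta_term u n)"
    by (rule sum.reindex_bij_witness[of _ Suc "\<lambda>m. m - 1"]) (auto simp: theta_term_def)
  then have "theta u - (\<Sum>m\<in>{0<..<q}. X (int m) * of_real (exp (- pi * (real m)\<^sup>2 * exp (2 * u) / real q))) = (\<Sum>n. theta_term u (n + (q - 1)))"
    using suminf_split_initial_segment[OF s, of "q - 1"] by (simp add: theta_def)
  also have "norm \<dots> \<le> (\<Sum>n. fact 10 / real q ^ 6 * (1 / (real (Suc n))\<^sup>2))"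
  proof (rule norm_suminf_le)
    fix n
    have "norm (theta_term u (n + (q - 1))) \<le> fact 10 / real q ^ 6 * (1 / (real (Suc (n + (q - 1))))\<^sup>2)"
      by (rule term_le) simp
    also have "\<dots> \<le> fact 10 / real q ^ 6 * (1 / (real (Suc n))\<^sup>2)"
      by (intro mult_left_mono divide_left_mono power_mono) (auto simp del: of_nat_Suc)
    finally show "norm (theta_term u (n + (q - 1))) \<le> fact 10 / real q ^ 6 * (1 / (real (Suc n))\<^sup>2)" .
  qed (rule summable_mult[OF sq])
  also have "\<dots> = fact 10 / real q ^ 6 * (\<Sum>n. 1 / (real (Suc n))\<^sup>2)" by (rule suminf_mult[OF sq])
  finally show ?thesis by (simp add: mult_ac)
qed

text \<open>From \<open>2 * ln q\<close> on, the decay of \<open>theta\<close> has absorbed its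
  factor \<open>q\<close>; reflection handles the negative side.\<close>

lemma norm_mellin_term_half_le:
  assumes u: "\<bar>u\<bar> \<ge> 2 * ln (real q)"
  shows "norm (mellin_term (1 / 2) u) \<le> exp (- \<bar>u\<bar>)"
proof -
  have *: "norm (mellin_term (1 / 2) v) \<le> exp (- v)" if v: "v \<ge> 2 * ln (real q)" for v
  proof -
    have "norm (mellin_term (1 / 2) v) \<le> exp (v / 2) * (fact 1 * real q ^ 1 * exp (- (2 * real 1 * v)))"
      unfolding mellin_term_def norm_mult using norm_theta_le[of 1 v] by (intro mult_mono) auto
    also have "\<dots> = exp (v / 2) * exp (ln (real q)) * exp (- (2 * v))" using q by simp
    also have "\<dots> = exp (v / 2 + ln (real q) + - (2 * v))" by (simp only: exp_add)
    also have "\<dots> \<le> exp (- v)" using v by simp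
    finally show ?thesis .
  qed
  have L: "ln (real q) > 0" using q by simp
  show ?thesis
  proof (cases "u \<ge> 0")
    case True
    then show ?thesis using *[of u] u by simp
  next
    case False
    have "norm (mellin_term (1 / 2) u) = norm (mellin_term (1 / 2) (- u))"
    proof -
      have "norm (exp (1 / 2 * complex_of_real (- u))) * norm (theta (- u)) = (exp (- u / 2) * exp u) * norm (theta u)"
        unfolding norm_theta_reflect by simp
      also have "exp (- u / 2) * exp u = exp (u / 2)" by (simp flip: exp_add)
      finally show ?thesis by (simp add: mellin_term_def norm_mult)
    qed
    then show ?thesis using *[of "- u"] u False by simp
  qed
qed

end

definition approx_const :: real where
  "approx_const = integral\<^sup>L lborel (\<lambda>u::real. exp (- \<bar>u\<bar>)) + 3 * (fact 10 * (\<Sum>n. 1 / (real (Suc n))\<^sup>2)) + 3 * fact 20"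

context even_primitive
begin

text \<open>Three replacements are made: the line by \<open>{- L / 10..2 * L}\<close>,
  \<open>theta\<close> by its first \<open>q - 1\<close> terms, and the integral of each term by a
  multiple of \<open>step_weight\<close>. The factor \<open>exp (L / 4)\<close> arises from the
  substitution and is matched by the power of \<open>pi / q\<close> in \<open>L_fun\<close>.\<close>

lemma norm_smoothed_mellin_le:
  assumes cont: "continuous_on UNIV g" and g: "\<And>x. 0 \<le> g x" "\<And>x. g x \<le> 1" "\<And>x. -2 \<le> x \<Longrightarrow> x \<le> -1/10 \<Longrightarrow> g x = 0"
  defines "L \<equiv> ln (real q)"
  shows "norm (integral\<^sup>L lborel (\<lambda>u. of_real (g (u / L)) * mellin_term (1 / 2) u))
     \<le> exp (L / 4) * (norm (\<Sum>m\<in>{0<..<q}. half_twist (\<lambda>m. of_real (step_weight g L (ln (real m)))) m * X (int m)) + approx_const)"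
proof -
  have L: "L > 0" "L \<le> real q" using q by (auto simp: L_def intro: ln_bound)
  have qL: "exp L = real q" using q by (simp add: L_def)
  define h where "h = mellin_term (1 / 2)"
  define G where "G = (\<lambda>u. complex_of_real (g (u / L)) * h u)"
  define K where "K = {- L / 10..2 * L}"
  have cgL: "continuous_on S (\<lambda>u. g (u / L))" for S
    using L by (intro continuous_on_compose2[OF cont] continuous_intros) auto
  have cG: "continuous_on S G" for S
    unfolding G_def h_def by (intro continuous_intros cgL continuous_mellin_term)
  have iG: "integrable lborel G"
  proof (rule Bochner_Integration.integrable_bound[OF integrable_mellin_term[of "1 / 2"]])
    show "G \<in> borel_measurable lborel" using borel_measurable_continuous_onI[OF cG[of UNIV]] by simp
  qed (use g in \<open>auto simp: G_def h_def norm_mult intro!: mult_left_le_one_le\<close>)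
  have si: "integrable lborel (\<lambda>u. indicator K u *\<^sub>R G u)"
    unfolding K_def by (intro integrable_mult_indicator iG) auto
  have GK: "integral K G = integral\<^sup>L lborel (\<lambda>u. indicator K u *\<^sub>R G u)"
    using set_borel_integral_eq_integral(2)[of K G] si
    by (simp add: K_def set_lebesgue_integral_def set_integrable_def)
  have "norm (integral\<^sup>L lborel G - integral K G) = norm (integral\<^sup>L lborel (\<lambda>u. G u - indicator K u *\<^sub>R G u))"
    unfolding GK by (simp add: Bochner_Integration.integral_diff[OF iG si])
  also have "\<dots> \<le> integral\<^sup>L lborel (\<lambda>u. exp (- \<bar>u\<bar>))"
  proof (rule order_trans[OF Bochner_Integration.integral_norm_bound integral_mono])
    show "integrable lborel (\<lambda>u. norm (G u - indicator K u *\<^sub>R G u))"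
      by (intro integrable_norm Bochner_Integration.integrable_diff si iG)
    show "integrable lborel (\<lambda>u::real. exp (- \<bar>u\<bar>))" by (rule integrable_exp_minus_abs)
    fix u :: real
    \<comment> \<open>Between \<open>- 2 * L\<close> and \<open>- L / 10\<close> the step function
      vanishes; farther out on either side the integrand is small.\<close>
    consider "u \<in> K" | "\<bar>u\<bar> \<ge> 2 * L" | "- 2 * L \<le> u" "u \<le> - L / 10" by (force simp: K_def)
    then show "norm (G u - indicator K u *\<^sub>R G u) \<le> exp (- \<bar>u\<bar>)"
    proof cases
      case 2
      have "norm (G u - indicator K u *\<^sub>R G u) \<le> norm (G u)" by (simp add: indicator_def)
      also have "\<dots> \<le> 1 * norm (h u)" unfolding G_def norm_mult using g by (intro mult_right_mono) auto
      also have "\<dots> \<le> exp (- \<bar>u\<bar>)" using norm_mellin_term_half_le[of u] 2 by (simp add: h_def L_def)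
      finally show ?thesis .
    next
      case 3
      then have "g (u / L) = 0" using L by (intro g) (auto simp: field_simps)
      then show ?thesis by (simp add: G_def)
    qed simp
  qed
  finally have step1: "norm (integral\<^sup>L lborel G - integral K G) \<le> integral\<^sup>L lborel (\<lambda>u::real. exp (- \<bar>u\<bar>))" .
  define f where "f = (\<lambda>m u. g (u / L) * (exp (u / 2) * exp (- pi * (real m)\<^sup>2 * exp (2 * u) / real q)))"
  have cf: "continuous_on S (f m)" for S m
    unfolding f_def using q by (intro continuous_intros cgL) auto
  have cff: "continuous_on S (\<lambda>u. complex_of_real (f m u))" for S m by (intro continuous_intros cf)
  define P where "P = (\<lambda>u. \<Sum>m\<in>{0<..<q}. X (int m) * complex_of_real (f m u))"
  have iP: "P integrable_on K"
    unfolding P_def K_def by (intro integrable_continuous_interval continuous_intros cf)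
  have "integral K (\<lambda>u. complex_of_real (f m u)) = of_real (integral K (f m))" for m
    using integral_linear[OF integrable_continuous_interval[OF cf] bounded_linear_of_real, of "- L / 10" "2 * L" m]
    by (simp add: K_def o_def)
  then have PK: "integral K P = (\<Sum>m\<in>{0<..<q}. X (int m) * of_real (integral K (f m)))"
    unfolding P_def using cff unfolding K_def
    by (subst integral_sum) (auto intro!: integrable_continuous_interval continuous_on_mult_left)
  have step2: "norm (integral K G - integral K P) \<le> 3 * (fact 10 * (\<Sum>n. 1 / (real (Suc n))\<^sup>2))"
  proof -
    define Z where "Z = (\<Sum>n. 1 / (real (Suc n))\<^sup>2)"
    have "0 \<le> Z * fact 10 / real q ^ 6"
      using norm_theta_minus_partial_le[of 0] L unfolding Z_def L_def
      by (intro order_trans[OF norm_ge_zero]) auto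
    then have Z0: "Z * fact 10 \<ge> 0" using q by (simp add: zero_le_divide_iff)
    have "norm (integral K (\<lambda>u. G u - P u)) \<le> real q * (Z * fact 10 / real q ^ 6) * (2 * L - (- L / 10))"
      unfolding K_def
    proof (rule integral_bound)
      show "continuous_on {- L / 10..2 * L} (\<lambda>u. G u - P u)"
        unfolding P_def by (intro continuous_intros cG cf)
      fix u assume u: "u \<in> {- L / 10..2 * L}"
      define D where "D = theta u - (\<Sum>m\<in>{0<..<q}. X (int m) * of_real (exp (- pi * (real m)\<^sup>2 * exp (2 * u) / real q)))"
      have "G u - P u = of_real (g (u / L) * exp (u / 2)) * D"
      proof -
        have "exp (1 / 2 * complex_of_real u) = of_real (exp (u / 2))" by (simp flip: exp_of_real)
        then have "G u = of_real (g (u / L) * exp (u / 2)) * theta u" by (simp add: G_def h_def mellin_term_def)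
        moreover have "P u = of_real (g (u / L) * exp (u / 2)) * (\<Sum>m\<in>{0<..<q}. X (int m) * of_real (exp (- pi * (real m)\<^sup>2 * exp (2 * u) / real q)))"
          unfolding P_def f_def sum_distrib_left by (intro sum.cong refl) (simp only: of_real_mult mult_ac)
        ultimately show ?thesis by (simp only: D_def right_diff_distrib)
      qed
      then have "norm (G u - P u) = g (u / L) * exp (u / 2) * norm D" using g by (simp add: norm_mult)
      also have "\<dots> \<le> 1 * real q * (Z * fact 10 / real q ^ 6)"
      proof (intro mult_mono)
        have "exp (u / 2) \<le> exp L" using u by simp
        then show "exp (u / 2) \<le> real q" unfolding qL .
        show "norm D \<le> Z * fact 10 / real q ^ 6"
          unfolding D_def Z_def using u by (intro norm_theta_minus_partial_le) (simp add: L_def)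
      qed (use g in auto)
      finally show "norm (G u - P u) \<le> real q * (Z * fact 10 / real q ^ 6)" by simp
    qed (use L in auto)
    also have "\<dots> \<le> real q * (Z * fact 10 / real q ^ 6) * (3 * real q)"
      using L Z0 by (intro mult_left_mono) auto
    also have "\<dots> = 3 * (Z * fact 10) / real q ^ 4"
      using q by (simp add: field_simps eval_nat_numeral)
    also have "\<dots> \<le> 3 * (Z * fact 10) / 1"
      using Z0 q by (intro divide_left_mono one_le_power) auto
    finally have "norm (integral K (\<lambda>u. G u - P u)) \<le> 3 * (fact 10 * Z)" by (simp add: mult_ac)
    then show ?thesis
      unfolding Z_def using Henstock_Kurzweil_Integration.integral_diff[OF _ iP, of G] cG
      by (simp add: K_def integrable_continuous_interval)
  qed
  define W where "W = (\<lambda>m. step_weight g L (ln (real m)))"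
  define S where "S = (\<Sum>m\<in>{0<..<q}. half_twist (\<lambda>m. of_real (W m)) m * X (int m))"
  have step3: "norm (integral K P - of_real (exp (L / 4)) * S) \<le> exp (L / 4) * (3 * fact 20)"
  proof -
    have "integral K P - of_real (exp (L / 4)) * S = (\<Sum>m\<in>{0<..<q}. X (int m) *
        of_real ((sqrt (real m) * integral K (f m) - exp (L / 4) * W m) / sqrt (real m)))"
      unfolding PK S_def half_twist_def sum_distrib_left sum_subtractf[symmetric]
      by (intro sum.cong refl) (simp add: field_simps)
    also have "norm \<dots> \<le> (\<Sum>m\<in>{0<..<q}. exp (L / 4) * (3 * fact 20 / (real q)\<^sup>2))"
    proof (rule sum_norm_le)
      fix m assume m: "m \<in> {0<..<q}"
      have "\<bar>sqrt (real m) * integral K (f m) - exp (L / 4) * W m\<bar> \<le> exp (L / 4) * (3 * fact 20 / (real q)\<^sup>2)"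
        unfolding K_def f_def W_def L_def using m q
        by (intro smoothed_gaussian_integral[OF cont g]) auto
      moreover have "\<bar>(sqrt (real m) * integral K (f m) - exp (L / 4) * W m) / sqrt (real m)\<bar> \<le>
          \<bar>sqrt (real m) * integral K (f m) - exp (L / 4) * W m\<bar> / 1"
        unfolding abs_divide using m by (intro divide_left_mono) auto
      ultimately have "\<bar>(sqrt (real m) * integral K (f m) - exp (L / 4) * W m) / sqrt (real m)\<bar> \<le> exp (L / 4) * (3 * fact 20 / (real q)\<^sup>2)"
        by simp
      then have "norm (X (int m)) * \<bar>(sqrt (real m) * integral K (f m) - exp (L / 4) * W m) / sqrt (real m)\<bar> \<le> 1 * (exp (L / 4) * (3 * fact 20 / (real q)\<^sup>2))"
        by (intro mult_mono norm_X_le) auto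
      then show "norm (X (int m) * of_real ((sqrt (real m) * integral K (f m) - exp (L / 4) * W m) / sqrt (real m))) \<le> exp (L / 4) * (3 * fact 20 / (real q)\<^sup>2)"
        by (simp only: norm_mult norm_of_real mult_1)
    qed
    also have "\<dots> = real (q - 1) * (exp (L / 4) * (3 * fact 20 / (real q)\<^sup>2))" by simp
    also have "\<dots> \<le> (real q)\<^sup>2 * (exp (L / 4) * (3 * fact 20 / (real q)\<^sup>2))"
    proof (intro mult_right_mono)
      have "real (q - 1) \<le> real q * 1" by simp
      also have "\<dots> \<le> real q * real q" using q by (intro mult_left_mono) auto
      finally show "real (q - 1) \<le> (real q)\<^sup>2" by (simp add: power2_eq_square)
    qed simp
    also have "\<dots> = exp (L / 4) * (3 * fact 20)" using q by simp
    finally show ?thesis .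
  qed
  have e1: "exp (L / 4) \<ge> 1" using L by simp
  define a where "a = integral\<^sup>L lborel (\<lambda>u::real. exp (- \<bar>u\<bar>)) + 3 * (fact 10 * (\<Sum>n. 1 / (real (Suc n))\<^sup>2))"
  have "norm (integral\<^sup>L lborel G - integral K P) \<le> a"
    unfolding a_def using norm_triangle_mono[OF step1 step2] by simp
  moreover from this have "1 * a \<le> exp (L / 4) * a" 
    using e1 norm_ge_zero[of "integral\<^sup>L lborel G - integral K P"] by (intro mult_right_mono) linarith+
  ultimately have "norm (integral\<^sup>L lborel G - integral K P) \<le> exp (L / 4) * a" by simp
  from norm_triangle_mono[OF this step3]
  have "norm (integral\<^sup>L lborel G - of_real (exp (L / 4)) * S) \<le> exp (L / 4) * approx_const"
    by (simp add: approx_const_def a_def distrib_left)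
  moreover have "norm (integral\<^sup>L lborel G) \<le> norm (integral\<^sup>L lborel G - of_real (exp (L / 4)) * S) + norm (of_real (exp (L / 4)) * S)"
    using norm_triangle_ineq[of "integral\<^sup>L lborel G - of_real (exp (L / 4)) * S" "of_real (exp (L / 4)) * S"] by simp
  ultimately show ?thesis
    unfolding G_def h_def S_def W_def by (simp add: norm_mult distrib_left)
qed

text \<open>At the central point the factor \<open>(pi / q) powr (1/4)\<close> cancels
  \<open>exp (L / 4)\<close>. The constant 8 consists of the 2 in \<open>L_fun\<close>, the bound 2
  for \<open>pi powr (1/4)\<close> and the 2 from folding the integral.\<close>

theorem norm_dirichlet_L_half_le:
  assumes cont: "continuous_on UNIV g" and g: "\<And>x. 0 \<le> g x" "\<And>x. g x \<le> 1" "\<And>x. g x + g (- x) = 1"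
    "\<And>x. -2 \<le> x \<Longrightarrow> x \<le> -1/10 \<Longrightarrow> g x = 0"
  shows "norm (dirichlet_L X (1 / 2)) \<le> 8 * norm (rGamma (1 / 4) :: complex) *
    (norm (\<Sum>m\<in>{0<..<q}. half_twist (\<lambda>m. of_real (step_weight g (ln (real q)) (ln (real m)))) m * X (int m)) + approx_const)"
proof -
  define L where "L = ln (real q)"
  define N where "N = norm (\<Sum>m\<in>{0<..<q}. half_twist (\<lambda>m. of_real (step_weight g L (ln (real m)))) m * X (int m)) + approx_const"
  have m: "norm (mellin (1 / 2)) \<le> 2 * (exp (L / 4) * N)"
    using norm_mellin_half_le[OF cont g(1,2,3), of L] norm_smoothed_mellin_le[OF cont g(1,2,4)]
    unfolding N_def L_def by linarith
  have "norm (complex_of_real (pi / real q) powr (1 / 2 / 2)) = (pi / real q) powr (1 / 4)"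
    using q by (subst norm_powr_real_powr') (auto simp: norm_divide)
  also have "\<dots> = pi powr (1 / 4) * exp (- (L / 4))"
  proof -
    have "(pi / real q) powr (1 / 4) = pi powr (1 / 4) / real q powr (1 / 4)"
      by (rule powr_divide)
    moreover have "real q powr (1 / 4) = exp (L / 4)" using q by (simp add: powr_def L_def)
    ultimately show ?thesis by (simp only: exp_minus divide_inverse)
  qed
  finally have p: "norm (complex_of_real (pi / real q) powr (1 / 2 / 2)) = pi powr (1 / 4) * exp (- (L / 4))" .
  have "pi powr (1 / 4) \<le> 4 powr (1 / 4)" using pi_less_4 by (intro powr_mono2) auto
  also have "(4::real) powr (1 / 4) \<le> 4 powr (1 / 2)" by (intro powr_mono) auto
  also have "(4::real) powr (1 / 2) = 2" by (simp add: powr_half_sqrt)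
  finally have pi2: "pi powr (1 / 4) \<le> 2" .
  have N0: "N \<ge> 0" using order_trans[OF norm_ge_zero m] by (simp add: zero_le_mult_iff)
  have "norm (dirichlet_L X (1 / 2)) = 2 * norm (rGamma (1 / 4) :: complex) * (pi powr (1 / 4) * exp (- (L / 4))) * norm (mellin (1 / 2))"
    unfolding dirichlet_L_eq L_fun_def norm_mult p by simp
  also have "\<dots> \<le> 2 * norm (rGamma (1 / 4) :: complex) * (2 * exp (- (L / 4))) * (2 * (exp (L / 4) * N))"
    using m pi2 by (intro mult_mono) auto
  also have "\<dots> = 8 * norm (rGamma (1 / 4) :: complex) * N * (exp (- (L / 4)) * exp (L / 4))" by (simp only: mult_ac)
  also have "exp (- (L / 4)) * exp (L / 4) = 1" by (simp flip: exp_add)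
  finally show ?thesis by (simp add: N_def L_def)
qed

end

section \<open>The moment bound\<close>

lemma card_dirichlet_chars_le:
  assumes "q > 1"
  shows "real (card {X. dirichlet_char q X}) \<le> real (totient q)"
proof -
  \<comment> \<open>The indicator of 1 is tested against the characters, all of which take the value
    1 there.\<close>
  have "(\<Sum>X | dirichlet_char q X. (norm (\<Sum>n\<in>{0<..<q}. (if n = 1 then 1 else 0) * X (int n)))\<^sup>2)
      = (\<Sum>X | dirichlet_char q X. 1)"
  proof (intro sum.cong refl)
    fix X assume "X \<in> {X. dirichlet_char q X}"
    then have "X 1 = 1" by (simp add: dirichlet_char_1)
    moreover have "(\<Sum>n\<in>{0<..<q}. (if n = 1 then 1 else 0) * X (int n)) = (\<Sum>n\<in>{1::nat}. X (int n))"
      using assms by (intro sum.mono_neutral_cong_right) auto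
    ultimately show "(norm (\<Sum>n\<in>{0<..<q}. (if n = 1 then 1 else 0) * X (int n)))\<^sup>2 = 1" by simp
  qed
  then have "real (card {X. dirichlet_char q X}) = (\<Sum>X | dirichlet_char q X. (norm (\<Sum>n\<in>{0<..<q}. (if n = 1 then 1 else 0) * X (int n)))\<^sup>2)"
    by simp
  also have "\<dots> \<le> real (totient q) * (\<Sum>n\<in>{0<..<q}. (norm (if n = 1 then 1 else 0 :: complex))\<^sup>2)"
    by (rule dirichlet_char_bessel[OF assms])
  also have "(\<Sum>n\<in>{0<..<q}. (norm (if n = 1 then 1 else 0 :: complex))\<^sup>2) = (\<Sum>n\<in>{1::nat}. 1)"
    using assms by (intro sum.mono_neutral_cong_right) auto
  finally show ?thesis by simp
qed

text \<open>Raising the constant to the full power 2 makes it independent of \<open>p\<close>, hence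
  uniform in \<beta>.\<close>

lemma powr_mult_add_le:
  fixes a c x p :: real
  assumes "a \<ge> 0" "c \<ge> 0" "x \<ge> 0" "0 \<le> p" "p \<le> 2"
  shows "(a * (x + c)) powr p \<le> (2 * (a + 1) * (c + 1))\<^sup>2 * (x powr p + 1)"
proof -
  define K where "K = 2 * (a + 1) * (c + 1)"
  have "1 * 1 \<le> (a + 1) * (c + 1)" using assms by (intro mult_mono) auto
  then have K: "K \<ge> 1" unfolding K_def mult.assoc by linarith
  have "a * (x + c) \<le> K * max x 1"
  proof -
    have "x + c \<le> 2 * (c + 1) * max x 1"
    proof -
      have "x + c \<le> max x 1 + c * max x 1" using assms mult_left_mono[of 1 "max x 1" c] by simp
      also have "\<dots> \<le> 2 * (c + 1) * max x 1" using assms by (simp add: algebra_simps)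
      finally show ?thesis .
    qed
    then have "a * (x + c) \<le> (a + 1) * (2 * (c + 1) * max x 1)" using assms by (intro mult_mono) auto
    then show ?thesis by (simp add: K_def algebra_simps)
  qed
  then have "(a * (x + c)) powr p \<le> (K * max x 1) powr p" using assms by (intro powr_mono2) auto
  also have "\<dots> = K powr p * max x 1 powr p" using K by (simp add: powr_mult)
  also have "\<dots> \<le> K powr 2 * (x powr p + 1)"
  proof (intro mult_mono powr_mono)
    show "max x 1 powr p \<le> x powr p + 1" by (simp add: max_def)
  qed (use K assms in auto)
  also have "K powr 2 = K\<^sup>2" using K by (simp add: powr_numeral)
  finally show ?thesis by (simp add: K_def)
qed

theorem corollary1p2:
  shows "\<exists>Q :: nat. \<forall>B :: real. B < 1 \<longrightarrow>
    (\<exists>C :: real. \<forall>(\<beta> :: real) (q :: nat).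
       0 < \<beta> \<and> \<beta> < B \<and> q \<ge> Q \<and> q mod 4 \<noteq> 2 \<longrightarrow>
       \<bar>1 / real (totient q) *
          (\<Sum>X | even_char X \<and> primitive_char q X.
             norm (dirichlet_L X (1 / 2)) powr (2 * \<beta>))\<bar>
         \<le> C * ln (real q) powr (\<beta>\<^sup>2))"
proof -
  \<comment> \<open>The decay of order 26 exceeds by two the power 24 lost to the twists.\<close>
  obtain g :: "real \<Rightarrow> real" and b :: "int \<Rightarrow> complex" and C1 :: real where
    g: "\<And>x. 0 \<le> g x" "\<And>x. g x \<le> 1" "\<And>x. g x + g (- x) = 1" "\<And>x. -2 \<le> x \<Longrightarrow> x \<le> -1/10 \<Longrightarrow> g x = 0"
    and cont: "continuous_on UNIV g"
    and b: "\<And>x. ((\<lambda>k. b k * cis (of_int k * x)) has_sum of_real (g x)) UNIV"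
    and bC: "\<And>k. norm (b k) \<le> C1 / (1 + \<bar>of_int k\<bar>) ^ 26"
    by (rule smooth_step_exists[of 26]) auto
  have summ: "(\<lambda>k. norm (b k)) summable_on UNIV"
  proof (rule summable_on_comparison_test)
    have "(\<lambda>k::int. C1 * (1 / (1 + \<bar>of_int k\<bar>) ^ 26)) summable_on UNIV"
      by (intro summable_on_cmult_right summable_on_int_inverse_power) simp
    then show "(\<lambda>k::int. C1 / (1 + \<bar>of_int k\<bar>) ^ 26) summable_on UNIV" by simp
  qed (use bC in auto)
  define Z where "Z = (\<Sum>\<^sub>\<infinity>k::int. 1 / (1 + \<bar>real_of_int k\<bar>) ^ 2)"
  have Z: "((\<lambda>k::int. 1 / (1 + \<bar>real_of_int k\<bar>) ^ 2) has_sum Z) UNIV"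
    unfolding Z_def by (intro has_sum_infsum summable_on_int_inverse_power) simp
  define C0 where "C0 = C1 * integral UNIV gauss_weight"
  \<comment> \<open>These constants depend only on the step function and absolute quantities, not on
    \<open>q\<close> or \<beta>.\<close>
  define M where "M = 2 * exp 4 * large_modulus.mean_const * ((C0 * Z)\<^sup>2 * exp 40 + 1)"
  define A where "A = 8 * norm (rGamma (1 / 4) :: complex)"
  define c where "c = \<bar>approx_const\<bar>"
  define K where "K = (2 * (A + 1) * (c + 1))\<^sup>2"
  define Q where "Q = nat \<lceil>exp 2048 :: real\<rceil>"
  have main: "\<bar>1 / real (totient q) * (\<Sum>X | even_char X \<and> primitive_char q X. norm (dirichlet_L X (1 / 2)) powr (2 * \<beta>))\<bar>
         \<le> K * (M + 1) * ln (real q) powr (\<beta>\<^sup>2)" if \<beta>: "0 < \<beta>" "\<beta> < 1" and Q: "q \<ge> Q" for \<beta> q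
  proof -
    have q_large: "real q \<ge> exp 2048" using Q unfolding Q_def by linarith
    then interpret large_modulus q by unfold_locales
    have "real q > 1" using q_large less_le_trans[OF _ q_large, of 1] by simp
    then have q: "q > 1" by simp
    define L where "L = ln (real q)"
    have L: "L \<ge> 1"
    proof -
      have "ln (exp 2048) \<le> L" unfolding L_def using q_large q by (subst ln_le_cancel_iff) auto
      then show ?thesis by simp
    qed
    define W where "W = (\<lambda>m::nat. complex_of_real (step_weight g L (ln (real m))))"
    obtain d :: "int \<Rightarrow> complex" where
      d: "\<And>x. ((\<lambda>k. d k * cis (- (of_int k * x / L))) has_sum of_real (step_weight g L x)) UNIV"
      and db: "\<And>k. norm (d k) \<le> norm (b k) * integral UNIV gauss_weight"
      using step_weight_fourier[OF cont _ b summ, of L] L by auto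
    have I0: "integral UNIV gauss_weight \<ge> 0"
      by (intro integral_nonneg integrable_gauss_weight gauss_weight_nonneg)
    define S where "S = (\<lambda>X. norm (\<Sum>m\<in>{0<..<q}. half_twist W m * X (int m)))"
    have moment: "(\<Sum>X | dirichlet_char q X. S X powr (2 * \<beta>)) \<le> real (totient q) * M * L powr (\<beta>\<^sup>2)"
      unfolding S_def M_def L_def
    proof (rule short_polynomial_moment[OF \<beta> _ _ _ Z])
      fix m assume m: "real q powr (7 / 10) < real m" "m < q"
      have "real m > 0" using m by (intro le_less_trans[OF _ m(1)]) simp
      moreover have "ln (real q powr (7 / 10)) \<le> ln (real m)" using m q by (intro ln_mono) auto
      ultimately have "7 / 10 * L \<le> ln (real m)" "ln (real m) \<le> L"
        using q m(2) by (auto simp: L_def ln_powr)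
      then show "W m = 0" unfolding W_def using L by (subst step_weight_eq_0[OF g(4)]) auto
    next
      show "((\<lambda>k. d k * cis (- (of_int k * ln (real m) / ln (real q)))) has_sum W m) UNIV" if "m > 0" for m
        unfolding W_def L_def[symmetric] by (rule d)
      fix k :: int
      have "norm (d k) \<le> C1 / (1 + \<bar>of_int k\<bar>) ^ 26 * integral UNIV gauss_weight"
        using db[of k] mult_right_mono[OF bC[of k] I0] by linarith
      then show "norm (d k) \<le> C0 / (1 + \<bar>of_int k\<bar>) ^ 26" by (simp add: C0_def)
    qed
    define E where "E = {X. even_char X \<and> primitive_char q X}"
    have ED: "E \<subseteq> {X. dirichlet_char q X}" by (auto simp: E_def primitive_char_def)
    have fin: "finite {X. dirichlet_char q X}" using q by (intro finite_dirichlet_chars) simp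
    have "norm (dirichlet_L X (1 / 2)) powr (2 * \<beta>) \<le> K * (S X powr (2 * \<beta>) + 1)" if "X \<in> E" for X
    proof -
      interpret X: even_primitive q X using that q by unfold_locales (auto simp: E_def)
      have "norm (dirichlet_L X (1 / 2)) \<le> A * (S X + approx_const)"
        using X.norm_dirichlet_L_half_le[OF cont g] unfolding A_def S_def W_def L_def .
      also have "\<dots> \<le> A * (S X + c)" by (intro mult_left_mono) (auto simp: c_def A_def)
      finally have "norm (dirichlet_L X (1 / 2)) powr (2 * \<beta>) \<le> (A * (S X + c)) powr (2 * \<beta>)"
        using \<beta> by (intro powr_mono2) auto
      also have "\<dots> \<le> K * (S X powr (2 * \<beta>) + 1)"
        unfolding K_def using \<beta> by (intro powr_mult_add_le) (auto simp: A_def c_def S_def)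
      finally show ?thesis .
    qed
    then have "(\<Sum>X\<in>E. norm (dirichlet_L X (1 / 2)) powr (2 * \<beta>)) \<le> (\<Sum>X\<in>E. K * (S X powr (2 * \<beta>) + 1))"
      by (rule sum_mono)
    \<comment> \<open>All terms are nonnegative, so the sum may be extended to all characters, the
      setting of the moment bound.\<close>
    also have "\<dots> \<le> (\<Sum>X | dirichlet_char q X. K * (S X powr (2 * \<beta>) + 1))"
      by (intro sum_mono2 fin ED mult_nonneg_nonneg add_nonneg_nonneg) (auto simp: K_def)
    also have "\<dots> = K * ((\<Sum>X | dirichlet_char q X. S X powr (2 * \<beta>)) + real (card {X. dirichlet_char q X}))"
      by (simp add: sum_distrib_left[symmetric] sum.distrib)
    also have "\<dots> \<le> K * (real (totient q) * M * L powr (\<beta>\<^sup>2) + real (totient q) * L powr (\<beta>\<^sup>2))"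
    proof (intro mult_left_mono add_mono moment)
      have "1 \<le> L powr (\<beta>\<^sup>2)" using L by (intro ge_one_powr_ge_zero) auto
      then have "real (totient q) * 1 \<le> real (totient q) * L powr (\<beta>\<^sup>2)" by (intro mult_left_mono) auto
      then show "real (card {X. dirichlet_char q X}) \<le> real (totient q) * L powr (\<beta>\<^sup>2)"
        using card_dirichlet_chars_le[OF q] by simp
    qed (simp add: K_def)
    finally have "(\<Sum>X\<in>E. norm (dirichlet_L X (1 / 2)) powr (2 * \<beta>)) \<le> real (totient q) * (K * (M + 1) * L powr (\<beta>\<^sup>2))"
      by (simp add: algebra_simps)
    moreover have "real (totient q) > 0" using q by simp
    ultimately have "1 / real (totient q) * (\<Sum>X\<in>E. norm (dirichlet_L X (1 / 2)) powr (2 * \<beta>)) \<le> K * (M + 1) * L powr (\<beta>\<^sup>2)"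
      by (simp add: divide_le_eq mult.commute)
    moreover have "0 \<le> 1 / real (totient q) * (\<Sum>X\<in>E. norm (dirichlet_L X (1 / 2)) powr (2 * \<beta>))"
      by (intro mult_nonneg_nonneg sum_nonneg) auto
    ultimately show ?thesis by (simp only: E_def L_def abs_of_nonneg)
  qed
  show ?thesis
  proof (intro exI allI impI)
    fix B \<beta> :: real and q :: nat
    assume "B < 1" "0 < \<beta> \<and> \<beta> < B \<and> q \<ge> Q \<and> q mod 4 \<noteq> 2"
    then show "\<bar>1 / real (totient q) * (\<Sum>X | even_char X \<and> primitive_char q X. norm (dirichlet_L X (1 / 2)) powr (2 * \<beta>))\<bar>
         \<le> K * (M + 1) * ln (real q) powr (\<beta>\<^sup>2)"
      by (intro main) auto
  qed
qed

end
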